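(* Let $k=0$, let $E=\mathcal E(u)$ be the minimal Gross--Pitaevskii energy and let $E_h^0=\mathcal E_h^0(\hat u_h^0)$ be the minimal modified discrete energy. Assume that the potential $V$ is $\mathcal T_h$-piecewise constant, i.e. $V\in\mathcal P^0(\mathcal T_h)$, and let the stabilisation parameter $\sigma>0$ and the mesh size $h$ be chosen such that $$1-\sigma\Big(\frac1{\pi^2}+C_{\mathrm{tr}}\Big)-\frac{4h^2E_h^0}{\pi^2}\ \ge\ 0,\qquad C_{\mathrm{tr}}:=\frac1{\pi^2}+\frac{2}{d\pi}.$$ Then the guaranteed lower energy bound $$E_h^0\le E$$ holds.
   Context: **Continuous problem.** $\Omega\subset\mathbb R^d$, $d\in\{2,3\}$, is a bounded convex Lipschitz domain (exactly triangulated by simplices), $V\in L^\infty(\Omega)$ with $V\ge0$, $\kappa>0$. For $v\in H^1_0(\Omega)$, $\mathcal E(v)=\frac12\|\nabla v\|_{L^2}^2+\frac12(Vv,v)_{L^2}+\frac\kappa4\|v\|_{L^4}^4$. The ground state $u$ is a minimiser of $\mathcal E$ over $\{v\in H_0^1(\Omega):\|v\|_{L^2}=1\}$ (unique up to sign), and $E:=\mathcal E(u)$. Here $\|\cdot\|_{L^p}$, $(\cdot,\cdot)_{L^2}$ without domain refer to $\Omega$. **Meshes and spaces.** $\mathcal T_h$ is a geometrically conforming, shape-regular simplicial mesh of $\Omega$, $h_T=\operatorname{diam}(T)$, $h=\max_{T\in\mathcal T_h}h_T$; $\mathcal F_h$ is its set of faces, $\mathcal F_h^b$ the boundary faces, $\mathcal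 F_{\partial T}$ the faces of $T$. $\mathcal P^l(T)$, $\mathcal P^k(F)$ are the polynomials of total degree at most $l$, $k$ on $T$, $F$; $\mathcal P^l(\mathcal T_h)$, $\mathcal P^k(\mathcal F_h)$ are the corresponding discontinuous piecewise polynomial spaces on $\Omega$ and on the mesh skeleton. $\Pi_F^k$ is the $L^2(F)$-orthogonal projection onto $\mathcal P^k(F)$; $\Pi^l_{\mathcal T_h}$ is the $L^2$-orthogonal projection onto $\mathcal P^l(\mathcal T_h)$. $\nabla_h$ is the elementwise gradient. For polynomial degree $k\in\mathbb N_0$, $\hat V_h=\mathcal P^{k+1}(\mathcal T_h)\times\mathcal P^k(\mathcal F_h)$, with elements $\hat v_h=(v_{\mathcal T_h},v_{\mathcal F_h})$; $v_T=v_{\mathcal T_h}|_T$, $v_F=v_{\mathcal F_h}|_F$, $v_{\partial T}|_F=v_F$ for $F\in\mathcal F_{\partial T}$. $\hat U_h=\{\hat v_h\in\hat V_h: v_F=0\ \forall F\in\mathcal F_h^b\}$. **Reconstruction.** $\mathcal R_h:\hat V_h\to\mathcal P^{k+1}(\mathcal T_h)$ is defined by: for all $T\in\mathcal T_h$, $\varphi\in\mathcal P^{k+1}(T)$, $(\nabla(\mathcal R_h\hat v_h)|_T,\nabla\varphi)_{L^2(T)}=-(v_T,\Delta\varphi)_{L^2(T)}+(v_{\partial T},\partial_n\varphi)_{L^2(\partial T)}$ and $((\mathcal R_h\hat v_h)|_T,1)_{L^2(T)}=(v_T,1)_{L^2(T)}$, where $\partial_n$ is the outward normal derivative on $\partial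 T$. **Discrete bilinear form.** For $\sigma>0$, $a_h(\hat v_h,\hat\varphi_h)=(\nabla_h\mathcal R_h\hat v_h,\nabla_h\mathcal R_h\hat\varphi_h)_{L^2}+s_h(\hat v_h,\hat\varphi_h)$, where $s_h$ is the sum over $T\in\mathcal T_h$ of $$\sigma\sum_{F\in\mathcal F_{\partial T}}\ell_{T,F}^{-1}\big(\Pi_F^k(v_{\partial T}-(\mathcal R_h\hat v_h)|_T),\Pi_F^k(\varphi_{\partial T}-(\mathcal R_h\hat\varphi_h)|_T)\big)_{L^2(F)}+\sigma h_T^{-2}\big(v_T-(\mathcal R_h\hat v_h)|_T,\varphi_T-(\mathcal R_h\hat\varphi_h)|_T\big)_{L^2(T)},$$ with $\ell_{T,F}=|F|_{d-1}h_T^2/|T_F|_d$, $T_F=\operatorname{conv}\{x_T,F\}$, $x_T$ the barycenter of $T$, and $|\cdot|_n$ the $n$-dimensional volume. **Modified HHO approximation.** For $\hat v_h\in\hat U_h$, $$\mathcal E_h^0(\hat v_h)=\tfrac12a_h(\hat v_h,\hat v_h)+\tfrac12(Vv_{\mathcal T_h},v_{\mathcal T_h})_{L^2}+\tfrac\kappa4(|\Pi^0_{\mathcal T_h}v_{\mathcal T_h}|^2v_{\mathcal T_h},v_{\mathcal T_h})_{L^2}.$$ $\hat u_h^0$ is any minimiser of $\mathcal E_h^0$ over $\{\hat v_h\in\hat U_h:\|v_{\mathcal T_h}\|_{L^2}=1\}$, and $E_h^0:=\mathcal E_h^0(\hat u_h^0)$ is the minimal value. *)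

theory Defs
  imports "HOL-Analysis.Analysis"
begin

section \<open>Differential operators on smooth functions\<close>

definition partial_deriv :: "'a::euclidean_space \<Rightarrow> ('a \<Rightarrow> real) \<Rightarrow> 'a \<Rightarrow> real" where
  "partial_deriv e f x = frechet_derivative f (at x) e"

definition grad :: "('a::euclidean_space \<Rightarrow> real) \<Rightarrow> 'a \<Rightarrow> 'a" where
  "grad f x = (\<Sum>b\<in>Basis. partial_deriv b f x *\<^sub>R b)"

definition laplacian :: "('a::euclidean_space \<Rightarrow> real) \<Rightarrow> 'a \<Rightarrow> real" where
  "laplacian f x = (\<Sum>b\<in>Basis. partial_deriv b (partial_deriv b f) x)"

primrec Ck :: "nat \<Rightarrow> ('a::euclidean_space \<Rightarrow> real) \<Rightarrow> bool" where
  "Ck 0 f \<longleftrightarrow> continuous_on UNIV f"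
| "Ck (Suc m) f \<longleftrightarrow> (\<forall>x. f differentiable at x) \<and> (\<forall>b\<in>Basis. Ck m (partial_deriv b f))"

definition test_functions :: "'a::euclidean_space set \<Rightarrow> ('a \<Rightarrow> real) set" where
  "test_functions \<Omega> =
     {\<phi>. (\<forall>m. Ck m \<phi>) \<and> compact (closure {x. \<phi> x \<noteq> 0}) \<and> closure {x. \<phi> x \<noteq> 0} \<subseteq> \<Omega>}"


section \<open>Lebesgue and Sobolev spaces\<close>

text \<open>Elements of the function spaces are represented by functions on the whole space, of which
  only the values on \<open>\<Omega>\<close> (up to null sets) matter.\<close>

definition L2_fun :: "'a::euclidean_space set \<Rightarrow> ('a \<Rightarrow> 'b::euclidean_space) \<Rightarrow> bool" where
  "L2_fun \<Omega> f \<longleftrightarrow>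
     f \<in> borel_measurable (lebesgue_on \<Omega>) \<and> integrable (lebesgue_on \<Omega>) (\<lambda>x. (norm (f x))\<^sup>2)"

definition L2_norm :: "'a::euclidean_space set \<Rightarrow> ('a \<Rightarrow> 'b::euclidean_space) \<Rightarrow> real" where
  "L2_norm \<Omega> f = sqrt (integral\<^sup>L (lebesgue_on \<Omega>) (\<lambda>x. (norm (f x))\<^sup>2))"

definition Linfty_fun :: "'a::euclidean_space set \<Rightarrow> ('a \<Rightarrow> real) \<Rightarrow> bool" where
  "Linfty_fun \<Omega> f \<longleftrightarrow>
     f \<in> borel_measurable (lebesgue_on \<Omega>) \<and> (\<exists>C. AE x in lebesgue_on \<Omega>. \<bar>f x\<bar> \<le> C)"

definition is_weak_gradient ::
  "'a::euclidean_space set \<Rightarrow> ('a \<Rightarrow> real) \<Rightarrow> ('a \<Rightarrow> 'a) \<Rightarrow> bool" where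
  "is_weak_gradient \<Omega> v g \<longleftrightarrow> L2_fun \<Omega> g \<and>
     (\<forall>\<phi>\<in>test_functions \<Omega>. \<forall>b\<in>Basis.
        integral\<^sup>L (lebesgue_on \<Omega>) (\<lambda>x. v x * partial_deriv b \<phi> x) =
        - integral\<^sup>L (lebesgue_on \<Omega>) (\<lambda>x. (g x \<bullet> b) * \<phi> x))"

definition H1 :: "'a::euclidean_space set \<Rightarrow> ('a \<Rightarrow> real) set" where
  "H1 \<Omega> = {v. L2_fun \<Omega> v \<and> (\<exists>g. is_weak_gradient \<Omega> v g)}"

definition weak_grad :: "'a::euclidean_space set \<Rightarrow> ('a \<Rightarrow> real) \<Rightarrow> 'a \<Rightarrow> 'a" where
  "weak_grad \<Omega> v = (SOME g. is_weak_gradient \<Omega> v g)"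

definition H1_norm :: "'a::euclidean_space set \<Rightarrow> ('a \<Rightarrow> real) \<Rightarrow> real" where
  "H1_norm \<Omega> v = sqrt ((L2_norm \<Omega> v)\<^sup>2 + (L2_norm \<Omega> (weak_grad \<Omega> v))\<^sup>2)"

definition H10 :: "'a::euclidean_space set \<Rightarrow> ('a \<Rightarrow> real) set" where
  "H10 \<Omega> = {v \<in> H1 \<Omega>. \<exists>\<phi>::nat \<Rightarrow> 'a \<Rightarrow> real. (\<forall>n. \<phi> n \<in> test_functions \<Omega>) \<and>
       (\<lambda>n. H1_norm \<Omega> (\<lambda>x. v x - \<phi> n x)) \<longlonglongrightarrow> 0}"

text \<open>All three terms are nonnegative, and they are taken in \<open>[0,\<infinity>]\<close>, so that the
  $L^4$-term is never a default value; it is finite on \<open>H10 \<Omega>\<close> in dimensions 2 and 3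
  by the Sobolev embedding.\<close>

definition GP_energy ::
  "'a::euclidean_space set \<Rightarrow> ('a \<Rightarrow> real) \<Rightarrow> real \<Rightarrow> ('a \<Rightarrow> real) \<Rightarrow> ennreal" where
  "GP_energy \<Omega> V \<kappa> v =
     ennreal (1/2) * (\<integral>\<^sup>+x. ennreal ((norm (weak_grad \<Omega> v x))\<^sup>2) \<partial>lebesgue_on \<Omega>)
   + ennreal (1/2) * (\<integral>\<^sup>+x. ennreal (V x * v x * v x) \<partial>lebesgue_on \<Omega>)
   + ennreal (\<kappa>/4) * (\<integral>\<^sup>+x. ennreal (\<bar>v x\<bar> ^ 4) \<partial>lebesgue_on \<Omega>)"

definition ground_state ::
  "'a::euclidean_space set \<Rightarrow> ('a \<Rightarrow> real) \<Rightarrow> real \<Rightarrow> ('a \<Rightarrow> real) \<Rightarrow> bool" where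
  "ground_state \<Omega> V \<kappa> u \<longleftrightarrow>
     is_arg_min (GP_energy \<Omega> V \<kappa>) (\<lambda>v. v \<in> H10 \<Omega> \<and> L2_norm \<Omega> v = 1) u"


section \<open>Lebesgue measure on flat sets\<close>

text \<open>The Lebesgue measure of the appropriate dimension on the affine hull of \<open>S\<close>: the
  construction of \<open>lborel\<close> with an orthonormal basis of the direction space of
  \<open>S\<close> in place of \<open>Basis\<close>. It does not depend on the choices of \<open>p\<close> and \<open>B\<close>.\<close>

definition flat_lborel :: "'a::euclidean_space set \<Rightarrow> 'a measure" where
  "flat_lborel S =
     (let p = (SOME p. p \<in> S);
          B = (SOME B. pairwise orthogonal B \<and> (\<forall>b\<in>B. norm b = 1) \<and>
                       span B = span {x - y |x y. x \<in> S \<and> y \<in> S})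
      in distr (\<Pi>\<^sub>M b\<in>B. lborel) borel (\<lambda>c. p + (\<Sum>b\<in>B. c b *\<^sub>R b)))"

definition face_measure :: "'a::euclidean_space set \<Rightarrow> 'a measure" where
  "face_measure F = restrict_space (flat_lborel F) F"


section \<open>Simplicial meshes\<close>

text \<open>Conformity is part of \<open>triangulation\<close>, whose cells are closed. The domains \<open>\<Omega>\<close> are nonempty, open, bounded
  and convex; such sets always have a Lipschitz boundary, so this is not required separately. For a
  single mesh, shape regularity means some lower bound \<open>\<rho>\<close> on the chunkiness of its elements.\<close>

definition simplicial_mesh :: "'a::euclidean_space set \<Rightarrow> 'a set set \<Rightarrow> bool" where
  "simplicial_mesh \<Omega> \<T> \<longleftrightarrow>
     triangulation \<T> \<and> (\<forall>T\<in>\<T>. int DIM('a) simplex T) \<and> \<Union>\<T> = closure \<Omega>"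

definition shape_regular :: "real \<Rightarrow> 'a::euclidean_space set set \<Rightarrow> bool" where
  "shape_regular \<rho> \<T> \<longleftrightarrow> \<rho> > 0 \<and> (\<forall>T\<in>\<T>. \<exists>x. cball x (\<rho> * diameter T) \<subseteq> T)"

definition mesh_size :: "'a::euclidean_space set set \<Rightarrow> real" where
  "mesh_size \<T> = Max (diameter ` \<T>)"

definition elem_faces :: "'a::euclidean_space set \<Rightarrow> 'a set set" where
  "elem_faces T = {F. F facet_of T}"

definition mesh_faces :: "'a::euclidean_space set set \<Rightarrow> 'a set set" where
  "mesh_faces \<T> = (\<Union>T\<in>\<T>. elem_faces T)"

definition boundary_faces :: "'a::euclidean_space set \<Rightarrow> 'a set set \<Rightarrow> 'a set set" where
  "boundary_faces \<Omega> \<T> = {F \<in> mesh_faces \<T>. F \<subseteq> frontier \<Omega>}"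

definition barycenter :: "'a::euclidean_space set \<Rightarrow> 'a" where
  "barycenter T = (1 / real (card {x. x extreme_point_of T})) *\<^sub>R \<Sum>{x. x extreme_point_of T}"

definition outer_normal :: "'a::euclidean_space set \<Rightarrow> 'a set \<Rightarrow> 'a" where
  "outer_normal T F = (THE n. norm n = 1 \<and> (\<forall>x\<in>T. \<forall>y\<in>F. n \<bullet> (x - y) \<le> 0))"

definition face_length :: "'a::euclidean_space set \<Rightarrow> 'a set \<Rightarrow> real" where
  "face_length T F =
     measure (face_measure F) F * (diameter T)\<^sup>2
       / measure lebesgue (convex hull (insert (barycenter T) F))"


section \<open>Piecewise polynomials\<close>

text \<open>Polynomial functions of total degree at most \<open>l\<close>; the multi-indices are the functions on
  \<open>Basis\<close>, made unique by extensionality.\<close>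

definition multi_indices :: "nat \<Rightarrow> ('a::euclidean_space \<Rightarrow> nat) set" where
  "multi_indices l = {\<alpha> \<in> extensional Basis. (\<Sum>b\<in>Basis. \<alpha> b) \<le> l}"

definition polys :: "nat \<Rightarrow> ('a::euclidean_space \<Rightarrow> real) set" where
  "polys l = {p. \<exists>c. \<forall>x. p x = (\<Sum>\<alpha>\<in>multi_indices l. c \<alpha> * (\<Prod>b\<in>Basis. (x \<bullet> b) ^ \<alpha> b))}"

lemma finite_multi_indices: "finite (multi_indices l :: ('a::euclidean_space \<Rightarrow> nat) set)"
proof (rule finite_subset)
  show "multi_indices l \<subseteq> (Basis :: 'a set) \<rightarrow>\<^sub>E {..l}"
  proof
    fix \<alpha> :: "'a \<Rightarrow> nat" assume \<alpha>: "\<alpha> \<in> multi_indices l"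
    have "\<alpha> b \<le> l" if "b \<in> Basis" for b
      using member_le_sum[of b Basis \<alpha>] that \<alpha> by (auto simp: multi_indices_def)
    then show "\<alpha> \<in> Basis \<rightarrow>\<^sub>E {..l}"
      using \<alpha> by (auto simp: multi_indices_def PiE_def)
  qed
qed (simp add: finite_PiE)

lemma polys_0: "polys 0 = (range (\<lambda>c. (\<lambda>x. c)) :: ('a::euclidean_space \<Rightarrow> real) set)"
proof -
  have *: "multi_indices 0 = {restrict (\<lambda>_. 0) (Basis :: 'a set)}"
    by (auto simp: multi_indices_def extensional_def restrict_def fun_eq_iff)
  show ?thesis
    unfolding polys_def * by (auto simp: fun_eq_iff image_iff)
qed

text \<open>A piecewise polynomial on a family \<open>\<S>\<close> of cells (elements or faces) is encoded by its
  polynomial pieces \<open>v S\<close> for \<open>S \<in> \<S>\<close>; only the values of \<open>v S\<close> on \<open>S\<close> matter. Integrals over the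
  domain of products of such functions are sums of the integrals over the elements.\<close>

definition piecewise_polys ::
  "nat \<Rightarrow> 'a::euclidean_space set set \<Rightarrow> ('a set \<Rightarrow> 'a \<Rightarrow> real) set" where
  "piecewise_polys l \<S> = {v. \<forall>S\<in>\<S>. v S \<in> polys l}"

definition broken_integral ::
  "'a::euclidean_space set set \<Rightarrow> ('a set \<Rightarrow> 'a \<Rightarrow> real) \<Rightarrow> real" where
  "broken_integral \<T> f = (\<Sum>T\<in>\<T>. integral\<^sup>L (lebesgue_on T) (f T))"

definition broken_L2_norm ::
  "'a::euclidean_space set set \<Rightarrow> ('a set \<Rightarrow> 'a \<Rightarrow> real) \<Rightarrow> real" where
  "broken_L2_norm \<T> v = sqrt (broken_integral \<T> (\<lambda>T x. (v T x)\<^sup>2))"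

definition L2_proj ::
  "'a::euclidean_space measure \<Rightarrow> nat \<Rightarrow> ('a \<Rightarrow> real) \<Rightarrow> 'a \<Rightarrow> real" where
  "L2_proj M l w =
     (SOME q. q \<in> polys l \<and> (\<forall>p\<in>polys l. integral\<^sup>L M (\<lambda>x. (w x - q x) * p x) = 0))"

abbreviation face_proj :: "nat \<Rightarrow> 'a::euclidean_space set \<Rightarrow> ('a \<Rightarrow> real) \<Rightarrow> 'a \<Rightarrow> real" where
  "face_proj k F \<equiv> L2_proj (face_measure F) k"

text \<open>The $L^2$-projection onto the piecewise polynomials acts elementwise, as these are
  discontinuous.\<close>

abbreviation mesh_proj ::
  "nat \<Rightarrow> ('a::euclidean_space set \<Rightarrow> 'a \<Rightarrow> real) \<Rightarrow> 'a set \<Rightarrow> 'a \<Rightarrow> real" where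
  "mesh_proj l v T \<equiv> L2_proj (lebesgue_on T) l (v T)"

definition piecewise_constant :: "'a::euclidean_space set set \<Rightarrow> ('a \<Rightarrow> real) \<Rightarrow> bool" where
  "piecewise_constant \<T> V \<longleftrightarrow>
     (\<exists>c\<in>piecewise_polys 0 \<T>. \<forall>T\<in>\<T>. AE x in lebesgue_on T. V x = c T x)"


section \<open>The hybrid high-order method\<close>

type_synonym 'a hybrid = "('a set \<Rightarrow> 'a \<Rightarrow> real) \<times> ('a set \<Rightarrow> 'a \<Rightarrow> real)"

definition hho_V :: "nat \<Rightarrow> 'a::euclidean_space set set \<Rightarrow> 'a hybrid set" where
  "hho_V k \<T> = piecewise_polys (k + 1) \<T> \<times> piecewise_polys k (mesh_faces \<T>)"

definition hho_U :: "nat \<Rightarrow> 'a::euclidean_space set \<Rightarrow> 'a set set \<Rightarrow> 'a hybrid set" where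
  "hho_U k \<Omega> \<T> = {v \<in> hho_V k \<T>. \<forall>F\<in>boundary_faces \<Omega> \<T>. \<forall>x\<in>F. snd v F x = 0}"

definition reconstruction ::
  "nat \<Rightarrow> 'a::euclidean_space hybrid \<Rightarrow> 'a set \<Rightarrow> 'a \<Rightarrow> real" where
  "reconstruction k v T =
     (SOME r. r \<in> polys (k + 1) \<and>
        (\<forall>\<phi>\<in>polys (k + 1).
           integral\<^sup>L (lebesgue_on T) (\<lambda>x. grad r x \<bullet> grad \<phi> x) =
           - integral\<^sup>L (lebesgue_on T) (\<lambda>x. fst v T x * laplacian \<phi> x)
           + (\<Sum>F\<in>elem_faces T.
                integral\<^sup>L (face_measure F)
                  (\<lambda>x. snd v F x * (grad \<phi> x \<bullet> outer_normal T F)))) \<and>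
        integral\<^sup>L (lebesgue_on T) r = integral\<^sup>L (lebesgue_on T) (fst v T))"

definition hho_stab ::
  "nat \<Rightarrow> real \<Rightarrow> 'a::euclidean_space set set \<Rightarrow> 'a hybrid \<Rightarrow> 'a hybrid \<Rightarrow> real" where
  "hho_stab k \<sigma> \<T> v w =
     (\<Sum>T\<in>\<T>.
        \<sigma> * (\<Sum>F\<in>elem_faces T. inverse (face_length T F) *
              integral\<^sup>L (face_measure F)
                (\<lambda>x. face_proj k F (\<lambda>y. snd v F y - reconstruction k v T y) x *
                     face_proj k F (\<lambda>y. snd w F y - reconstruction k w T y) x))
      + \<sigma> * inverse ((diameter T)\<^sup>2) *
          integral\<^sup>L (lebesgue_on T)
            (\<lambda>x. (fst v T x - reconstruction k v T x) * (fst w T x - reconstruction k w T x)))"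

definition hho_form ::
  "nat \<Rightarrow> real \<Rightarrow> 'a::euclidean_space set set \<Rightarrow> 'a hybrid \<Rightarrow> 'a hybrid \<Rightarrow> real" where
  "hho_form k \<sigma> \<T> v w =
     broken_integral \<T> (\<lambda>T x. grad (reconstruction k v T) x \<bullet> grad (reconstruction k w T) x)
     + hho_stab k \<sigma> \<T> v w"

definition hho_energy0 ::
  "nat \<Rightarrow> real \<Rightarrow> 'a::euclidean_space set set \<Rightarrow> ('a \<Rightarrow> real) \<Rightarrow> real \<Rightarrow> 'a hybrid \<Rightarrow> real" where
  "hho_energy0 k \<sigma> \<T> V \<kappa> v =
     1/2 * hho_form k \<sigma> \<T> v v
     + 1/2 * broken_integral \<T> (\<lambda>T x. V x * fst v T x * fst v T x)
     + \<kappa>/4 * broken_integral \<T> (\<lambda>T x. \<bar>mesh_proj 0 (fst v) T x\<bar>\<^sup>2 * fst v T x * fst v T x)"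

definition hho_ground_state ::
  "nat \<Rightarrow> real \<Rightarrow> 'a::euclidean_space set \<Rightarrow> 'a set set \<Rightarrow> ('a \<Rightarrow> real) \<Rightarrow> real \<Rightarrow> 'a hybrid \<Rightarrow> bool"
where
  "hho_ground_state k \<sigma> \<Omega> \<T> V \<kappa> u \<longleftrightarrow>
     is_arg_min (hho_energy0 k \<sigma> \<T> V \<kappa>)
       (\<lambda>v. v \<in> hho_U k \<Omega> \<T> \<and> broken_L2_norm \<T> (fst v) = 1) u"

definition C_tr :: "nat \<Rightarrow> real" where
  "C_tr d = 1 / pi\<^sup>2 + 2 / (real d * pi)"

end

theory Submission
  imports Defs "HOL-Probability.Giry_Monad"
begin

text \<open>The Poincare constant of a simplex is not obtained from the Payne--Weinberger theorem on convex
  domains but from the barycentric coordinates. The uniform probability measure on a simplex is the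
  image of a product of one-dimensional power densities under stick-breaking. The Efron--Stein
  inequality together with the Stein kernels of the factors bounds the variance of \<open>\<phi>\<close> by a weighted
  quadratic form of the derivatives of \<open>\<phi>\<close> along the edges, which for \<open>d \<le> 3\<close> is at most
  \<open>7 / 72 \<cdot> h\<^sup>2 \<integral>|\<nabla>\<phi>|\<^sup>2\<close>, and \<open>7 / 72 < 1 / \<pi>\<^sup>2\<close>.

  The hybrid interpolant of a test function \<open>\<phi>\<close> consists of its elementwise \<open>L\<^sup>2\<close>-projection onto
  affine functions and of its face means. Its reconstruction is the elementwise Galerkin projection,
  so the discrete form is bounded by \<open>\<parallel>\<nabla>\<phi>\<parallel>\<^sup>2\<close> minus a multiple of the reconstruction error, which the
  Poincare and the trace inequalities and the condition on \<open>\<sigma>\<close> and \<open>h\<close> convert into the mass lost by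
  the projection. The projection lowers the potential energy, as \<open>V\<close> is piecewise constant, and
  the modified nonlinear term by Jensen's inequality. All inequalities are passed to the limit from
  test functions to the ground state.\<close>

section \<open>Lebesgue measure on subspaces\<close>

text \<open>Constants decide the shape of the proof. One stick-breaking order weights the edge of
  the vertices i < j by 1/(j + 1); bounding all weights by 1/2 would give the Poincare constant 1/8,
  which exceeds 1/pi^2. The uniform measure does not see the order, so the bound may be averaged
  over cyclic relabellings, and the largest mean weight drops to 7/18 (for d = 2). The remaining
  factor 1/4 is the variance bound for a quantity whose range is at most h times the norm of the
  gradient.

  In the trace term the gradient error has mean zero, so the apex of the cone identity can be moved
  to the barycenter, which is within d h / (d + 1) of every point of the element.

  The interpolant loses mass and has to be normalised again. If x >= 1 is the ratio of the masses,
  x^2 - 1 <= 2 x (x - 1) leads to the factor 4 in the condition.\<close>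

definition frame_measure :: "'a::euclidean_space set \<Rightarrow> 'a measure" where
  "frame_measure B = distr (\<Pi>\<^sub>M b\<in>B. lborel) borel (\<lambda>c. \<Sum>b\<in>B. c b *\<^sub>R b)"

lemma sets_frame_measure [simp, measurable_cong]: "sets (frame_measure B) = sets borel"
  and space_frame_measure [simp]: "space (frame_measure B) = UNIV"
  by (simp_all add: frame_measure_def)

lemma nn_integral_frame:
  assumes [measurable]: "f \<in> borel_measurable borel"
  shows "(\<integral>\<^sup>+x. f x \<partial>frame_measure B) = (\<integral>\<^sup>+c. f (\<Sum>b\<in>B. c b *\<^sub>R b) \<partial>(\<Pi>\<^sub>M b\<in>B. lborel))"
  unfolding frame_measure_def by (subst nn_integral_distr) auto

interpretation lborel_PiM: product_sigma_finite "\<lambda>b. lborel :: real measure"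
  by standard

lemma sigma_finite_frame_PiM:
  "finite B \<Longrightarrow> sigma_finite_measure (\<Pi>\<^sub>M b\<in>B. (lborel :: real measure))"
  by (rule lborel_PiM.sigma_finite)

text \<open>For linearly dependent \<open>B\<close> the measure \<open>frame_measure B\<close> need
  not be sigma-finite, so measurability of parametric integrals is taken from the coefficient space,
  whose product measure is sigma-finite.\<close>

lemma measurable_nn_integral_frame [measurable (raw)]:
  assumes "finite B" and f: "case_prod f \<in> borel_measurable (N \<Otimes>\<^sub>M borel)"
  shows "(\<lambda>t. \<integral>\<^sup>+x. f t x \<partial>frame_measure B) \<in> borel_measurable N"
proof -
  interpret sigma_finite_measure "\<Pi>\<^sub>M b\<in>B. (lborel :: real measure)"
    by (rule sigma_finite_frame_PiM) fact
  note f[measurable]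
  have "(\<integral>\<^sup>+x. f t x \<partial>frame_measure B) = (\<integral>\<^sup>+c. f t (\<Sum>b\<in>B. c b *\<^sub>R b) \<partial>(\<Pi>\<^sub>M b\<in>B. lborel))"
    if "t \<in> space N" for t
    using that by (intro nn_integral_frame) measurable
  then show ?thesis
    by (simp cong: measurable_cong)
qed

lemma nn_integral_frame_insert:
  assumes B: "finite B" "b \<notin> B" and [measurable]: "f \<in> borel_measurable borel"
  shows "(\<integral>\<^sup>+x. f x \<partial>frame_measure (insert b B))
    = (\<integral>\<^sup>+t. (\<integral>\<^sup>+w. f (t *\<^sub>R b + w) \<partial>frame_measure B) \<partial>lborel)"
proof -
  have [measurable]: "(\<lambda>c. f (\<Sum>b\<in>insert b B. c b *\<^sub>R b)) \<in> borel_measurable (\<Pi>\<^sub>M b\<in>insert b B. lborel)"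
    by measurable
  have "(\<integral>\<^sup>+x. f x \<partial>frame_measure (insert b B))
    = (\<integral>\<^sup>+t. (\<integral>\<^sup>+c. f (\<Sum>x\<in>insert b B. (c(b := t)) x *\<^sub>R x) \<partial>(\<Pi>\<^sub>M b\<in>B. lborel)) \<partial>lborel)"
    using B by (subst nn_integral_frame, simp, subst lborel_PiM.product_nn_integral_insert_rev) auto
  also have "\<dots> = (\<integral>\<^sup>+t. (\<integral>\<^sup>+c. f (t *\<^sub>R b + (\<Sum>x\<in>B. c x *\<^sub>R x)) \<partial>(\<Pi>\<^sub>M b\<in>B. lborel)) \<partial>lborel)"
  proof -
    have "(\<Sum>x\<in>insert b B. (c(b := t)) x *\<^sub>R x) = t *\<^sub>R b + (\<Sum>x\<in>B. c x *\<^sub>R x)" for c t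
      using B by (auto intro!: sum.cong)
    then show ?thesis by simp
  qed
  finally show ?thesis
    by (simp add: nn_integral_frame)
qed

text \<open>Translation and scaling reduce to the substitution rule on the line, one vector at a
  time: the part \<open>k *\<^sub>R b\<close> of the shift is absorbed by the coefficient of
  \<open>b\<close>, and the rest \<open>a - k *\<^sub>R b\<close> lies in \<open>span B\<close> and
  goes to the induction hypothesis. Negative \<open>s\<close> is included and yields reflection
  invariance.\<close>

lemma nn_integral_frame_affine:
  assumes "finite B" "a \<in> span B" "s \<noteq> 0" "f \<in> borel_measurable borel"
  shows "(\<integral>\<^sup>+x. f x \<partial>frame_measure B)
    = ennreal (\<bar>s\<bar> ^ card B) * (\<integral>\<^sup>+x. f (a + s *\<^sub>R x) \<partial>frame_measure B)"
  using assms
proof (induction B arbitrary: a f rule: finite_induct)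
  case empty
  then show ?case
    by (simp add: nn_integral_frame)
next
  case (insert b B)
  note [measurable] = insert.prems(3) and [simp] = insert.hyps(1)
  obtain k where k: "a - k *\<^sub>R b \<in> span B"
    using insert.prems(1) by (auto simp: span_breakdown_eq)
  have "(\<integral>\<^sup>+x. f x \<partial>frame_measure (insert b B))
    = (\<integral>\<^sup>+t. (\<integral>\<^sup>+w. f (t *\<^sub>R b + w) \<partial>frame_measure B) \<partial>lborel)"
    using insert.hyps by (intro nn_integral_frame_insert) auto
  also have "\<dots> = (\<integral>\<^sup>+t. ennreal (\<bar>s\<bar> ^ card B) *
      (\<integral>\<^sup>+w. f (t *\<^sub>R b + ((a - k *\<^sub>R b) + s *\<^sub>R w)) \<partial>frame_measure B) \<partial>lborel)"
    using insert.prems by (intro nn_integral_cong insert.IH k) auto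
  also have "\<dots> = ennreal \<bar>s\<bar> * (\<integral>\<^sup>+t. ennreal (\<bar>s\<bar> ^ card B) *
      (\<integral>\<^sup>+w. f ((k + s * t) *\<^sub>R b + ((a - k *\<^sub>R b) + s *\<^sub>R w)) \<partial>frame_measure B) \<partial>lborel)"
    using insert.prems by (intro nn_integral_real_affine) auto
  also have "\<dots> = ennreal (\<bar>s\<bar> ^ card (insert b B)) * (\<integral>\<^sup>+t.
      (\<integral>\<^sup>+w. f (a + s *\<^sub>R (t *\<^sub>R b + w)) \<partial>frame_measure B) \<partial>lborel)"
  proof -
    have "f ((k + s * t) *\<^sub>R b + ((a - k *\<^sub>R b) + s *\<^sub>R w)) = f (a + s *\<^sub>R (t *\<^sub>R b + w))" for t w
      by (rule arg_cong[of _ _ f]) (simp add: algebra_simps)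
    moreover have "ennreal (\<bar>s\<bar> ^ card (insert b B)) = ennreal \<bar>s\<bar> * ennreal (\<bar>s\<bar> ^ card B)"
      using insert.hyps by (simp add: ennreal_mult'')
    ultimately show ?thesis
      by (simp add: nn_integral_cmult mult.assoc)
  qed
  also have "\<dots> = ennreal (\<bar>s\<bar> ^ card (insert b B)) * (\<integral>\<^sup>+x. f (a + s *\<^sub>R x) \<partial>frame_measure (insert b B))"
    using insert.hyps nn_integral_frame_insert[of B b "\<lambda>x. f (a + s *\<^sub>R x)"] by simp
  finally show ?case .
qed

lemma frame_Basis_eq_lborel: "frame_measure (Basis :: 'a::euclidean_space set) = lborel"
proof -
  have "distr (\<Pi>\<^sub>M b\<in>(Basis::'a set). interval_measure (\<lambda>x. x)) borel (\<lambda>f. \<Sum>b\<in>Basis. f b *\<^sub>R b)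
     = frame_measure (Basis :: 'a set)"
    unfolding frame_measure_def lborel_eq_real ..
  then show ?thesis by (simp add: lborel_def)
qed

lemma nn_integral_frame_swap:
  assumes "finite B" "finite C" and [measurable]: "case_prod f \<in> borel_measurable (borel \<Otimes>\<^sub>M borel)"
  shows "(\<integral>\<^sup>+x. (\<integral>\<^sup>+y. f x y \<partial>frame_measure B) \<partial>frame_measure C)
    = (\<integral>\<^sup>+y. (\<integral>\<^sup>+x. f x y \<partial>frame_measure C) \<partial>frame_measure B)"
proof -
  interpret pair_sigma_finite "\<Pi>\<^sub>M b\<in>B. (lborel :: real measure)" "\<Pi>\<^sub>M b\<in>C. (lborel :: real measure)"
    using assms by (intro pair_sigma_finite.intro sigma_finite_frame_PiM)
  note [simp] = assms(1,2)
  have "(\<integral>\<^sup>+x. (\<integral>\<^sup>+y. f x y \<partial>frame_measure B) \<partial>frame_measure C)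
    = (\<integral>\<^sup>+c. (\<integral>\<^sup>+d. f (\<Sum>b\<in>C. c b *\<^sub>R b) (\<Sum>b\<in>B. d b *\<^sub>R b) \<partial>(\<Pi>\<^sub>M b\<in>B. lborel)) \<partial>(\<Pi>\<^sub>M b\<in>C. lborel))"
    by (subst nn_integral_frame[of "\<lambda>x. \<integral>\<^sup>+y. f x y \<partial>frame_measure B"])
       (auto intro!: nn_integral_cong nn_integral_frame)
  also have "\<dots> = (\<integral>\<^sup>+d. (\<integral>\<^sup>+c. f (\<Sum>b\<in>C. c b *\<^sub>R b) (\<Sum>b\<in>B. d b *\<^sub>R b) \<partial>(\<Pi>\<^sub>M b\<in>C. lborel)) \<partial>(\<Pi>\<^sub>M b\<in>B. lborel))"
    by (rule Fubini') measurable
  also have "\<dots> = (\<integral>\<^sup>+y. (\<integral>\<^sup>+x. f x y \<partial>frame_measure C) \<partial>frame_measure B)"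
    by (subst nn_integral_frame[of "\<lambda>y. \<integral>\<^sup>+x. f x y \<partial>frame_measure C"])
       (auto intro!: nn_integral_cong nn_integral_frame[symmetric])
  finally show ?thesis .
qed

text \<open>The uniqueness argument for Haar measure: the double integral of
  \<open>f x * g (x + y)\<close> is evaluated in both orders, and translations together with one
  reflection separate the factors. The product form avoids quotients of possibly infinite
  integrals.\<close>

lemma frame_measure_proportional:
  fixes B C :: "'a::euclidean_space set"
  assumes B: "finite B" "span B = UNIV" and C: "finite C" "span C = UNIV"
    and [measurable]: "f \<in> borel_measurable borel" "g \<in> borel_measurable borel"
  shows "(\<integral>\<^sup>+x. f x \<partial>frame_measure B) * (\<integral>\<^sup>+x. g x \<partial>frame_measure C)
    = (\<integral>\<^sup>+x. g x \<partial>frame_measure B) * (\<integral>\<^sup>+x. f x \<partial>frame_measure C)"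
proof -
  note [simp] = B(1) C(1)
  have "(\<integral>\<^sup>+x. f x \<partial>frame_measure B) * (\<integral>\<^sup>+x. g x \<partial>frame_measure C)
    = (\<integral>\<^sup>+x. f x * (\<integral>\<^sup>+y. g y \<partial>frame_measure C) \<partial>frame_measure B)"
    by (simp add: nn_integral_multc)
  also have "\<dots> = (\<integral>\<^sup>+x. (\<integral>\<^sup>+y. f x * g (x + y) \<partial>frame_measure C) \<partial>frame_measure B)"
  proof (rule nn_integral_cong)
    fix x :: 'a
    have "(\<integral>\<^sup>+y. g y \<partial>frame_measure C) = (\<integral>\<^sup>+y. g (x + y) \<partial>frame_measure C)"
      using nn_integral_frame_affine[of C x 1 g] C by simp
    then show "f x * (\<integral>\<^sup>+y. g y \<partial>frame_measure C) = (\<integral>\<^sup>+y. f x * g (x + y) \<partial>frame_measure C)"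
      by (simp add: nn_integral_cmult)
  qed
  also have "\<dots> = (\<integral>\<^sup>+y. (\<integral>\<^sup>+x. f x * g (x + y) \<partial>frame_measure B) \<partial>frame_measure C)"
    by (rule nn_integral_frame_swap) auto
  also have "\<dots> = (\<integral>\<^sup>+y. (\<integral>\<^sup>+x. f (x - y) * g x \<partial>frame_measure B) \<partial>frame_measure C)"
  proof (rule nn_integral_cong)
    fix y :: 'a
    show "(\<integral>\<^sup>+x. f x * g (x + y) \<partial>frame_measure B) = (\<integral>\<^sup>+x. f (x - y) * g x \<partial>frame_measure B)"
      using nn_integral_frame_affine[of B "-y" 1 "\<lambda>x. f x * g (x + y)"] B by (simp add: algebra_simps)
  qed
  also have "\<dots> = (\<integral>\<^sup>+x. (\<integral>\<^sup>+y. f (x - y) * g x \<partial>frame_measure C) \<partial>frame_measure B)"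
    by (rule nn_integral_frame_swap[symmetric]) auto
  also have "\<dots> = (\<integral>\<^sup>+x. g x * (\<integral>\<^sup>+y. f y \<partial>frame_measure C) \<partial>frame_measure B)"
  proof (rule nn_integral_cong)
    fix x :: 'a
    have "(\<integral>\<^sup>+y. f y \<partial>frame_measure C) = (\<integral>\<^sup>+y. f (x - y) \<partial>frame_measure C)"
      using nn_integral_frame_affine[of C x "-1" f] C by simp
    then show "(\<integral>\<^sup>+y. f (x - y) * g x \<partial>frame_measure C) = g x * (\<integral>\<^sup>+y. f y \<partial>frame_measure C)"
      using nn_integral_cmult[of "\<lambda>y. f (x - y)" "frame_measure C" "g x"] by (simp add: mult.commute)
  qed
  also have "\<dots> = (\<integral>\<^sup>+x. g x \<partial>frame_measure B) * (\<integral>\<^sup>+x. f x \<partial>frame_measure C)"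
    by (rule nn_integral_multc) simp
  finally show ?thesis .
qed

lemma orthonormal_add_norm:
  assumes "pairwise orthogonal (insert b B)" "b \<notin> B" "norm b = 1" "w \<in> span B"
  shows "(norm (t *\<^sub>R b + w))\<^sup>2 = t\<^sup>2 + (norm w)\<^sup>2"
proof -
  have "orthogonal b w"
    by (rule orthogonal_to_span[OF assms(4)]) (use assms(1,2) in \<open>auto simp: pairwise_def\<close>)
  then have "(t *\<^sub>R b) \<bullet> w = 0"
    by (simp add: orthogonal_def)
  then show ?thesis
    using norm_add_Pythagorean[of "t *\<^sub>R b" w] assms(3) by (simp add: orthogonal_def power_mult_distrib)
qed

lemma nn_integral_frame_cong_span:
  assumes "\<And>w. w \<in> span B \<Longrightarrow> f w = g w" and [measurable]: "f \<in> borel_measurable borel" "g \<in> borel_measurable borel"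
  shows "(\<integral>\<^sup>+w. f w \<partial>frame_measure B) = (\<integral>\<^sup>+w. g w \<partial>frame_measure B)"
  by (simp add: nn_integral_frame assms(1) span_sum span_scale span_base cong: nn_integral_cong)

text \<open>By Pythagoras the squared norm of \<open>t *\<^sub>R b + w\<close> is t^2 plus the
  squared norm of w. Peeling off one unit vector on each side shows by induction that the law
  depends only on the number of vectors. This supplies a set on which proportional measures can be
  compared.\<close>

lemma distr_norm_frame_measure:
  fixes B C :: "'a::euclidean_space set"
  assumes "finite B" "finite C" "card B = card C"
    "pairwise orthogonal B" "\<forall>b\<in>B. norm b = 1" "pairwise orthogonal C" "\<forall>b\<in>C. norm b = 1"
  shows "distr (frame_measure B) borel (\<lambda>x. (norm x)\<^sup>2) = distr (frame_measure C) borel (\<lambda>x. (norm x)\<^sup>2)"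
  using assms
proof (induction B arbitrary: C rule: finite_induct)
  case empty
  then show ?case by simp
next
  case (insert b B)
  have "C \<noteq> {}"
    using insert.prems(2) insert.hyps by auto
  then obtain c where "c \<in> C" by blast
  define C' where "C' = C - {c}"
  have C: "C = insert c C'" "c \<notin> C'" "finite C'"
    using \<open>c \<in> C\<close> insert.prems(1) by (auto simp: C'_def)
  note [simp] = C(3) insert.hyps(1)
  have IH: "distr (frame_measure B) borel (\<lambda>x. (norm x)\<^sup>2) = distr (frame_measure C') borel (\<lambda>x. (norm x)\<^sup>2)"
    using insert.prems insert.hyps C by (intro insert.IH) (auto simp: pairwise_insert)
  have expand: "emeasure (distr (frame_measure (insert d D)) borel (\<lambda>x. (norm x)\<^sup>2)) A
      = (\<integral>\<^sup>+t. (\<integral>\<^sup>+r. indicator A (t\<^sup>2 + r) \<partial>distr (frame_measure D) borel (\<lambda>x. (norm x)\<^sup>2)) \<partial>lborel)"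
    if D: "finite D" "d \<notin> D" "pairwise orthogonal (insert d D)" "norm d = 1"
      and A[measurable]: "A \<in> sets borel" for d :: 'a and D A
  proof -
    have "emeasure (distr (frame_measure (insert d D)) borel (\<lambda>x. (norm x)\<^sup>2)) A
        = (\<integral>\<^sup>+r. indicator A r \<partial>distr (frame_measure (insert d D)) borel (\<lambda>x. (norm x)\<^sup>2))"
      by simp
    also have "\<dots> = (\<integral>\<^sup>+x. indicator A ((norm x)\<^sup>2) \<partial>frame_measure (insert d D))"
      by (rule nn_integral_distr) measurable
    also have "\<dots> = (\<integral>\<^sup>+t. (\<integral>\<^sup>+w. indicator A ((norm (t *\<^sub>R d + w))\<^sup>2) \<partial>frame_measure D) \<partial>lborel)"
      using D by (intro nn_integral_frame_insert) measurable
    also have "\<dots> = (\<integral>\<^sup>+t. (\<integral>\<^sup>+w. indicator A (t\<^sup>2 + (norm w)\<^sup>2) \<partial>frame_measure D) \<partial>lborel)"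
      using D by (intro nn_integral_cong nn_integral_frame_cong_span) (simp_all add: orthonormal_add_norm)
    also have "\<dots> = (\<integral>\<^sup>+t. (\<integral>\<^sup>+r. indicator A (t\<^sup>2 + r) \<partial>distr (frame_measure D) borel (\<lambda>x. (norm x)\<^sup>2)) \<partial>lborel)"
      by (intro nn_integral_cong nn_integral_distr[symmetric]) measurable
    finally show ?thesis .
  qed
  show ?case
  proof (rule measure_eqI)
    fix A assume "A \<in> sets (distr (frame_measure (insert b B)) borel (\<lambda>x. (norm x)\<^sup>2))"
    then have A: "A \<in> sets borel" by simp
    have b: "norm b = 1" "norm c = 1" "pairwise orthogonal (insert c C')"
      using insert.prems C by auto
    show "emeasure (distr (frame_measure (insert b B)) borel (\<lambda>x. (norm x)\<^sup>2)) A
        = emeasure (distr (frame_measure C) borel (\<lambda>x. (norm x)\<^sup>2)) A"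
      unfolding C(1) using expand[OF insert.hyps insert.prems(3) b(1) A] expand[OF C(3,2) b(3) b(2) A] IH
      by simp
  qed simp
qed

text \<open>Rotation invariance without determinants: translation invariance makes the two measures
  proportional, and the unit ball, a sublevel set of the norm with finite positive volume, forces
  the constant to be 1.\<close>

lemma frame_measure_eq_lborel:
  fixes B :: "'a::euclidean_space set"
  assumes orth: "pairwise orthogonal B" "\<forall>b\<in>B. norm b = 1" and "span B = UNIV"
  shows "frame_measure B = lborel"
proof -
  have indep: "independent B"
    using orth by (intro pairwise_orthogonal_independent) auto
  then have fin: "finite B"
    by (rule independent_imp_finite)
  have "card B = card (Basis :: 'a set)"
    using dim_eq_card_independent[OF indep] dim_span[of B] \<open>span B = UNIV\<close> by simp
  moreover have "pairwise orthogonal (Basis :: 'a set)"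
    by (auto simp: pairwise_def orthogonal_def inner_not_same_Basis)
  ultimately have eq: "distr (frame_measure B) borel (\<lambda>x. (norm x)\<^sup>2) = distr (frame_measure (Basis :: 'a set)) borel (\<lambda>x. (norm x)\<^sup>2)"
    using fin orth by (intro distr_norm_frame_measure) auto
  have rad: "(\<integral>\<^sup>+x. indicator {..1::real} ((norm x)\<^sup>2) \<partial>frame_measure B)
      = (\<integral>\<^sup>+x. indicator {..1::real} ((norm x)\<^sup>2) \<partial>frame_measure (Basis :: 'a set))"
    using arg_cong[OF eq, of "\<lambda>M. \<integral>\<^sup>+r. indicator {..1} r \<partial>M"]
    by (subst (asm) (1 2) nn_integral_distr) auto
  have ball: "indicator {..1::real} ((norm x)\<^sup>2) = (indicator (cball 0 1) x :: ennreal)" for x :: 'a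
    by (auto simp: indicator_def power_le_one_iff abs_square_le_1)
  define K where "K = (\<integral>\<^sup>+x. indicator {..1::real} ((norm x)\<^sup>2) \<partial>(lborel :: 'a measure))"
  have K: "K = emeasure lborel (cball (0::'a) 1)"
    unfolding K_def ball by simp
  have "K \<noteq> \<infinity>"
    unfolding K using emeasure_lborel_cball_finite[of "0::'a" 1] by auto
  moreover have "K \<noteq> 0"
    using content_cball_pos[of 1 "0::'a"] K by (auto simp: measure_def)
  moreover have "(\<integral>\<^sup>+x. f x \<partial>frame_measure B) * K = K * (\<integral>\<^sup>+x. f x \<partial>lborel)"
    if [measurable]: "f \<in> borel_measurable borel" for f
    using frame_measure_proportional[of B Basis f "\<lambda>x. indicator {..1::real} ((norm x)\<^sup>2)"]
      fin \<open>span B = UNIV\<close> rad by (simp add: K_def frame_Basis_eq_lborel span_Basis)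
  ultimately have *: "(\<integral>\<^sup>+x. f x \<partial>frame_measure B) = (\<integral>\<^sup>+x. f x \<partial>lborel)"
    if "f \<in> borel_measurable borel" for f
    using that by (metis ennreal_mult_cancel_left infinity_ennreal_def mult.commute)
  show ?thesis
  proof (rule measure_eqI)
    fix A assume A: "A \<in> sets (frame_measure B)"
    then show "emeasure (frame_measure B) A = emeasure lborel A"
      using *[of "indicator A"] by simp
  qed simp
qed

section \<open>Uniform measures on cones\<close>

text \<open>The law Beta(k, 1): for a uniform point of a k-dimensional cone it is the distribution
  of the relative height measured from the apex. For k = 0 it is the zero measure, hence the
  assumptions k > 0 below.\<close>

definition power_measure :: "nat \<Rightarrow> real measure" where
  "power_measure k = density lborel (\<lambda>s. ennreal (real k * s ^ (k - 1)) * indicator {0..1} s)"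

lemma sets_power_measure [simp, measurable_cong]: "sets (power_measure k) = sets borel"
  and space_power_measure [simp]: "space (power_measure k) = UNIV"
  by (simp_all add: power_measure_def)

lemma nn_integral_power_01:
  "(\<integral>\<^sup>+s. ennreal (s ^ k) * indicator {0..1} s \<partial>lborel) = ennreal (1 / real (Suc k))"
proof -
  have "(\<integral>\<^sup>+s. ennreal (s ^ k) * indicator {0..1} s \<partial>lborel)
      = ennreal (1 ^ Suc k / real (Suc k) - 0 ^ Suc k / real (Suc k))"
    by (rule nn_integral_FTC_Icc) (auto intro!: derivative_eq_intros simp del: power_Suc)
  then show ?thesis by simp
qed

lemma prob_space_power_measure: "k > 0 \<Longrightarrow> prob_space (power_measure k)"
proof (rule prob_spaceI)
  assume "k > 0"
  have "emeasure (power_measure k) UNIV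
      = (\<integral>\<^sup>+s. ennreal (real k) * (ennreal (s ^ (k - 1)) * indicator {0..1} s) \<partial>lborel)"
    unfolding power_measure_def
    by (subst emeasure_density) (auto intro!: nn_integral_cong simp: ennreal_mult'' indicator_def mult.assoc ennreal_mult)
  also have "\<dots> = 1"
    using \<open>k > 0\<close> by (subst nn_integral_cmult) (auto simp: nn_integral_power_01 ennreal_mult[symmetric])
  finally show "emeasure (power_measure k) (space (power_measure k)) = 1"
    by simp
qed

text \<open>Stick-breaking, one vertex at a time: each step moves a random point of the current
  simplex towards the next vertex. The factor Beta(k + 1, 1) is the one that makes the result
  uniform for affinely independent vertices. The recursion exhibits the measure as the image of a
  product, the form required for the tensorisation of variance.\<close>

fun dirichlet_measure :: "(nat \<Rightarrow> 'a::euclidean_space) \<Rightarrow> nat \<Rightarrow> 'a measure" where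
  "dirichlet_measure v 0 = return borel (v 0)"
| "dirichlet_measure v (Suc k) =
     distr (power_measure (Suc k) \<Otimes>\<^sub>M dirichlet_measure v k) borel
       (\<lambda>(s, y). v (Suc k) + s *\<^sub>R (y - v (Suc k)))"

lemma sets_dirichlet_measure [simp, measurable_cong]: "sets (dirichlet_measure v k) = sets borel"
  and space_dirichlet_measure [simp]: "space (dirichlet_measure v k) = UNIV"
  by (cases k; simp)+

text \<open>A solid pyramid and not an infinite cone: s = 0 is the apex and s = 1 the base.\<close>

definition cone :: "'a::real_vector \<Rightarrow> 'a set \<Rightarrow> 'a set" where
  "cone p F = {p + s *\<^sub>R (y - p) | s y. 0 \<le> s \<and> s \<le> 1 \<and> y \<in> F}"

lemma convex_hull_insert_cone:
  assumes "S \<noteq> {}"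
  shows "convex hull (insert p S) = cone p (convex hull S)"
proof -
  have "u *\<^sub>R p + s *\<^sub>R y = p + s *\<^sub>R (y - p)" if "u + s = 1" for u s y
  proof -
    have u: "u = 1 - s" using that by simp
    show ?thesis unfolding u by (simp add: algebra_simps)
  qed
  note * = this
  show ?thesis
  proof (intro set_eqI iffI)
    fix x assume "x \<in> convex hull (insert p S)"
    then obtain u s y where "0 \<le> u" "0 \<le> s" "y \<in> convex hull S" "u + s = 1" "x = u *\<^sub>R p + s *\<^sub>R y"
      unfolding convex_hull_insert[OF assms] by blast
    then show "x \<in> cone p (convex hull S)"
      unfolding cone_def using * by (intro CollectI exI[of _ s] exI[of _ y]) auto
  next
    fix x assume "x \<in> cone p (convex hull S)"
    then obtain s y where "0 \<le> s" "s \<le> 1" "y \<in> convex hull S" "x = p + s *\<^sub>R (y - p)"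
      unfolding cone_def by blast
    then show "x \<in> convex hull (insert p S)"
      unfolding convex_hull_insert[OF assms] using *[of "1 - s" s y]
      by (intro CollectI exI[of _ "1 - s"] conjI exI[of _ s] exI[of _ y]) auto
  qed
qed

text \<open>Fubini in the direction \<open>n\<close>. Modulo \<open>span B\<close> the base lies at
  height \<open>H\<close> above the apex, and the slice at height \<open>H * s\<close> is the base
  shrunk by the factor \<open>s\<close>. Substituting the height contributes \<open>H\<close>,
  substituting inside the slice contributes \<open>s ^ card B\<close>.\<close>

lemma cone_formula:
  fixes B :: "'a::euclidean_space set"
  assumes B: "finite B" and n: "n \<notin> span B" and H: "H > 0"
    and qp: "q - p - H *\<^sub>R n \<in> span B"
    and F: "\<And>y. y \<in> F \<Longrightarrow> y - q \<in> span B"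
    and [measurable]: "F \<in> sets borel" "cone p F \<in> sets borel" "f \<in> borel_measurable borel"
  shows "(\<integral>\<^sup>+x. f (p + x) * indicator (cone p F) (p + x) \<partial>frame_measure (insert n B))
    = (\<integral>\<^sup>+s. ennreal (H * s ^ card B) * indicator {0..1} s *
        (\<integral>\<^sup>+w. f (p + s *\<^sub>R (q + w - p)) * indicator F (q + w) \<partial>frame_measure B) \<partial>lborel)"
proof -
  note [simp] = B
  have nB: "n \<notin> B" using n span_base by blast
  have uniq: "s = t" if "s *\<^sub>R n - t *\<^sub>R n \<in> span B" for s t
  proof (rule ccontr)
    assume "s \<noteq> t"
    have "(1 / (s - t)) *\<^sub>R (s *\<^sub>R n - t *\<^sub>R n) \<in> span B"
      using that by (rule span_scale)
    also have "(1 / (s - t)) *\<^sub>R (s *\<^sub>R n - t *\<^sub>R n) = n"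
      using \<open>s \<noteq> t\<close> by (simp add: scaleR_left_diff_distrib[symmetric])
    finally show False using n by simp
  qed
  have "(\<integral>\<^sup>+x. f (p + x) * indicator (cone p F) (p + x) \<partial>frame_measure (insert n B))
    = (\<integral>\<^sup>+t. (\<integral>\<^sup>+w. f (p + (t *\<^sub>R n + w)) * indicator (cone p F) (p + (t *\<^sub>R n + w)) \<partial>frame_measure B) \<partial>lborel)"
    using B nB by (rule nn_integral_frame_insert) measurable
  also have "\<dots> = ennreal \<bar>H\<bar> * (\<integral>\<^sup>+s. (\<integral>\<^sup>+w. f (p + ((0 + H * s) *\<^sub>R n + w)) *
      indicator (cone p F) (p + ((0 + H * s) *\<^sub>R n + w)) \<partial>frame_measure B) \<partial>lborel)"
    using H by (intro nn_integral_real_affine) auto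
  also have "\<dots> = (\<integral>\<^sup>+s. ennreal H * (\<integral>\<^sup>+w. f (p + ((H * s) *\<^sub>R n + w)) *
      indicator (cone p F) (p + ((H * s) *\<^sub>R n + w)) \<partial>frame_measure B) \<partial>lborel)"
    using H by (subst nn_integral_cmult) auto
  also have "\<dots> = (\<integral>\<^sup>+s. ennreal (H * s ^ card B) * indicator {0..1} s *
        (\<integral>\<^sup>+w. f (p + s *\<^sub>R (q + w - p)) * indicator F (q + w) \<partial>frame_measure B) \<partial>lborel)"
  proof (rule nn_integral_cong_AE)
    \<comment> \<open>The slice at the apex cannot be rescaled to the base, so this null value of s
      is removed before dividing by s.\<close>
    have "AE s in lborel. s \<noteq> (0::real)"
      by (rule AE_lborel_singleton)
    then show "AE s in lborel. ennreal H * (\<integral>\<^sup>+w. f (p + ((H * s) *\<^sub>R n + w)) *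
        indicator (cone p F) (p + ((H * s) *\<^sub>R n + w)) \<partial>frame_measure B)
      = ennreal (H * s ^ card B) * indicator {0..1} s *
        (\<integral>\<^sup>+w. f (p + s *\<^sub>R (q + w - p)) * indicator F (q + w) \<partial>frame_measure B)"
    proof eventually_elim
      fix s :: real assume "s \<noteq> 0"
      \<comment> \<open>As \<open>n\<close> lies outside \<open>span B\<close>, the coefficient of
        \<open>n\<close> determines the scaling \<open>s'\<close>; the remaining component then
        determines the base point \<open>y\<close>.\<close>
      have height: "s' = s \<and> y - q - (1 / s) *\<^sub>R (w - s *\<^sub>R (q - p - H *\<^sub>R n)) = 0"
        if "w \<in> span B" "y \<in> F" and eq: "p + ((H * s) *\<^sub>R n + w) = p + s' *\<^sub>R (y - p)" for w y s'
      proof -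
        have "(H * s) *\<^sub>R n - (H * s') *\<^sub>R n = s' *\<^sub>R (y - q) + s' *\<^sub>R (q - p - H *\<^sub>R n) - w"
          using eq by (simp add: algebra_simps)
        also have "\<dots> \<in> span B"
          by (rule span_diff[OF span_add[OF span_scale[OF F[OF that(2)]] span_scale[OF qp]] that(1)])
        finally have "H * s = H * s'" by (rule uniq)
        then have [simp]: "s' = s" using H by simp
        have "s *\<^sub>R (y - q) = w - s *\<^sub>R (q - p - H *\<^sub>R n)"
          using eq by (simp add: algebra_simps)
        then have "(1 / s) *\<^sub>R (s *\<^sub>R (y - q)) = (1 / s) *\<^sub>R (w - s *\<^sub>R (q - p - H *\<^sub>R n))"
          by simp
        then show ?thesis using \<open>s \<noteq> 0\<close> by simp
      qed
      show "ennreal H * (\<integral>\<^sup>+w. f (p + ((H * s) *\<^sub>R n + w)) *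
          indicator (cone p F) (p + ((H * s) *\<^sub>R n + w)) \<partial>frame_measure B)
        = ennreal (H * s ^ card B) * indicator {0..1} s *
          (\<integral>\<^sup>+w. f (p + s *\<^sub>R (q + w - p)) * indicator F (q + w) \<partial>frame_measure B)"
      proof (cases "0 \<le> s \<and> s \<le> 1")
        case False
        have "(\<integral>\<^sup>+w. f (p + ((H * s) *\<^sub>R n + w)) * indicator (cone p F) (p + ((H * s) *\<^sub>R n + w)) \<partial>frame_measure B)
          = (\<integral>\<^sup>+w. 0 \<partial>frame_measure B)"
        proof (rule nn_integral_frame_cong_span)
          fix w assume w: "w \<in> span B"
          have "p + ((H * s) *\<^sub>R n + w) \<notin> cone p F"
            using height[OF w] False unfolding cone_def by blast
          then show "f (p + ((H * s) *\<^sub>R n + w)) * indicator (cone p F) (p + ((H * s) *\<^sub>R n + w)) = 0"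
            by simp
        qed auto
        then show ?thesis using False by (auto simp: indicator_def)
      next
        case True
        have "(\<integral>\<^sup>+w. f (p + ((H * s) *\<^sub>R n + w)) * indicator (cone p F) (p + ((H * s) *\<^sub>R n + w)) \<partial>frame_measure B)
          = ennreal (\<bar>s\<bar> ^ card B) * (\<integral>\<^sup>+w. f (p + ((H * s) *\<^sub>R n + (s *\<^sub>R (q - p - H *\<^sub>R n) + s *\<^sub>R w))) *
            indicator (cone p F) (p + ((H * s) *\<^sub>R n + (s *\<^sub>R (q - p - H *\<^sub>R n) + s *\<^sub>R w))) \<partial>frame_measure B)"
          using qp \<open>s \<noteq> 0\<close> by (intro nn_integral_frame_affine span_scale) auto
        also have "(\<integral>\<^sup>+w. f (p + ((H * s) *\<^sub>R n + (s *\<^sub>R (q - p - H *\<^sub>R n) + s *\<^sub>R w))) *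
            indicator (cone p F) (p + ((H * s) *\<^sub>R n + (s *\<^sub>R (q - p - H *\<^sub>R n) + s *\<^sub>R w))) \<partial>frame_measure B)
          = (\<integral>\<^sup>+w. f (p + s *\<^sub>R (q + w - p)) * indicator F (q + w) \<partial>frame_measure B)"
        proof (rule nn_integral_frame_cong_span)
          fix w assume w: "w \<in> span B"
          have eq: "p + ((H * s) *\<^sub>R n + (s *\<^sub>R (q - p - H *\<^sub>R n) + s *\<^sub>R w)) = p + s *\<^sub>R (q + w - p)"
            by (simp add: algebra_simps)
          have "p + s *\<^sub>R (q + w - p) \<in> cone p F \<longleftrightarrow> q + w \<in> F"
          proof
            assume "q + w \<in> F"
            then show "p + s *\<^sub>R (q + w - p) \<in> cone p F"
              unfolding cone_def using True by blast
          next
            assume "p + s *\<^sub>R (q + w - p) \<in> cone p F"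
            then obtain s' y where y: "y \<in> F" "p + s *\<^sub>R (q + w - p) = p + s' *\<^sub>R (y - p)"
              unfolding cone_def by blast
            have "s *\<^sub>R (q - p - H *\<^sub>R n) + s *\<^sub>R w \<in> span B"
              using w qp by (intro span_add span_scale)
            moreover have "p + ((H * s) *\<^sub>R n + (s *\<^sub>R (q - p - H *\<^sub>R n) + s *\<^sub>R w)) = p + s' *\<^sub>R (y - p)"
              using y(2) by (simp only: eq)
            ultimately have "y - q - (1 / s) *\<^sub>R (s *\<^sub>R (q - p - H *\<^sub>R n) + s *\<^sub>R w - s *\<^sub>R (q - p - H *\<^sub>R n)) = 0"
              using height y(1) by blast
            then have "y = q + w" using \<open>s \<noteq> 0\<close> by (simp add: algebra_simps)
            then show "q + w \<in> F" using y by simp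
          qed
          then show "f (p + ((H * s) *\<^sub>R n + (s *\<^sub>R (q - p - H *\<^sub>R n) + s *\<^sub>R w))) *
            indicator (cone p F) (p + ((H * s) *\<^sub>R n + (s *\<^sub>R (q - p - H *\<^sub>R n) + s *\<^sub>R w)))
            = f (p + s *\<^sub>R (q + w - p)) * indicator F (q + w)"
            unfolding eq by (simp add: indicator_def)
        qed auto
        finally show ?thesis
          using True H by (simp add: ennreal_mult mult.assoc)
      qed
    qed
  qed
  finally show ?thesis .
qed

text \<open>Agrees with \<open>flat_lborel\<close> once a base point and an orthonormal basis are
  fixed, but keeps both explicit so that they can be varied.\<close>

definition flat_measure :: "'a::euclidean_space \<Rightarrow> 'a set \<Rightarrow> 'a measure" where
  "flat_measure q B = distr (frame_measure B) borel (\<lambda>w. q + w)"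

lemma sets_flat_measure [simp, measurable_cong]: "sets (flat_measure q B) = sets borel"
  and space_flat_measure [simp]: "space (flat_measure q B) = UNIV"
  by (simp_all add: flat_measure_def)

lemma nn_integral_flat_measure:
  assumes [measurable]: "f \<in> borel_measurable borel"
  shows "(\<integral>\<^sup>+y. f y \<partial>flat_measure q B) = (\<integral>\<^sup>+w. f (q + w) \<partial>frame_measure B)"
  unfolding flat_measure_def by (rule nn_integral_distr) auto

lemma flat_measure_base:
  assumes "finite B" "p - q \<in> span B"
  shows "flat_measure p B = flat_measure q B"
proof (rule measure_eqI)
  fix A assume "A \<in> sets (flat_measure p B)"
  then have [measurable]: "A \<in> sets borel" by simp
  have "(\<integral>\<^sup>+w. indicator A (q + w) \<partial>frame_measure B)
      = (\<integral>\<^sup>+w. indicator A (q + ((p - q) + w)) \<partial>frame_measure B)"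
    using nn_integral_frame_affine[of B "p - q" 1 "\<lambda>w. indicator A (q + w)"] assms by simp
  then show "emeasure (flat_measure p B) A = emeasure (flat_measure q B) A"
    using nn_integral_flat_measure[of "indicator A" p B] nn_integral_flat_measure[of "indicator A" q B]
    by (simp add: algebra_simps)
qed simp

text \<open>The cone formula with constant integrand gives the volume. Dividing by it cancels the
  height \<open>H\<close> and leaves the density (k + 1) s^k of the scaling, whatever the base
  point: under the uniform measure of the cone, scaling and base point are independent.\<close>

lemma
  fixes B :: "'a::euclidean_space set"
  assumes B: "finite B" and n: "n \<notin> span B" and H: "H > 0"
    and qp: "q - p - H *\<^sub>R n \<in> span B"
    and F: "\<And>y. y \<in> F \<Longrightarrow> y - q \<in> span B"
    and [measurable]: "F \<in> sets borel" "cone p F \<in> sets borel"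
  shows emeasure_cone:
      "emeasure (flat_measure p (insert n B)) (cone p F)
        = ennreal (H / real (Suc (card B))) * emeasure (flat_measure q B) F"
    and uniform_measure_cone:
      "\<lbrakk>emeasure (flat_measure q B) F \<noteq> 0; emeasure (flat_measure q B) F \<noteq> \<infinity>\<rbrakk> \<Longrightarrow>
        uniform_measure (flat_measure p (insert n B)) (cone p F)
        = distr (power_measure (Suc (card B)) \<Otimes>\<^sub>M uniform_measure (flat_measure q B) F) borel
            (\<lambda>(s, y). p + s *\<^sub>R (y - p))"
proof -
  define k where "k = card B"
  define a where "a = emeasure (flat_measure q B) F"
  have cone: "(\<integral>\<^sup>+x. f x * indicator (cone p F) x \<partial>flat_measure p (insert n B))
     = ennreal H * (\<integral>\<^sup>+s. ennreal (s ^ k) * indicator {0..1} s *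
        (\<integral>\<^sup>+y. f (p + s *\<^sub>R (y - p)) * indicator F y \<partial>flat_measure q B) \<partial>lborel)"
    if [measurable]: "f \<in> borel_measurable borel" for f
  proof -
    have "(\<integral>\<^sup>+x. f x * indicator (cone p F) x \<partial>flat_measure p (insert n B))
     = (\<integral>\<^sup>+s. ennreal (H * s ^ k) * indicator {0..1} s *
        (\<integral>\<^sup>+w. f (p + s *\<^sub>R (q + w - p)) * indicator F (q + w) \<partial>frame_measure B) \<partial>lborel)"
      unfolding k_def using B n H qp F
      by (subst nn_integral_flat_measure, simp, intro cone_formula) auto
    also have "\<dots> = (\<integral>\<^sup>+s. ennreal H * (ennreal (s ^ k) * indicator {0..1} s *
        (\<integral>\<^sup>+w. f (p + s *\<^sub>R (q + w - p)) * indicator F (q + w) \<partial>frame_measure B)) \<partial>lborel)"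
      using H by (intro nn_integral_cong) (auto simp: ennreal_mult mult.assoc indicator_def)
    also have "\<dots> = ennreal H * (\<integral>\<^sup>+s. (ennreal (s ^ k) * indicator {0..1} s *
        (\<integral>\<^sup>+w. f (p + s *\<^sub>R (q + w - p)) * indicator F (q + w) \<partial>frame_measure B)) \<partial>lborel)"
      using B by (intro nn_integral_cmult) measurable
    finally show ?thesis
      by (simp add: nn_integral_flat_measure)
  qed
  have "emeasure (flat_measure p (insert n B)) (cone p F)
      = ennreal H * (\<integral>\<^sup>+s. ennreal (s ^ k) * indicator {0..1} s * a \<partial>lborel)"
    using cone[of "\<lambda>_. 1"] by (simp add: a_def)
  also have "\<dots> = ennreal H * (ennreal (1 / real (Suc k)) * a)"
    by (simp add: nn_integral_multc nn_integral_power_01)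
  also have "\<dots> = ennreal (H / real (Suc k)) * a"
    using H by (simp add: mult.assoc[symmetric] ennreal_mult[symmetric])
  finally show vol: "emeasure (flat_measure p (insert n B)) (cone p F)
        = ennreal (H / real (Suc (card B))) * emeasure (flat_measure q B) F"
    by (simp add: a_def k_def)
  assume a: "emeasure (flat_measure q B) F \<noteq> 0" "emeasure (flat_measure q B) F \<noteq> \<infinity>"
  define U where "U = uniform_measure (flat_measure q B) F"
  have [simp, measurable_cong]: "sets U = sets borel" by (simp add: U_def)
  interpret U: prob_space U
    unfolding U_def using a by (intro prob_space_uniform_measure) auto
  show "uniform_measure (flat_measure p (insert n B)) (cone p F)
        = distr (power_measure (Suc (card B)) \<Otimes>\<^sub>M uniform_measure (flat_measure q B) F) borel
            (\<lambda>(s, y). p + s *\<^sub>R (y - p))"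
    (is "?L = ?R")
  proof (rule measure_eqI)
    fix A assume "A \<in> sets ?L"
    then have [measurable]: "A \<in> sets borel" by simp
    obtain r where r: "a = ennreal r" "r > 0"
      using a unfolding a_def[symmetric] by (cases a) (auto simp: less_le)
    define X where "X s = (\<integral>\<^sup>+y. indicator A (p + s *\<^sub>R (y - p)) * indicator F y \<partial>flat_measure q B)" for s
    have [measurable]: "X \<in> borel_measurable borel"
      unfolding X_def using B by (simp add: nn_integral_flat_measure)
    define Y where "Y = (\<integral>\<^sup>+s. ennreal (s ^ k) * indicator {0..1} s * X s \<partial>lborel)"
    have "emeasure ?L A = (\<integral>\<^sup>+x. indicator A x \<partial>?L)"
      by simp
    also have "\<dots> = (\<integral>\<^sup>+x. indicator A x * indicator (cone p F) x \<partial>flat_measure p (insert n B))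
        / emeasure (flat_measure p (insert n B)) (cone p F)"
      by (rule nn_integral_uniform_measure) auto
    also have "\<dots> = ennreal H * Y / (ennreal (H / real (Suc k)) * a)"
      by (simp add: cone vol a_def k_def Y_def X_def)
    also have "\<dots> = ennreal (real (Suc k)) * Y / a"
    proof -
      have "ennreal H * Y / (ennreal (H / real (Suc k)) * a) = Y * (ennreal H / ennreal (H / real (Suc k) * r))"
        using H r by (simp add: ennreal_mult[symmetric] mult.commute ennreal_times_divide)
      also have "ennreal H / ennreal (H / real (Suc k) * r) = ennreal (real (Suc k)) / ennreal r"
        using H r by (simp add: divide_ennreal del: of_nat_Suc)
      finally show ?thesis
        by (simp add: r ennreal_times_divide mult.commute)
    qed
    finally have L: "emeasure ?L A = ennreal (real (Suc k)) * Y / a" .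
    have "emeasure ?R A = (\<integral>\<^sup>+x. indicator A x \<partial>?R)"
      by simp
    also have "\<dots> = (\<integral>\<^sup>+z. indicator A (case z of (s, y) \<Rightarrow> p + s *\<^sub>R (y - p)) \<partial>(power_measure (Suc k) \<Otimes>\<^sub>M U))"
      unfolding U_def[symmetric] k_def by (rule nn_integral_distr) measurable
    also have "\<dots> = (\<integral>\<^sup>+s. (\<integral>\<^sup>+y. indicator A (p + s *\<^sub>R (y - p)) \<partial>U) \<partial>power_measure (Suc k))"
      by (subst U.nn_integral_fst[symmetric]) auto
    also have "\<dots> = (\<integral>\<^sup>+s. X s / a \<partial>power_measure (Suc k))"
      unfolding U_def X_def a_def by (intro nn_integral_cong nn_integral_uniform_measure) auto
    also have "\<dots> = (\<integral>\<^sup>+s. ennreal (real (Suc k) * s ^ k) * indicator {0..1} s * (X s / a) \<partial>lborel)"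
      unfolding power_measure_def by (subst nn_integral_density) auto
    also have "\<dots> = (\<integral>\<^sup>+s. ennreal (real (Suc k)) * (ennreal (s ^ k) * indicator {0..1} s * X s) / a \<partial>lborel)"
      by (intro nn_integral_cong)
         (auto simp: ennreal_mult mult.assoc indicator_def ennreal_times_divide simp del: of_nat_Suc)
    also have "\<dots> = ennreal (real (Suc k)) * Y / a"
      by (simp add: nn_integral_divide nn_integral_cmult Y_def del: of_nat_Suc)
    finally show "emeasure ?L A = emeasure ?R A"
      using L by simp
  qed (simp)
qed

section \<open>Simplices as iterated cones\<close>

lemma span_diffs_insert:
  fixes v :: "nat \<Rightarrow> 'a::euclidean_space"
  shows "span ((\<lambda>i. v i - v 0) ` {..Suc k}) = span (insert (v (Suc k) - v 0) ((\<lambda>i. v i - v 0) ` {..k}))"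
  by (simp add: atMost_Suc)

lemma affine_hull_diffs:
  fixes v :: "nat \<Rightarrow> 'a::euclidean_space"
  shows "affine hull (v ` {..k}) = {x. x - v 0 \<in> span ((\<lambda>i. v i - v 0) ` {..k})}"
proof -
  have "affine hull (v ` {..k}) = (+) (v 0) ` span ((\<lambda>x. - v 0 + x) ` (v ` {..k}))"
    by (intro affine_hull_span_gen hull_inc) auto
  also have "(\<lambda>x. - v 0 + x) ` (v ` {..k}) = (\<lambda>i. v i - v 0) ` {..k}"
    by (auto simp: image_image)
  finally show ?thesis
    by (auto simp: image_iff algebra_simps intro!: bexI[of _ "_ - v 0"])
qed

text \<open>Bridges two descriptions of the direction space: \<open>flat_lborel\<close> uses all
  differences of points of the hull, the recursion over the vertices only the edges at
  \<open>v 0\<close>.\<close>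

lemma span_differences:
  fixes v :: "nat \<Rightarrow> 'a::euclidean_space"
  shows "span {x - y |x y. x \<in> convex hull (v ` {..k}) \<and> y \<in> convex hull (v ` {..k})}
    = span ((\<lambda>i. v i - v 0) ` {..k})" (is "span ?D = span ?S")
proof (rule subset_antisym)
  have "x - y \<in> span ?S" if "x \<in> convex hull (v ` {..k})" "y \<in> convex hull (v ` {..k})" for x y
  proof -
    have "x - v 0 \<in> span ?S" "y - v 0 \<in> span ?S"
      using that convex_hull_subset_affine_hull[of "v ` {..k}"] by (auto simp: affine_hull_diffs)
    from span_diff[OF this] show ?thesis by simp
  qed
  then show "span ?D \<subseteq> span ?S"
    by (intro span_minimal subspace_span) auto
  have "?S \<subseteq> ?D"
  proof (intro image_subsetI CollectI exI conjI)
    fix i assume "i \<in> {..k}"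
    then show "v i \<in> convex hull (v ` {..k})" "v 0 \<in> convex hull (v ` {..k})"
      by (auto intro: hull_inc)
  qed (rule refl)
  then show "span ?S \<subseteq> span ?D"
    by (rule span_mono)
qed

text \<open>One step of the construction of a simplex as a cone over a facet: an orthonormal basis \<open>B\<close>
  of the direction space of the facet is completed by a unit vector \<open>n\<close> pointing from the apex
  to the facet.\<close>

lemma simplex_step:
  fixes v :: "nat \<Rightarrow> 'a::euclidean_space" and k :: nat
  defines "p \<equiv> v (Suc k)" and "F \<equiv> convex hull (v ` {..k})" and "T \<equiv> convex hull (v ` {..Suc k})"
  assumes orth: "pairwise orthogonal B" "\<forall>b\<in>B. norm b = 1"
    and span: "span B = span ((\<lambda>i. v i - v 0) ` {..k})"
    and p: "p \<notin> affine hull (v ` {..k})"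
  obtains n H where "norm n = 1" "n \<notin> B" "pairwise orthogonal (insert n B)" "H > 0"
    "\<And>y. y \<in> F \<Longrightarrow> n \<bullet> (y - p) = H"
    "span (insert n B) = span ((\<lambda>i. v i - v 0) ` {..Suc k})"
    "\<And>q. q \<in> F \<Longrightarrow> emeasure (flat_measure p (insert n B)) T
        = ennreal (H / real (Suc (card B))) * emeasure (flat_measure q B) F"
    "\<And>q. \<lbrakk>q \<in> F; emeasure (flat_measure q B) F \<noteq> 0; emeasure (flat_measure q B) F \<noteq> \<infinity>\<rbrakk> \<Longrightarrow>
        uniform_measure (flat_measure p (insert n B)) T
        = distr (power_measure (Suc (card B)) \<Otimes>\<^sub>M uniform_measure (flat_measure q B) F) borel
            (\<lambda>(s, y). p + s *\<^sub>R (y - p))"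
proof -
  have fin: "finite B"
    using orth by (intro independent_imp_finite pairwise_orthogonal_independent) auto
  have F_span: "y - x \<in> span B" if "x \<in> F" "y \<in> F" for x y
    unfolding span span_differences[symmetric]
    using that by (intro span_base) (auto simp: F_def)
  have cone: "T = cone p F"
    unfolding T_def F_def p_def by (simp add: atMost_Suc convex_hull_insert_cone)
  have [measurable]: "F \<in> sets borel" "T \<in> sets borel"
    unfolding F_def T_def by (intro borel_closed compact_imp_closed compact_convex_hull finite_imp_compact; simp)+
  have v0: "v 0 \<in> F"
    unfolding F_def by (auto intro: hull_inc)
  \<comment> \<open>\<open>m\<close> is the orthogonal projection of \<open>v 0 - p\<close> onto the
    direction space of the facet. The remainder \<open>n0\<close> is the height vector, nonzero
    because the apex lies off the affine hull.\<close>
  define m where "m = (\<Sum>b\<in>B. ((v 0 - p) \<bullet> b) *\<^sub>R b)"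
  define n0 where "n0 = (v 0 - p) - m"
  have m: "m \<in> span B"
    unfolding m_def by (intro span_sum span_scale span_base)
  have "p - v 0 \<notin> span B"
    using p by (simp add: affine_hull_diffs span)
  then have np: "v 0 - p \<notin> span B"
    using span_neg[of "v 0 - p" B] by auto
  then have "n0 \<noteq> 0"
    using m by (auto simp: n0_def)
  have n0_orth: "n0 \<bullet> b = 0" if "b \<in> B" for b
  proof -
    have "m \<bullet> b = (\<Sum>c\<in>B. if c = b then (v 0 - p) \<bullet> b else 0)"
      unfolding m_def inner_sum_left
      using orth that by (intro sum.cong) (auto simp: pairwise_def orthogonal_def dot_square_norm)
    also have "\<dots> = (v 0 - p) \<bullet> b"
      using that fin by simp
    finally show ?thesis by (simp add: n0_def inner_diff_left)
  qed
  define H where "H = norm n0"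
  define n where "n = (1 / H) *\<^sub>R n0"
  have H: "H > 0" and n1: "norm n = 1" and Hn: "H *\<^sub>R n = n0"
    using \<open>n0 \<noteq> 0\<close> by (auto simp: H_def n_def)
  have n_orth: "n \<bullet> w = 0" if "w \<in> span B" for w
  proof -
    have "orthogonal n w"
      by (rule orthogonal_to_span[OF that]) (simp add: orthogonal_def n_def n0_orth)
    then show ?thesis by (simp add: orthogonal_def)
  qed
  have nB: "n \<notin> span B"
    using n_orth[of n] n1 by (auto simp: dot_square_norm)
  have qp: "q - p - H *\<^sub>R n \<in> span B" if "q \<in> F" for q
  proof -
    have eq: "q - p - H *\<^sub>R n = (q - v 0) + m"
      unfolding Hn n0_def by simp
    show ?thesis
      unfolding eq by (rule span_add[OF F_span[OF v0 that] m])
  qed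
  have dist: "n \<bullet> (y - p) = H" if "y \<in> F" for y
    using n_orth[OF qp[OF that]] n1 by (simp add: inner_diff_right dot_square_norm)
  have "insert n B \<subseteq> span (insert (v (Suc k) - v 0) B)"
  proof -
    have "v (Suc k) - v 0 \<in> span (insert (v (Suc k) - v 0) B)"
      by (intro span_base) auto
    moreover have "m \<in> span (insert (v (Suc k) - v 0) B)"
      using m span_mono[of B "insert (v (Suc k) - v 0) B"] by auto
    ultimately have "- (1 / H) *\<^sub>R ((v (Suc k) - v 0) + m) \<in> span (insert (v (Suc k) - v 0) B)"
      by (intro span_scale span_add)
    moreover have "- (1 / H) *\<^sub>R ((v (Suc k) - v 0) + m) = n"
      by (simp add: n_def n0_def p_def algebra_simps)
    ultimately show ?thesis
      using span_superset[of "insert (v (Suc k) - v 0) B"] by auto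
  qed
  then have 1: "span (insert n B) \<subseteq> span (insert (v (Suc k) - v 0) B)"
    by (intro span_minimal subspace_span)
  have "insert (v (Suc k) - v 0) B \<subseteq> span (insert n B)"
  proof -
    have "n \<in> span (insert n B)"
      by (intro span_base) auto
    moreover have "m \<in> span (insert n B)"
      using m span_mono[of B "insert n B"] by auto
    ultimately have "- (H *\<^sub>R n + m) \<in> span (insert n B)"
      by (intro span_neg span_scale span_add)
    moreover have "- (H *\<^sub>R n + m) = v (Suc k) - v 0"
      by (simp add: Hn n0_def p_def)
    ultimately show ?thesis
      using span_superset[of "insert n B"] by auto
  qed
  then have 2: "span (insert (v (Suc k) - v 0) B) \<subseteq> span (insert n B)"
    by (intro span_minimal subspace_span)
  have span': "span (insert n B) = span ((\<lambda>i. v i - v 0) ` {..Suc k})"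
  proof -
    have "span (insert (v (Suc k) - v 0) B) = span (insert (v (Suc k) - v 0) ((\<lambda>i. v i - v 0) ` {..k}))"
      by (simp only: span_insert span)
    with 1 2 show ?thesis
      unfolding span_diffs_insert by simp
  qed
  show ?thesis
  proof (rule that[of n H])
    show "pairwise orthogonal (insert n B)"
      using orth(1) n_orth[OF span_base] by (auto simp: pairwise_insert orthogonal_def inner_commute)
    show "emeasure (flat_measure p (insert n B)) T
        = ennreal (H / real (Suc (card B))) * emeasure (flat_measure q B) F" if "q \<in> F" for q
      unfolding cone
      by (rule emeasure_cone[OF fin nB H qp[OF that] F_span[OF that]]) (simp_all add: cone[symmetric])
    show "uniform_measure (flat_measure p (insert n B)) T
        = distr (power_measure (Suc (card B)) \<Otimes>\<^sub>M uniform_measure (flat_measure q B) F) borel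
            (\<lambda>(s, y). p + s *\<^sub>R (y - p))"
      if "q \<in> F" "emeasure (flat_measure q B) F \<noteq> 0" "emeasure (flat_measure q B) F \<noteq> \<infinity>" for q
      unfolding cone
      by (rule uniform_measure_cone[OF fin nB H qp[OF that(1)] F_span[OF that(1)] _ _ that(2,3)])
         (simp_all add: cone[symmetric])
  qed (use H n1 nB dist span' span_base in auto)
qed

lemma flat_measure_UNIV:
  fixes B :: "'a::euclidean_space set"
  assumes "pairwise orthogonal B" "\<forall>b\<in>B. norm b = 1" "span B = UNIV"
  shows "flat_measure q B = lborel"
  unfolding flat_measure_def frame_measure_eq_lborel[OF assms]
  by (rule lborel_distr_plus)

lemma flat_measure_empty: "flat_measure q {} = return borel q"
proof (rule measure_eqI)
  fix A assume "A \<in> sets (flat_measure q {})"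
  then have [measurable]: "A \<in> sets borel" by simp
  show "emeasure (flat_measure q {}) A = emeasure (return borel q) A"
    using nn_integral_flat_measure[of "indicator A" q "{}"] by (simp add: nn_integral_frame PiM_empty)
qed simp

text \<open>Induction over the vertices with the cone step. That the volume of the current face is
  finite and nonzero belongs to the claim because the next normalisation divides by it. The basis is
  existential because every step extends it by the normal found there.\<close>

lemma uniform_measure_flat_simplex:
  fixes v :: "nat \<Rightarrow> 'a::euclidean_space"
  assumes "\<And>j. j < k \<Longrightarrow> v (Suc j) \<notin> affine hull (v ` {..j})"
  shows "\<exists>B. pairwise orthogonal B \<and> (\<forall>b\<in>B. norm b = 1) \<and> finite B \<and> card B = k \<and>
    span B = span ((\<lambda>i. v i - v 0) ` {..k}) \<and>
    emeasure (flat_measure (v 0) B) (convex hull (v ` {..k})) \<noteq> 0 \<and>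
    emeasure (flat_measure (v 0) B) (convex hull (v ` {..k})) \<noteq> \<infinity> \<and>
    uniform_measure (flat_measure (v 0) B) (convex hull (v ` {..k})) = dirichlet_measure v k"
  using assms
proof (induction k)
  case 0
  have one: "emeasure (return borel (v 0)) {v 0} = 1"
    by simp
  have "uniform_measure (return borel (v 0)) {v 0} = return borel (v 0)"
  proof (rule measure_eqI)
    fix A assume "A \<in> sets (uniform_measure (return borel (v 0)) {v 0})"
    then have [measurable]: "A \<in> sets borel" by simp
    have "emeasure (uniform_measure (return borel (v 0)) {v 0}) A
        = emeasure (return borel (v 0)) ({v 0} \<inter> A) / emeasure (return borel (v 0)) {v 0}"
      by (rule emeasure_uniform_measure) auto
    then show "emeasure (uniform_measure (return borel (v 0)) {v 0}) A = emeasure (return borel (v 0)) A"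
      by (simp add: one emeasure_return indicator_def)
  qed simp
  then show ?case
    by (intro exI[of _ "{}"]) (auto simp: flat_measure_empty one)
next
  case (Suc k)
  note Suc.IH[OF Suc.prems[OF less_SucI]]
  then obtain B where B: "pairwise orthogonal B" "\<forall>b\<in>B. norm b = 1" "finite B"
    "card B = k" "span B = span ((\<lambda>i. v i - v 0) ` {..k})"
    "emeasure (flat_measure (v 0) B) (convex hull (v ` {..k})) \<noteq> 0"
    "emeasure (flat_measure (v 0) B) (convex hull (v ` {..k})) \<noteq> \<infinity>"
    "uniform_measure (flat_measure (v 0) B) (convex hull (v ` {..k})) = dirichlet_measure v k"
    by blast
  have v0: "v 0 \<in> convex hull (v ` {..k})"
    by (auto intro: hull_inc)
  obtain n H where n: "norm n = 1" "n \<notin> B" "pairwise orthogonal (insert n B)" "H > 0"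
    "\<And>y. y \<in> convex hull (v ` {..k}) \<Longrightarrow> n \<bullet> (y - v (Suc k)) = H"
    "span (insert n B) = span ((\<lambda>i. v i - v 0) ` {..Suc k})"
    "\<And>q. q \<in> convex hull (v ` {..k}) \<Longrightarrow> emeasure (flat_measure (v (Suc k)) (insert n B)) (convex hull (v ` {..Suc k}))
        = ennreal (H / real (Suc (card B))) * emeasure (flat_measure q B) (convex hull (v ` {..k}))"
    "\<And>q. \<lbrakk>q \<in> convex hull (v ` {..k}); emeasure (flat_measure q B) (convex hull (v ` {..k})) \<noteq> 0;
        emeasure (flat_measure q B) (convex hull (v ` {..k})) \<noteq> \<infinity>\<rbrakk> \<Longrightarrow>
        uniform_measure (flat_measure (v (Suc k)) (insert n B)) (convex hull (v ` {..Suc k}))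
        = distr (power_measure (Suc (card B)) \<Otimes>\<^sub>M uniform_measure (flat_measure q B) (convex hull (v ` {..k}))) borel
            (\<lambda>(s, y). v (Suc k) + s *\<^sub>R (y - v (Suc k)))"
    by (rule simplex_step[OF B(1,2,5) Suc.prems[OF lessI]]) (rule that)
  have base: "flat_measure (v (Suc k)) (insert n B) = flat_measure (v 0) (insert n B)"
    using B(3) n(6) by (intro flat_measure_base) (auto intro!: span_base)
  show ?case
  proof (intro exI[of _ "insert n B"] conjI)
    show "emeasure (flat_measure (v 0) (insert n B)) (convex hull (v ` {..Suc k})) \<noteq> 0"
      "emeasure (flat_measure (v 0) (insert n B)) (convex hull (v ` {..Suc k})) \<noteq> \<infinity>"
      using n(7)[OF v0] B(6,7) n(4) by (auto simp: base ennreal_mult_eq_top_iff)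
    show "uniform_measure (flat_measure (v 0) (insert n B)) (convex hull (v ` {..Suc k})) = dirichlet_measure v (Suc k)"
      using n(8)[OF v0 B(6,7)] by (simp add: base B(4,8))
  qed (use B n in auto)
qed

section \<open>Poincare inequality on simplices\<close>

text \<open>With the partial means a, b and the mean m, the interaction term F - a - b + m has a
  nonnegative second moment. Expanded, this says that the variances of a and b together do not
  exceed that of F; equivalently, Var F is at most the sum of the two mean conditional variances.
  The uniform bound on F makes every product in the expansion integrable.\<close>

lemma efron_stein:
  fixes F :: "'b \<Rightarrow> 'c \<Rightarrow> real"
  assumes "prob_space N" "prob_space M"
    and [measurable]: "case_prod F \<in> borel_measurable (N \<Otimes>\<^sub>M M)"
    and bound: "\<And>s y. \<bar>F s y\<bar> \<le> C"
    and R1: "integrable N R1" "AE s in N. (\<integral>y. (F s y)\<^sup>2 \<partial>M) - (\<integral>y. F s y \<partial>M)\<^sup>2 \<le> R1 s"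
    and R2: "integrable M R2" "AE y in M. (\<integral>s. (F s y)\<^sup>2 \<partial>N) - (\<integral>s. F s y \<partial>N)\<^sup>2 \<le> R2 y"
  shows "(\<integral>z. (case_prod F z)\<^sup>2 \<partial>(N \<Otimes>\<^sub>M M)) - (\<integral>z. case_prod F z \<partial>(N \<Otimes>\<^sub>M M))\<^sup>2
    \<le> (\<integral>s. R1 s \<partial>N) + (\<integral>y. R2 y \<partial>M)"
proof -
  interpret N: prob_space N by fact
  interpret M: prob_space M by fact
  interpret pair_prob_space N M ..
  define P where "P = N \<Otimes>\<^sub>M M"
  interpret Q: prob_space P unfolding P_def by (rule P.prob_space_axioms)
  have C: "C \<ge> 0" using bound[of undefined undefined] by linarith
  define a where "a s = (\<integral>y. F s y \<partial>M)" for s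
  define b where "b y = (\<integral>s. F s y \<partial>N)" for y
  have [measurable]: "a \<in> borel_measurable N" "b \<in> borel_measurable M"
    unfolding a_def b_def by measurable
  have [measurable]: "case_prod F \<in> borel_measurable P" "fst \<in> measurable P N" "snd \<in> measurable P M"
    unfolding P_def by measurable
  have Fs: "integrable M (F s)" if "s \<in> space N" for s
  proof (rule M.integrable_const_bound[where B = C])
    show "F s \<in> borel_measurable M"
      using measurable_compose[OF measurable_Pair1'[OF that] assms(3)] by simp
  qed (use bound in auto)
  have Fy: "integrable N (\<lambda>s. F s y)" if "y \<in> space M" for y
  proof (rule N.integrable_const_bound[where B = C])
    show "(\<lambda>s. F s y) \<in> borel_measurable N"
      using measurable_compose[OF measurable_Pair2'[OF that] assms(3)] by simp
  qed (use bound in auto)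
  have ab: "\<bar>a s\<bar> \<le> C" if "s \<in> space N" for s
  proof -
    have "\<bar>a s\<bar> \<le> (\<integral>y. \<bar>F s y\<bar> \<partial>M)"
      unfolding a_def by (rule integral_abs_bound)
    also have "\<dots> \<le> (\<integral>y. C \<partial>M)"
      using Fs[OF that] bound by (intro integral_mono) auto
    finally show ?thesis by (simp add: M.prob_space)
  qed
  have bb: "\<bar>b y\<bar> \<le> C" if "y \<in> space M" for y
  proof -
    have "\<bar>b y\<bar> \<le> (\<integral>s. \<bar>F s y\<bar> \<partial>N)"
      unfolding b_def by (rule integral_abs_bound)
    also have "\<dots> \<le> (\<integral>s. C \<partial>N)"
      using Fy[OF that] bound by (intro integral_mono) auto
    finally show ?thesis by (simp add: N.prob_space)
  qed
  \<comment> \<open>Including the constant 1 lets one statement cover all squares, mixed products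
    and single functions of the expansion.\<close>
  have bdd: "integrable P (\<lambda>z. f z * g z)"
    if f: "f \<in> {case_prod F, a \<circ> fst, b \<circ> snd, \<lambda>_. 1}" and g: "g \<in> {case_prod F, a \<circ> fst, b \<circ> snd, \<lambda>_. 1}" for f g
  proof (rule Q.integrable_const_bound[where B = "(1 + C) * (1 + C)"])
    have *: "\<bar>h z\<bar> \<le> 1 + C" if "h \<in> {case_prod F, a \<circ> fst, b \<circ> snd, \<lambda>_. 1}" "z \<in> space P" for h z
      using that bound[of "fst z" "snd z"] ab[of "fst z"] bb[of "snd z"] C
      by (auto simp: P_def space_pair_measure)
    show "AE z in P. norm (f z * g z) \<le> (1 + C) * (1 + C)"
      using *[OF f] *[OF g] C by (intro AE_I2) (auto simp: abs_mult intro!: mult_mono)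
    have "h \<in> borel_measurable P" if "h \<in> {case_prod F, a \<circ> fst, b \<circ> snd, \<lambda>_. 1}" for h
      using that by (auto simp: comp_def)
    from this[OF f] this[OF g] show "(\<lambda>z. f z * g z) \<in> borel_measurable P"
      by measurable
  qed
  define A where "A = (\<integral>s. (a s)\<^sup>2 \<partial>N)"
  define B where "B = (\<integral>y. (b y)\<^sup>2 \<partial>M)"
  define m where "m = (\<integral>z. case_prod F z \<partial>P)"
  define S where "S = (\<integral>z. (case_prod F z)\<^sup>2 \<partial>P)"
  have fst: "(\<integral>z. f z \<partial>P) = (\<integral>s. (\<integral>y. f (s, y) \<partial>M) \<partial>N)" if "integrable P f" for f :: "_ \<Rightarrow> real"
    using integral_fst'[of f] that by (simp add: P_def)
  have snd: "(\<integral>z. f z \<partial>P) = (\<integral>y. (\<integral>s. f (s, y) \<partial>N) \<partial>M)" if "integrable P f" for f :: "_ \<Rightarrow> real"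
    using integral_snd[of "\<lambda>s y. f (s, y)"] that by (simp add: P_def)
  have ma: "m = (\<integral>s. a s \<partial>N)" and mb: "m = (\<integral>y. b y \<partial>M)"
    using fst[OF bdd, of "case_prod F" "\<lambda>_. 1"] snd[OF bdd, of "case_prod F" "\<lambda>_. 1"]
    by (simp_all add: m_def a_def b_def)
  have a1: "(\<integral>z. a (fst z) \<partial>P) = m"
    using fst[OF bdd, of "a \<circ> fst" "\<lambda>_. 1"] by (simp add: ma M.prob_space)
  have b1: "(\<integral>z. b (snd z) \<partial>P) = m"
    using snd[OF bdd, of "b \<circ> snd" "\<lambda>_. 1"] by (simp add: mb N.prob_space)
  have aa: "(\<integral>z. a (fst z) * a (fst z) \<partial>P) = A"
    using fst[OF bdd, of "a \<circ> fst" "a \<circ> fst"] by (simp add: A_def M.prob_space power2_eq_square)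
  have bb': "(\<integral>z. b (snd z) * b (snd z) \<partial>P) = B"
    using snd[OF bdd, of "b \<circ> snd" "b \<circ> snd"] by (simp add: B_def N.prob_space power2_eq_square)
  have Fa: "(\<integral>z. case_prod F z * a (fst z) \<partial>P) = A"
    using fst[OF bdd, of "case_prod F" "a \<circ> fst"] by (simp add: A_def a_def[symmetric] power2_eq_square)
  have Fb: "(\<integral>z. case_prod F z * b (snd z) \<partial>P) = B"
    using snd[OF bdd, of "case_prod F" "b \<circ> snd"] by (simp add: B_def b_def[symmetric] power2_eq_square)
  have ab': "(\<integral>z. a (fst z) * b (snd z) \<partial>P) = m\<^sup>2"
    using fst[OF bdd, of "a \<circ> fst" "b \<circ> snd"] by (simp add: ma[symmetric] mb[symmetric] power2_eq_square)
  have FF: "(\<integral>z. case_prod F z * case_prod F z \<partial>P) = S"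
    by (simp add: S_def power2_eq_square)
  note i = bdd[of "case_prod F" "case_prod F", simplified] bdd[of "a \<circ> fst" "a \<circ> fst", simplified]
    bdd[of "b \<circ> snd" "b \<circ> snd", simplified] bdd[of "case_prod F" "a \<circ> fst", simplified]
    bdd[of "case_prod F" "b \<circ> snd", simplified] bdd[of "a \<circ> fst" "b \<circ> snd", simplified]
    bdd[of "case_prod F" "\<lambda>_. 1", simplified] bdd[of "a \<circ> fst" "\<lambda>_. 1", simplified] bdd[of "b \<circ> snd" "\<lambda>_. 1", simplified]
  note i' = i[unfolded comp_def]
  have "0 \<le> (\<integral>z. (case_prod F z - a (fst z) - b (snd z) + m)\<^sup>2 \<partial>P)"
    by (rule integral_nonneg_AE) simp
  also have "(\<lambda>z. (case_prod F z - a (fst z) - b (snd z) + m)\<^sup>2)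
    = (\<lambda>z. case_prod F z * case_prod F z + a (fst z) * a (fst z) + b (snd z) * b (snd z) + m * m
        - 2 * (case_prod F z * a (fst z)) - 2 * (case_prod F z * b (snd z)) + 2 * (a (fst z) * b (snd z))
        + 2 * m * case_prod F z - 2 * m * a (fst z) - 2 * m * b (snd z))"
    by (rule ext) (simp add: power2_eq_square algebra_simps)
  also have "(\<integral>z. case_prod F z * case_prod F z + a (fst z) * a (fst z) + b (snd z) * b (snd z) + m * m
        - 2 * (case_prod F z * a (fst z)) - 2 * (case_prod F z * b (snd z)) + 2 * (a (fst z) * b (snd z))
        + 2 * m * case_prod F z - 2 * m * a (fst z) - 2 * m * b (snd z) \<partial>P)
     = S + A + B + m * m - 2 * A - 2 * B + 2 * m\<^sup>2 + 2 * m * m - 2 * m * m - 2 * m * m"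
    using i' by (simp add: FF aa bb' Fa Fb ab' a1 b1 m_def[symmetric] Q.prob_space)
  finally have key: "A + B \<le> S + m\<^sup>2"
    by (simp add: power2_eq_square)
  have iF2: "integrable P (\<lambda>z. (case_prod F z)\<^sup>2)"
    using bdd[of "case_prod F" "case_prod F"] by (simp add: power2_eq_square)
  have i1: "integrable N (\<lambda>s. \<integral>y. (F s y)\<^sup>2 \<partial>M)"
    using integrable_fst'[OF iF2[unfolded P_def]] by simp
  have i2: "integrable M (\<lambda>y. \<integral>s. (F s y)\<^sup>2 \<partial>N)"
    using integrable_snd[of "\<lambda>s y. (F s y)\<^sup>2"] iF2 by (simp add: P_def case_prod_unfold)
  have ia: "integrable N (\<lambda>s. (a s)\<^sup>2)"
    using ab C by (intro N.integrable_const_bound[where B = "C\<^sup>2"] AE_I2) (auto simp: abs_le_square_iff[symmetric])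
  have ib: "integrable M (\<lambda>y. (b y)\<^sup>2)"
    using bb C by (intro M.integrable_const_bound[where B = "C\<^sup>2"] AE_I2) (auto simp: abs_le_square_iff[symmetric])
  have S1: "(\<integral>s. (\<integral>y. (F s y)\<^sup>2 \<partial>M) \<partial>N) = S" and S2: "(\<integral>y. (\<integral>s. (F s y)\<^sup>2 \<partial>N) \<partial>M) = S"
    using fst[OF iF2] snd[OF iF2] by (simp_all add: S_def)
  have "S - A = (\<integral>s. (\<integral>y. (F s y)\<^sup>2 \<partial>M) - (a s)\<^sup>2 \<partial>N)"
    using i1 ia by (simp add: S1 A_def)
  also have "\<dots> \<le> (\<integral>s. R1 s \<partial>N)"
    using i1 ia R1 by (intro integral_mono_AE) (auto simp: a_def)
  finally have 1: "S - A \<le> (\<integral>s. R1 s \<partial>N)" .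
  have "S - B = (\<integral>y. (\<integral>s. (F s y)\<^sup>2 \<partial>N) - (b y)\<^sup>2 \<partial>M)"
    using i2 ib by (simp add: S2 B_def)
  also have "\<dots> \<le> (\<integral>y. R2 y \<partial>M)"
    using i2 ib R2 by (intro integral_mono_AE) (auto simp: b_def)
  finally have 2: "S - B \<le> (\<integral>y. R2 y \<partial>M)" .
  show ?thesis
    using key 1 2 by (simp add: S_def m_def P_def)
qed

lemma AE_power_measure: "AE s in power_measure k. 0 \<le> s \<and> s \<le> 1"
  unfolding power_measure_def by (subst AE_density) (auto simp: indicator_def)

lemma integrable_power_measure:
  fixes f :: "real \<Rightarrow> real"
  assumes "k > 0" "continuous_on UNIV f"
  shows "integrable (power_measure k) f"
proof -
  interpret prob_space "power_measure k" using assms(1) by (rule prob_space_power_measure)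
  have "compact (f ` {0..1})"
    using assms(2) by (intro compact_continuous_image) (auto intro: continuous_on_subset)
  then obtain B where B: "\<And>s. s \<in> {0..1} \<Longrightarrow> norm (f s) \<le> B"
    by (meson bounded_iff compact_imp_bounded imageI)
  show ?thesis
  proof (rule integrable_const_bound)
    show "AE s in power_measure k. norm (f s) \<le> B"
      using AE_power_measure[of k] by eventually_elim (use B in auto)
    show "f \<in> borel_measurable (power_measure k)"
      using borel_measurable_continuous_onI[OF assms(2)] by simp
  qed
qed

lemma integral_power_measure:
  fixes f :: "real \<Rightarrow> real"
  assumes "continuous_on UNIV f"
  shows "(\<integral>s. f s \<partial>power_measure k) = integral {0..1} (\<lambda>s. real k * s ^ (k - 1) * f s)"
proof -
  have [measurable]: "f \<in> borel_measurable borel"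
    using borel_measurable_continuous_onI[OF assms] .
  have "power_measure k = density lborel (\<lambda>s. ennreal (indicator {0..1} s * (real k * s ^ (k - 1))))"
    unfolding power_measure_def by (rule density_cong) (auto simp: indicator_def)
  then have "(\<integral>s. f s \<partial>power_measure k) = (\<integral>s. (indicator {0..1} s * (real k * s ^ (k - 1))) *\<^sub>R f s \<partial>lborel)"
    by (simp add: integral_density indicator_def)
  also have "\<dots> = (LINT s:{0..1}|lborel. real k * s ^ (k - 1) * f s)"
    unfolding set_lebesgue_integral_def by (simp add: mult.assoc)
  also have "\<dots> = integral {0..1} (\<lambda>s. real k * s ^ (k - 1) * f s)"
  proof (rule set_borel_integral_eq_integral)
    show "set_integrable lborel {0..1} (\<lambda>s. real k * s ^ (k - 1) * f s)"
      using assms by (intro borel_integrable_atLeastAtMost' continuous_intros continuous_on_subset[OF assms]) auto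
  qed
  finally show ?thesis .
qed

text \<open>Nonnegativity of the integral of (g' - c)^2 for the mean slope c, multiplied by the
  length of the interval.\<close>

lemma increment_Cauchy_Schwarz:
  fixes g :: "real \<Rightarrow> real"
  assumes g: "\<And>s. (g has_real_derivative g' s) (at s)" and cont: "continuous_on UNIV g'" and "t \<le> s"
  shows "(g s - g t)\<^sup>2 \<le> (s - t) * integral {t..s} (\<lambda>r. (g' r)\<^sup>2)"
proof (cases "t = s")
  case False
  with \<open>t \<le> s\<close> have L: "s - t > 0" by simp
  define c where "c = (g s - g t) / (s - t)"
  define I where "I = integral {t..s} (\<lambda>r. (g' r)\<^sup>2)"
  have c': "continuous_on {t..s} g'" using cont continuous_on_subset by blast
  have 1: "(g' has_integral (g s - g t)) {t..s}"
    using \<open>t \<le> s\<close> g by (intro fundamental_theorem_of_calculus)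
      (auto simp: has_real_derivative_iff_has_vector_derivative[symmetric] intro: DERIV_subset)
  have 2: "((\<lambda>r. (g' r)\<^sup>2) has_integral I) {t..s}"
    unfolding I_def by (intro integrable_integral integrable_continuous_real continuous_intros c')
  have 3: "((\<lambda>r. c\<^sup>2) has_integral (s - t) * c\<^sup>2) {t..s}"
    using has_integral_const_real[of "c\<^sup>2" t s] \<open>t \<le> s\<close> by simp
  have "((\<lambda>r. (g' r)\<^sup>2 - (2 * c) * g' r + c\<^sup>2) has_integral (I - (2 * c) * (g s - g t) + (s - t) * c\<^sup>2)) {t..s}"
    by (intro has_integral_add has_integral_diff has_integral_mult_right 1 2 3)
  moreover have "0 \<le> (g' r)\<^sup>2 - (2 * c) * g' r + c\<^sup>2" for r
    using zero_le_power2[of "g' r - c"] by (simp add: power2_eq_square algebra_simps)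
  ultimately have I: "0 \<le> I - (2 * c) * (g s - g t) + (s - t) * c\<^sup>2"
    by (rule has_integral_nonneg)
  have D: "g s - g t = c * (s - t)"
    using L by (simp add: c_def)
  have "c\<^sup>2 * (s - t) \<le> I"
    using I unfolding D by (simp add: power2_eq_square algebra_simps)
  then have "(s - t) * (c\<^sup>2 * (s - t)) \<le> (s - t) * I"
    using L by (intro mult_left_mono) auto
  then show ?thesis
    unfolding D I_def by (simp add: power2_eq_square mult_ac)
qed simp

text \<open>The function \<open>s (1 - s) / (k + 1)\<close> is the Stein kernel of the measure with density
  \<open>k s\<^sup>k\<^sup>-\<^sup>1\<close>.\<close>

lemma poincare_power_measure:
  fixes g :: "real \<Rightarrow> real"
  assumes k: "k > 0" and g: "\<And>s. (g has_real_derivative g' s) (at s)" and cont: "continuous_on UNIV g'"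
  shows "(\<integral>s. (g s)\<^sup>2 \<partial>power_measure k) - (\<integral>s. g s \<partial>power_measure k)\<^sup>2
    \<le> (\<integral>s. s * (1 - s) / (real k + 1) * (g' s)\<^sup>2 \<partial>power_measure k)"
proof -
  define N where "N = power_measure k"
  interpret N: prob_space N unfolding N_def using k by (rule prob_space_power_measure)
  \<comment> \<open>The primitive of g'^2, clamped outside [0, 1] so as to be continuous on the
    whole line. The bound on increments reads (g s - g t)^2 <= (s - t) (G s - G t), and averaging it
    over independent s and t gives Var g <= Cov(s, G).\<close>
  define G where "G s = integral {0..max 0 (min 1 s)} (\<lambda>r. (g' r)\<^sup>2)" for s
  have cg: "continuous_on UNIV g"
    using g by (meson DERIV_isCont continuous_at_imp_continuous_on)
  have cg'2: "continuous_on A (\<lambda>r. (g' r)\<^sup>2)" for A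
    by (intro continuous_intros continuous_on_subset[OF cont]) auto
  have cI: "continuous_on {0..1} (\<lambda>s. integral {0..s} (\<lambda>r. (g' r)\<^sup>2))"
    by (intro indefinite_integral_continuous_1 integrable_continuous_real cg'2)
  have cG: "continuous_on UNIV G"
    unfolding G_def by (rule continuous_on_compose2[OF cI]) (auto intro!: continuous_intros)
  have int: "integrable N f" if "continuous_on UNIV f" for f :: "real \<Rightarrow> real"
    unfolding N_def by (rule integrable_power_measure[OF k that])
  have dG: "(g s - g t)\<^sup>2 \<le> (s - t) * (G s - G t)" if "t \<le> s" "0 \<le> t" "s \<le> 1" for s t
  proof -
    have "integral {0..t} (\<lambda>r. (g' r)\<^sup>2) + integral {t..s} (\<lambda>r. (g' r)\<^sup>2) = integral {0..s} (\<lambda>r. (g' r)\<^sup>2)"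
      using that by (intro Henstock_Kurzweil_Integration.integral_combine integrable_continuous_real cg'2) auto
    then have "integral {t..s} (\<lambda>r. (g' r)\<^sup>2) = G s - G t"
      using that by (simp add: G_def)
    then show ?thesis
      using increment_Cauchy_Schwarz[OF g cont \<open>t \<le> s\<close>] by simp
  qed
  have dG': "(g s - g t)\<^sup>2 \<le> (s - t) * (G s - G t)" if "0 \<le> s" "s \<le> 1" "0 \<le> t" "t \<le> 1" for s t
    using dG[of t s] dG[of s t] that
    by (cases "t \<le> s") (auto simp: power2_commute algebra_simps)
  define mg where "mg = (\<integral>s. g s \<partial>N)"
  define mG where "mG = (\<integral>s. G s \<partial>N)"
  define m1 where "m1 = (\<integral>s. s \<partial>N)"
  define mgg where "mgg = (\<integral>s. (g s)\<^sup>2 \<partial>N)"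
  define msG where "msG = (\<integral>s. s * G s \<partial>N)"
  note c = continuous_intros cg cG continuous_on_id
  have "0 \<le> s * G s - s * mG - m1 * G s + msG - (g s)\<^sup>2 + 2 * mg * g s - mgg"
    if s: "0 \<le> s" "s \<le> 1" for s
  proof -
    have "0 \<le> (\<integral>t. (s - t) * (G s - G t) - (g s - g t)\<^sup>2 \<partial>N)"
    proof (rule integral_nonneg_AE)
      show "AE t in N. 0 \<le> (s - t) * (G s - G t) - (g s - g t)\<^sup>2"
        using AE_power_measure[of k] unfolding N_def
        by eventually_elim (use dG' s in auto)
    qed
    also have "(\<lambda>t. (s - t) * (G s - G t) - (g s - g t)\<^sup>2)
        = (\<lambda>t. s * G s - s * G t - G s * t + t * G t - (g s)\<^sup>2 + 2 * g s * g t - (g t)\<^sup>2)"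
      by (rule ext) (simp add: power2_eq_square algebra_simps)
    also have "(\<integral>t. s * G s - s * G t - G s * t + t * G t - (g s)\<^sup>2 + 2 * g s * g t - (g t)\<^sup>2 \<partial>N)
        = s * G s - s * mG - G s * m1 + msG - (g s)\<^sup>2 + 2 * g s * mg - mgg"
      unfolding mg_def mG_def m1_def mgg_def msG_def
      by (subst Bochner_Integration.integral_diff Bochner_Integration.integral_add;
          (intro int c)?; simp add: N.prob_space int c)+
    finally show ?thesis by (simp add: algebra_simps)
  qed
  then have "0 \<le> (\<integral>s. s * G s - s * mG - m1 * G s + msG - (g s)\<^sup>2 + 2 * mg * g s - mgg \<partial>N)"
    using AE_power_measure[of k] unfolding N_def by (intro integral_nonneg_AE) (auto elim: eventually_mono)
  also have "\<dots> = msG - m1 * mG - m1 * mG + msG - mgg + 2 * mg * mg - mgg"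
  proof -
    have i: "integrable N (\<lambda>s. s * G s)" "integrable N (\<lambda>s. s)" "integrable N G" "integrable N (\<lambda>s. (g s)\<^sup>2)" "integrable N g"
      by (intro int c)+
    then show ?thesis
      by (simp add: N.prob_space mg_def[symmetric] mG_def[symmetric] m1_def[symmetric] mgg_def[symmetric] msG_def[symmetric])
  qed
  finally have var: "mgg - mg\<^sup>2 \<le> msG - m1 * mG"
    by (simp add: power2_eq_square)
  define \<mu> where "\<mu> = real k / (real k + 1)"
  have kk: "real k * s ^ (k - 1) * s = real k * s ^ k" for s :: real
    using k by (cases k) auto
  have m1: "m1 = \<mu>"
  proof -
    have "m1 = integral {0..1} (\<lambda>s. real k * s ^ k)"
      unfolding m1_def N_def by (subst integral_power_measure) (simp_all only: kk continuous_on_id)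
    also have "\<dots> = \<mu>"
    proof (rule integral_unique)
      have "((\<lambda>s. real k * s ^ k) has_integral (\<mu> * 1 ^ Suc k - \<mu> * 0 ^ Suc k)) {0..1}"
      proof (rule fundamental_theorem_of_calculus)
        fix x :: real
        have "((\<lambda>s. \<mu> * s ^ Suc k) has_real_derivative \<mu> * (real (Suc k) * x ^ k)) (at x within {0..1})"
          by (rule DERIV_cmult) (auto intro!: derivative_eq_intros simp del: power_Suc)
        moreover have "\<mu> * (real (Suc k) * x ^ k) = real k * x ^ k"
          unfolding \<mu>_def by (simp add: field_simps)
        ultimately show "((\<lambda>s. \<mu> * s ^ Suc k) has_vector_derivative real k * x ^ k) (at x within {0..1})"
          by (simp only: has_real_derivative_iff_has_vector_derivative)
      qed simp
      then show "((\<lambda>s. real k * s ^ k) has_integral \<mu>) {0..1}" by simp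
    qed
    finally show ?thesis .
  qed
  \<comment> \<open>\<open>K\<close> is the density times the Stein kernel: its derivative is the
    density times \<mu> - s, and it vanishes at both end points. Integration by parts against
    \<open>G\<close> therefore turns the covariance of s and G into the integral of K g'^2.\<close>
  define K where "K s = \<mu> * (s ^ k - s ^ Suc k)" for s :: real
  have dK: "(K has_real_derivative real k * s ^ (k - 1) * (\<mu> - s)) (at s within X)" for s X
  proof -
    have "(K has_real_derivative \<mu> * (real k * s ^ (k - 1) - real (Suc k) * s ^ k)) (at s within X)"
      unfolding K_def by (intro DERIV_cmult DERIV_diff) (auto intro!: derivative_eq_intros simp del: power_Suc)
    moreover have "\<mu> * (real k * s ^ (k - 1) - real (Suc k) * s ^ k) = real k * s ^ (k - 1) * (\<mu> - s)"
    proof -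
      have "\<mu> * real (Suc k) = real k"
        unfolding \<mu>_def by (simp add: field_simps)
      then have "\<mu> * real (Suc k) * s ^ k = real k * s ^ (k - 1) * s"
        by (simp only: kk)
      then show ?thesis
        by (simp only: right_diff_distrib mult.assoc) (simp only: mult_ac)
    qed
    ultimately show ?thesis by simp
  qed
  have "((\<lambda>s. K s * (g' s)\<^sup>2 + real k * s ^ (k - 1) * (\<mu> - s) * G s) has_integral (K 1 * G 1 - K 0 * G 0)) {0..1}"
  proof (rule fundamental_theorem_of_calculus)
    fix s :: real assume s: "s \<in> {0..1}"
    have "((\<lambda>s. integral {0..s} (\<lambda>r. (g' r)\<^sup>2)) has_real_derivative (g' s)\<^sup>2) (at s within {0..1})"
      using s by (intro integral_has_real_derivative cg'2) auto
    then have "(G has_real_derivative (g' s)\<^sup>2) (at s within {0..1})"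
      by (rule has_field_derivative_transform_within[where d = 1]) (use s in \<open>auto simp: G_def\<close>)
    from DERIV_mult[OF dK[of s "{0..1}"] this]
    have "((\<lambda>s. K s * G s) has_real_derivative K s * (g' s)\<^sup>2 + real k * s ^ (k - 1) * (\<mu> - s) * G s) (at s within {0..1})"
      by (simp add: algebra_simps)
    then show "((\<lambda>s. K s * G s) has_vector_derivative K s * (g' s)\<^sup>2 + real k * s ^ (k - 1) * (\<mu> - s) * G s) (at s within {0..1})"
      by (simp add: has_real_derivative_iff_has_vector_derivative)
  qed simp
  moreover have "K 1 = 0" "K 0 = 0"
    using k by (auto simp: K_def)
  ultimately have "integral {0..1} (\<lambda>s. K s * (g' s)\<^sup>2 + real k * s ^ (k - 1) * (\<mu> - s) * G s) = 0"
    by (simp add: integral_unique)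
  also have "(\<lambda>s. K s * (g' s)\<^sup>2 + real k * s ^ (k - 1) * (\<mu> - s) * G s)
    = (\<lambda>s. real k * s ^ (k - 1) * (s * (1 - s) / (real k + 1) * (g' s)\<^sup>2 + (\<mu> - s) * G s))"
  proof (rule ext)
    fix s :: real
    have "K s = real k * s ^ (k - 1) * s * (1 - s) / (real k + 1)"
      unfolding K_def \<mu>_def kk by (simp add: field_simps)
    then show "K s * (g' s)\<^sup>2 + real k * s ^ (k - 1) * (\<mu> - s) * G s
      = real k * s ^ (k - 1) * (s * (1 - s) / (real k + 1) * (g' s)\<^sup>2 + (\<mu> - s) * G s)"
      by (simp add: algebra_simps)
  qed
  finally have "(\<integral>s. s * (1 - s) / (real k + 1) * (g' s)\<^sup>2 + (\<mu> - s) * G s \<partial>N) = 0"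
    unfolding N_def by (subst integral_power_measure) (auto intro!: continuous_intros cG cont)
  also have "(\<lambda>s. s * (1 - s) / (real k + 1) * (g' s)\<^sup>2 + (\<mu> - s) * G s)
     = (\<lambda>s. s * (1 - s) / (real k + 1) * (g' s)\<^sup>2 + \<mu> * G s - s * G s)"
    by (rule ext) (simp add: algebra_simps)
  finally have "(\<integral>s. s * (1 - s) / (real k + 1) * (g' s)\<^sup>2 \<partial>N) + \<mu> * mG - msG = 0"
  proof -
    assume *: "(\<integral>s. s * (1 - s) / (real k + 1) * (g' s)\<^sup>2 + \<mu> * G s - s * G s \<partial>N) = 0"
    have "integrable N (\<lambda>s. s * (1 - s) / (real k + 1) * (g' s)\<^sup>2)" "integrable N G" "integrable N (\<lambda>s. s * G s)"
      by (intro int c cont; simp)+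
    with * show ?thesis
      by (simp add: mG_def msG_def)
  qed
  with var m1 show ?thesis
    by (simp add: mgg_def mg_def N_def)
qed

section \<open>Integration against the stick-breaking measure\<close>

lemma prob_space_dirichlet_measure: "prob_space (dirichlet_measure v k)"
proof (induction k)
  case 0
  then show ?case by (simp add: prob_space_return)
next
  case (Suc k)
  interpret N: prob_space "power_measure (Suc k)" by (rule prob_space_power_measure) simp
  interpret M: prob_space "dirichlet_measure v k" by (rule Suc)
  interpret NM: pair_prob_space "power_measure (Suc k)" "dirichlet_measure v k" ..
  show ?case
    unfolding dirichlet_measure.simps by (rule NM.P.prob_space_distr) measurable
qed

lemma compact_simplex: "compact (convex hull (v ` {..k::nat}))"
  for v :: "nat \<Rightarrow> 'a::euclidean_space"
  by (intro compact_convex_hull finite_imp_compact) auto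

lemma sets_simplex [measurable]: "convex hull (v ` {..k::nat}) \<in> sets borel"
  for v :: "nat \<Rightarrow> 'a::euclidean_space"
  by (intro borel_closed compact_imp_closed compact_simplex)

lemma simplex_Suc: "convex hull (v ` {..Suc k}) = cone (v (Suc k)) (convex hull (v ` {..k}))"
  for v :: "nat \<Rightarrow> 'a::euclidean_space"
  by (simp add: atMost_Suc convex_hull_insert_cone)

lemma AE_dirichlet_measure: "AE x in dirichlet_measure v k. x \<in> convex hull (v ` {..k})"
proof (induction k)
  case 0
  show ?case unfolding dirichlet_measure.simps by (subst AE_return) auto
next
  case (Suc k)
  define N where "N = power_measure (Suc k)"
  define M where "M = dirichlet_measure v k"
  interpret N: prob_space N unfolding N_def by (rule prob_space_power_measure) simp
  interpret M: prob_space M unfolding M_def by (rule prob_space_dirichlet_measure)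
  interpret NM: pair_prob_space N M ..
  have [measurable_cong]: "sets N = sets borel" "sets M = sets borel" by (simp_all add: N_def M_def)
  have "AE z in N \<Otimes>\<^sub>M M. (case z of (s, y) \<Rightarrow> v (Suc k) + s *\<^sub>R (y - v (Suc k))) \<in> convex hull (v ` {..Suc k})"
  proof (rule NM.AE_pair_measure)
    show "{x \<in> space (N \<Otimes>\<^sub>M M). (case x of (s, y) \<Rightarrow> v (Suc k) + s *\<^sub>R (y - v (Suc k))) \<in> convex hull (v ` {..Suc k})}
      \<in> sets (N \<Otimes>\<^sub>M M)"
      by measurable
    have M: "AE y in M. y \<in> convex hull (v ` {..k})" using Suc unfolding M_def .
    show "AE s in N. AE y in M. (case (s, y) of (s, y) \<Rightarrow> v (Suc k) + s *\<^sub>R (y - v (Suc k))) \<in> convex hull (v ` {..Suc k})"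
      using AE_power_measure[of "Suc k", folded N_def]
    proof eventually_elim
      fix s :: real assume s: "0 \<le> s \<and> s \<le> 1"
      show "AE y in M. (case (s, y) of (s, y) \<Rightarrow> v (Suc k) + s *\<^sub>R (y - v (Suc k))) \<in> convex hull (v ` {..Suc k})"
        using M by eventually_elim (use s in \<open>auto simp: simplex_Suc cone_def\<close>)
    qed
  qed
  then show ?case
    unfolding dirichlet_measure.simps N_def[symmetric] M_def[symmetric]
    by (subst AE_distr_iff) (auto simp: case_prod_unfold)
qed

lemma integrable_dirichlet_measure:
  fixes f :: "'a::euclidean_space \<Rightarrow> real"
  assumes "continuous_on UNIV f"
  shows "integrable (dirichlet_measure v k) f"
proof -
  interpret prob_space "dirichlet_measure v k" by (rule prob_space_dirichlet_measure)
  have "compact (f ` (convex hull (v ` {..k})))"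
    using compact_simplex assms by (intro compact_continuous_image) (auto intro: continuous_on_subset)
  then obtain B where B: "\<And>x. x \<in> convex hull (v ` {..k}) \<Longrightarrow> norm (f x) \<le> B"
    by (meson bounded_iff compact_imp_bounded imageI)
  show ?thesis
  proof (rule integrable_const_bound)
    show "AE x in dirichlet_measure v k. norm (f x) \<le> B"
      using AE_dirichlet_measure[of v k] by eventually_elim (use B in auto)
    show "f \<in> borel_measurable (dirichlet_measure v k)"
      using borel_measurable_continuous_onI[OF assms] by simp
  qed
qed

text \<open>Both orders of integration are recorded because the two terms of the Efron-Stein bound
  are iterated integrals in opposite orders.\<close>

lemma
  fixes f :: "'a::euclidean_space \<Rightarrow> real" and v :: "nat \<Rightarrow> 'a" and k :: nat
  assumes f: "continuous_on UNIV f"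
  defines "N \<equiv> power_measure (Suc k)" and "M \<equiv> dirichlet_measure v k"
    and "X \<equiv> \<lambda>s y. v (Suc k) + s *\<^sub>R (y - v (Suc k))"
  shows integral_dirichlet_Suc: "(\<integral>x. f x \<partial>dirichlet_measure v (Suc k)) = (\<integral>s. (\<integral>y. f (X s y) \<partial>M) \<partial>N)"
    and integral_dirichlet_Suc': "(\<integral>x. f x \<partial>dirichlet_measure v (Suc k)) = (\<integral>y. (\<integral>s. f (X s y) \<partial>N) \<partial>M)"
    and integrable_dirichlet_Suc: "integrable N (\<lambda>s. \<integral>y. f (X s y) \<partial>M)"
    and integrable_dirichlet_Suc': "integrable M (\<lambda>y. \<integral>s. f (X s y) \<partial>N)"
proof -
  interpret N: prob_space N unfolding N_def by (rule prob_space_power_measure) simp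
  interpret M: prob_space M unfolding M_def by (rule prob_space_dirichlet_measure)
  interpret NM: pair_prob_space N M ..
  have [measurable_cong]: "sets N = sets borel" "sets M = sets borel" by (simp_all add: N_def M_def)
  have [measurable]: "f \<in> borel_measurable borel" using f by (rule borel_measurable_continuous_onI)
  have [measurable]: "case_prod X \<in> N \<Otimes>\<^sub>M M \<rightarrow>\<^sub>M borel" unfolding X_def by measurable
  have d: "dirichlet_measure v (Suc k) = distr (N \<Otimes>\<^sub>M M) borel (case_prod X)"
    by (simp add: N_def M_def X_def)
  have "integrable (distr (N \<Otimes>\<^sub>M M) borel (case_prod X)) f"
    unfolding d[symmetric] by (rule integrable_dirichlet_measure[OF f])
  then have i: "integrable (N \<Otimes>\<^sub>M M) (\<lambda>(s, y). f (X s y))"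
    by (subst (asm) integrable_distr_eq) (auto simp: case_prod_unfold)
  have e: "(\<integral>x. f x \<partial>dirichlet_measure v (Suc k)) = (\<integral>(s, y). f (X s y) \<partial>(N \<Otimes>\<^sub>M M))"
    unfolding d by (subst integral_distr) (auto simp: case_prod_unfold)
  show "(\<integral>x. f x \<partial>dirichlet_measure v (Suc k)) = (\<integral>s. (\<integral>y. f (X s y) \<partial>M) \<partial>N)"
    unfolding e using NM.integral_fst'[OF i] by simp
  show "(\<integral>x. f x \<partial>dirichlet_measure v (Suc k)) = (\<integral>y. (\<integral>s. f (X s y) \<partial>N) \<partial>M)"
    unfolding e using NM.integral_snd[OF i] by simp
  show "integrable N (\<lambda>s. \<integral>y. f (X s y) \<partial>M)"
    using NM.integrable_fst'[OF i] by simp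
  show "integrable M (\<lambda>y. \<integral>s. f (X s y) \<partial>N)"
    using NM.integrable_snd[OF i] by simp
qed

text \<open>Only affinity along lines, continuity and the values at the vertices are assumed.
  Relabelling the vertices then just relabels the coordinates, and one family serves all faces
  spanned by an initial segment of the vertices.\<close>

locale barycentric =
  fixes v :: "nat \<Rightarrow> 'a::euclidean_space" and \<beta> :: "nat \<Rightarrow> 'a \<Rightarrow> real" and d :: nat
  assumes affine: "\<And>i x y s. \<beta> i (x + s *\<^sub>R (y - x)) = \<beta> i x + s * (\<beta> i y - \<beta> i x)"
    and vertex: "\<And>i j. i \<le> d \<Longrightarrow> j \<le> d \<Longrightarrow> \<beta> i (v j) = (if i = j then 1 else 0)"
    and cont: "\<And>i. continuous_on UNIV (\<beta> i)"
begin

text \<open>The properties together cut out a convex set that contains the vertices, hence the hull.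
  The vanishing of the coordinates beyond \<open>k\<close> is what gives the new coordinate the
  value 1 - s in the cone step.\<close>

lemma simplex_coordinates:
  assumes "x \<in> convex hull (v ` {..k})" "k \<le> d"
  shows "(\<forall>i\<le>k. \<beta> i x \<ge> 0) \<and> (\<forall>i\<le>d. i > k \<longrightarrow> \<beta> i x = 0) \<and>
    (\<Sum>i\<le>k. \<beta> i x) = 1 \<and> (\<Sum>i\<le>k. \<beta> i x *\<^sub>R v i) = x" (is "?P x")
proof -
  have "convex {x. ?P x}"
    unfolding convex_alt
  proof (intro ballI allI impI)
    fix x y :: 'a and u :: real
    assume x: "x \<in> {x. ?P x}" and y: "y \<in> {x. ?P x}" and u: "0 \<le> u \<and> u \<le> 1"
    have eq: "(1 - u) *\<^sub>R x + u *\<^sub>R y = x + u *\<^sub>R (y - x)"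
      by (simp add: algebra_simps)
    have b: "\<beta> i ((1 - u) *\<^sub>R x + u *\<^sub>R y) = (1 - u) * \<beta> i x + u * \<beta> i y" for i
      unfolding eq affine by (simp add: algebra_simps)
    have "(\<Sum>i\<le>k. \<beta> i ((1 - u) *\<^sub>R x + u *\<^sub>R y)) = (1 - u) * (\<Sum>i\<le>k. \<beta> i x) + u * (\<Sum>i\<le>k. \<beta> i y)"
      unfolding b by (simp add: sum.distrib sum_distrib_left)
    moreover have "(\<Sum>i\<le>k. \<beta> i ((1 - u) *\<^sub>R x + u *\<^sub>R y) *\<^sub>R v i)
        = (1 - u) *\<^sub>R (\<Sum>i\<le>k. \<beta> i x *\<^sub>R v i) + u *\<^sub>R (\<Sum>i\<le>k. \<beta> i y *\<^sub>R v i)"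
      unfolding b by (simp add: scaleR_add_left sum.distrib scaleR_sum_right)
    ultimately show "(1 - u) *\<^sub>R x + u *\<^sub>R y \<in> {x. ?P x}"
      using x y u by (auto simp: b)
  qed
  moreover have "v ` {..k} \<subseteq> {x. ?P x}"
  proof safe
    fix j assume j: "j \<le> k"
    show "\<beta> i (v j) \<ge> 0" if "i \<le> k" for i using vertex[of i j] that j assms(2) by auto
    show "\<beta> i (v j) = 0" if "i \<le> d" "i > k" for i using vertex[of i j] that j assms(2) by auto
    have "(\<Sum>i\<le>k. \<beta> i (v j)) = (\<Sum>i\<le>k. if i = j then 1 else 0)"
      using j assms(2) by (intro sum.cong) (auto simp: vertex)
    then show "(\<Sum>i\<le>k. \<beta> i (v j)) = 1" using j by simp
    have "(\<Sum>i\<le>k. \<beta> i (v j) *\<^sub>R v i) = (\<Sum>i\<le>k. if i = j then v j else 0)"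
      using j assms(2) by (intro sum.cong) (auto simp: vertex)
    then show "(\<Sum>i\<le>k. \<beta> i (v j) *\<^sub>R v i) = v j" using j by simp
  qed
  ultimately have "convex hull (v ` {..k}) \<subseteq> {x. ?P x}"
    by (intro hull_minimal)
  with assms show ?thesis by blast
qed

definition energy_density :: "nat \<Rightarrow> ('a \<Rightarrow> 'a) \<Rightarrow> 'a \<Rightarrow> real" where
  "energy_density k G x = (\<Sum>j\<le>k. \<Sum>i<j. \<beta> i x * \<beta> j x * (G x \<bullet> (v i - v j))\<^sup>2 / (real j + 1))"

lemma continuous_on_energy_density:
  "continuous_on UNIV G \<Longrightarrow> continuous_on UNIV (energy_density k G)"
  unfolding energy_density_def[abs_def] by (intro continuous_intros cont) auto

text \<open>The weights \<open>\<beta>\<^sub>i \<beta>\<^sub>j / (j + 1)\<close> combine the Stein kernels of the factors of the product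
  structure of the uniform measure.\<close>

lemma poincare_dirichlet:
  assumes "k \<le> d" and f: "\<And>x. (f has_derivative (\<lambda>h. G x \<bullet> h)) (at x)" and G: "continuous_on UNIV G"
  shows "(\<integral>x. (f x)\<^sup>2 \<partial>dirichlet_measure v k) - (\<integral>x. f x \<partial>dirichlet_measure v k)\<^sup>2
    \<le> (\<integral>x. energy_density k G x \<partial>dirichlet_measure v k)"
  using assms
proof (induction k arbitrary: f G)
  case 0
  have cf: "continuous_on UNIV f"
    by (intro continuous_at_imp_continuous_on ballI has_derivative_continuous[OF 0(2)])
  have m: "f \<in> borel_measurable borel" "energy_density 0 G \<in> borel_measurable borel"
    by (rule borel_measurable_continuous_onI[OF cf])
       (intro borel_measurable_continuous_onI continuous_on_energy_density 0(3))
  have "(\<integral>x. (f x)\<^sup>2 \<partial>return borel (v 0)) = (f (v 0))\<^sup>2" "(\<integral>x. f x \<partial>return borel (v 0)) = f (v 0)"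
    "(\<integral>x. energy_density 0 G x \<partial>return borel (v 0)) = energy_density 0 G (v 0)"
    using m by (intro integral_return; simp)+
  then show ?case
    by (simp add: energy_density_def)
next
  case (Suc k)
  note f = Suc.prems(2) and G = Suc.prems(3)
  define p where "p = v (Suc k)"
  define X where "X s y = p + s *\<^sub>R (y - p)" for s and y :: 'a
  define N where "N = power_measure (Suc k)"
  define M where "M = dirichlet_measure v k"
  define K where "K = convex hull (v ` {..k})"
  define K' where "K' = convex hull (v ` {..Suc k})"
  define D where "D = dirichlet_measure v (Suc k)"
  interpret N: prob_space N unfolding N_def by (rule prob_space_power_measure) simp
  interpret M: prob_space M unfolding M_def by (rule prob_space_dirichlet_measure)
  have [measurable_cong]: "sets N = sets borel" "sets M = sets borel" by (simp_all add: N_def M_def)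
  have [measurable]: "case_prod X \<in> N \<Otimes>\<^sub>M M \<rightarrow>\<^sub>M borel" unfolding X_def by measurable
  have D: "D = distr (N \<Otimes>\<^sub>M M) borel (case_prod X)"
  proof -
    have "case_prod X = (\<lambda>(s, y). v (Suc k) + s *\<^sub>R (y - v (Suc k)))"
      by (auto simp: X_def p_def fun_eq_iff)
    then show ?thesis by (simp add: N_def M_def D_def)
  qed
  have cf: "continuous_on UNIV f"
    by (intro continuous_at_imp_continuous_on ballI has_derivative_continuous[OF f])
  have X_K': "X s y \<in> K'" if "0 \<le> s" "s \<le> 1" "y \<in> K" for s y
    using that unfolding K'_def simplex_Suc X_def p_def K_def cone_def by blast
  have "compact (f ` K')"
    unfolding K'_def using compact_simplex cf by (intro compact_continuous_image) (auto intro: continuous_on_subset)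
  then obtain C where "\<And>x. x \<in> K' \<Longrightarrow> norm (f x) \<le> C"
    by (meson bounded_iff compact_imp_bounded imageI)
  then have C: "\<bar>f x\<bar> \<le> C" if "x \<in> K'" for x
    using that by simp
  \<comment> \<open>The Efron-Stein lemma needs a bound valid everywhere, while \<open>f\<close> is
    bounded only on the compact simplex. Truncation changes nothing there, and the measures live on
    the simplex.\<close>
  define f' where "f' x = max (- \<bar>C\<bar>) (min \<bar>C\<bar> (f x))" for x
  have f'_bound: "\<bar>f' x\<bar> \<le> \<bar>C\<bar>" for x
    by (auto simp: f'_def)
  have f'_eq: "f' x = f x" if "x \<in> K'" for x
    using C[OF that] by (auto simp: f'_def)
  have [measurable]: "f \<in> borel_measurable borel" "f' \<in> borel_measurable borel"
    unfolding f'_def[abs_def] using borel_measurable_continuous_onI[OF cf] by auto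
  \<comment> \<open>\<open>g1\<close> collects the edges of the base and \<open>g2\<close> the edges
    to the new vertex; they bound the two conditional variances.\<close>
  define g1 where "g1 x = (\<Sum>j\<le>k. \<Sum>i<j. \<beta> i x * \<beta> j x * (G x \<bullet> (v i - v j))\<^sup>2 / (real j + 1))" for x
  define g2 where "g2 x = (\<Sum>i<Suc k. \<beta> i x * \<beta> (Suc k) x * (G x \<bullet> (v i - v (Suc k)))\<^sup>2 / (real (Suc k) + 1))" for x
  have g12: "energy_density (Suc k) G x = g1 x + g2 x" for x
    by (simp add: energy_density_def g1_def g2_def)
  have cg: "continuous_on UNIV g1" "continuous_on UNIV g2"
    unfolding g1_def[abs_def] g2_def[abs_def] by (intro continuous_intros cont G; simp)+
  have AE_M: "AE y in M. y \<in> K" and AE_N: "AE s in N. 0 \<le> s \<and> s \<le> 1"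
    unfolding M_def K_def N_def by (rule AE_dirichlet_measure AE_power_measure)+
  have AE_D: "AE x in D. x \<in> K'"
    unfolding D_def K'_def by (rule AE_dirichlet_measure)
  \<comment> \<open>In the cone the old coordinates are multiplied by s. A product of two of them
    gains s^2, exactly the factor produced by the chain rule in the induction hypothesis; a product
    with the new coordinate gains s (1 - s), the numerator of the Stein kernel.\<close>
  have \<beta>X: "\<beta> i (X s y) = s * \<beta> i y" if "i \<le> k" for i s y
    using vertex[of i "Suc k"] that Suc.prems(1) by (simp add: X_def p_def affine)
  have \<beta>X': "\<beta> (Suc k) (X s y) = 1 - s" if "y \<in> K" for s y
    using vertex[of "Suc k" "Suc k"] simplex_coordinates[of y k] that Suc.prems(1)
    by (simp add: X_def p_def affine K_def)
  have 1: "AE s in N. (\<integral>y. (f' (X s y))\<^sup>2 \<partial>M) - (\<integral>y. f' (X s y) \<partial>M)\<^sup>2 \<le> (\<integral>y. g1 (X s y) \<partial>M)"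
    using AE_N
  proof eventually_elim
    fix s :: real assume s: "0 \<le> s \<and> s \<le> 1"
    have "(\<integral>y. (f' (X s y))\<^sup>2 \<partial>M) - (\<integral>y. f' (X s y) \<partial>M)\<^sup>2 = (\<integral>y. (f (X s y))\<^sup>2 \<partial>M) - (\<integral>y. f (X s y) \<partial>M)\<^sup>2"
    proof -
      have [measurable]: "(\<lambda>y. X s y) \<in> M \<rightarrow>\<^sub>M borel" unfolding X_def by measurable
      have "AE y in M. f' (X s y) = f (X s y)"
        using AE_M by eventually_elim (use s X_K' f'_eq in auto)
      then have "(\<integral>y. (f' (X s y))\<^sup>2 \<partial>M) = (\<integral>y. (f (X s y))\<^sup>2 \<partial>M)" "(\<integral>y. f' (X s y) \<partial>M) = (\<integral>y. f (X s y) \<partial>M)"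
        by (auto intro!: integral_cong_AE elim!: eventually_mono)
      then show ?thesis by simp
    qed
    also have "\<dots> \<le> (\<integral>y. energy_density k (\<lambda>y. s *\<^sub>R G (X s y)) y \<partial>M)"
      unfolding M_def
    proof (rule Suc.IH)
      show "((\<lambda>y. f (X s y)) has_derivative (\<lambda>h. (s *\<^sub>R G (X s y)) \<bullet> h)) (at y)" for y
        unfolding X_def
        by (rule has_derivative_eq_rhs[OF has_derivative_compose[OF _ f]])
           (auto intro!: derivative_eq_intros simp: inner_scaleR_right)
      show "continuous_on UNIV (\<lambda>y. s *\<^sub>R G (X s y))"
        unfolding X_def by (intro continuous_intros continuous_on_compose2[OF G]) auto
    qed (use Suc.prems in simp)
    also have "\<dots> = (\<integral>y. g1 (X s y) \<partial>M)"
      unfolding energy_density_def g1_def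
      by (intro Bochner_Integration.integral_cong refl sum.cong) (auto simp: \<beta>X power2_eq_square)
    finally show "(\<integral>y. (f' (X s y))\<^sup>2 \<partial>M) - (\<integral>y. f' (X s y) \<partial>M)\<^sup>2 \<le> (\<integral>y. g1 (X s y) \<partial>M)" .
  qed
  have 2: "AE y in M. (\<integral>s. (f' (X s y))\<^sup>2 \<partial>N) - (\<integral>s. f' (X s y) \<partial>N)\<^sup>2 \<le> (\<integral>s. g2 (X s y) \<partial>N)"
    using AE_M
  proof eventually_elim
    fix y assume y: "y \<in> K"
    note coord = simplex_coordinates[of y k, folded K_def, OF y] Suc.prems(1)
    have cX: "continuous_on UNIV (\<lambda>s. X s y)"
      unfolding X_def by (intro continuous_intros)
    have "(\<integral>s. (f' (X s y))\<^sup>2 \<partial>N) - (\<integral>s. f' (X s y) \<partial>N)\<^sup>2 = (\<integral>s. (f (X s y))\<^sup>2 \<partial>N) - (\<integral>s. f (X s y) \<partial>N)\<^sup>2"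
    proof -
      have [measurable]: "(\<lambda>s. X s y) \<in> N \<rightarrow>\<^sub>M borel" unfolding X_def by measurable
      have "AE s in N. f' (X s y) = f (X s y)"
        using AE_N by eventually_elim (use y X_K' f'_eq in auto)
      then have "(\<integral>s. (f' (X s y))\<^sup>2 \<partial>N) = (\<integral>s. (f (X s y))\<^sup>2 \<partial>N)" "(\<integral>s. f' (X s y) \<partial>N) = (\<integral>s. f (X s y) \<partial>N)"
        by (auto intro!: integral_cong_AE elim!: eventually_mono)
      then show ?thesis by simp
    qed
    also have "\<dots> \<le> (\<integral>s. s * (1 - s) / (real (Suc k) + 1) * (G (X s y) \<bullet> (y - p))\<^sup>2 \<partial>N)"
      unfolding N_def
    proof (rule poincare_power_measure)
      fix s
      have "((\<lambda>s. f (X s y)) has_derivative (\<lambda>h. G (X s y) \<bullet> (h *\<^sub>R (y - p)))) (at s)"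
        unfolding X_def
        by (rule has_derivative_eq_rhs[OF has_derivative_compose[OF _ f]]) (auto intro!: derivative_eq_intros)
      then show "((\<lambda>s. f (X s y)) has_real_derivative G (X s y) \<bullet> (y - p)) (at s)"
        unfolding has_field_derivative_def by (simp add: mult_commute_abs)
      show "continuous_on UNIV (\<lambda>s. G (X s y) \<bullet> (y - p))"
        by (intro continuous_intros continuous_on_compose2[OF G] cX) auto
    qed simp
    also have "\<dots> \<le> (\<integral>s. g2 (X s y) \<partial>N)"
    proof (rule integral_mono_AE)
      show "integrable N (\<lambda>s. s * (1 - s) / (real (Suc k) + 1) * (G (X s y) \<bullet> (y - p))\<^sup>2)"
        "integrable N (\<lambda>s. g2 (X s y))"
        unfolding N_def
        by (intro integrable_power_measure continuous_intros continuous_on_compose2[OF G]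
          continuous_on_compose2[OF cg(2)] cX; simp)+
      show "AE s in N. s * (1 - s) / (real (Suc k) + 1) * (G (X s y) \<bullet> (y - p))\<^sup>2 \<le> g2 (X s y)"
        using AE_N
      proof eventually_elim
        fix s :: real assume s: "0 \<le> s \<and> s \<le> 1"
        define w where "w i = G (X s y) \<bullet> (v i - p)" for i
        have \<beta>: "(\<Sum>i\<le>k. \<beta> i y) = 1" "\<And>i. i \<le> k \<Longrightarrow> \<beta> i y \<ge> 0" "(\<Sum>i\<le>k. \<beta> i y *\<^sub>R v i) = y"
          using coord by auto
        have "y - p = (\<Sum>i\<le>k. \<beta> i y *\<^sub>R v i) - (\<Sum>i\<le>k. \<beta> i y) *\<^sub>R p"
          using \<beta> by simp
        also have "\<dots> = (\<Sum>i\<le>k. \<beta> i y *\<^sub>R (v i - p))"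
          by (simp add: scaleR_diff_right sum_subtractf scaleR_sum_left)
        finally have "G (X s y) \<bullet> (y - p) = (\<Sum>i\<le>k. \<beta> i y * w i)"
          by (simp add: inner_sum_right w_def)
        \<comment> \<open>Jensen's inequality with the barycentric weights of \<open>y\<close>
          splits the derivative from the apex towards \<open>y\<close> into derivatives along the
          edges.\<close>
        also have "(\<Sum>i\<le>k. \<beta> i y * w i)\<^sup>2 \<le> (\<Sum>i\<le>k. \<beta> i y * (w i)\<^sup>2)"
        proof -
          define m where "m = (\<Sum>i\<le>k. \<beta> i y * w i)"
          have "0 \<le> (\<Sum>i\<le>k. \<beta> i y * (w i - m)\<^sup>2)"
            using \<beta> by (intro sum_nonneg mult_nonneg_nonneg) auto
          also have "\<dots> = (\<Sum>i\<le>k. \<beta> i y * (w i)\<^sup>2 - (2 * m) * (\<beta> i y * w i) + m\<^sup>2 * \<beta> i y)"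
            by (intro sum.cong refl) (simp add: power2_eq_square algebra_simps)
          also have "\<dots> = (\<Sum>i\<le>k. \<beta> i y * (w i)\<^sup>2) - (2 * m) * m + m\<^sup>2 * 1"
            unfolding sum.distrib sum_subtractf sum_distrib_left[symmetric] \<beta>(1) m_def[symmetric] by simp
          finally show ?thesis by (simp add: m_def power2_eq_square)
        qed
        finally have "s * (1 - s) / (real (Suc k) + 1) * (G (X s y) \<bullet> (y - p))\<^sup>2
            \<le> s * (1 - s) / (real (Suc k) + 1) * (\<Sum>i\<le>k. \<beta> i y * (w i)\<^sup>2)"
          using s by (intro mult_left_mono) auto
        also have "\<dots> = g2 (X s y)"
          unfolding g2_def lessThan_Suc_atMost sum_distrib_left
          by (intro sum.cong refl) (simp add: \<beta>X \<beta>X'[OF y] w_def p_def)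
        finally show "s * (1 - s) / (real (Suc k) + 1) * (G (X s y) \<bullet> (y - p))\<^sup>2 \<le> g2 (X s y)" .
      qed
    qed
    finally show "(\<integral>s. (f' (X s y))\<^sup>2 \<partial>N) - (\<integral>s. f' (X s y) \<partial>N)\<^sup>2 \<le> (\<integral>s. g2 (X s y) \<partial>N)" .
  qed
  have "(\<integral>x. (f x)\<^sup>2 \<partial>D) - (\<integral>x. f x \<partial>D)\<^sup>2 = (\<integral>x. (f' x)\<^sup>2 \<partial>D) - (\<integral>x. f' x \<partial>D)\<^sup>2"
  proof -
    have [measurable_cong]: "sets D = sets borel" by (simp add: D_def)
    have "AE x in D. f x = f' x"
      using AE_D by eventually_elim (use f'_eq in auto)
    then have "(\<integral>x. (f x)\<^sup>2 \<partial>D) = (\<integral>x. (f' x)\<^sup>2 \<partial>D)" "(\<integral>x. f x \<partial>D) = (\<integral>x. f' x \<partial>D)"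
      by (auto intro!: integral_cong_AE elim!: eventually_mono)
    then show ?thesis by simp
  qed
  also have "\<dots> = (\<integral>z. (case_prod (\<lambda>s y. f' (X s y)) z)\<^sup>2 \<partial>(N \<Otimes>\<^sub>M M)) - (\<integral>z. case_prod (\<lambda>s y. f' (X s y)) z \<partial>(N \<Otimes>\<^sub>M M))\<^sup>2"
    unfolding D by (subst (1 2) integral_distr) (auto simp: case_prod_unfold)
  also have "\<dots> \<le> (\<integral>s. (\<integral>y. g1 (X s y) \<partial>M) \<partial>N) + (\<integral>y. (\<integral>s. g2 (X s y) \<partial>N) \<partial>M)"
  proof (rule efron_stein[where C = "\<bar>C\<bar>"])
    show "integrable N (\<lambda>s. \<integral>y. g1 (X s y) \<partial>M)"
      unfolding N_def M_def X_def p_def by (rule integrable_dirichlet_Suc[OF cg(1)])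
    show "integrable M (\<lambda>y. \<integral>s. g2 (X s y) \<partial>N)"
      unfolding N_def M_def X_def p_def by (rule integrable_dirichlet_Suc'[OF cg(2)])
    show "(\<lambda>(s, y). f' (X s y)) \<in> borel_measurable (N \<Otimes>\<^sub>M M)"
      by measurable
  qed (use 1 2 f'_bound N.prob_space_axioms M.prob_space_axioms in auto)
  also have "\<dots> = (\<integral>x. g1 x \<partial>D) + (\<integral>x. g2 x \<partial>D)"
    unfolding N_def M_def X_def p_def D_def
    by (simp only: integral_dirichlet_Suc[OF cg(1)] integral_dirichlet_Suc'[OF cg(2)])
  also have "\<dots> = (\<integral>x. energy_density (Suc k) G x \<partial>D)"
    unfolding g12 D_def
    by (rule Bochner_Integration.integral_add[symmetric]) (intro integrable_dirichlet_measure cg)+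
  finally show ?case unfolding D_def .
qed

end

text \<open>The pair sum is a variance; leaving the total weight general is what makes the induction
  on \<open>d\<close> work.\<close>

lemma pairwise_sq_diff_sum:
  fixes b u :: "nat \<Rightarrow> real"
  shows "(\<Sum>j\<le>d. \<Sum>i<j. b i * b j * (u i - u j)\<^sup>2)
    = (\<Sum>i\<le>d. b i) * (\<Sum>i\<le>d. b i * (u i)\<^sup>2) - (\<Sum>i\<le>d. b i * u i)\<^sup>2"
proof (induction d)
  case 0
  then show ?case by (simp add: power2_eq_square algebra_simps)
next
  case (Suc d)
  have "(\<Sum>i<Suc d. b i * b (Suc d) * (u i - u (Suc d))\<^sup>2)
    = (\<Sum>i\<le>d. b (Suc d) * (b i * (u i)\<^sup>2) - 2 * b (Suc d) * u (Suc d) * (b i * u i) + b (Suc d) * (u (Suc d))\<^sup>2 * b i)"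
    unfolding lessThan_Suc_atMost by (intro sum.cong refl) (simp add: power2_eq_square algebra_simps)
  also have "\<dots> = b (Suc d) * (\<Sum>i\<le>d. b i * (u i)\<^sup>2) - 2 * b (Suc d) * u (Suc d) * (\<Sum>i\<le>d. b i * u i)
      + b (Suc d) * (u (Suc d))\<^sup>2 * (\<Sum>i\<le>d. b i)"
    unfolding sum.distrib sum_subtractf sum_distrib_left[symmetric] by simp
  finally show ?case
    using Suc by (simp add: power2_eq_square algebra_simps)
qed

text \<open>Averaging (B - u)(u - A) >= 0 over the weights bounds the variance by (B - m)(m - A),
  which is largest at the midpoint m = (A + B)/2.\<close>

lemma popoviciu:
  fixes b u :: "nat \<Rightarrow> real"
  assumes b: "\<And>i. i \<le> d \<Longrightarrow> b i \<ge> 0" "(\<Sum>i\<le>d. b i) = 1"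
    and u: "\<And>i j. i \<le> d \<Longrightarrow> j \<le> d \<Longrightarrow> u i - u j \<le> R"
  shows "(\<Sum>j\<le>d. \<Sum>i<j. b i * b j * (u i - u j)\<^sup>2) \<le> R\<^sup>2 / 4"
proof -
  define A where "A = Min (u ` {..d})"
  define B where "B = Max (u ` {..d})"
  define m where "m = (\<Sum>i\<le>d. b i * u i)"
  have AB: "A \<le> u i" "u i \<le> B" if "i \<le> d" for i
    using that by (auto simp: A_def B_def)
  have "A \<in> u ` {..d}" "B \<in> u ` {..d}"
    unfolding A_def B_def by (intro Min_in Max_in; simp)+
  then have R: "B - A \<le> R" "0 \<le> B - A"
    using u AB by auto
  have "0 \<le> (\<Sum>i\<le>d. b i * ((B - u i) * (u i - A)))"
    using b AB by (intro sum_nonneg mult_nonneg_nonneg) auto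
  also have "\<dots> = (\<Sum>i\<le>d. (A + B) * (b i * u i) - A * B * b i - b i * (u i)\<^sup>2)"
    by (intro sum.cong refl) (simp add: power2_eq_square algebra_simps)
  also have "\<dots> = (A + B) * m - A * B - (\<Sum>i\<le>d. b i * (u i)\<^sup>2)"
    unfolding sum_subtractf sum_distrib_left[symmetric] m_def b(2) by simp
  finally have "(\<Sum>i\<le>d. b i * (u i)\<^sup>2) - m\<^sup>2 \<le> (A + B) * m - A * B - m\<^sup>2" by simp
  also have "\<dots> \<le> (B - A)\<^sup>2 / 4"
    using zero_le_power2[of "m - (A + B) / 2"] by (simp add: power2_eq_square field_simps)
  also have "\<dots> \<le> R\<^sup>2 / 4"
    using R by (simp add: power_mono)
  finally show ?thesis
    unfolding pairwise_sq_diff_sum b(2) m_def by simp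
qed

section \<open>Full-dimensional simplices and their Poincare constant\<close>

lemma affinely_independent_sequence:
  fixes v :: "nat \<Rightarrow> 'a::euclidean_space"
  assumes "inj_on v {..d}" "\<not> affine_dependent (v ` {..d})" "j < d"
  shows "v (Suc j) \<notin> affine hull (v ` {..j})"
proof
  assume *: "v (Suc j) \<in> affine hull (v ` {..j})"
  have "v ` {..j} \<subseteq> v ` {..d} - {v (Suc j)}"
  proof safe
    fix i assume "i \<le> j" "v i = v (Suc j)"
    then have "i = Suc j"
      using assms(3) by (intro inj_onD[OF assms(1)]) auto
    then show False using \<open>i \<le> j\<close> by simp
  qed (use assms in auto)
  then have "v (Suc j) \<in> affine hull (v ` {..d} - {v (Suc j)})"
    using * hull_mono by blast
  then show False
    using assms unfolding affine_dependent_def by auto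
qed

text \<open>The edges at \<open>v 0\<close> are linearly independent, so linear functionals with
  prescribed values on them exist; adding the value at \<open>v 0\<close> makes them affine. For i =
  0 the functional is -1 on every edge and the constant is 1.\<close>

lemma barycentric_exists:
  fixes v :: "nat \<Rightarrow> 'a::euclidean_space"
  assumes inj: "inj_on v {..d}" and indep: "\<not> affine_dependent (v ` {..d})"
  shows "\<exists>\<beta>. barycentric v \<beta> d"
proof -
  have "v 0 \<in> v ` {..d}" by auto
  from affine_dependent_iff_dependent2[OF this] indep
  have "independent ((\<lambda>x. - v 0 + x) ` (v ` {..d} - {v 0}))"
    by simp
  moreover have "(\<lambda>x. - v 0 + x) ` (v ` {..d} - {v 0}) = (\<lambda>j. v j - v 0) ` {1..d}"
  proof -
    have "v ` {..d} - {v 0} = v ` {1..d}"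
    proof -
      have "v ` ({..d} - {0}) = v ` {..d} - v ` {0}"
        using inj by (rule inj_on_image_set_diff) auto
      moreover have "{..d} - {0} = {1..d}" by auto
      ultimately show ?thesis by simp
    qed
    then show ?thesis by (simp add: image_image)
  qed
  ultimately have ind: "independent ((\<lambda>j. v j - v 0) ` {1..d})" by simp
  have inj': "inj_on (\<lambda>j. v j - v 0) {1..d}"
    using inj by (auto simp: inj_on_def)
  have "\<exists>g. linear g \<and> (\<forall>j\<in>{1..d}. g (v j - v 0) = (if i = j then 1 else 0) - (if i = 0 then 1 else (0::real)))" for i
  proof -
    define F where "F x = (\<lambda>j. (if i = j then 1 else 0) - (if i = 0 then 1 else (0::real)))
        (the_inv_into {1..d} (\<lambda>j. v j - v 0) x)" for x
    from linear_independent_extend[OF ind, of F]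
    obtain g where g: "linear g" "\<forall>x\<in>(\<lambda>j. v j - v 0) ` {1..d}. g x = F x"
      by (elim exE conjE)
    show ?thesis
    proof (intro exI[of _ g] conjI ballI)
      fix j assume j: "j \<in> {1..d}"
      have "the_inv_into {1..d} (\<lambda>j. v j - v 0) (v j - v 0) = j"
        using the_inv_into_f_f[OF inj' j] .
      then show "g (v j - v 0) = (if i = j then 1 else 0) - (if i = 0 then 1 else 0)"
        using g(2) j by (simp only: F_def bex_simps ball_simps)
    qed (rule g)
  qed
  then obtain g where g: "\<And>i. linear (g i)"
    "\<And>i j. j \<in> {1..d} \<Longrightarrow> g i (v j - v 0) = (if i = j then 1 else 0) - (if i = 0 then 1 else (0::real))"
    by metis
  have "barycentric v (\<lambda>i x. (if i = 0 then 1 else 0) + g i (x - v 0)) d"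
  proof
    fix i j :: nat and x y :: 'a and s :: real
    show "(if i = 0 then 1 else 0) + g i (x + s *\<^sub>R (y - x) - v 0)
      = (if i = 0 then 1 else 0) + g i (x - v 0) +
        s * ((if i = 0 then 1 else 0) + g i (y - v 0) - ((if i = 0 then 1 else 0) + g i (x - v 0)))"
    proof -
      have "x + s *\<^sub>R (y - x) - v 0 = (x - v 0) + s *\<^sub>R ((y - v 0) - (x - v 0))"
        by simp
      then have "g i (x + s *\<^sub>R (y - x) - v 0) = g i (x - v 0) + s * (g i (y - v 0) - g i (x - v 0))"
        using g(1)[of i] by (simp only: linear_add linear_diff linear_scale real_scaleR_def)
      then show ?thesis by simp
    qed
    show "(if i = 0 then 1 else 0) + g i (v j - v 0) = (if i = j then 1 else 0)" if "i \<le> d" "j \<le> d"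
      using g(2)[of j i] that linear_0[OF g(1)] by (cases "j = 0") auto
    have "continuous_on UNIV (g i)"
      using g(1)[of i] by (intro linear_continuous_on) (simp add: linear_conv_bounded_linear)
    then have "continuous_on UNIV (\<lambda>x. g i (x - v 0))"
      by (rule continuous_on_compose2) (auto intro!: continuous_on_diff continuous_on_id continuous_on_const)
    then show "continuous_on UNIV (\<lambda>x. (if i = 0 then 1 else 0) + g i (x - v 0))"
      by (intro continuous_on_add continuous_on_const)
  qed
  then show ?thesis by blast
qed

lemma integral_lebesgue_on_borel:
  fixes f :: "'a::euclidean_space \<Rightarrow> real"
  assumes [measurable]: "f \<in> borel_measurable borel" "S \<in> sets borel"
  shows "(\<integral>x. f x \<partial>lebesgue_on S) = (\<integral>x. indicator S x * f x \<partial>lborel)"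
proof -
  have "(\<integral>x. f x \<partial>lebesgue_on S) = (\<integral>x. indicator S x *\<^sub>R f x \<partial>lebesgue)"
    by (rule integral_restrict_space) simp
  also have "\<dots> = (\<integral>x. indicator S x *\<^sub>R f x \<partial>lborel)"
    by (rule integral_completion) measurable
  finally show ?thesis by simp
qed

lemma integral_uniform_measure:
  fixes f :: "'a \<Rightarrow> real"
  assumes [measurable]: "f \<in> borel_measurable M" "S \<in> sets M"
    and S: "emeasure M S \<noteq> 0" "emeasure M S \<noteq> \<infinity>"
  shows "(\<integral>x. f x \<partial>uniform_measure M S) = (\<integral>x. indicator S x * f x \<partial>M) / measure M S"
proof -
  have m: "emeasure M S = ennreal (measure M S)" "measure M S > 0"
  proof -
    show eq: "emeasure M S = ennreal (measure M S)"
      using S by (simp add: emeasure_eq_ennreal_measure)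
    then have "measure M S \<noteq> 0"
      using S by auto
    then show "measure M S > 0"
      by (simp add: less_le)
  qed
  have "uniform_measure M S = density M (\<lambda>x. ennreal (indicator S x / measure M S))"
    unfolding uniform_measure_def
    by (rule density_cong) (use m in \<open>auto simp: indicator_def divide_ennreal ennreal_1[symmetric] simp del: ennreal_1\<close>)
  then show ?thesis
    by (simp add: integral_density)
qed

text \<open>The vertices are enumerated because stick-breaking depends on their order; the set
  \<open>T\<close> and its uniform measure \<open>U\<close> do not.\<close>

locale full_simplex =
  fixes v :: "nat \<Rightarrow> 'a::euclidean_space" and d :: nat
  assumes inj: "inj_on v {..d}" and indep: "\<not> affine_dependent (v ` {..d})" and d: "d = DIM('a)"
begin

definition T where "T = convex hull (v ` {..d})"

definition U where "U = uniform_measure lborel T"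

lemma span_UNIV: "span ((\<lambda>i. v i - v 0) ` {..d}) = UNIV"
proof -
  have "int (card (v ` {..d})) = int d + 1"
    by (simp add: card_image[OF inj])
  then have "aff_dim (v ` {..d}) = int DIM('a)"
    using indep by (simp add: affine_independent_iff_card d)
  then have "affine hull (v ` {..d}) = UNIV"
    by (simp add: aff_dim_eq_full)
  then have "x + v 0 - v 0 \<in> span ((\<lambda>i. v i - v 0) ` {..d})" for x
    unfolding affine_hull_diffs by blast
  then show ?thesis by auto
qed

lemma sets_T [measurable]: "T \<in> sets borel" and compact_T: "compact T"
  unfolding T_def by (auto intro: sets_simplex compact_simplex)

text \<open>In full dimension the orthonormal basis spans the space, so the flat measure is Lebesgue
  measure itself. As \<open>U\<close> ignores the enumeration, \<open>U_eq\<close> makes every order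
  of stick-breaking available for the same measure.\<close>

lemma emeasure_T: "emeasure lborel T \<noteq> 0" "emeasure lborel T \<noteq> \<infinity>"
  and U_eq: "U = dirichlet_measure v d"
proof -
  have "v (Suc j) \<notin> affine hull (v ` {..j})" if "j < d" for j
    using inj indep that by (rule affinely_independent_sequence)
  from uniform_measure_flat_simplex[OF this]
  obtain B where B: "pairwise orthogonal B" "\<forall>b\<in>B. norm b = 1"
    "span B = span ((\<lambda>i. v i - v 0) ` {..d})"
    "emeasure (flat_measure (v 0) B) T \<noteq> 0" "emeasure (flat_measure (v 0) B) T \<noteq> \<infinity>"
    "uniform_measure (flat_measure (v 0) B) T = dirichlet_measure v d"
    unfolding T_def by blast
  have "flat_measure (v 0) B = lborel"
    using B(1-3) by (intro flat_measure_UNIV) (auto simp: span_UNIV)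
  then show "emeasure lborel T \<noteq> 0" "emeasure lborel T \<noteq> \<infinity>" "U = dirichlet_measure v d"
    using B(4-6) by (auto simp: U_def)
qed

lemma prob_space_U: "prob_space U"
  unfolding U_eq by (rule prob_space_dirichlet_measure)

lemma measure_T: "measure lebesgue T > 0"
proof -
  have "measure lebesgue T = measure lborel T" by simp
  also have "\<dots> > 0"
  proof -
    have "emeasure lborel T = ennreal (measure lborel T)"
      using emeasure_T by (simp add: emeasure_eq_ennreal_measure)
    then have "measure lborel T \<noteq> 0"
      using emeasure_T by auto
    then show ?thesis
      using measure_nonneg[of lborel T] by linarith
  qed
  finally show ?thesis .
qed

lemma integral_T:
  fixes f :: "'a \<Rightarrow> real"
  assumes f: "continuous_on UNIV f"
  shows "(\<integral>x. f x \<partial>lebesgue_on T) = measure lebesgue T * (\<integral>x. f x \<partial>U)"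
proof -
  have [measurable]: "f \<in> borel_measurable borel"
    using f by (rule borel_measurable_continuous_onI)
  show ?thesis
    using measure_T emeasure_T unfolding U_def
    by (simp add: integral_lebesgue_on_borel integral_uniform_measure)
qed

lemma integrable_U: "continuous_on UNIV f \<Longrightarrow> integrable U f" for f :: "'a \<Rightarrow> real"
  unfolding U_eq by (rule integrable_dirichlet_measure)

lemma AE_U: "AE x in U. x \<in> T"
  unfolding U_eq T_def by (rule AE_dirichlet_measure)

lemma full_simplex_permute:
  assumes \<rho>: "bij_betw \<rho> {..d} {..d}"
  shows "full_simplex (v \<circ> \<rho>) d" and "(v \<circ> \<rho>) ` {..d} = v ` {..d}"
proof -
  show im: "(v \<circ> \<rho>) ` {..d} = v ` {..d}"
    using \<rho> by (metis bij_betw_imp_surj_on image_comp)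
  show "full_simplex (v \<circ> \<rho>) d"
  proof
    show "inj_on (v \<circ> \<rho>) {..d}"
      using \<rho> inj by (metis bij_betw_def comp_inj_on)
  qed (unfold im, use indep d in auto)
qed

lemma poincare_permuted:
  assumes \<rho>: "bij_betw \<rho> {..d} {..d}" and \<beta>: "barycentric v \<beta> d"
    and f: "\<And>x. (f has_derivative (\<lambda>h. G x \<bullet> h)) (at x)" and G: "continuous_on UNIV G"
  shows "(\<integral>x. (f x)\<^sup>2 \<partial>U) - (\<integral>x. f x \<partial>U)\<^sup>2
    \<le> (\<integral>x. (\<Sum>j\<le>d. \<Sum>i<j. \<beta> (\<rho> i) x * \<beta> (\<rho> j) x * (G x \<bullet> (v (\<rho> i) - v (\<rho> j)))\<^sup>2 / (real j + 1)) \<partial>U)"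
proof -
  interpret b: barycentric v \<beta> d by fact
  interpret p: full_simplex "v \<circ> \<rho>" d by (rule full_simplex_permute[OF \<rho>])
  have le: "\<rho> i \<le> d" if "i \<le> d" for i
    using \<rho> that by (auto simp: bij_betw_def)
  interpret b': barycentric "v \<circ> \<rho>" "\<lambda>i. \<beta> (\<rho> i)" d
    using \<rho> le by unfold_locales (auto simp: b.affine b.vertex b.cont bij_betw_def inj_on_def)
  have "p.U = U"
    unfolding p.U_def U_def p.T_def T_def full_simplex_permute(2)[OF \<rho>] ..
  then have "dirichlet_measure (v \<circ> \<rho>) d = U"
    by (simp add: p.U_eq)
  then show ?thesis
    using b'.poincare_dirichlet[OF order_refl f G] by (simp add: b'.energy_density_def)
qed

text \<open>The bounds of \<open>poincare_permuted\<close> are averaged over the cyclic shifts. For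
  d = 2 every edge then has the mean weight (1/2 + 1/3 + 1/3)/3 = 7/18; for d = 3 the mean weights
  1/3 and 7/24 are smaller. What remains is the variance of the values
  \<open>G x \<bullet> v i\<close> under the barycentric weights, at most a quarter of their squared
  range.\<close>

lemma poincare_simplex:
  assumes dim: "d \<in> {2, 3}"
    and f: "\<And>x. (f has_derivative (\<lambda>h. G x \<bullet> h)) (at x)" and G: "continuous_on UNIV G"
  shows "(\<integral>x. (f x)\<^sup>2 \<partial>U) - (\<integral>x. f x \<partial>U)\<^sup>2 \<le> 7 / 72 * (diameter T)\<^sup>2 * (\<integral>x. (norm (G x))\<^sup>2 \<partial>U)"
proof -
  obtain \<beta> where \<beta>: "barycentric v \<beta> d"
    using barycentric_exists[OF inj indep] by blast
  interpret b: barycentric v \<beta> d by fact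
  define w where "w x i j = \<beta> i x * \<beta> j x * (G x \<bullet> (v i - v j))\<^sup>2" for x i j
  define \<rho> where "\<rho> r i = (i + r) mod Suc d" for r i :: nat
  define Z where "Z r x = (\<Sum>j\<le>d. \<Sum>i<j. w x (\<rho> r i) (\<rho> r j) / (real j + 1))" for r x
  have w_sym: "w x i j = w x j i" for x i j
  proof -
    have "G x \<bullet> (v i - v j) = - (G x \<bullet> (v j - v i))"
      by (simp add: inner_diff_right)
    then show ?thesis
      unfolding w_def by (simp add: mult_ac)
  qed
  have \<rho>_if: "\<rho> r i = (if i + r < Suc d then i + r else i + r - Suc d)" if "i \<le> d" "r \<le> d" for r i
    using that by (auto simp: \<rho>_def le_mod_geq)
  have bij: "bij_betw (\<rho> r) {..d} {..d}" if "r \<le> d" for r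
  proof -
    have "inj_on (\<rho> r) {..d}"
      using that by (intro inj_onI) (auto simp: \<rho>_if split: if_splits)
    moreover have "\<rho> r ` {..d} \<subseteq> {..d}"
      using that by (auto simp: \<rho>_if)
    ultimately show ?thesis
      by (simp add: bij_betw_def endo_inj_surj)
  qed
  have cont_w: "continuous_on UNIV (\<lambda>x. w x i j)" for i j
    unfolding w_def by (intro continuous_intros b.cont G)
  have cont_Z: "continuous_on UNIV (Z r)" for r
    unfolding Z_def[abs_def] by (intro continuous_intros cont_w) auto
  have Var: "(\<integral>x. (f x)\<^sup>2 \<partial>U) - (\<integral>x. f x \<partial>U)\<^sup>2 \<le> (\<integral>x. Z r x \<partial>U)" if "r \<le> d" for r
    using poincare_permuted[OF bij[OF that] \<beta> f G] by (simp add: Z_def w_def)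
  have "real (Suc d) * ((\<integral>x. (f x)\<^sup>2 \<partial>U) - (\<integral>x. f x \<partial>U)\<^sup>2) = (\<Sum>r\<le>d. (\<integral>x. (f x)\<^sup>2 \<partial>U) - (\<integral>x. f x \<partial>U)\<^sup>2)"
    by simp
  also have "\<dots> \<le> (\<Sum>r\<le>d. \<integral>x. Z r x \<partial>U)"
    by (intro sum_mono Var) simp
  also have "\<dots> = (\<integral>x. (\<Sum>r\<le>d. Z r x) \<partial>U)"
    by (rule Bochner_Integration.integral_sum[symmetric]) (intro integrable_U cont_Z)
  also have "\<dots> \<le> (\<integral>x. real (Suc d) * (7 / 72 * (diameter T)\<^sup>2) * (norm (G x))\<^sup>2 \<partial>U)"
  proof (rule integral_mono_AE)
    show "integrable U (\<lambda>x. \<Sum>r\<le>d. Z r x)"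
      "integrable U (\<lambda>x. real (Suc d) * (7 / 72 * (diameter T)\<^sup>2) * (norm (G x))\<^sup>2)"
      by (intro integrable_U continuous_intros cont_Z G)+
    show "AE x in U. (\<Sum>r\<le>d. Z r x) \<le> real (Suc d) * (7 / 72 * (diameter T)\<^sup>2) * (norm (G x))\<^sup>2"
      using AE_U
    proof eventually_elim
      fix x assume x: "x \<in> T"
      note coord = b.simplex_coordinates[OF x[unfolded T_def] order_refl]
      have w0: "w x i j \<ge> 0" if "i \<le> d" "j \<le> d" for i j
        unfolding w_def using coord that by simp
      have S: "(\<Sum>j\<le>d. \<Sum>i<j. w x i j) \<le> (norm (G x) * diameter T)\<^sup>2 / 4"
      proof -
        have "G x \<bullet> v i - G x \<bullet> v j \<le> norm (G x) * diameter T" if "i \<le> d" "j \<le> d" for i j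
        proof -
          have "G x \<bullet> (v i - v j) \<le> norm (G x) * norm (v i - v j)"
            by (rule norm_cauchy_schwarz)
          also have "norm (v i - v j) \<le> diameter T"
            using diameter_bounded_bound[OF compact_imp_bounded[OF compact_T], of "v i" "v j"] that
            by (auto simp: T_def dist_norm intro: hull_inc)
          finally show ?thesis by (simp add: inner_diff_right mult_left_mono)
        qed
        from popoviciu[of d "\<lambda>i. \<beta> i x" "\<lambda>i. G x \<bullet> v i", OF _ _ this] coord show ?thesis
          by (simp add: w_def inner_diff_right)
      qed
      have "(\<Sum>r\<le>d. Z r x) \<le> real (Suc d) * (7 / 18) * (\<Sum>j\<le>d. \<Sum>i<j. w x i j)"
      proof -
        consider "d = 2" | "d = 3" using dim by auto
        then show ?thesis
        proof cases
          case 1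
          then show ?thesis
            using w_sym[of x 1 0] w_sym[of x 2 0] w_sym[of x 2 1]
            by (simp add: Z_def \<rho>_def numeral_2_eq_2 lessThan_Suc atMost_Suc)
        next
          case 2
          have W: "w x 0 1 \<ge> 0" "w x 0 2 \<ge> 0" "w x 0 3 \<ge> 0" "w x 1 2 \<ge> 0" "w x 1 3 \<ge> 0" "w x 2 3 \<ge> 0"
            using w0 2 by auto
          have sums: "(\<Sum>i\<le>3. h i) = h 0 + h 1 + h 2 + h 3" "(\<Sum>i<3. h i) = h 0 + h 1 + h 2"
            "(\<Sum>i<2. h i) = h 0 + h 1" "(\<Sum>i<1. h i) = h 0" for h :: "nat \<Rightarrow> real"
            by (simp_all add: numeral_3_eq_3 numeral_2_eq_2 lessThan_Suc atMost_Suc)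
          have Z: "Z r x = w x (\<rho> r 0) (\<rho> r 1) / 2 + (w x (\<rho> r 0) (\<rho> r 2) + w x (\<rho> r 1) (\<rho> r 2)) / 3
              + (w x (\<rho> r 0) (\<rho> r 3) + w x (\<rho> r 1) (\<rho> r 3) + w x (\<rho> r 2) (\<rho> r 3)) / 4" for r
            unfolding Z_def 2 sums by (simp add: add_divide_distrib)
          have "\<rho> 0 0 = 0" "\<rho> 0 1 = 1" "\<rho> 0 2 = 2" "\<rho> 0 3 = 3" "\<rho> 1 0 = 1" "\<rho> 1 1 = 2" "\<rho> 1 2 = 3" "\<rho> 1 3 = 0"
            "\<rho> 2 0 = 2" "\<rho> 2 1 = 3" "\<rho> 2 2 = 0" "\<rho> 2 3 = 1" "\<rho> 3 0 = 3" "\<rho> 3 1 = 0" "\<rho> 3 2 = 1" "\<rho> 3 3 = 2"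
            by (simp_all add: \<rho>_def 2)
          \<comment> \<open>Adjacent vertices of the 4-cycle collect 1/2 + 1/3 + 1/4 + 1/4 = 4/3,
            opposite ones twice 1/3 + 1/4, that is 7/6.\<close>
          then have E1: "(\<Sum>r\<le>d. Z r x) = 4 / 3 * (w x 0 1 + w x 1 2 + w x 2 3 + w x 0 3) + 7 / 6 * (w x 0 2 + w x 1 3)"
            unfolding 2 sums Z
            by (simp only: w_sym[of x 1 0] w_sym[of x 2 0] w_sym[of x 2 1] w_sym[of x 3 0] w_sym[of x 3 1] w_sym[of x 3 2])
               (simp add: field_simps)
          have E2: "(\<Sum>j\<le>d. \<Sum>i<j. w x i j) = w x 0 1 + (w x 0 2 + w x 1 2) + (w x 0 3 + w x 1 3 + w x 2 3)"
            unfolding 2 sums by simp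
          have gen: "4 / 3 * (a + p + r + c) + 7 / 6 * (b + q) \<le> real (Suc 3) * (7 / 18) * (a + (b + p) + (c + q + r))"
            if "0 \<le> a" "0 \<le> b" "0 \<le> c" "0 \<le> p" "0 \<le> q" "0 \<le> r" for a b c p q r :: real
          proof -
            have r4: "real (Suc 3) = 4" by simp
            have "4 * (7 / 18) * (a + (b + p) + (c + q + r)) - (4 / 3 * (a + p + r + c) + 7 / 6 * (b + q))
                = 2 / 9 * (a + p + r + c) + 7 / 18 * (b + q)"
              by (simp add: field_simps)
            also have "\<dots> \<ge> 0" using that by simp
            finally show ?thesis unfolding r4 by simp
          qed
          show ?thesis
            unfolding E1 E2 unfolding 2 by (rule gen[OF W])
        qed
      qed
      also have "\<dots> \<le> real (Suc d) * (7 / 18) * ((norm (G x) * diameter T)\<^sup>2 / 4)"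
        by (rule mult_left_mono[OF S]) simp
      finally show "(\<Sum>r\<le>d. Z r x) \<le> real (Suc d) * (7 / 72 * (diameter T)\<^sup>2) * (norm (G x))\<^sup>2"
        by (simp add: power_mult_distrib algebra_simps)
    qed
  qed
  also have "\<dots> = real (Suc d) * (7 / 72 * (diameter T)\<^sup>2 * (\<integral>x. (norm (G x))\<^sup>2 \<partial>U))"
    by simp
  finally show ?thesis
    by (simp del: of_nat_Suc)
qed

end

section \<open>Traces on the facets\<close>

text \<open>Orthonormal bases of the direction space exist, so the choices hidden in
  \<open>flat_lborel\<close> meet their specification; from here on they are an explicit
  \<open>q\<close> and \<open>B\<close>.\<close>

lemma flat_lborel_simplex:
  fixes v :: "nat \<Rightarrow> 'a::euclidean_space" and k :: nat
  defines "F \<equiv> convex hull (v ` {..k})"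
  obtains q B where "flat_lborel F = flat_measure q B" "q \<in> F" "pairwise orthogonal B" "\<forall>b\<in>B. norm b = 1"
    "span B = span ((\<lambda>i. v i - v 0) ` {..k})"
proof -
  define q where "q = (SOME p. p \<in> F)"
  define B where "B = (SOME B. pairwise orthogonal B \<and> (\<forall>b\<in>B. norm b = 1) \<and>
                       span B = span {x - y |x y. x \<in> F \<and> y \<in> F})"
  have "v 0 \<in> F" unfolding F_def by (auto intro: hull_inc)
  then have q: "q \<in> F" unfolding q_def by (rule someI)
  obtain B0 where B0: "B0 \<subseteq> span {x - y |x y. x \<in> F \<and> y \<in> F}" "pairwise orthogonal B0" "\<And>x. x \<in> B0 \<Longrightarrow> norm x = 1"
      "independent B0" "card B0 = dim (span {x - y |x y. x \<in> F \<and> y \<in> F})" "span B0 = span {x - y |x y. x \<in> F \<and> y \<in> F}"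
    by (rule orthonormal_basis_subspace[OF subspace_span]) (rule that)
  then have "pairwise orthogonal B0 \<and> (\<forall>b\<in>B0. norm b = 1) \<and> span B0 = span {x - y |x y. x \<in> F \<and> y \<in> F}"
    by blast
  then have B: "pairwise orthogonal B \<and> (\<forall>b\<in>B. norm b = 1) \<and> span B = span {x - y |x y. x \<in> F \<and> y \<in> F}"
    unfolding B_def by (rule someI)
  have "flat_lborel F = distr (\<Pi>\<^sub>M b\<in>B. lborel) borel (\<lambda>c. q + (\<Sum>b\<in>B. c b *\<^sub>R b))"
    unfolding flat_lborel_def Let_def q_def B_def ..
  also have "\<dots> = flat_measure q B"
    unfolding flat_measure_def frame_measure_def by (subst distr_distr) (auto simp: comp_def)
  finally show ?thesis
    using that[of q B] q B span_differences[of v k] unfolding F_def by simp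
qed

lemma integral_face_measure:
  fixes f :: "'a::euclidean_space \<Rightarrow> real"
  assumes "F \<in> sets borel"
  shows "(\<integral>x. f x \<partial>face_measure F) = (\<integral>x. indicator F x * f x \<partial>flat_lborel F)"
proof -
  have "sets (flat_lborel F) = sets borel" "space (flat_lborel F) = UNIV"
    by (simp_all add: flat_lborel_def Let_def)
  then show ?thesis
    unfolding face_measure_def using assms by (subst integral_restrict_space) auto
qed

lemma measure_face_measure:
  assumes "F \<in> sets borel"
  shows "measure (face_measure F) F = measure (flat_lborel F) F"
proof -
  have "sets (flat_lborel F) = sets borel" "space (flat_lborel F) = UNIV"
    by (simp_all add: flat_lborel_def Let_def)
  then show ?thesis
    unfolding face_measure_def using assms by (subst measure_restrict_space) auto
qed

lemma integrable_face_measure: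
  fixes f :: "'a::euclidean_space \<Rightarrow> real"
  assumes F: "compact F" "emeasure (flat_lborel F) F \<noteq> \<infinity>" and f: "continuous_on UNIV f"
  shows "integrable (face_measure F) f"
proof -
  have s [simp, measurable_cong]: "sets (flat_lborel F) = sets borel" "space (flat_lborel F) = UNIV"
    by (simp_all add: flat_lborel_def Let_def)
  have Fb: "F \<in> sets borel"
    using F by (simp add: borel_closed compact_imp_closed)
  have "compact (f ` F)"
    using F f by (intro compact_continuous_image) (auto intro: continuous_on_subset)
  then obtain b where b: "\<And>x. x \<in> F \<Longrightarrow> norm (f x) \<le> b"
    by (meson bounded_iff compact_imp_bounded imageI)
  interpret finite_measure "face_measure F"
  proof (rule finite_measureI)
    show "emeasure (face_measure F) (space (face_measure F)) \<noteq> \<infinity>"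
      using F Fb by (simp add: face_measure_def space_restrict_space emeasure_restrict_space)
  qed
  show ?thesis
  proof (rule integrable_const_bound[of _ b])
    show "AE x in face_measure F. norm (f x) \<le> b"
      using b by (intro AE_I2) (auto simp: face_measure_def space_restrict_space)
    show "f \<in> borel_measurable (face_measure F)"
      unfolding face_measure_def using borel_measurable_continuous_onI[OF f]
      by (intro measurable_restrict_space1) simp
  qed
qed

text \<open>The identity \<open>div ((x - p) f) = d f + (x - p) \<bullet> \<nabla>f\<close>, integrated over a cone with apex \<open>p\<close>:
  only the base contributes to the boundary term.\<close>

lemma cone_trace_identity:
  fixes f :: "'a::euclidean_space \<Rightarrow> real"
  assumes UF: "prob_space UF" "sets UF = sets borel"
    and f: "\<And>x. (f has_derivative (\<lambda>h. G x \<bullet> h)) (at x)" and G: "continuous_on UNIV G"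
    and U: "U = distr (power_measure (Suc k) \<Otimes>\<^sub>M UF) borel (\<lambda>(s, y). p + s *\<^sub>R (y - p))"
    and int: "\<And>g :: 'a \<Rightarrow> real. continuous_on UNIV g \<Longrightarrow> integrable U g"
  shows "(\<integral>x. f x + (x - p) \<bullet> G x / real (Suc k) \<partial>U) = (\<integral>y. f y \<partial>UF)"
proof -
  define N where "N = power_measure (Suc k)"
  interpret N: prob_space N unfolding N_def by (rule prob_space_power_measure) simp
  interpret UF: prob_space UF by fact
  interpret pair_prob_space N UF ..
  have [measurable_cong]: "sets N = sets borel" "sets UF = sets borel"
    using UF by (simp_all add: N_def)
  define X where "X s y = p + s *\<^sub>R (y - p)" for s and y :: 'a
  have [measurable]: "case_prod X \<in> N \<Otimes>\<^sub>M UF \<rightarrow>\<^sub>M borel" unfolding X_def by measurable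
  have X: "case_prod X = (\<lambda>(s, y). p + s *\<^sub>R (y - p))"
    by (auto simp: X_def fun_eq_iff)
  have U': "U = distr (N \<Otimes>\<^sub>M UF) borel (case_prod X)"
    unfolding U X N_def ..
  have cf: "continuous_on UNIV f"
    by (intro continuous_at_imp_continuous_on ballI has_derivative_continuous[OF f])
  define g where "g x = f x + (x - p) \<bullet> G x / real (Suc k)" for x
  have cg: "continuous_on UNIV g"
    unfolding g_def[abs_def] by (intro continuous_intros cf G) auto
  then have [measurable]: "g \<in> borel_measurable borel"
    by (rule borel_measurable_continuous_onI)
  have "integrable (distr (N \<Otimes>\<^sub>M UF) borel (case_prod X)) g"
    using int[OF cg] unfolding U' .
  then have i: "integrable (N \<Otimes>\<^sub>M UF) (\<lambda>(s, y). g (X s y))"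
    by (subst (asm) integrable_distr_eq) (auto simp: case_prod_unfold)
  have "(\<integral>x. g x \<partial>U) = (\<integral>(s, y). g (X s y) \<partial>(N \<Otimes>\<^sub>M UF))"
    unfolding U' by (subst integral_distr) (auto simp: case_prod_unfold)
  also have "\<dots> = (\<integral>y. (\<integral>s. g (X s y) \<partial>N) \<partial>UF)"
    using integral_snd[OF i] by simp
  also have "\<dots> = (\<integral>y. f y \<partial>UF)"
  proof (intro Bochner_Integration.integral_cong refl)
    fix y
    have cX: "continuous_on UNIV (\<lambda>s. X s y)"
      unfolding X_def by (intro continuous_intros)
    have "(\<integral>s. g (X s y) \<partial>N) = integral {0..1} (\<lambda>s. real (Suc k) * s ^ k * g (X s y))"
      unfolding N_def using continuous_on_compose2[OF cg cX] by (subst integral_power_measure) auto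
    also have "\<dots> = f y"
    proof (rule integral_unique)
      \<comment> \<open>Along each ray from the apex the integrand is the derivative of
        \<open>s ^ Suc k * f (X s y)\<close>; the power of s removes the contribution of the
        apex.\<close>
      have "((\<lambda>s. real (Suc k) * s ^ k * g (X s y)) has_integral (1 ^ Suc k * f (X 1 y) - 0 ^ Suc k * f (X 0 y))) {0..1}"
      proof (rule fundamental_theorem_of_calculus)
        fix s :: real
        have 1: "((\<lambda>s. f (X s y)) has_derivative (\<lambda>h. G (X s y) \<bullet> (h *\<^sub>R (y - p)))) (at s)"
          unfolding X_def
          by (rule has_derivative_eq_rhs[OF has_derivative_compose[OF _ f]]) (auto intro!: derivative_eq_intros)
        then have "((\<lambda>s. f (X s y)) has_real_derivative G (X s y) \<bullet> (y - p)) (at s)"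
          unfolding has_field_derivative_def by (simp add: mult_commute_abs)
        moreover have "((\<lambda>s. s ^ Suc k) has_real_derivative real (Suc k) * s ^ k) (at s)"
          by (auto intro!: derivative_eq_intros simp del: power_Suc)
        ultimately have "((\<lambda>s. s ^ Suc k * f (X s y)) has_real_derivative
            (real (Suc k) * s ^ k) * f (X s y) + (G (X s y) \<bullet> (y - p)) * s ^ Suc k) (at s)"
          by (rule DERIV_mult[rotated])
        moreover have "(real (Suc k) * s ^ k) * f (X s y) + (G (X s y) \<bullet> (y - p)) * s ^ Suc k
            = real (Suc k) * s ^ k * g (X s y)"
        proof -
          have "(X s y - p) \<bullet> G (X s y) = s * (G (X s y) \<bullet> (y - p))"
            by (simp add: X_def inner_commute)
          then have "real (Suc k) * s ^ k * g (X s y) = real (Suc k) * s ^ k * f (X s y) + s ^ k * (s * (G (X s y) \<bullet> (y - p)))"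
            unfolding g_def distrib_left by (simp del: of_nat_Suc)
          then show ?thesis by (simp add: mult_ac)
        qed
        ultimately have "((\<lambda>s. s ^ Suc k * f (X s y)) has_real_derivative real (Suc k) * s ^ k * g (X s y)) (at s)"
          by simp
        then show "((\<lambda>s. s ^ Suc k * f (X s y)) has_vector_derivative real (Suc k) * s ^ k * g (X s y)) (at s within {0..1})"
          by (simp only: has_real_derivative_iff_has_vector_derivative[symmetric] DERIV_subset[OF _ subset_UNIV])
      qed simp
      then show "((\<lambda>s. real (Suc k) * s ^ k * g (X s y)) has_integral f y) {0..1}"
        by (simp add: X_def)
    qed
    finally show "(\<integral>s. g (X s y) \<partial>N) = f y" .
  qed
  finally show ?thesis unfolding g_def .
qed

text \<open>Any candidate has nonpositive products with x - y and with y - x for points of the base,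
  so it is orthogonal to the base and by the last hypothesis a multiple of \<open>n\<close>; the
  apex fixes the sign. This resolves the description operator in
  \<open>outer_normal\<close>.\<close>

lemma outer_normal_eq:
  fixes T F :: "'a::euclidean_space set"
  assumes n: "norm n = 1" "\<And>y. y \<in> F \<Longrightarrow> n \<bullet> (y - p) = H" "H > 0"
    and T: "T = cone p F" "F \<noteq> {}"
    and normal: "\<And>w. (\<And>x y. x \<in> F \<Longrightarrow> y \<in> F \<Longrightarrow> w \<bullet> (x - y) = 0) \<Longrightarrow> w = (w \<bullet> n) *\<^sub>R n"
  shows "outer_normal T F = n"
  unfolding outer_normal_def
proof (rule the_equality)
  show "norm n = 1 \<and> (\<forall>x\<in>T. \<forall>y\<in>F. n \<bullet> (x - y) \<le> 0)"
  proof (intro conjI ballI)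
    fix x y assume "x \<in> T" "y \<in> F"
    then obtain s z where z: "x = p + s *\<^sub>R (z - p)" "z \<in> F" "0 \<le> s" "s \<le> 1"
      unfolding T cone_def by blast
    have "n \<bullet> (x - y) = s * (n \<bullet> (z - p)) - n \<bullet> (y - p)"
      unfolding z by (simp add: algebra_simps inner_simps)
    also have "\<dots> = (s - 1) * H"
      using n(2)[OF z(2)] n(2)[OF \<open>y \<in> F\<close>] by (simp add: algebra_simps)
    also have "\<dots> \<le> 0"
      using z n(3) by (simp add: mult_nonpos_nonneg)
    finally show "n \<bullet> (x - y) \<le> 0" .
  qed (rule n)
  fix m assume m: "norm m = 1 \<and> (\<forall>x\<in>T. \<forall>y\<in>F. m \<bullet> (x - y) \<le> 0)"
  have FT: "x \<in> T" if "x \<in> F" for x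
    unfolding T cone_def using that by (intro CollectI exI[of _ 1] exI[of _ x]) auto
  have "m \<bullet> (x - y) = 0" if "x \<in> F" "y \<in> F" for x y
  proof -
    have "m \<bullet> (x - y) \<le> 0" "m \<bullet> (y - x) \<le> 0"
      using m FT that by auto
    then show ?thesis by (simp add: inner_diff_right)
  qed
  then have mn: "m = (m \<bullet> n) *\<^sub>R n"
    by (rule normal)
  obtain y where y: "y \<in> F" using T(2) by blast
  have "p \<in> T"
    unfolding T cone_def using y by (intro CollectI exI[of _ 0] exI[of _ y]) auto
  then have "m \<bullet> (p - y) \<le> 0" using m y by auto
  also have "m \<bullet> (p - y) = (m \<bullet> n) * (n \<bullet> (p - y))"
    by (subst mn) simp
  also have "n \<bullet> (p - y) = - H"
    using n(2)[OF y] by (simp add: inner_diff_right)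
  finally have "m \<bullet> n \<ge> 0"
    using n(3) by (simp add: zero_le_mult_iff)
  moreover have "\<bar>m \<bullet> n\<bar> = 1"
  proof -
    have "norm m = \<bar>m \<bullet> n\<bar> * norm n"
      by (subst mn) simp
    then show ?thesis using m n(1) by simp
  qed
  ultimately show "m = n" using mn by simp
qed

context full_simplex
begin

text \<open>Height, area and trace identity of the facet opposite the last vertex come from one cone
  decomposition and share the witness \<open>H\<close>. That height times area is the same for every
  facet, namely d times the volume, is what makes the facet terms combine in the Gauss
  theorem.\<close>

lemma facet_last:
  assumes d0: "d = Suc k"
  defines "F \<equiv> convex hull (v ` {..k})" and "p \<equiv> v d"
  shows "\<exists>H>0. (\<forall>y\<in>F. outer_normal T F \<bullet> (y - p) = H) \<and> measure (face_measure F) F > 0 \<and>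
    H * measure (face_measure F) F = real d * measure lebesgue T \<and>
    (\<forall>f. continuous_on UNIV f \<longrightarrow> integrable (face_measure F) (f :: 'a \<Rightarrow> real)) \<and>
    (\<forall>f G. (\<forall>x. (f has_derivative (\<lambda>h. G x \<bullet> h)) (at x)) \<longrightarrow> continuous_on UNIV G \<longrightarrow>
      (\<integral>x. f x \<partial>face_measure F) = measure (face_measure F) F * (\<integral>x. f x + (x - p) \<bullet> G x / real d \<partial>U))"
proof -
  obtain q B where B: "flat_lborel F = flat_measure q B" "q \<in> F" "pairwise orthogonal B" "\<forall>b\<in>B. norm b = 1"
    "span B = span ((\<lambda>i. v i - v 0) ` {..k})"
    unfolding F_def by (rule flat_lborel_simplex)
  have p: "v (Suc k) \<notin> affine hull (v ` {..k})"
    using inj indep by (rule affinely_independent_sequence) (simp add: d0)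
  have ind: "independent B"
    using B(3,4) by (intro pairwise_orthogonal_independent) auto
  have [measurable]: "F \<in> sets borel" and cF: "compact F"
    unfolding F_def by (rule sets_simplex compact_simplex)+
  obtain n H where n: "norm n = 1" "n \<notin> B" "pairwise orthogonal (insert n B)" "H > 0"
    "\<And>y. y \<in> F \<Longrightarrow> n \<bullet> (y - p) = H"
    "span (insert n B) = span ((\<lambda>i. v i - v 0) ` {..d})"
    "\<And>q. q \<in> F \<Longrightarrow> emeasure (flat_measure p (insert n B)) T
        = ennreal (H / real (Suc (card B))) * emeasure (flat_measure q B) F"
    "\<And>q. \<lbrakk>q \<in> F; emeasure (flat_measure q B) F \<noteq> 0; emeasure (flat_measure q B) F \<noteq> \<infinity>\<rbrakk> \<Longrightarrow>
        uniform_measure (flat_measure p (insert n B)) T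
        = distr (power_measure (Suc (card B)) \<Otimes>\<^sub>M uniform_measure (flat_measure q B) F) borel
            (\<lambda>(s, y). p + s *\<^sub>R (y - p))"
    by (rule simplex_step[OF B(3-5) p, folded d0, folded F_def p_def T_def]) (rule that)
  have spanU: "span (insert n B) = UNIV"
    using n(6) span_UNIV by simp
  have ind': "independent (insert n B)"
    using n(1,3) B(4) by (intro pairwise_orthogonal_independent) auto
  have "card (insert n B) = d"
    using dim_eq_card_independent[OF ind'] dim_span[of "insert n B"] by (simp add: spanU d)
  then have cardB: "card B = k"
    using independent_imp_finite[OF ind] n(2) by (simp add: d0)
  have leb: "flat_measure p (insert n B) = lborel"
    using n(1,3) B(4) spanU by (intro flat_measure_UNIV) auto
  define a where "a = emeasure (flat_lborel F) F"
  have vol: "emeasure lborel T = ennreal (H / real d) * a"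
    using n(7)[OF B(2)] by (simp add: leb cardB d0 a_def B(1))
  have a: "a \<noteq> 0" "a \<noteq> \<infinity>"
  proof -
    show "a \<noteq> 0" using vol emeasure_T by auto
    show "a \<noteq> \<infinity>" using vol emeasure_T n(4) by (auto simp: d0 ennreal_mult_eq_top_iff)
  qed
  have U: "U = distr (power_measure (Suc k) \<Otimes>\<^sub>M uniform_measure (flat_lborel F) F) borel
            (\<lambda>(s, y). p + s *\<^sub>R (y - p))"
    using n(8)[OF B(2)] a by (simp add: leb cardB a_def B(1) U_def)
  have M: "a = ennreal (measure (face_measure F) F)" "measure (face_measure F) F > 0"
  proof -
    show eq: "a = ennreal (measure (face_measure F) F)"
      using a unfolding a_def by (simp add: measure_face_measure emeasure_eq_ennreal_measure)
    then have "measure (face_measure F) F \<noteq> 0" using a by auto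
    then show "measure (face_measure F) F > 0" using measure_nonneg[of "face_measure F" F] by linarith
  qed
  have T_cone: "T = cone p F"
    using simplex_Suc[of v k, folded d0] unfolding T_def F_def p_def .
  have F0: "F \<noteq> {}" using B(2) by blast
  \<comment> \<open>Removing the \<open>n\<close>-component of \<open>w\<close> leaves a vector
    orthogonal to a full orthonormal basis, hence zero.\<close>
  have normal: "w = (w \<bullet> n) *\<^sub>R n" if w: "\<And>x y. x \<in> F \<Longrightarrow> y \<in> F \<Longrightarrow> w \<bullet> (x - y) = 0" for w
  proof -
    define u where "u = w - (w \<bullet> n) *\<^sub>R n"
    have n_orth: "n \<bullet> b = 0" if "b \<in> B" for b
      using n(2,3) that by (auto simp: pairwise_insert orthogonal_def)
    have "orthogonal w b" if "b \<in> span B" for b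
    proof (rule orthogonal_to_span)
      show "b \<in> span {x - y |x y. x \<in> F \<and> y \<in> F}"
        using that unfolding B(5) F_def span_differences .
    qed (use w in \<open>auto simp: orthogonal_def\<close>)
    then have "u \<bullet> b = 0" if "b \<in> B" for b
      using that n_orth span_base[of b B] by (simp add: u_def inner_diff_left orthogonal_def)
    moreover have "u \<bullet> n = 0"
      using n(1) by (simp add: u_def inner_diff_left dot_square_norm)
    ultimately have "orthogonal u b" if "b \<in> insert n B" for b
      using that by (auto simp: orthogonal_def)
    then have "orthogonal u u"
      by (intro orthogonal_to_span[of u "insert n B" u]) (auto simp: spanU)
    then show ?thesis by (simp add: u_def orthogonal_self)
  qed
  have on: "outer_normal T F = n"
    by (rule outer_normal_eq[OF n(1,5,4) T_cone F0 normal])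
  have HM: "H * measure (face_measure F) F = real d * measure lebesgue T"
  proof -
    have "ennreal (measure lebesgue T) = emeasure lborel T"
      using emeasure_T by (simp add: emeasure_eq_ennreal_measure)
    also have "\<dots> = ennreal (H / real d * measure (face_measure F) F)"
      unfolding vol M(1) using n(4) by (intro ennreal_mult[symmetric]) auto
    finally have "measure lebesgue T = H / real d * measure (face_measure F) F"
      using n(4) by (subst (asm) ennreal_inj) auto
    then show ?thesis by (simp add: d0 field_simps)
  qed
  have face_int: "(\<integral>x. f x \<partial>face_measure F) = measure (face_measure F) F * (\<integral>x. f x + (x - p) \<bullet> G x / real d \<partial>U)"
    if f: "\<forall>x. (f has_derivative (\<lambda>h. G x \<bullet> h)) (at x)" and G: "continuous_on UNIV G" for f and G :: "'a \<Rightarrow> 'a"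
  proof -
    define UF where "UF = uniform_measure (flat_lborel F) F"
    have s [simp]: "sets (flat_lborel F) = sets borel"
      by (simp add: flat_lborel_def Let_def)
    have "prob_space UF"
      unfolding UF_def using a by (intro prob_space_uniform_measure) (auto simp: a_def)
    then have "(\<integral>x. f x + (x - p) \<bullet> G x / real (Suc k) \<partial>U) = (\<integral>y. f y \<partial>UF)"
      using U f by (intro cone_trace_identity[OF _ _ _ G _ integrable_U]) (auto simp: UF_def)
    also have "\<dots> = (\<integral>x. indicator F x * f x \<partial>flat_lborel F) / measure (flat_lborel F) F"
    proof -
      have "f \<in> borel_measurable borel"
        using f by (intro borel_measurable_continuous_onI continuous_at_imp_continuous_on ballI has_derivative_continuous) blast
      then have "f \<in> borel_measurable (flat_lborel F)"
        by (subst measurable_cong_sets[OF s refl])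
      then show ?thesis
        unfolding UF_def using a by (intro integral_uniform_measure) (auto simp: a_def)
    qed
    finally show ?thesis
      using M(2) by (simp add: integral_face_measure measure_face_measure d0 del: of_nat_Suc)
  qed
  show ?thesis
    using n(4,5) M HM face_int integrable_face_measure[OF cF] a
    by (intro exI[of _ H]) (auto simp: on a_def)
qed

end

text \<open>A mesh provides only vertex sets. Statements free of an order are transferred from
  \<open>full_simplex\<close>, each time through a suitable enumeration.\<close>

locale simplex_cell =
  fixes C :: "'a::euclidean_space set"
  assumes indep: "\<not> affine_dependent C" and card_C: "card C = Suc DIM('a)"
begin

definition T where "T = convex hull C"
definition U where "U = uniform_measure lborel T"
definition vol where "vol = measure lebesgue T"
definition face where "face c = convex hull (C - {c})" for c

lemma finite_C: "finite C"
  using indep by (rule aff_independent_finite)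

text \<open>Placing \<open>c\<close> last makes the facet opposite \<open>c\<close> the base of the
  final cone step, where \<open>facet_last\<close> applies.\<close>

lemma enumeration:
  assumes "c \<in> C"
  obtains v where "full_simplex v DIM('a)" "v ` {..DIM('a)} = C" "v DIM('a) = c"
    "v ` {..DIM('a) - 1} = C - {c}" "full_simplex.T v DIM('a) = T" "full_simplex.U v DIM('a) = U"
proof -
  define d where "d = DIM('a)"
  have d: "d > 0" by (simp add: d_def)
  have "card (C - {c}) = d"
    using assms card_C finite_C by (simp add: d_def)
  then obtain h where h: "bij_betw h {0..<d} (C - {c})"
    using ex_bij_betw_nat_finite[of "C - {c}"] finite_C by auto
  define v where "v i = (if i < d then h i else c)" for i
  have im1: "v ` {..<d} = C - {c}"
  proof -
    have "v ` {..<d} = h ` {0..<d}"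
      by (intro image_cong) (auto simp: v_def)
    then show ?thesis using h by (simp add: bij_betw_def)
  qed
  have vd: "v d = c" by (simp add: v_def)
  have at: "{..d} = insert d {..<d}" by auto
  have im: "v ` {..d} = C"
    unfolding at image_insert im1 vd using assms by auto
  have "inj_on v {..<d}"
  proof (rule inj_onI)
    fix i j assume "i \<in> {..<d}" "j \<in> {..<d}" "v i = v j"
    then show "i = j"
      using h by (auto simp: v_def bij_betw_def inj_on_def)
  qed
  moreover have "v d \<notin> v ` {..<d}"
    unfolding im1 vd by simp
  ultimately have inj: "inj_on v {..d}"
    unfolding at by (simp add: inj_on_insert)
  have fs: "full_simplex v d"
    by unfold_locales (use inj indep im in \<open>simp_all add: d_def\<close>)
  have "{..d - 1} = {..<d}" using d by auto
  then show ?thesis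
    using that[of v] fs im vd im1
    by (simp add: d_def full_simplex.T_def[OF fs[unfolded d_def]] full_simplex.U_def[OF fs[unfolded d_def]] T_def U_def)
qed

lemma some_enumeration:
  obtains v where "full_simplex v DIM('a)" "v ` {..DIM('a)} = C"
    "full_simplex.T v DIM('a) = T" "full_simplex.U v DIM('a) = U"
proof -
  have "C \<noteq> {}" using card_C by auto
  then obtain c where "c \<in> C" by blast
  then show ?thesis by (rule enumeration) (rule that)
qed

lemma vol_pos: "vol > 0"
proof -
  obtain v where v: "full_simplex v DIM('a)" "full_simplex.T v DIM('a) = T"
    by (rule some_enumeration)
  show ?thesis using full_simplex.measure_T[OF v(1)] by (simp add: v(2) vol_def)
qed

lemma compact_T: "compact T"
  unfolding T_def by (intro compact_convex_hull finite_imp_compact finite_C)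

lemma sets_T [measurable]: "T \<in> sets borel"
  using compact_T by (simp add: borel_closed compact_imp_closed)

lemma prob_space_U: "prob_space U"
proof -
  obtain v where v: "full_simplex v DIM('a)" "full_simplex.U v DIM('a) = U"
    by (rule some_enumeration)
  show ?thesis using full_simplex.prob_space_U[OF v(1)] by (simp add: v(2))
qed

lemma integrable_U: "continuous_on UNIV f \<Longrightarrow> integrable U f" for f :: "'a \<Rightarrow> real"
proof -
  assume f: "continuous_on UNIV f"
  obtain v where v: "full_simplex v DIM('a)" "full_simplex.U v DIM('a) = U"
    by (rule some_enumeration)
  show ?thesis using full_simplex.integrable_U[OF v(1) f] by (simp add: v(2))
qed

lemma AE_U: "AE x in U. x \<in> T"
proof -
  obtain v where v: "full_simplex v DIM('a)" "full_simplex.T v DIM('a) = T" "full_simplex.U v DIM('a) = U"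
    by (rule some_enumeration)
  show ?thesis using full_simplex.AE_U[OF v(1)] unfolding v(2,3) .
qed

lemma integral_T:
  fixes f :: "'a \<Rightarrow> real"
  assumes "continuous_on UNIV f"
  shows "(\<integral>x. f x \<partial>lebesgue_on T) = vol * (\<integral>x. f x \<partial>U)"
proof -
  obtain v where v: "full_simplex v DIM('a)" "full_simplex.T v DIM('a) = T" "full_simplex.U v DIM('a) = U"
    by (rule some_enumeration)
  show ?thesis using full_simplex.integral_T[OF v(1) assms] by (simp add: v(2,3) vol_def)
qed

lemma poincare:
  assumes dim: "DIM('a) \<in> {2, 3}"
    and f: "\<And>x. (f has_derivative (\<lambda>h. G x \<bullet> h)) (at x)" and G: "continuous_on UNIV G"
  shows "(\<integral>x. (f x)\<^sup>2 \<partial>U) - (\<integral>x. f x \<partial>U)\<^sup>2 \<le> 7 / 72 * (diameter T)\<^sup>2 * (\<integral>x. (norm (G x))\<^sup>2 \<partial>U)"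
proof -
  obtain v where v: "full_simplex v DIM('a)" "full_simplex.T v DIM('a) = T" "full_simplex.U v DIM('a) = U"
    by (rule some_enumeration)
  show ?thesis using full_simplex.poincare_simplex[OF v(1) dim f G] by (simp add: v(2,3))
qed

lemma elem_faces_T: "elem_faces T = face ` C" and inj_face: "inj_on face C"
proof -
  have ne: "convex hull (C - {c}) \<noteq> {}" if "c \<in> C" for c
  proof -
    have "card (C - {c}) = DIM('a)"
      using that card_C finite_C by simp
    then have "card (C - {c}) > 0" by simp
    then have "C - {c} \<noteq> {}" by (metis card.empty less_irrefl)
    then show ?thesis by simp
  qed
  show "elem_faces T = face ` C"
    unfolding elem_faces_def T_def face_def[abs_def]
    using facet_of_convex_hull_affine_independent[OF indep] ne by auto
  show "inj_on face C"
  proof (rule inj_onI, rule ccontr)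
    fix c c' assume c: "c \<in> C" "c' \<in> C" "face c = face c'" "c \<noteq> c'"
    then have "c \<in> face c'"
      unfolding face_def by (intro hull_inc) auto
    then have "c \<in> convex hull (C - {c})"
      using c(3) unfolding face_def by simp
    then have "c \<in> affine hull (C - {c})"
      using convex_hull_subset_affine_hull by blast
    then show False
      using indep c(1) unfolding affine_dependent_def by blast
  qed
qed

lemma facet:
  assumes "c \<in> C"
  shows "\<exists>H>0. (\<forall>y\<in>face c. outer_normal T (face c) \<bullet> (y - c) = H) \<and> measure (face_measure (face c)) (face c) > 0 \<and>
    H * measure (face_measure (face c)) (face c) = real DIM('a) * vol \<and>
    (\<forall>f. continuous_on UNIV f \<longrightarrow> integrable (face_measure (face c)) (f :: 'a \<Rightarrow> real)) \<and>
    (\<forall>f G. (\<forall>x. (f has_derivative (\<lambda>h. G x \<bullet> h)) (at x)) \<longrightarrow> continuous_on UNIV G \<longrightarrow>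
      (\<integral>x. f x \<partial>face_measure (face c))
        = measure (face_measure (face c)) (face c) * (\<integral>x. f x + (x - c) \<bullet> G x / real DIM('a) \<partial>U))"
proof -
  obtain v where v: "full_simplex v DIM('a)" "v ` {..DIM('a)} = C" "v DIM('a) = c"
    "v ` {..DIM('a) - 1} = C - {c}" "full_simplex.T v DIM('a) = T" "full_simplex.U v DIM('a) = U"
    using assms by (rule enumeration)
  have "DIM('a) = Suc (DIM('a) - 1)" by simp
  from full_simplex.facet_last[OF v(1) this] show ?thesis
    unfolding v face_def vol_def .
qed

lemma integral_face:
  assumes "c \<in> C" "\<And>x. (f has_derivative (\<lambda>h. G x \<bullet> h)) (at x)" "continuous_on UNIV G"
  shows "(\<integral>x. f x \<partial>face_measure (face c))
        = measure (face_measure (face c)) (face c) * (\<integral>x. f x + (x - c) \<bullet> G x / real DIM('a) \<partial>U)"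
  using facet[OF assms(1)] assms(2,3) by blast

lemma face_measure_pos: "c \<in> C \<Longrightarrow> measure (face_measure (face c)) (face c) > 0"
  using facet by blast

lemma integrable_face: "c \<in> C \<Longrightarrow> continuous_on UNIV f \<Longrightarrow> integrable (face_measure (face c)) f"
  for f :: "'a \<Rightarrow> real"
  using facet by blast

lemma vertex_differences:
  assumes "c0 \<in> C"
  shows "span ((\<lambda>c. c - c0) ` C) = UNIV"
proof -
  have "aff_dim C = int DIM('a)"
    using indep card_C by (simp add: affine_independent_iff_card)
  then have "affine hull C = UNIV"
    by (simp add: aff_dim_eq_full)
  moreover have "affine hull C = (+) c0 ` span ((\<lambda>x. - c0 + x) ` C)"
    by (intro affine_hull_span_gen hull_inc assms)
  ultimately have U: "UNIV = (+) c0 ` span ((\<lambda>x. - c0 + x) ` C)"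
    by simp
  have "x \<in> span ((\<lambda>x. - c0 + x) ` C)" for x
  proof -
    have "c0 + x \<in> (+) c0 ` span ((\<lambda>x. - c0 + x) ` C)"
      by (subst U[symmetric]) simp
    then show ?thesis by auto
  qed
  moreover have "(\<lambda>x. - c0 + x) = (\<lambda>c. c - c0)" by auto
  ultimately show ?thesis by auto
qed

text \<open>The Gauss theorem on a simplex follows from the trace identities with two different apices,
  as the differences of the vertices span the space.\<close>

lemma divergence:
  assumes f: "\<And>x. (f has_derivative (\<lambda>h. G x \<bullet> h)) (at x)" and G: "continuous_on UNIV G"
  shows "(\<Sum>F\<in>elem_faces T. (\<integral>x. f x \<partial>face_measure F) * (a \<bullet> outer_normal T F)) = vol * (\<integral>x. G x \<bullet> a \<partial>U)"
proof -
  define d where "d = DIM('a)"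
  have d: "d > 0" by (simp add: d_def)
  have cf: "continuous_on UNIV f"
    by (intro continuous_at_imp_continuous_on ballI has_derivative_continuous[OF f])
  define I where "I c = (\<integral>x. f x + (x - c) \<bullet> G x / real d \<partial>U)" for c
  define n where "n c = outer_normal T (face c)" for c
  define S where "S c = measure (face_measure (face c)) (face c)" for c
  obtain H where H: "\<And>c. c \<in> C \<Longrightarrow> H c > 0" "\<And>c y. c \<in> C \<Longrightarrow> y \<in> face c \<Longrightarrow> n c \<bullet> (y - c) = H c"
    "\<And>c. c \<in> C \<Longrightarrow> H c * S c = real d * vol"
    using facet unfolding n_def S_def d_def by metis
  have IU: "integrable U (\<lambda>x. G x \<bullet> a)" "integrable U (\<lambda>x. f x + (x - a) \<bullet> G x / real d)" for a
    by (intro integrable_U continuous_intros G cf; simp add: d)+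
  \<comment> \<open>The defect of the Gauss formula is linear in the direction \<open>a\<close>, so
    it is enough that it vanishes on differences of vertices.\<close>
  define L where "L a = (\<Sum>c\<in>C. S c * I c * (a \<bullet> n c)) - vol * (\<integral>x. G x \<bullet> a \<partial>U)" for a
  have L: "linear L"
  proof (rule linearI)
    fix x y :: 'a and r :: real
    show "L (x + y) = L x + L y"
      unfolding L_def inner_add_left inner_add_right
      by (simp add: IU(1) sum.distrib distrib_left algebra_simps)
    show "L (r *\<^sub>R x) = r *\<^sub>R L x"
      unfolding L_def by (simp add: sum_distrib_left right_diff_distrib mult_ac)
  qed
  have I_diff: "I p - I q = (\<integral>x. G x \<bullet> (q - p) \<partial>U) / real d" for p q
  proof -
    have "I p - I q = (\<integral>x. (f x + (x - p) \<bullet> G x / real d) - (f x + (x - q) \<bullet> G x / real d) \<partial>U)"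
      unfolding I_def by (rule Bochner_Integration.integral_diff[symmetric]) (rule IU)+
    also have "\<dots> = (\<integral>x. G x \<bullet> (q - p) / real d \<partial>U)"
    proof (intro Bochner_Integration.integral_cong refl)
      fix x
      have "(f x + (x - p) \<bullet> G x / real d) - (f x + (x - q) \<bullet> G x / real d) = ((x - p) \<bullet> G x - (x - q) \<bullet> G x) / real d"
        by (simp add: diff_divide_distrib)
      also have "(x - p) \<bullet> G x - (x - q) \<bullet> G x = G x \<bullet> (q - p)"
        by (simp add: inner_commute inner_diff_left inner_diff_right)
      finally show "(f x + (x - p) \<bullet> G x / real d) - (f x + (x - q) \<bullet> G x / real d) = G x \<bullet> (q - p) / real d" .
    qed
    finally show ?thesis by simp
  qed
  have LC: "L (p - q) = 0" if p: "p \<in> C" and q: "q \<in> C" for p q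
  proof (cases "p = q")
    case True
    then show ?thesis using linear_0[OF L] by simp
  next
    case False
    have in_face: "c \<in> face c'" if "c \<in> C" "c' \<in> C" "c \<noteq> c'" for c c'
      unfolding face_def using that by (intro hull_inc) auto
    \<comment> \<open>For c other than p and q both vertices lie on the facet opposite c, so p - q
      is tangential there. Only two facets contribute, and \<open>H c * S c = real d * vol\<close>
      makes their weights equal.\<close>
    have np: "(p - q) \<bullet> n c = (if c = q then H q else 0) - (if c = p then H p else 0)" if c: "c \<in> C" for c
    proof -
      have "(p - q) \<bullet> n c = n c \<bullet> (p - c) - n c \<bullet> (q - c)"
        by (simp add: inner_commute inner_diff_right)
      also have "n c \<bullet> (p - c) = (if c = p then 0 else H c)"
        using H(2)[OF c in_face[OF p c]] by auto
      also have "n c \<bullet> (q - c) = (if c = q then 0 else H c)"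
        using H(2)[OF c in_face[OF q c]] by auto
      finally show ?thesis using False by auto
    qed
    have "(\<Sum>c\<in>C. S c * I c * ((p - q) \<bullet> n c))
      = (\<Sum>c\<in>C. (if c = q then S q * I q * H q else 0) - (if c = p then S p * I p * H p else 0))"
      by (intro sum.cong refl) (auto simp: np right_diff_distrib)
    also have "\<dots> = S q * I q * H q - S p * I p * H p"
      using finite_C p q by (simp add: sum_subtractf)
    also have "\<dots> = (H q * S q) * I q - (H p * S p) * I p"
      by (simp add: mult_ac)
    also have "\<dots> = vol * (real d * (I q - I p))"
      by (simp add: H(3) p q algebra_simps)
    also have "real d * (I q - I p) = (\<integral>x. G x \<bullet> (p - q) \<partial>U)"
      unfolding I_diff using d by simp
    finally show ?thesis
      unfolding L_def by simp
  qed
  have L0: "L x = 0" for x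
  proof -
    have "C \<noteq> {}" using card_C by auto
    then obtain c0 where c0: "c0 \<in> C" by blast
    have "x \<in> span ((\<lambda>c. c - c0) ` C)"
      using vertex_differences[OF c0] by simp
    then show ?thesis
    proof (rule linear_eq_0_on_span[OF L, rotated])
      fix y assume "y \<in> (\<lambda>c. c - c0) ` C"
      then obtain c where "c \<in> C" "y = c - c0" by blast
      then show "L y = 0" using LC[OF _ c0] by simp
    qed
  qed
  have "(\<Sum>F\<in>elem_faces T. (\<integral>x. f x \<partial>face_measure F) * (a \<bullet> outer_normal T F))
    = (\<Sum>c\<in>C. (\<integral>x. f x \<partial>face_measure (face c)) * (a \<bullet> n c))"
    unfolding elem_faces_T n_def by (simp add: sum.reindex[OF inj_face])
  also have "\<dots> = (\<Sum>c\<in>C. S c * I c * (a \<bullet> n c))"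
    using integral_face[OF _ f G] by (intro sum.cong refl) (simp add: S_def I_def d_def)
  finally show ?thesis
    using L0[of a] unfolding L_def by simp
qed

lemma extreme_points_T: "{x. x extreme_point_of T} = C"
  unfolding T_def using extreme_point_of_convex_hull_affine_independent[OF indep] by auto

lemma barycenter_T: "barycenter T = (1 / real (Suc DIM('a))) *\<^sub>R \<Sum>C"
  unfolding barycenter_def extreme_points_T card_C ..

text \<open>The vector from the barycenter to a vertex is the mean of its differences to all d + 1
  vertices, one of which is zero; hence the factor d/(d + 1). Convexity of the ball carries the
  bound from the vertices to the simplex.\<close>

lemma norm_diff_barycenter:
  assumes "x \<in> T"
  shows "norm (x - barycenter T) \<le> real DIM('a) / real (Suc DIM('a)) * diameter T"
proof -
  define r where "r = real DIM('a) / real (Suc DIM('a)) * diameter T"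
  have "C \<subseteq> cball (barycenter T) r"
  proof
    fix c assume c: "c \<in> C"
    have diam: "norm (c - c') \<le> diameter T" if "c' \<in> C" for c'
      using diameter_bounded_bound[OF compact_imp_bounded[OF compact_T], of c c'] c that
      by (auto simp: T_def dist_norm intro: hull_inc)
    have "c - barycenter T = (1 / real (Suc DIM('a))) *\<^sub>R (\<Sum>c'\<in>C. c - c')"
    proof -
      have "(\<Sum>c'\<in>C. c - c') = real (Suc DIM('a)) *\<^sub>R c - \<Sum>C"
        by (simp only: sum_subtractf sum_constant_scaleR card_C)
      then show ?thesis
        unfolding barycenter_T by (simp only: scaleR_diff_right) simp
    qed
    also have "(\<Sum>c'\<in>C. c - c') = (\<Sum>c'\<in>C - {c}. c - c')"
      using c finite_C by (simp add: sum.remove)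
    also have "norm ((1 / real (Suc DIM('a))) *\<^sub>R (\<Sum>c'\<in>C - {c}. c - c')) \<le> (1 / real (Suc DIM('a))) * (\<Sum>c'\<in>C - {c}. diameter T)"
      unfolding norm_scaleR using diam
      by (simp only: abs_of_nonneg[of "1 / real (Suc DIM('a))"] of_nat_0_le_iff zero_le_divide_1_iff)
         (intro mult_left_mono sum_norm_le; simp)
    also have "(\<Sum>c'\<in>C - {c}. diameter T) = real DIM('a) * diameter T"
      using c finite_C card_C by simp
    finally show "c \<in> cball (barycenter T) r"
      by (simp add: r_def dist_norm norm_minus_commute)
  qed
  then have "T \<subseteq> cball (barycenter T) r"
    unfolding T_def by (intro hull_minimal convex_cball)
  then show ?thesis
    using assms by (auto simp: r_def dist_norm norm_minus_commute)
qed

lemma barycenter_in_T: "barycenter T \<in> T"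
proof -
  have "(\<Sum>c\<in>C. (1 / real (Suc DIM('a))) *\<^sub>R c) \<in> T"
    unfolding T_def using finite_C card_C
    by (intro convex_sum convex_convex_hull) (auto intro: hull_inc simp del: of_nat_Suc)
  then show ?thesis
    unfolding barycenter_T by (simp add: scaleR_sum_right)
qed

end

section \<open>The interpolant on one element\<close>

lemma polys_add: "p \<in> polys l \<Longrightarrow> q \<in> polys l \<Longrightarrow> (\<lambda>x. p x + q x) \<in> polys l"
proof -
  assume "p \<in> polys l" "q \<in> polys l"
  then obtain c e where "\<forall>x. p x = (\<Sum>\<alpha>\<in>multi_indices l. c \<alpha> * (\<Prod>b\<in>Basis. (x \<bullet> b) ^ \<alpha> b))"
    "\<forall>x. q x = (\<Sum>\<alpha>\<in>multi_indices l. e \<alpha> * (\<Prod>b\<in>Basis. (x \<bullet> b) ^ \<alpha> b))"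
    unfolding polys_def by blast
  then have "\<forall>x. p x + q x = (\<Sum>\<alpha>\<in>multi_indices l. (c \<alpha> + e \<alpha>) * (\<Prod>b\<in>Basis. (x \<bullet> b) ^ \<alpha> b))"
    by (simp add: distrib_right sum.distrib)
  then show ?thesis
    unfolding polys_def by (intro CollectI exI[of _ "\<lambda>\<alpha>. c \<alpha> + e \<alpha>"])
qed

lemma polys_scale: "p \<in> polys l \<Longrightarrow> (\<lambda>x. r * p x) \<in> polys l"
proof -
  assume "p \<in> polys l"
  then obtain c where "\<forall>x. p x = (\<Sum>\<alpha>\<in>multi_indices l. c \<alpha> * (\<Prod>b\<in>Basis. (x \<bullet> b) ^ \<alpha> b))"
    unfolding polys_def by blast
  then have "\<forall>x. r * p x = (\<Sum>\<alpha>\<in>multi_indices l. (r * c \<alpha>) * (\<Prod>b\<in>Basis. (x \<bullet> b) ^ \<alpha> b))"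
    by (simp add: sum_distrib_left mult.assoc)
  then show ?thesis
    unfolding polys_def by (intro CollectI exI[of _ "\<lambda>\<alpha>. r * c \<alpha>"])
qed

lemma monomial_in_polys:
  assumes "\<alpha> \<in> multi_indices l"
  shows "(\<lambda>x. \<Prod>b\<in>Basis. (x \<bullet> b) ^ \<alpha> b) \<in> polys l"
proof -
  have "(\<Prod>b\<in>Basis. (x \<bullet> b) ^ \<alpha> b)
     = (\<Sum>\<beta>\<in>multi_indices l. (if \<beta> = \<alpha> then 1 else 0) * (\<Prod>b\<in>Basis. (x \<bullet> b) ^ \<beta> b))" for x :: 'a
  proof -
    have "(\<Sum>\<beta>\<in>multi_indices l. (if \<beta> = \<alpha> then 1 else 0) * (\<Prod>b\<in>Basis. (x \<bullet> b) ^ \<beta> b))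
      = (\<Sum>\<beta>\<in>multi_indices l. if \<beta> = \<alpha> then (\<Prod>b\<in>Basis. (x \<bullet> b) ^ \<alpha> b) else 0)"
      by (intro sum.cong) auto
    then show ?thesis using assms by (simp add: finite_multi_indices)
  qed
  then show ?thesis
    unfolding polys_def by (intro CollectI exI[of _ "\<lambda>\<beta>. if \<beta> = \<alpha> then 1 else 0"]) blast
qed

text \<open>A multi-index of total degree at most 1 is zero or a unit vector, so the monomials are 1
  and the coordinates. In this form gradients are constant and Laplacians vanish.\<close>

lemma polys_1: "polys 1 = {p :: 'a::euclidean_space \<Rightarrow> real. \<exists>a g. p = (\<lambda>x. a + g \<bullet> x)}"
proof (intro set_eqI iffI)
  fix p :: "'a \<Rightarrow> real" assume "p \<in> polys 1"
  then obtain c where c: "\<And>x. p x = (\<Sum>\<alpha>\<in>multi_indices 1. c \<alpha> * (\<Prod>b\<in>Basis. (x \<bullet> b) ^ \<alpha> b))"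
    unfolding polys_def by blast
  have "\<exists>a g. \<forall>x. (\<Prod>b\<in>Basis. (x \<bullet> b) ^ \<alpha> b) = a + g \<bullet> x" if \<alpha>: "\<alpha> \<in> multi_indices 1" for \<alpha> :: "'a \<Rightarrow> nat"
  proof (cases "\<forall>b\<in>Basis. \<alpha> b = 0")
    case True
    then show ?thesis
      by (intro exI[of _ 1] exI[of _ 0]) simp
  next
    case False
    then obtain b where b: "b \<in> Basis" "\<alpha> b \<noteq> 0" by blast
    have "(\<Sum>b\<in>Basis. \<alpha> b) = \<alpha> b + (\<Sum>b\<in>Basis - {b}. \<alpha> b)"
      using b by (simp add: sum.remove)
    moreover have "(\<Sum>b\<in>Basis. \<alpha> b) \<le> 1" using \<alpha> by (simp add: multi_indices_def)
    ultimately have "\<alpha> b = 1" "(\<Sum>b\<in>Basis - {b}. \<alpha> b) = 0" using b(2) by linarith+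
    then have "(\<Prod>b'\<in>Basis. (x \<bullet> b') ^ \<alpha> b') = x \<bullet> b" for x
      using b by (simp add: prod.remove[of Basis b])
    then show ?thesis
      by (intro exI[of _ 0] exI[of _ b]) (simp add: inner_commute)
  qed
  then obtain a g where ag: "\<And>\<alpha> x. \<alpha> \<in> multi_indices 1 \<Longrightarrow> (\<Prod>b\<in>Basis. (x \<bullet> b) ^ \<alpha> b) = a \<alpha> + g \<alpha> \<bullet> (x :: 'a)"
    by metis
  have "p x = (\<Sum>\<alpha>\<in>multi_indices 1. c \<alpha> * a \<alpha>) + (\<Sum>\<alpha>\<in>multi_indices 1. c \<alpha> *\<^sub>R g \<alpha>) \<bullet> x" for x
    unfolding c inner_sum_left sum.distrib[symmetric]
    by (intro sum.cong refl) (simp add: ag distrib_left)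
  then show "p \<in> {p. \<exists>a g. p = (\<lambda>x. a + g \<bullet> x)}" by blast
next
  fix p :: "'a \<Rightarrow> real" assume "p \<in> {p. \<exists>a g. p = (\<lambda>x. a + g \<bullet> x)}"
  then obtain a g where p: "p = (\<lambda>x. a + g \<bullet> x)" by blast
  have const: "(\<lambda>x :: 'a. a) \<in> polys 1" for a :: real
  proof -
    have "restrict (\<lambda>_. 0) Basis \<in> (multi_indices 1 :: ('a \<Rightarrow> nat) set)"
      by (simp add: multi_indices_def)
    from polys_scale[OF monomial_in_polys[OF this], of a] show ?thesis
      by simp
  qed
  have coord: "(\<lambda>x. x \<bullet> b) \<in> polys 1" if b: "b \<in> Basis" for b :: 'a
  proof -
    have "(\<Sum>i\<in>Basis. if i = b then 1 else 0 :: nat) = 1" using b by simp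
    then have "restrict (\<lambda>i. if i = b then 1 else 0) Basis \<in> (multi_indices 1 :: ('a \<Rightarrow> nat) set)"
      by (simp add: multi_indices_def)
    from monomial_in_polys[OF this]
    have "(\<lambda>x. \<Prod>i\<in>Basis. (x \<bullet> i) ^ restrict (\<lambda>i. if i = b then 1 else 0) Basis i) \<in> polys 1" .
    moreover have "(\<Prod>i\<in>Basis. (x \<bullet> i) ^ restrict (\<lambda>i. if i = b then 1 else 0) Basis i) = x \<bullet> b" for x :: 'a
    proof -
      have "(\<Prod>i\<in>Basis. (x \<bullet> i) ^ restrict (\<lambda>i. if i = b then 1 else 0) Basis i) = (\<Prod>i\<in>Basis. if i = b then x \<bullet> b else 1)"
        by (intro prod.cong) auto
      then show ?thesis using b by simp
    qed
    ultimately show ?thesis by simp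
  qed
  have "(\<lambda>x. \<Sum>b\<in>B. (g \<bullet> b) * (x \<bullet> b)) \<in> polys 1" if "finite B" "B \<subseteq> Basis" for B :: "'a set"
    using that
  proof (induction B rule: finite_induct)
    case empty
    then show ?case using const[of 0] by simp
  next
    case (insert b B)
    then show ?case
      using polys_add[OF polys_scale[OF coord[of b], of "g \<bullet> b"]] by simp
  qed
  from polys_add[OF const[of a] this[OF finite_Basis subset_refl]]
  show "p \<in> polys 1"
    unfolding p by (simp add: euclidean_inner[symmetric])
qed

lemma has_derivative_affine_fun: "((\<lambda>x. a + g \<bullet> x) has_derivative (\<lambda>h. g \<bullet> h)) (at x)"
  for g :: "'a::euclidean_space"
  by (auto intro!: derivative_eq_intros)

lemma grad_unique:
  fixes f :: "'a::euclidean_space \<Rightarrow> real"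
  assumes "(f has_derivative (\<lambda>h. G \<bullet> h)) (at x)"
  shows "grad f x = G"
proof -
  have "frechet_derivative f (at x) = (\<lambda>h. G \<bullet> h)"
    using frechet_derivative_at[OF assms] by simp
  then show ?thesis
    unfolding grad_def partial_deriv_def by (simp add: euclidean_representation)
qed

lemma grad_affine_fun: "grad (\<lambda>x. a + g \<bullet> x) x = g" for g :: "'a::euclidean_space"
  by (rule grad_unique[OF has_derivative_affine_fun])

lemma laplacian_affine_fun: "laplacian (\<lambda>x. a + g \<bullet> x) x = 0" for g :: "'a::euclidean_space"
proof -
  have "partial_deriv b (\<lambda>x. a + g \<bullet> x) = (\<lambda>x. g \<bullet> b)" for b
    unfolding partial_deriv_def using frechet_derivative_at[OF has_derivative_affine_fun[of a g], symmetric]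
    by (simp add: fun_eq_iff)
  then show ?thesis
    unfolding laplacian_def by (simp add: partial_deriv_def)
qed

text \<open>If pi were at least 16/5, then 8/5 would not exceed pi/2 and its cosine would be
  nonnegative, whereas the Taylor bound 1 - x^2/2 + x^4/24 is negative at 8/5. The bound is just
  sharp enough: it gives 1/pi^2 >= 25/256, slightly above 7/72.\<close>

lemma pi_less_16_5: "pi < 16 / 5"
proof (rule ccontr)
  assume "\<not> pi < 16 / 5"
  then have "cos (8 / 5 :: real) \<ge> 0"
    by (intro cos_ge_zero) auto
  obtain t :: real where t: "cos (8 / 5 :: real) = (\<Sum>m<4. cos_coeff m * (8 / 5) ^ m) + (cos (t + 1 / 2 * real 4 * pi) / fact 4) * (8 / 5) ^ 4"
    using Maclaurin_cos_expansion[of "8 / 5" 4] by blast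
  have "(\<Sum>m<4. cos_coeff m * (8 / 5 :: real) ^ m) = 1 - (8 / 5)\<^sup>2 / 2"
  proof -
    have "(\<Sum>m<4. h m) = h 0 + h 1 + h 2 + h 3" for h :: "nat \<Rightarrow> real"
      by (simp add: eval_nat_numeral lessThan_Suc)
    then show ?thesis by (simp add: cos_coeff_def)
  qed
  moreover have "(cos (t + 1 / 2 * real 4 * pi) / fact 4) * (8 / 5) ^ 4 \<le> (1 / 24) * (8 / 5 :: real) ^ 4"
  proof (rule mult_right_mono)
    have "(fact 4 :: real) = 24" by (simp add: fact_numeral)
    then show "cos (t + 1 / 2 * real 4 * pi) / fact 4 \<le> 1 / 24"
      using cos_le_one[of "t + 1 / 2 * real 4 * pi"] by simp
  qed simp
  ultimately have "cos (8 / 5 :: real) \<le> 1 - (8 / 5)\<^sup>2 / 2 + (1 / 24) * (8 / 5) ^ 4"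
    using t by linarith
  also have "\<dots> < 0" by (simp add: power2_eq_square power4_eq_xxxx)
  finally show False using \<open>cos (8 / 5 :: real) \<ge> 0\<close> by simp
qed

text \<open>The first inequality passes from the Poincare constant to the one in the condition. In
  the second, 1/(d + 1) is the cost of the face terms and 7/72 that of the cell term of the
  stabilisation.\<close>

lemma stabilisation_constants:
  "7 / 72 \<le> 1 / pi\<^sup>2" "d \<in> {2, 3} \<Longrightarrow> 1 / real (Suc d) + 7 / 72 \<le> 1 / pi\<^sup>2 + C_tr d"
proof -
  have "pi\<^sup>2 \<le> (16 / 5)\<^sup>2"
    using pi_less_16_5 pi_ge_zero by (intro power_mono) auto
  then have "1 / (16 / 5)\<^sup>2 \<le> 1 / pi\<^sup>2"
    by (intro divide_left_mono) auto
  then have 1: "25 / 256 \<le> 1 / pi\<^sup>2" by (simp add: power2_eq_square)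
  then show "7 / 72 \<le> 1 / pi\<^sup>2" by simp
  have 2: "5 / 16 \<le> 1 / pi"
    using pi_less_16_5 by (simp add: field_simps)
  assume "d \<in> {2, 3}"
  then show "1 / real (Suc d) + 7 / 72 \<le> 1 / pi\<^sup>2 + C_tr d"
  proof
    assume d: "d = 2"
    have "C_tr d = 1 / pi\<^sup>2 + 1 / pi" by (simp add: C_tr_def d)
    then show ?thesis using 1 2 by (simp add: d)
  next
    assume "d \<in> {3}"
    then have d: "d = 3" by simp
    have "C_tr d = 1 / pi\<^sup>2 + (2 / 3) * (1 / pi)" by (simp add: C_tr_def d)
    then show ?thesis using 1 2 by (simp add: d)
  qed
qed

section \<open>Projections onto affine functions and constants\<close>

context simplex_cell
begin

text \<open>For nonzero g the integrand vanishes only on a hyperplane, a null set for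
  \<open>U\<close>. This is the nondegeneracy of the covariance operator in the next lemma.\<close>

lemma integral_U_zero_affine:
  assumes "(\<integral>x. (g \<bullet> (x - z))\<^sup>2 \<partial>U) = 0"
  shows "g = 0"
proof (rule ccontr)
  assume g: "g \<noteq> 0"
  interpret U: prob_space U by (rule prob_space_U)
  have "integrable U (\<lambda>x. (g \<bullet> (x - z))\<^sup>2)"
    by (intro integrable_U continuous_intros)
  then have "AE x in U. (g \<bullet> (x - z))\<^sup>2 = 0"
    using assms by (subst (asm) integral_nonneg_eq_0_iff_AE) auto
  moreover have "AE x in U. g \<bullet> x \<noteq> g \<bullet> z"
  proof -
    have n: "negligible {x. g \<bullet> x = g \<bullet> z}"
      using g by (intro negligible_hyperplane) auto
    have "{x. g \<bullet> x = g \<bullet> z} \<in> sets borel"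
      by (intro borel_closed closed_hyperplane)
    then have "{x. g \<bullet> x = g \<bullet> z} \<in> null_sets lborel"
      using n by (simp add: negligible_iff_null_sets null_sets_def)
    then have "AE x in lborel. g \<bullet> x \<noteq> g \<bullet> z"
      by (rule AE_I') auto
    then show ?thesis
      unfolding U_def by (intro AE_uniform_measureI) auto
  qed
  ultimately have "AE x in U. False"
    by eventually_elim (simp add: inner_diff_right)
  then show False using U.AE_False by simp
qed

text \<open>Subtracting the mean point \<open>xm\<close> decouples constants from linear parts. What
  remains is a linear system for the covariance operator \<open>A\<close>, which is injective and
  hence surjective in finite dimension.\<close>

lemma affine_projection_exists:
  fixes f :: "'a \<Rightarrow> real"
  assumes f: "continuous_on UNIV f"
  obtains q where "q \<in> polys 1" "\<And>p. p \<in> polys 1 \<Longrightarrow> (\<integral>x. (f x - q x) * p x \<partial>U) = 0"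
proof -
  interpret U: prob_space U by (rule prob_space_U)
  define xm where "xm = (\<Sum>b\<in>Basis. (\<integral>x. x \<bullet> b \<partial>U) *\<^sub>R b)"
  have I: "integrable U h" if "continuous_on UNIV h" for h :: "'a \<Rightarrow> real"
    by (rule integrable_U[OF that])
  have xm: "(\<integral>x. g \<bullet> (x - xm) \<partial>U) = 0" for g
  proof -
    have "(\<integral>x. g \<bullet> x \<partial>U) = (\<integral>x. (\<Sum>b\<in>Basis. (g \<bullet> b) * (x \<bullet> b)) \<partial>U)"
      by (subst euclidean_inner) simp
    also have "\<dots> = (\<Sum>b\<in>Basis. (g \<bullet> b) * (\<integral>x. x \<bullet> b \<partial>U))"
      by (subst Bochner_Integration.integral_sum) (auto intro!: I continuous_intros)
    also have "\<dots> = g \<bullet> xm"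
      by (simp add: xm_def inner_sum_right mult.commute)
    finally show ?thesis
      using I[of "\<lambda>x. g \<bullet> x"] by (simp add: inner_diff_right U.prob_space continuous_on_inner continuous_on_id)
  qed
  define A where "A g = (\<Sum>b\<in>Basis. (\<integral>x. (g \<bullet> (x - xm)) * (b \<bullet> (x - xm)) \<partial>U) *\<^sub>R b)" for g
  define rhs where "rhs = (\<Sum>b\<in>Basis. (\<integral>x. f x * (b \<bullet> (x - xm)) \<partial>U) *\<^sub>R b)"
  have expand: "(\<integral>x. h x * (a \<bullet> (x - xm)) \<partial>U) = (\<Sum>b\<in>Basis. (\<integral>x. h x * (b \<bullet> (x - xm)) \<partial>U) *\<^sub>R b) \<bullet> a"
    if h: "continuous_on UNIV h" for h a
  proof -
    have "(\<integral>x. h x * (a \<bullet> (x - xm)) \<partial>U) = (\<integral>x. (\<Sum>b\<in>Basis. (a \<bullet> b) * (h x * (b \<bullet> (x - xm)))) \<partial>U)"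
      by (intro Bochner_Integration.integral_cong refl, subst euclidean_inner)
         (simp add: sum_distrib_left inner_commute mult_ac)
    also have "\<dots> = (\<Sum>b\<in>Basis. (a \<bullet> b) * (\<integral>x. h x * (b \<bullet> (x - xm)) \<partial>U))"
      by (subst Bochner_Integration.integral_sum) (auto intro!: I continuous_intros h)
    finally show ?thesis
      by (simp add: inner_sum_left inner_commute[of a] mult.commute)
  qed
  have linA: "linear A"
  proof (rule linearI)
    show "A (x + y) = A x + A y" for x y
    proof -
      have "(\<integral>z. ((x + y) \<bullet> (z - xm)) * (b \<bullet> (z - xm)) \<partial>U)
        = (\<integral>z. (x \<bullet> (z - xm)) * (b \<bullet> (z - xm)) \<partial>U) + (\<integral>z. (y \<bullet> (z - xm)) * (b \<bullet> (z - xm)) \<partial>U)" for b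
        unfolding inner_add_left distrib_right
        by (rule Bochner_Integration.integral_add) (intro I continuous_intros)+
      then show ?thesis
        unfolding A_def by (simp add: scaleR_add_left sum.distrib)
    qed
    show "A (r *\<^sub>R x) = r *\<^sub>R A x" for r x
      unfolding A_def by (simp add: scaleR_sum_right mult.assoc)
  qed
  have "A g \<bullet> g = (\<integral>x. (g \<bullet> (x - xm))\<^sup>2 \<partial>U)" for g
    unfolding A_def power2_eq_square by (rule expand[symmetric]) (intro continuous_intros)
  then have "A g = 0 \<Longrightarrow> g = 0" for g
    using integral_U_zero_affine[of g xm] by (metis inner_zero_left)
  then have "inj A"
    using linA by (simp add: linear_injective_0)
  from linear_injective_imp_surjective[OF linA this]
  have "surj A" by simp
  then obtain \<gamma> where \<gamma>: "A \<gamma> = rhs" by (metis surjD)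
  define mf where "mf = (\<integral>x. f x \<partial>U)"
  define q where "q x = mf + \<gamma> \<bullet> (x - xm)" for x
  show ?thesis
  proof (rule that[of q])
    have "q = (\<lambda>x. (mf - \<gamma> \<bullet> xm) + \<gamma> \<bullet> x)"
      by (simp add: q_def fun_eq_iff inner_diff_right)
    then show "q \<in> polys 1" unfolding polys_1 by blast
    fix p :: "'a \<Rightarrow> real" assume "p \<in> polys 1"
    then obtain a g where p: "p = (\<lambda>x. a + g \<bullet> x)" unfolding polys_1 by blast
    have cq: "continuous_on UNIV q" unfolding q_def by (intro continuous_intros)
    have i: "integrable U (\<lambda>x. f x * (g \<bullet> (x - xm)))" "integrable U (\<lambda>x. (\<gamma> \<bullet> (x - xm)) * (g \<bullet> (x - xm)))"
      "integrable U (\<lambda>x. g \<bullet> (x - xm))" "integrable U f" "integrable U (\<lambda>x. \<gamma> \<bullet> (x - xm))"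
      by (intro I continuous_intros f)+
    have "(\<integral>x. (f x - q x) * p x \<partial>U) = (\<integral>x. f x * (g \<bullet> (x - xm)) - mf * (g \<bullet> (x - xm))
        - (\<gamma> \<bullet> (x - xm)) * (g \<bullet> (x - xm)) + (a + g \<bullet> xm) * (f x - mf - \<gamma> \<bullet> (x - xm)) \<partial>U)"
      by (intro Bochner_Integration.integral_cong refl) (simp add: p q_def inner_diff_right algebra_simps)
    also have "\<dots> = (\<integral>x. f x * (g \<bullet> (x - xm)) \<partial>U) - (\<integral>x. (\<gamma> \<bullet> (x - xm)) * (g \<bullet> (x - xm)) \<partial>U)"
      using i by (simp add: xm U.prob_space mf_def[symmetric])
    also have "\<dots> = rhs \<bullet> g - A \<gamma> \<bullet> g"
      unfolding rhs_def A_def by (subst (1 2) expand) (auto intro!: continuous_intros f)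
    finally show "(\<integral>x. (f x - q x) * p x \<partial>U) = 0"
      using \<gamma> by simp
  qed
qed

lemma L2_proj_1:
  fixes f :: "'a \<Rightarrow> real"
  assumes f: "continuous_on UNIV f"
  defines "q \<equiv> L2_proj (lebesgue_on T) 1 f"
  shows "q \<in> polys 1" "\<And>p. p \<in> polys 1 \<Longrightarrow> (\<integral>x. (f x - q x) * p x \<partial>U) = 0"
proof -
  have cp: "continuous_on UNIV p" if "p \<in> polys 1" for p :: "'a \<Rightarrow> real"
    using that unfolding polys_1 by (auto intro!: continuous_intros)
  have eq: "(\<integral>x. (f x - q x) * p x \<partial>lebesgue_on T) = vol * (\<integral>x. (f x - q x) * p x \<partial>U)"
    if "p \<in> polys 1" "q \<in> polys 1" for p q :: "'a \<Rightarrow> real"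
    by (intro integral_T continuous_intros f cp that)
  obtain q0 where "q0 \<in> polys 1" "\<And>p. p \<in> polys 1 \<Longrightarrow> (\<integral>x. (f x - q0 x) * p x \<partial>U) = 0"
    using affine_projection_exists[OF f] by blast
  then have "q0 \<in> polys 1 \<and> (\<forall>p\<in>polys 1. (\<integral>x. (f x - q0 x) * p x \<partial>lebesgue_on T) = 0)"
    by (simp add: eq)
  then have *: "q \<in> polys 1 \<and> (\<forall>p\<in>polys 1. (\<integral>x. (f x - q x) * p x \<partial>lebesgue_on T) = 0)"
    unfolding q_def L2_proj_def
    by (rule someI[of "\<lambda>q. q \<in> polys 1 \<and> (\<forall>p\<in>polys 1. (\<integral>x. (f x - q x) * p x \<partial>lebesgue_on T) = 0)"])
  then show "q \<in> polys 1" by blast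
  show "(\<integral>x. (f x - q x) * p x \<partial>U) = 0" if "p \<in> polys 1" for p
  proof -
    have "(\<integral>x. (f x - q x) * p x \<partial>lebesgue_on T) = 0" "q \<in> polys 1"
      using * that by blast+
    then show ?thesis
      using eq[OF that, of q] vol_pos by simp
  qed
qed

text \<open>Members of \<open>polys 0\<close> are constant on the whole space, so testing with 1
  determines the choice as a function and not only on \<open>T\<close>.\<close>

lemma L2_proj_0:
  fixes f :: "'a \<Rightarrow> real"
  assumes f: "continuous_on UNIV f"
  shows "L2_proj (lebesgue_on T) 0 f = (\<lambda>x. \<integral>x. f x \<partial>U)"
proof -
  interpret U: prob_space U by (rule prob_space_U)
  have iff: "(q \<in> polys 0 \<and> (\<forall>p\<in>polys 0. (\<integral>x. (f x - q x) * p x \<partial>lebesgue_on T) = 0)) \<longleftrightarrow> q = (\<lambda>x. \<integral>x. f x \<partial>U)" for q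
  proof -
    have "(\<integral>x. (f x - c) * e \<partial>lebesgue_on T) = vol * (((\<integral>x. f x \<partial>U) - c) * e)" for c e
      using integrable_U[OF f] by (subst integral_T) (auto intro!: continuous_intros f simp: U.prob_space)
    note I = this
    show ?thesis
    proof
      assume *: "q \<in> polys 0 \<and> (\<forall>p\<in>polys 0. (\<integral>x. (f x - q x) * p x \<partial>lebesgue_on T) = 0)"
      then obtain r where q: "q = (\<lambda>x. r)" unfolding polys_0 by blast
      have one: "(\<lambda>x :: 'a. 1) \<in> polys 0" unfolding polys_0 by blast
      from bspec[OF conjunct2[OF *[unfolded q]] one]
      have "(\<integral>x. (f x - r) * 1 \<partial>lebesgue_on T) = 0" .
      then show "q = (\<lambda>x. \<integral>x. f x \<partial>U)" unfolding I q using vol_pos by simp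
    next
      assume q: "q = (\<lambda>x. \<integral>x. f x \<partial>U)"
      show "q \<in> polys 0 \<and> (\<forall>p\<in>polys 0. (\<integral>x. (f x - q x) * p x \<partial>lebesgue_on T) = 0)"
        unfolding q polys_0
      proof (intro conjI ballI)
        fix p :: "'a \<Rightarrow> real" assume "p \<in> range (\<lambda>c x. c)"
        then obtain e where p: "p = (\<lambda>x. e)" by blast
        show "(\<integral>x. (f x - (\<integral>x. f x \<partial>U)) * p x \<partial>lebesgue_on T) = 0"
          unfolding p I by simp
      qed blast
    qed
  qed
  show ?thesis
    unfolding L2_proj_def iff by simp
qed

lemma face_proj_0:
  fixes f :: "'a \<Rightarrow> real"
  assumes c: "c \<in> C" and f: "continuous_on UNIV f"
  shows "face_proj 0 (face c) f = (\<lambda>x. (\<integral>x. f x \<partial>face_measure (face c)) / measure (face_measure (face c)) (face c))"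
proof -
  define M where "M = face_measure (face c)"
  have sp: "space M = face c"
    by (simp add: M_def face_measure_def space_restrict_space flat_lborel_def Let_def)
  have fin: "integrable M (\<lambda>x. r)" for r :: real
    unfolding M_def by (rule integrable_face[OF c]) (intro continuous_intros)
  have iff: "(q \<in> polys 0 \<and> (\<forall>p\<in>polys 0. (\<integral>x. (f x - q x) * p x \<partial>M) = 0))
      \<longleftrightarrow> q = (\<lambda>x. (\<integral>x. f x \<partial>M) / measure M (face c))" for q
  proof -
    have "(\<integral>x. (f x - r) * e \<partial>M) = ((\<integral>x. f x \<partial>M) - r * measure M (face c)) * e" for r e
      using integrable_face[OF c f, folded M_def] fin[of r] by (simp add: sp mult.commute)
    note I = this
    have pos: "measure M (face c) > 0"
      unfolding M_def by (rule face_measure_pos[OF c])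
    show ?thesis
    proof
      assume *: "q \<in> polys 0 \<and> (\<forall>p\<in>polys 0. (\<integral>x. (f x - q x) * p x \<partial>M) = 0)"
      then obtain r where q: "q = (\<lambda>x. r)" unfolding polys_0 by blast
      have one: "(\<lambda>x :: 'a. 1) \<in> polys 0" unfolding polys_0 by blast
      from bspec[OF conjunct2[OF *[unfolded q]] one]
      have "(\<integral>x. (f x - r) * 1 \<partial>M) = 0" .
      then show "q = (\<lambda>x. (\<integral>x. f x \<partial>M) / measure M (face c))" unfolding I q using pos by (simp add: field_simps)
    next
      assume q: "q = (\<lambda>x. (\<integral>x. f x \<partial>M) / measure M (face c))"
      show "q \<in> polys 0 \<and> (\<forall>p\<in>polys 0. (\<integral>x. (f x - q x) * p x \<partial>M) = 0)"
        unfolding q polys_0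
      proof (intro conjI ballI)
        fix p :: "'a \<Rightarrow> real" assume "p \<in> range (\<lambda>c x. c)"
        then obtain e where p: "p = (\<lambda>x. e)" by blast
        show "(\<integral>x. (f x - (\<integral>x. f x \<partial>M) / measure M (face c)) * p x \<partial>M) = 0"
          unfolding p I using pos by simp
      qed blast
    qed
  qed
  show ?thesis
    unfolding L2_proj_def iff[unfolded M_def] by simp
qed

end

section \<open>The reconstruction and the local energy estimate\<close>

context simplex_cell
begin

text \<open>For k = 0 the test functions are affine: the Laplacian term drops out, and by the Gauss
  theorem the face means reproduce the integral of the gradient of \<open>f\<close>. The
  reconstruction thus has the mean gradient \<open>gm\<close> and the mean value of
  \<open>f\<close>; these data determine an affine function, which resolves the choice.\<close>

lemma reconstruction_interpolant:
  fixes f :: "'a \<Rightarrow> real"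
  assumes f: "\<And>x. (f has_derivative (\<lambda>h. G x \<bullet> h)) (at x)" and G: "continuous_on UNIV G"
    and fst_v: "fst v T = L2_proj (lebesgue_on T) 1 f"
    and snd_v: "\<And>c. c \<in> C \<Longrightarrow> snd v (face c) = (\<lambda>x. (\<integral>x. f x \<partial>face_measure (face c)) / measure (face_measure (face c)) (face c))"
  defines "gm \<equiv> \<Sum>b\<in>Basis. (\<integral>x. G x \<bullet> b \<partial>U) *\<^sub>R b"
  shows "reconstruction 0 v T = (\<lambda>x. ((\<integral>x. f x \<partial>U) - (\<integral>x. gm \<bullet> x \<partial>U)) + gm \<bullet> x)"
    and "\<And>a. (\<integral>x. G x \<bullet> a \<partial>U) = gm \<bullet> a"
proof -
  interpret U: prob_space U by (rule prob_space_U)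
  have cf: "continuous_on UNIV f"
    by (intro continuous_at_imp_continuous_on ballI has_derivative_continuous[OF f])
  show gm: "(\<integral>x. G x \<bullet> a \<partial>U) = gm \<bullet> a" for a
  proof -
    have "(\<integral>x. G x \<bullet> a \<partial>U) = (\<integral>x. (\<Sum>b\<in>Basis. (a \<bullet> b) * (G x \<bullet> b)) \<partial>U)"
      by (subst euclidean_inner) (simp add: mult.commute)
    also have "\<dots> = (\<Sum>b\<in>Basis. (a \<bullet> b) * (\<integral>x. G x \<bullet> b \<partial>U))"
      by (subst Bochner_Integration.integral_sum) (auto intro!: integrable_U continuous_intros G)
    finally show ?thesis
      by (simp add: gm_def inner_sum_left inner_commute[of a] mult.commute)
  qed
  define q where "q = L2_proj (lebesgue_on T) 1 f"
  note q = L2_proj_1[OF cf, folded q_def]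
  have const: "(\<lambda>x :: 'a. r) \<in> polys 1" for r :: real
    unfolding polys_1 by (intro CollectI exI[of _ r] exI[of _ 0]) simp
  have cq: "continuous_on UNIV q"
    using q(1) unfolding polys_1 by (auto intro!: continuous_intros)
  have mq: "(\<integral>x. q x \<partial>U) = (\<integral>x. f x \<partial>U)"
    using q(2)[OF const[of 1]] integrable_U[OF cf] integrable_U[OF cq] by simp
  define \<rho> where "\<rho> = (\<integral>x. f x \<partial>U) - (\<integral>x. gm \<bullet> x \<partial>U)"
  define P where "P r \<longleftrightarrow> r \<in> polys (0 + 1) \<and>
        (\<forall>\<phi>\<in>polys (0 + 1).
           integral\<^sup>L (lebesgue_on T) (\<lambda>x. grad r x \<bullet> grad \<phi> x) =
           - integral\<^sup>L (lebesgue_on T) (\<lambda>x. fst v T x * laplacian \<phi> x)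
           + (\<Sum>F\<in>elem_faces T.
                integral\<^sup>L (face_measure F)
                  (\<lambda>x. snd v F x * (grad \<phi> x \<bullet> outer_normal T F)))) \<and>
        integral\<^sup>L (lebesgue_on T) r = integral\<^sup>L (lebesgue_on T) (fst v T)" for r
  have faces: "(\<Sum>F\<in>elem_faces T. integral\<^sup>L (face_measure F) (\<lambda>x. snd v F x * (h \<bullet> outer_normal T F))) = vol * (gm \<bullet> h)" for h
  proof -
    have "(\<integral>x. snd v F x * (h \<bullet> outer_normal T F) \<partial>face_measure F) = (\<integral>x. f x \<partial>face_measure F) * (h \<bullet> outer_normal T F)"
      if F: "F \<in> elem_faces T" for F
    proof -
      obtain c where c: "c \<in> C" "F = face c" using F unfolding elem_faces_T by blast
      have sp: "space (face_measure F) = F"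
        by (simp add: face_measure_def space_restrict_space flat_lborel_def Let_def)
      show ?thesis
        using face_measure_pos[OF c(1)] unfolding c(2) snd_v[OF c(1)] by (simp add: sp[unfolded c(2)])
    qed
    then have "(\<Sum>F\<in>elem_faces T. integral\<^sup>L (face_measure F) (\<lambda>x. snd v F x * (h \<bullet> outer_normal T F)))
        = (\<Sum>F\<in>elem_faces T. (\<integral>x. f x \<partial>face_measure F) * (h \<bullet> outer_normal T F))"
      by (intro sum.cong refl)
    also have "\<dots> = vol * (gm \<bullet> h)"
      using divergence[OF f G, of h] unfolding gm .
    finally show ?thesis .
  qed
  have P_iff: "P (\<lambda>x. a + g \<bullet> x) \<longleftrightarrow> g = gm \<and> a = \<rho>" for a g
  proof -
    have I: "(\<integral>x. a + g \<bullet> x \<partial>lebesgue_on T) = vol * (a + (\<integral>x. g \<bullet> x \<partial>U))"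
      using integrable_U[of "\<lambda>x. g \<bullet> x"]
      by (subst integral_T) (auto intro!: continuous_intros simp: U.prob_space continuous_on_inner continuous_on_id)
    have FQ: "(\<integral>x. fst v T x \<partial>lebesgue_on T) = vol * (\<integral>x. f x \<partial>U)"
      unfolding fst_v q_def[symmetric] by (simp add: integral_T[OF cq] mq)
    have gr: "(\<integral>x. g \<bullet> h \<partial>lebesgue_on T) = vol * (g \<bullet> h)" for h
      by (subst integral_T) (auto intro!: continuous_intros simp: U.prob_space)
    define Q where "Q \<phi> \<longleftrightarrow> integral\<^sup>L (lebesgue_on T) (\<lambda>x. grad (\<lambda>x. a + g \<bullet> x) x \<bullet> grad \<phi> x) =
           - integral\<^sup>L (lebesgue_on T) (\<lambda>x. fst v T x * laplacian \<phi> x)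
           + (\<Sum>F\<in>elem_faces T. integral\<^sup>L (face_measure F) (\<lambda>x. snd v F x * (grad \<phi> x \<bullet> outer_normal T F)))" for \<phi>
    have Q_iff: "Q (\<lambda>x. a' + h \<bullet> x) \<longleftrightarrow> vol * (g \<bullet> h) = vol * (gm \<bullet> h)" for a' h
      unfolding Q_def grad_affine_fun laplacian_affine_fun gr faces by simp
    have g1: "(\<lambda>x. a + g \<bullet> x) \<in> polys 1" unfolding polys_1 by blast
    have "(\<forall>\<phi>\<in>polys 1. Q \<phi>) \<longleftrightarrow> (\<forall>h. vol * (g \<bullet> h) = vol * (gm \<bullet> h))"
    proof
      assume *: "\<forall>\<phi>\<in>polys 1. Q \<phi>"
      have "Q (\<lambda>x. 0 + h \<bullet> x)" for h
        by (rule bspec[OF *]) (use polys_1 in blast)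
      then show "\<forall>h. vol * (g \<bullet> h) = vol * (gm \<bullet> h)" unfolding Q_iff by blast
    next
      assume *: "\<forall>h. vol * (g \<bullet> h) = vol * (gm \<bullet> h)"
      show "\<forall>\<phi>\<in>polys 1. Q \<phi>"
      proof
        fix \<phi> :: "'a \<Rightarrow> real" assume "\<phi> \<in> polys 1"
        then obtain a' h where "\<phi> = (\<lambda>x. a' + h \<bullet> x)" unfolding polys_1 by blast
        then show "Q \<phi>" using Q_iff * by simp
      qed
    qed
    then have "P (\<lambda>x. a + g \<bullet> x) \<longleftrightarrow> (\<forall>h. vol * (g \<bullet> h) = vol * (gm \<bullet> h)) \<and> vol * (a + (\<integral>x. g \<bullet> x \<partial>U)) = vol * (\<integral>x. f x \<partial>U)"
      unfolding P_def add_0 I FQ Q_def using g1 by simp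
    also have "\<dots> \<longleftrightarrow> (\<forall>h. g \<bullet> h = gm \<bullet> h) \<and> a + (\<integral>x. g \<bullet> x \<partial>U) = (\<integral>x. f x \<partial>U)"
      using vol_pos by simp
    also have "(\<forall>h. g \<bullet> h = gm \<bullet> h) \<longleftrightarrow> g = gm"
      by (metis vector_eq_ldot inner_commute)
    finally show ?thesis
      unfolding \<rho>_def by auto
  qed
  have "(SOME r. P r) = (\<lambda>x. \<rho> + gm \<bullet> x)"
  proof (rule some_equality)
    show "P (\<lambda>x. \<rho> + gm \<bullet> x)" using P_iff by simp
    fix r assume r: "P r"
    then have "r \<in> polys 1" unfolding P_def by simp
    then obtain a g where eq: "r = (\<lambda>x. a + g \<bullet> x)" unfolding polys_1 by blast
    have "g = gm \<and> a = \<rho>" using r unfolding eq P_iff .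
    then show "r = (\<lambda>x. \<rho> + gm \<bullet> x)" using eq by simp
  qed
  then show "reconstruction 0 v T = (\<lambda>x. ((\<integral>x. f x \<partial>U) - (\<integral>x. gm \<bullet> x \<partial>U)) + gm \<bullet> x)"
    unfolding reconstruction_def P_def \<rho>_def .
qed

text \<open>\<open>Ew\<close> is the squared L^2 norm of the gradient of the reconstruction error on
  the element. It occurs as a gain in the discrete energy and as a bound for the mass lost by the
  projection, so that one can be traded for the other. The further conclusions are what the
  potential and the nonlinear term require of the projection.\<close>

lemma cell_estimate:
  fixes f :: "'a \<Rightarrow> real"
  assumes dim: "DIM('a) \<in> {2, 3}" and \<sigma>: "\<sigma> \<ge> 0"
    and f: "\<And>x. (f has_derivative (\<lambda>h. G x \<bullet> h)) (at x)" and G: "continuous_on UNIV G"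
    and fst_v: "fst v T = L2_proj (lebesgue_on T) 1 f"
    and snd_v: "\<And>c. c \<in> C \<Longrightarrow> snd v (face c) = (\<lambda>x. (\<integral>x. f x \<partial>face_measure (face c)) / measure (face_measure (face c)) (face c))"
  obtains Ew where "Ew \<ge> 0"
    "(\<integral>x. grad (reconstruction 0 v T) x \<bullet> grad (reconstruction 0 v T) x \<partial>lebesgue_on T)
     + (\<sigma> * (\<Sum>F\<in>elem_faces T. inverse (face_length T F) *
              integral\<^sup>L (face_measure F)
                (\<lambda>x. face_proj 0 F (\<lambda>y. snd v F y - reconstruction 0 v T y) x *
                     face_proj 0 F (\<lambda>y. snd v F y - reconstruction 0 v T y) x))
      + \<sigma> * inverse ((diameter T)\<^sup>2) *
          integral\<^sup>L (lebesgue_on T)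
            (\<lambda>x. (fst v T x - reconstruction 0 v T x) * (fst v T x - reconstruction 0 v T x)))
     \<le> (\<integral>x. (norm (G x))\<^sup>2 \<partial>lebesgue_on T) - (1 - \<sigma> * (1 / pi\<^sup>2 + C_tr DIM('a))) * Ew"
    "(\<integral>x. (f x)\<^sup>2 \<partial>lebesgue_on T) - (\<integral>x. (fst v T x)\<^sup>2 \<partial>lebesgue_on T) \<le> (diameter T)\<^sup>2 / pi\<^sup>2 * Ew"
    "(\<integral>x. (fst v T x)\<^sup>2 \<partial>lebesgue_on T) \<le> (\<integral>x. (f x)\<^sup>2 \<partial>lebesgue_on T)"
    "L2_proj (lebesgue_on T) 0 (fst v T) = (\<lambda>x. \<integral>x. f x \<partial>U)"
    "fst v T \<in> polys 1"
proof -
  interpret U: prob_space U by (rule prob_space_U)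
  define d where "d = DIM('a)"
  have d: "d > 0" by (simp add: d_def)
  define h where "h = diameter T"
  have h0: "h \<ge> 0" unfolding h_def by (intro diameter_ge_0 compact_imp_bounded compact_T)
  have cf: "continuous_on UNIV f"
    by (intro continuous_at_imp_continuous_on ballI has_derivative_continuous[OF f])
  define gm where "gm = (\<Sum>b\<in>Basis. (\<integral>x. G x \<bullet> b \<partial>U) *\<^sub>R b)"
  define \<rho> where "\<rho> = (\<integral>x. f x \<partial>U) - (\<integral>x. gm \<bullet> x \<partial>U)"
  define r where "r x = \<rho> + gm \<bullet> x" for x
  have rec: "reconstruction 0 v T = r"
    unfolding r_def[abs_def] \<rho>_def gm_def by (rule reconstruction_interpolant(1)[OF f G fst_v snd_v])
  have gm: "(\<integral>x. G x \<bullet> a \<partial>U) = gm \<bullet> a" for a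
    unfolding gm_def by (rule reconstruction_interpolant(2)[OF f G fst_v snd_v])
  define q where "q = L2_proj (lebesgue_on T) 1 f"
  note q = L2_proj_1[OF cf, folded q_def]
  have const: "(\<lambda>x :: 'a. r) \<in> polys 1" for r :: real
    unfolding polys_1 by (intro CollectI exI[of _ r] exI[of _ 0]) simp
  have cq: "continuous_on UNIV q"
    using q(1) unfolding polys_1 by (auto intro!: continuous_intros)
  have mq: "(\<integral>x. q x \<partial>U) = (\<integral>x. f x \<partial>U)"
    using q(2)[OF const[of 1]] integrable_U[OF cf] integrable_U[OF cq] by simp
  have r1: "r \<in> polys 1" unfolding polys_1 r_def[abs_def] by blast
  have cr: "continuous_on UNIV r" unfolding r_def[abs_def] by (intro continuous_intros)
  have gr: "grad r x = gm" for x
    unfolding r_def[abs_def] by (rule grad_affine_fun)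
  have dr: "(r has_derivative (\<lambda>h. gm \<bullet> h)) (at x)" for x
    unfolding r_def[abs_def] by (rule has_derivative_affine_fun)
  have mr: "(\<integral>x. r x \<partial>U) = (\<integral>x. f x \<partial>U)"
    using integrable_U[of "\<lambda>x. gm \<bullet> x"] unfolding r_def
    by (simp add: U.prob_space \<rho>_def continuous_on_inner continuous_on_id)
  define w where "w x = f x - r x" for x
  define W where "W x = G x - gm" for x
  have w: "(w has_derivative (\<lambda>h. W x \<bullet> h)) (at x)" for x
    unfolding w_def[abs_def] W_def inner_diff_left by (intro has_derivative_diff f dr)
  have cW: "continuous_on UNIV W" unfolding W_def[abs_def] by (intro continuous_intros G)
  have cw: "continuous_on UNIV w" unfolding w_def[abs_def] by (intro continuous_intros cf cr)
  have mw: "(\<integral>x. w x \<partial>U) = 0"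
    unfolding w_def using integrable_U[OF cf] integrable_U[OF cr] by (simp add: mr)
  have mW: "(\<integral>x. a \<bullet> W x \<partial>U) = 0" for a
  proof -
    have "(\<integral>x. a \<bullet> W x \<partial>U) = (\<integral>x. G x \<bullet> a - gm \<bullet> a \<partial>U)"
      by (simp add: W_def inner_diff_right inner_commute)
    also have "\<dots> = 0"
      using integrable_U[of "\<lambda>x. G x \<bullet> a"] G by (simp add: gm U.prob_space continuous_on_inner)
    finally show ?thesis .
  qed
  define E where "E = (\<integral>x. (norm (W x))\<^sup>2 \<partial>U)"
  have E0: "E \<ge> 0" unfolding E_def by simp
  \<comment> \<open>\<open>gm\<close> is the mean of \<open>G\<close>, so the splitting of the
    Dirichlet energy is orthogonal; \<open>E\<close> is the part that the reconstruction
    saves.\<close>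
  have 1: "(\<integral>x. (norm (G x))\<^sup>2 \<partial>U) = gm \<bullet> gm + E"
  proof -
    have "E = (\<integral>x. (norm (G x))\<^sup>2 - 2 * (G x \<bullet> gm) + gm \<bullet> gm \<partial>U)"
      unfolding E_def W_def
      by (intro Bochner_Integration.integral_cong refl)
         (simp add: power2_norm_eq_inner inner_diff_left inner_diff_right inner_commute)
    also have "\<dots> = (\<integral>x. (norm (G x))\<^sup>2 \<partial>U) - 2 * (gm \<bullet> gm) + gm \<bullet> gm"
    proof -
      have "integrable U (\<lambda>x. (norm (G x))\<^sup>2)" "integrable U (\<lambda>x. G x \<bullet> gm)"
        by (intro integrable_U continuous_intros G)+
      then show ?thesis by (simp add: gm U.prob_space)
    qed
    finally show ?thesis by simp
  qed
  have 2: "(\<integral>x. (w x)\<^sup>2 \<partial>U) \<le> 7 / 72 * h\<^sup>2 * E"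
    using poincare[OF dim w cW] by (simp add: mw E_def h_def)
  have iq: "integrable U (\<lambda>x. (f x - q x)\<^sup>2)" "integrable U (\<lambda>x. (q x)\<^sup>2)" "integrable U (\<lambda>x. (q x - r x)\<^sup>2)"
    "integrable U (\<lambda>x. (f x - q x) * q x)" "integrable U (\<lambda>x. (f x - q x) * (q x - r x))"
    by (intro integrable_U continuous_intros cf cq cr)+
  have 3: "(\<integral>x. (f x)\<^sup>2 \<partial>U) = (\<integral>x. (f x - q x)\<^sup>2 \<partial>U) + (\<integral>x. (q x)\<^sup>2 \<partial>U)"
  proof -
    have "(\<integral>x. (f x)\<^sup>2 \<partial>U) = (\<integral>x. (f x - q x)\<^sup>2 + (q x)\<^sup>2 + 2 * ((f x - q x) * q x) \<partial>U)"
      by (intro Bochner_Integration.integral_cong refl) (simp add: power2_eq_square algebra_simps)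
    then show ?thesis using iq q(2)[OF q(1)] by simp
  qed
  have qr: "(\<lambda>x. q x - r x) \<in> polys 1"
    using polys_add[OF q(1) polys_scale[OF r1, of "-1"]] by simp
  \<comment> \<open>The projection error is orthogonal to the affine function q - r. Hence the
    single Poincare bound for \<open>w\<close> controls both the lost mass and the cell term of the
    stabilisation.\<close>
  have 4: "(\<integral>x. (w x)\<^sup>2 \<partial>U) = (\<integral>x. (f x - q x)\<^sup>2 \<partial>U) + (\<integral>x. (q x - r x)\<^sup>2 \<partial>U)"
  proof -
    have "(\<integral>x. (w x)\<^sup>2 \<partial>U) = (\<integral>x. (f x - q x)\<^sup>2 + (q x - r x)\<^sup>2 + 2 * ((f x - q x) * (q x - r x)) \<partial>U)"
      unfolding w_def
      by (intro Bochner_Integration.integral_cong refl) (simp add: power2_eq_square algebra_simps)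
    then show ?thesis using iq q(2)[OF qr] by simp
  qed
  have pos: "(\<integral>x. (f x - q x)\<^sup>2 \<partial>U) \<ge> 0" "(\<integral>x. (q x - r x)\<^sup>2 \<partial>U) \<ge> 0"
    by simp_all
  \<comment> \<open>The face mean of the error \<open>w\<close>. Both \<open>w\<close> and its
    gradient have mean zero on the element, so in the trace identity the vertex c may be replaced by
    the barycenter, and all facets share one value.\<close>
  define \<kappa> where "\<kappa> = (\<integral>x. (x - barycenter T) \<bullet> W x \<partial>U) / real d"
  have mean_w: "(\<integral>x. w x \<partial>face_measure (face c)) = measure (face_measure (face c)) (face c) * \<kappa>" if c: "c \<in> C" for c
  proof -
    have "(\<integral>x. w x + (x - c) \<bullet> W x / real d \<partial>U)
        = (\<integral>x. w x + (x - barycenter T) \<bullet> W x / real d + (barycenter T - c) \<bullet> W x / real d \<partial>U)"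
      by (intro Bochner_Integration.integral_cong refl)
         (simp add: inner_diff_left diff_divide_distrib)
    also have "\<dots> = \<kappa>"
    proof -
      have "integrable U w" "integrable U (\<lambda>x. (x - barycenter T) \<bullet> W x)" "integrable U (\<lambda>x. (barycenter T - c) \<bullet> W x)"
        by (intro integrable_U continuous_intros cw cW)+
      then show ?thesis by (simp add: mw mW \<kappa>_def)
    qed
    finally show ?thesis
      using integral_face[OF c w cW] by (simp add: d_def)
  qed
  \<comment> \<open>The distance bound d h / (d + 1) is divided by the d of the trace identity,
    which leaves h / (d + 1); Jensen's inequality passes from the mean of the norm of
    \<open>W\<close> to \<open>E\<close>.\<close>
  have \<kappa>2: "\<kappa>\<^sup>2 \<le> h\<^sup>2 * (E / (real (Suc d))\<^sup>2)"
  proof -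
    have iW: "integrable U (\<lambda>x. norm (W x))" "integrable U (\<lambda>x. (norm (W x))\<^sup>2)"
      by (intro integrable_U continuous_intros cW)+
    define mN where "mN = (\<integral>x. norm (W x) \<partial>U)"
    have mN0: "mN \<ge> 0" unfolding mN_def by simp
    have "0 \<le> (\<integral>x. (norm (W x) - mN)\<^sup>2 \<partial>U)" by simp
    also have "\<dots> = (\<integral>x. (norm (W x))\<^sup>2 - 2 * mN * norm (W x) + mN\<^sup>2 \<partial>U)"
      by (intro Bochner_Integration.integral_cong refl) (simp add: power2_eq_square algebra_simps)
    also have "\<dots> = E - mN\<^sup>2"
      using iW by (simp add: E_def mN_def[symmetric] U.prob_space power2_eq_square)
    finally have mN: "mN\<^sup>2 \<le> E" by simp
    have "\<bar>\<integral>x. (x - barycenter T) \<bullet> W x \<partial>U\<bar> \<le> (\<integral>x. \<bar>(x - barycenter T) \<bullet> W x\<bar> \<partial>U)"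
      by (rule integral_abs_bound)
    also have "\<dots> \<le> (\<integral>x. real d / real (Suc d) * h * norm (W x) \<partial>U)"
    proof (rule integral_mono_AE)
      show "integrable U (\<lambda>x. \<bar>(x - barycenter T) \<bullet> W x\<bar>)"
        by (intro integrable_U continuous_intros cW)
      show "integrable U (\<lambda>x. real d / real (Suc d) * h * norm (W x))"
        by (intro integrable_U continuous_intros cW)
      show "AE x in U. \<bar>(x - barycenter T) \<bullet> W x\<bar> \<le> real d / real (Suc d) * h * norm (W x)"
        using AE_U
      proof eventually_elim
        fix x assume "x \<in> T"
        have "\<bar>(x - barycenter T) \<bullet> W x\<bar> \<le> norm (x - barycenter T) * norm (W x)"
          by (rule Cauchy_Schwarz_ineq2)
        also have "\<dots> \<le> real d / real (Suc d) * h * norm (W x)"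
          unfolding d_def h_def by (intro mult_right_mono norm_diff_barycenter \<open>x \<in> T\<close>) simp
        finally show "\<bar>(x - barycenter T) \<bullet> W x\<bar> \<le> real d / real (Suc d) * h * norm (W x)" .
      qed
    qed
    also have "\<dots> = real d / real (Suc d) * h * mN"
      by (simp add: mN_def)
    finally have "\<bar>\<kappa>\<bar> \<le> (real d / real (Suc d) * h * mN) / real d"
      unfolding \<kappa>_def abs_divide abs_of_nat using d by (intro divide_right_mono) auto
    also have "\<dots> = h * mN / real (Suc d)"
      using d by (simp del: of_nat_Suc)
    finally have "\<kappa>\<^sup>2 \<le> (h * mN / real (Suc d))\<^sup>2"
      by (rule power2_le_iff_abs_le[THEN iffD2, rotated]) (use h0 mN0 in simp)
    also have "\<dots> = h\<^sup>2 * (mN\<^sup>2 / (real (Suc d))\<^sup>2)"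
      by (simp add: power_divide power_mult_distrib)
    also have "\<dots> \<le> h\<^sup>2 * (E / (real (Suc d))\<^sup>2)"
      using mN by (intro mult_left_mono divide_right_mono) auto
    finally show ?thesis .
  qed
  \<comment> \<open>Division by zero yields 0, so the case h = 0 is harmless here.\<close>
  have \<kappa>h: "\<kappa>\<^sup>2 / h\<^sup>2 \<le> E / (real (Suc d))\<^sup>2"
  proof (cases "h = 0")
    case True
    then show ?thesis using E0 by simp
  next
    case False
    then have "h\<^sup>2 > 0" by simp
    then show ?thesis using \<kappa>2 by (simp add: divide_le_eq mult.commute)
  qed
  have face_term: "inverse (face_length T F) * integral\<^sup>L (face_measure F)
                (\<lambda>x. face_proj 0 F (\<lambda>y. snd v F y - r y) x * face_proj 0 F (\<lambda>y. snd v F y - r y) x)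
      \<le> vol * (E / (real (Suc d))\<^sup>2)" if F: "F \<in> elem_faces T" for F
  proof -
    obtain c where c: "c \<in> C" "F = face c" using F unfolding elem_faces_T by blast
    define m where "m = measure (face_measure F) F"
    have m: "m > 0" unfolding m_def c(2) by (rule face_measure_pos[OF c(1)])
    have sp: "space (face_measure F) = F"
      by (simp add: face_measure_def space_restrict_space flat_lborel_def Let_def)
    have iF: "integrable (face_measure F) g" if "continuous_on UNIV g" for g :: "'a \<Rightarrow> real"
      unfolding c(2) by (rule integrable_face[OF c(1) that])
    have "face_proj 0 F (\<lambda>y. snd v F y - r y) = (\<lambda>x. (\<integral>y. snd v F y - r y \<partial>face_measure F) / m)"
      unfolding c(2) m_def snd_v[OF c(1)] by (rule face_proj_0[OF c(1)]) (intro continuous_intros cr)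
    also have "(\<integral>y. snd v F y - r y \<partial>face_measure F) = (\<integral>y. f y \<partial>face_measure F) - (\<integral>y. r y \<partial>face_measure F)"
      unfolding c(2) snd_v[OF c(1)] using iF[OF cr] iF[OF continuous_on_const] m
      by (simp add: c(2) sp[unfolded c(2)] m_def)
    also have "\<dots> = (\<integral>y. w y \<partial>face_measure F)"
      unfolding w_def using iF[OF cf] iF[OF cr] by simp
    also have "\<dots> = m * \<kappa>"
      unfolding m_def c(2) by (rule mean_w[OF c(1)])
    finally have fp: "face_proj 0 F (\<lambda>y. snd v F y - r y) = (\<lambda>x. \<kappa>)"
      using m by simp
    define TF where "TF = measure lebesgue (convex hull (insert (barycenter T) F))"
    \<comment> \<open>The inclusion of the subsimplex in \<open>T\<close> is sharp enough: each of
      the d + 1 faces costs at most \<open>vol * (E / (real (Suc d))\<^sup>2)\<close>, in total vol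
      E / (d + 1).\<close>
    have TF: "TF \<le> vol"
      unfolding TF_def vol_def
    proof (rule measure_mono_fmeasurable)
      have sub: "insert (barycenter T) F \<subseteq> T"
        using barycenter_in_T hull_mono[of "C - {c}" C convex] by (auto simp: c(2) face_def T_def)
      then show "convex hull (insert (barycenter T) F) \<subseteq> T"
        unfolding T_def by (intro hull_minimal) auto
      have "compact (insert (barycenter T) F)"
        unfolding c(2) face_def using finite_C by (intro compact_insert compact_convex_hull finite_imp_compact) auto
      then have "compact (convex hull (insert (barycenter T) F))"
        by (rule compact_convex_hull)
      then show "convex hull (insert (barycenter T) F) \<in> sets lebesgue"
        using lmeasurable_compact by (metis fmeasurableD)
      show "T \<in> lmeasurable" using compact_T by (rule lmeasurable_compact)
    qed
    have TF0: "TF \<ge> 0" unfolding TF_def by simp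
    have "integral\<^sup>L (face_measure F) (\<lambda>x. \<kappa> * \<kappa>) = m * \<kappa>\<^sup>2"
      by (simp add: sp m_def power2_eq_square)
    then have "inverse (face_length T F) * integral\<^sup>L (face_measure F) (\<lambda>x. \<kappa> * \<kappa>)
        = inverse (m * h\<^sup>2 / TF) * (m * \<kappa>\<^sup>2)"
      unfolding face_length_def m_def h_def TF_def by simp
    also have "\<dots> = TF * (\<kappa>\<^sup>2 / h\<^sup>2)"
      using m by (simp add: field_simps)
    also have "\<dots> \<le> vol * (E / (real (Suc d))\<^sup>2)"
      using TF TF0 \<kappa>h vol_pos by (intro mult_mono) auto
    finally show ?thesis unfolding fp .
  qed
  have card_faces: "card (elem_faces T) = Suc d"
    unfolding elem_faces_T using card_image[OF inj_face] card_C by (simp add: d_def)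
  have faces: "(\<Sum>F\<in>elem_faces T. inverse (face_length T F) * integral\<^sup>L (face_measure F)
                (\<lambda>x. face_proj 0 F (\<lambda>y. snd v F y - r y) x * face_proj 0 F (\<lambda>y. snd v F y - r y) x))
      \<le> vol * E * (1 / real (Suc d))"
  proof -
    have "(\<Sum>F\<in>elem_faces T. inverse (face_length T F) * integral\<^sup>L (face_measure F)
                (\<lambda>x. face_proj 0 F (\<lambda>y. snd v F y - r y) x * face_proj 0 F (\<lambda>y. snd v F y - r y) x))
      \<le> (\<Sum>F\<in>elem_faces T. vol * (E / (real (Suc d))\<^sup>2))"
      by (rule sum_mono[OF face_term])
    also have "\<dots> = real (Suc d) * (vol * (E / (real (Suc d))\<^sup>2))"
      by (simp add: card_faces)
    also have "\<dots> = vol * E * (1 / real (Suc d))"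
      by (simp add: power2_eq_square field_simps del: of_nat_Suc)
    finally show ?thesis .
  qed
  have qr_le: "(\<integral>x. (q x - r x)\<^sup>2 \<partial>U) \<le> h\<^sup>2 * (7 / 72 * E)"
  proof -
    have "7 / 72 * h\<^sup>2 * E = h\<^sup>2 * (7 / 72 * E)" by simp
    then show ?thesis using 2 4 pos by linarith
  qed
  have "inverse (h\<^sup>2) * (\<integral>x. (q x - r x)\<^sup>2 \<partial>U) \<le> 7 / 72 * E"
  proof (cases "h = 0")
    case True
    then show ?thesis using E0 by simp
  next
    case False
    then have "inverse (h\<^sup>2) * (\<integral>x. (q x - r x)\<^sup>2 \<partial>U) \<le> inverse (h\<^sup>2) * (h\<^sup>2 * (7 / 72 * E))"
      using qr_le by (intro mult_left_mono) auto
    moreover have "inverse (h\<^sup>2) * (h\<^sup>2 * (7 / 72 * E)) = 7 / 72 * E"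
      using False by (simp add: mult.assoc[symmetric])
    ultimately show ?thesis by linarith
  qed
  then have "vol * (inverse (h\<^sup>2) * (\<integral>x. (q x - r x)\<^sup>2 \<partial>U)) \<le> vol * (7 / 72 * E)"
    using vol_pos by (intro mult_left_mono) auto
  moreover have "(\<integral>x. (q x - r x) * (q x - r x) \<partial>lebesgue_on T) = vol * (\<integral>x. (q x - r x)\<^sup>2 \<partial>U)"
    by (subst integral_T) (auto intro!: continuous_intros cq cr simp: power2_eq_square)
  ultimately have cell: "inverse (h\<^sup>2) * (\<integral>x. (q x - r x) * (q x - r x) \<partial>lebesgue_on T) \<le> vol * E * (7 / 72)"
    by (simp add: mult_ac)
  have fq: "fst v T = q" unfolding fst_v q_def ..
  show ?thesis
  proof (rule that[of "vol * E"])
    show "vol * E \<ge> 0" using E0 vol_pos by simp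
    have A1: "(\<integral>x. gm \<bullet> gm \<partial>lebesgue_on T) = vol * (gm \<bullet> gm)"
      by (subst integral_T) (auto intro!: continuous_intros simp: U.prob_space)
    have A2: "(\<integral>x. (norm (G x))\<^sup>2 \<partial>lebesgue_on T) = vol * (gm \<bullet> gm + E)"
      using 1 by (subst integral_T) (auto intro!: continuous_intros G)
    have A3: "\<sigma> * (vol * E * (1 / real (Suc d)) + vol * E * (7 / 72)) \<le> \<sigma> * (vol * E * (1 / pi\<^sup>2 + C_tr DIM('a)))"
    proof -
      have "(vol * E) * (1 / real (Suc d) + 7 / 72) \<le> (vol * E) * (1 / pi\<^sup>2 + C_tr DIM('a))"
        using stabilisation_constants(2)[OF dim] E0 vol_pos unfolding d_def by (intro mult_left_mono) auto
      then show ?thesis using \<sigma> by (intro mult_left_mono) (simp_all add: distrib_left)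
    qed
    have A4: "\<sigma> * (\<Sum>F\<in>elem_faces T. inverse (face_length T F) * integral\<^sup>L (face_measure F)
                (\<lambda>x. face_proj 0 F (\<lambda>y. snd v F y - r y) x * face_proj 0 F (\<lambda>y. snd v F y - r y) x))
       + \<sigma> * inverse (h\<^sup>2) * (\<integral>x. (q x - r x) * (q x - r x) \<partial>lebesgue_on T)
       \<le> \<sigma> * (vol * E * (1 / real (Suc d)) + vol * E * (7 / 72))"
      using mult_left_mono[OF add_mono[OF faces cell] \<sigma>] by (simp add: distrib_left mult.assoc)
    have A5: "vol * (gm \<bullet> gm + E) - (1 - \<sigma> * (1 / pi\<^sup>2 + C_tr DIM('a))) * (vol * E)
      = vol * (gm \<bullet> gm) + \<sigma> * (vol * E * (1 / pi\<^sup>2 + C_tr DIM('a)))"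
      by (simp add: algebra_simps)
    show "(\<integral>x. grad (reconstruction 0 v T) x \<bullet> grad (reconstruction 0 v T) x \<partial>lebesgue_on T)
     + (\<sigma> * (\<Sum>F\<in>elem_faces T. inverse (face_length T F) *
              integral\<^sup>L (face_measure F)
                (\<lambda>x. face_proj 0 F (\<lambda>y. snd v F y - reconstruction 0 v T y) x *
                     face_proj 0 F (\<lambda>y. snd v F y - reconstruction 0 v T y) x))
      + \<sigma> * inverse ((diameter T)\<^sup>2) *
          integral\<^sup>L (lebesgue_on T)
            (\<lambda>x. (fst v T x - reconstruction 0 v T x) * (fst v T x - reconstruction 0 v T x)))
     \<le> (\<integral>x. (norm (G x))\<^sup>2 \<partial>lebesgue_on T) - (1 - \<sigma> * (1 / pi\<^sup>2 + C_tr DIM('a))) * (vol * E)"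
      unfolding rec gr fq h_def[symmetric] A1 A2 A5 using A3 A4 by linarith
    have sq: "(\<integral>x. (f x)\<^sup>2 \<partial>lebesgue_on T) = vol * (\<integral>x. (f x)\<^sup>2 \<partial>U)"
      "(\<integral>x. (q x)\<^sup>2 \<partial>lebesgue_on T) = vol * (\<integral>x. (q x)\<^sup>2 \<partial>U)"
      by (subst integral_T; auto intro!: continuous_intros cf cq)+
    show "(\<integral>x. (fst v T x)\<^sup>2 \<partial>lebesgue_on T) \<le> (\<integral>x. (f x)\<^sup>2 \<partial>lebesgue_on T)"
      unfolding fq sq using 3 pos vol_pos by (intro mult_left_mono) auto
    have "(\<integral>x. (f x - q x)\<^sup>2 \<partial>U) \<le> h\<^sup>2 / pi\<^sup>2 * E"
    proof -
      have "(\<integral>x. (f x - q x)\<^sup>2 \<partial>U) \<le> 7 / 72 * (h\<^sup>2 * E)"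
      proof -
        have "7 / 72 * h\<^sup>2 * E = 7 / 72 * (h\<^sup>2 * E)" by simp
        then show ?thesis using 2 4 pos by linarith
      qed
      also have "\<dots> \<le> 1 / pi\<^sup>2 * (h\<^sup>2 * E)"
        using stabilisation_constants(1) E0 by (intro mult_right_mono) auto
      finally show ?thesis by simp
    qed
    then have "vol * (\<integral>x. (f x - q x)\<^sup>2 \<partial>U) \<le> vol * (h\<^sup>2 / pi\<^sup>2 * E)"
      using vol_pos by (intro mult_left_mono) auto
    then show "(\<integral>x. (f x)\<^sup>2 \<partial>lebesgue_on T) - (\<integral>x. (fst v T x)\<^sup>2 \<partial>lebesgue_on T) \<le> (diameter T)\<^sup>2 / pi\<^sup>2 * (vol * E)"
      unfolding fq sq 3 h_def[symmetric] by (simp add: distrib_left mult_ac)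
    show "L2_proj (lebesgue_on T) 0 (fst v T) = (\<lambda>x. \<integral>x. f x \<partial>U)"
      unfolding fq L2_proj_0[OF cq] mq ..
    show "fst v T \<in> polys 1" unfolding fq by (rule q(1))
  qed
qed

end

section \<open>Test functions on the mesh\<close>

text \<open>Besides the calculus this records that test functions are closed under partial
  derivatives, so that a derivative can itself be inserted as a test function in the definition of a
  weak gradient.\<close>

lemma test_functionD:
  assumes "\<phi> \<in> test_functions \<Omega>"
  shows "(\<phi> has_derivative (\<lambda>h. grad \<phi> x \<bullet> h)) (at x)" "continuous_on UNIV (grad \<phi>)" "continuous_on UNIV \<phi>"
    "x \<notin> \<Omega> \<Longrightarrow> \<phi> x = 0"
    "b \<in> Basis \<Longrightarrow> partial_deriv b \<phi> \<in> test_functions \<Omega>"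
    "grad \<phi> x \<bullet> e = partial_deriv e \<phi> x"
    "x \<notin> closure {x. \<phi> x \<noteq> 0} \<Longrightarrow> grad \<phi> x = 0"
proof -
  have Ck: "Ck m \<phi>" for m using assms by (simp add: test_functions_def)
  have cpt: "compact (closure {x. \<phi> x \<noteq> 0})" "closure {x. \<phi> x \<noteq> 0} \<subseteq> \<Omega>"
    using assms by (auto simp: test_functions_def)
  have diff: "\<phi> differentiable at x" for x
    using Ck[of "Suc 0"] by simp
  have lin: "linear (frechet_derivative \<phi> (at x))" for x
    using diff by (rule linear_frechet_derivative)
  have gr: "grad \<phi> x \<bullet> h = frechet_derivative \<phi> (at x) h" for x h
  proof -
    have "frechet_derivative \<phi> (at x) h = frechet_derivative \<phi> (at x) (\<Sum>b\<in>Basis. (h \<bullet> b) *\<^sub>R b)"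
      by (simp add: euclidean_representation)
    also have "\<dots> = (\<Sum>b\<in>Basis. (h \<bullet> b) * frechet_derivative \<phi> (at x) b)"
      using lin by (simp add: linear_sum linear_scale)
    finally show ?thesis
      unfolding grad_def partial_deriv_def by (simp add: inner_sum_left inner_commute[of h] mult.commute)
  qed
  show d: "(\<phi> has_derivative (\<lambda>h. grad \<phi> x \<bullet> h)) (at x)" for x
    unfolding gr using diff[of x] by (simp add: frechet_derivative_works)
  show "continuous_on UNIV \<phi>"
    by (intro continuous_at_imp_continuous_on ballI has_derivative_continuous[OF d])
  have "continuous_on UNIV (partial_deriv b \<phi>)" if "b \<in> Basis" for b
    using Ck[of "Suc 0"] that by simp
  then show "continuous_on UNIV (grad \<phi>)"
    unfolding grad_def[abs_def] by (intro continuous_intros) auto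
  have in_cl: "x \<in> closure {x. \<phi> x \<noteq> 0}" if "\<phi> x \<noteq> 0" for x
    using that by (intro subsetD[OF closure_subset]) simp
  show z: "\<phi> x = 0" if "x \<notin> \<Omega>" for x
  proof (rule ccontr)
    assume "\<phi> x \<noteq> 0"
    then have "x \<in> closure {x. \<phi> x \<noteq> 0}"
      by (rule in_cl)
    then show False using subsetD[OF cpt(2)] that by blast
  qed
  show "grad \<phi> x \<bullet> e = partial_deriv e \<phi> x" for x e
    unfolding gr partial_deriv_def ..
  have z': "grad \<phi> x = 0" if "x \<notin> closure {x. \<phi> x \<noteq> 0}" for x
  proof (rule grad_unique)
    have "((\<lambda>x. 0 :: real) has_derivative (\<lambda>h. 0 \<bullet> h)) (at x)" by simp
    moreover have "open (- closure {x. \<phi> x \<noteq> 0})" by auto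
    moreover have "x \<in> - closure {x. \<phi> x \<noteq> 0}" using that by simp
    moreover have "0 = \<phi> y" if "y \<in> - closure {x. \<phi> x \<noteq> 0}" for y
      using that in_cl[of y] by auto
    ultimately show "(\<phi> has_derivative (\<lambda>h. 0 \<bullet> h)) (at x)"
      by (rule has_derivative_transform_within_open)
  qed
  show "grad \<phi> x = 0" if "x \<notin> closure {x. \<phi> x \<noteq> 0}" using z' that .
  show "partial_deriv b \<phi> \<in> test_functions \<Omega>" if b: "b \<in> Basis" for b
  proof -
    have "Ck m (partial_deriv b \<phi>)" for m
      using Ck[of "Suc m"] b by simp
    moreover have "{x. partial_deriv b \<phi> x \<noteq> 0} \<subseteq> closure {x. \<phi> x \<noteq> 0}"
    proof
      fix x assume "x \<in> {x. partial_deriv b \<phi> x \<noteq> 0}"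
      then have *: "grad \<phi> x \<bullet> b \<noteq> 0" by (simp add: gr partial_deriv_def)
      show "x \<in> closure {x. \<phi> x \<noteq> 0}"
      proof (rule ccontr)
        assume "x \<notin> closure {x. \<phi> x \<noteq> 0}"
        from z'[OF this] * show False by simp
      qed
    qed
    then have sub: "closure {x. partial_deriv b \<phi> x \<noteq> 0} \<subseteq> closure {x. \<phi> x \<noteq> 0}"
      by (intro closure_minimal) auto
    moreover have "compact (closure {x. partial_deriv b \<phi> x \<noteq> 0})"
      using compact_Int_closed[OF cpt(1), of "closure {x. partial_deriv b \<phi> x \<noteq> 0}"] sub
      by (simp add: Int_absorb1)
    ultimately show ?thesis
      using cpt unfolding test_functions_def by blast
  qed
qed

lemma test_function_scale:
  assumes "\<phi> \<in> test_functions \<Omega>"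
  shows "(\<lambda>x. c * \<phi> x) \<in> test_functions \<Omega>" and "grad (\<lambda>x. c * \<phi> x) x = c *\<^sub>R grad \<phi> x"
proof -
  have pd: "partial_deriv b (\<lambda>x. c * f x) = (\<lambda>x. c * partial_deriv b f x)" if "\<And>x. f differentiable at x" for b f
  proof
    fix x
    have "((\<lambda>x. c * f x) has_derivative (\<lambda>h. c * frechet_derivative f (at x) h)) (at x)"
      using that[of x] by (intro has_derivative_mult_right) (simp add: frechet_derivative_works)
    from frechet_derivative_at[OF this] show "partial_deriv b (\<lambda>x. c * f x) x = c * partial_deriv b f x"
      unfolding partial_deriv_def by metis
  qed
  have "Ck m f \<Longrightarrow> Ck m (\<lambda>x. c * f x)" for m and f :: "'a \<Rightarrow> real"
  proof (induction m arbitrary: f)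
    case 0
    then show ?case by (auto intro!: continuous_intros)
  next
    case (Suc m)
    then have d: "f differentiable at x" for x by simp
    show ?case
      using Suc d by (auto simp: pd[OF d] intro!: differentiable_mult)
  qed
  moreover have Ck: "Ck m \<phi>" for m using assms by (simp add: test_functions_def)
  moreover have sub: "closure {x. c * \<phi> x \<noteq> 0} \<subseteq> closure {x. \<phi> x \<noteq> 0}"
    by (intro closure_mono) auto
  moreover have cpt: "compact (closure {x. \<phi> x \<noteq> 0})" "closure {x. \<phi> x \<noteq> 0} \<subseteq> \<Omega>"
    using assms by (auto simp: test_functions_def)
  moreover have "compact (closure {x. c * \<phi> x \<noteq> 0})"
    using compact_Int_closed[OF cpt(1), of "closure {x. c * \<phi> x \<noteq> 0}"] sub
    by (simp add: Int_absorb1)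
  ultimately show "(\<lambda>x. c * \<phi> x) \<in> test_functions \<Omega>"
    unfolding test_functions_def by blast
  have d: "\<phi> differentiable at x" for x using Ck[of "Suc 0"] by simp
  show "grad (\<lambda>x. c * \<phi> x) x = c *\<^sub>R grad \<phi> x"
    unfolding grad_def by (simp add: pd[OF d] scaleR_sum_right)
qed

lemma continuous_integrable_lebesgue_on:
  fixes f :: "'a::euclidean_space \<Rightarrow> real"
  assumes "bounded S" "S \<in> sets lebesgue" and f: "continuous_on UNIV f"
  shows "integrable (lebesgue_on S) f"
proof -
  have S: "S \<in> lmeasurable" using assms by (simp add: bounded_set_imp_lmeasurable)
  then interpret finite_measure "lebesgue_on S" by (rule finite_measure_lebesgue_on)
  have "compact (f ` closure S)"
    using assms by (intro compact_continuous_image) (auto intro: continuous_on_subset)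
  then obtain b where b: "\<And>x. x \<in> closure S \<Longrightarrow> norm (f x) \<le> b"
    by (meson bounded_iff compact_imp_bounded imageI)
  show ?thesis
  proof (rule integrable_const_bound[of _ b])
    show "AE x in lebesgue_on S. norm (f x) \<le> b"
      using b closure_subset by (intro AE_I2) auto
    show "f \<in> borel_measurable (lebesgue_on S)"
      using f by (intro continuous_imp_measurable_on_sets_lebesgue assms) (auto intro: continuous_on_subset)
  qed
qed

text \<open>Only the comparison function is known to be measurable; completeness of Lebesgue measure
  supplies the measurability of \<open>f\<close>.\<close>

lemma integral_AE_lebesgue_on:
  fixes f g :: "'a::euclidean_space \<Rightarrow> real"
  assumes S: "S \<in> sets lebesgue" and g: "g \<in> borel_measurable (lebesgue_on S)"
    and AE: "AE x in lebesgue_on S. f x = g x"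
  shows "(\<integral>x. f x \<partial>lebesgue_on S) = (\<integral>x. g x \<partial>lebesgue_on S)"
    "integrable (lebesgue_on S) g \<Longrightarrow> integrable (lebesgue_on S) f"
proof -
  have "AE x in lebesgue. (if x \<in> S then g x else 0) = (if x \<in> S then f x else 0)"
    using AE S by (subst (asm) AE_restrict_space_iff) auto
  from borel_measurable_AE[OF borel_measurable_if_I[OF g S] this]
  have f: "f \<in> borel_measurable (lebesgue_on S)"
    by (rule borel_measurable_if_D)
  show "(\<integral>x. f x \<partial>lebesgue_on S) = (\<integral>x. g x \<partial>lebesgue_on S)"
    by (rule integral_cong_AE[OF f g AE])
  show "integrable (lebesgue_on S) g \<Longrightarrow> integrable (lebesgue_on S) f"
    using integrable_cong_AE[OF f g AE] by simp
qed

lemma hho_form_nonneg: "\<sigma> \<ge> 0 \<Longrightarrow> hho_form k \<sigma> \<T> v v \<ge> 0"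
  for v :: "'a::euclidean_space hybrid"
proof -
  assume \<sigma>: "\<sigma> \<ge> 0"
  have "inverse (face_length T F) * (\<integral>x. f x * f x \<partial>M) \<ge> 0" for T F f and M :: "'a measure"
  proof -
    have "face_length T F \<ge> 0"
      unfolding face_length_def by (intro divide_nonneg_nonneg mult_nonneg_nonneg) auto
    moreover have "(\<integral>x. f x * f x \<partial>M) \<ge> 0"
      by (rule Bochner_Integration.integral_nonneg) simp
    ultimately show ?thesis by simp
  qed
  moreover have "(\<integral>x. f x * f x \<partial>M) \<ge> (0::real)" for f and M :: "'a measure"
    by (rule Bochner_Integration.integral_nonneg) simp
  moreover have "(\<integral>x. g x \<bullet> g x \<partial>M) \<ge> (0::real)" for g :: "'a \<Rightarrow> 'a" and M :: "'a measure"
    by (rule Bochner_Integration.integral_nonneg) simp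
  ultimately show ?thesis
    unfolding hho_form_def hho_stab_def broken_integral_def using \<sigma>
    by (intro add_nonneg_nonneg sum_nonneg mult_nonneg_nonneg[of \<sigma>] mult_nonneg_nonneg[of "\<sigma> * _"]) simp_all
qed

text \<open>The projections of f and of c f are chosen separately, so their norms are compared
  through orthogonality: testing both defining relations with both projections expresses one norm by
  the other.\<close>

lemma (in simplex_cell) integral_L2_proj_scale:
  assumes f: "continuous_on UNIV f"
  shows "(\<integral>x. (L2_proj (lebesgue_on T) 1 (\<lambda>x. c * f x) x)\<^sup>2 \<partial>lebesgue_on T)
    = c\<^sup>2 * (\<integral>x. (L2_proj (lebesgue_on T) 1 f x)\<^sup>2 \<partial>lebesgue_on T)"
proof -
  define q where "q = L2_proj (lebesgue_on T) 1 f"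
  define q' where "q' = L2_proj (lebesgue_on T) 1 (\<lambda>x. c * f x)"
  have cf: "continuous_on UNIV (\<lambda>x. c * f x)" by (intro continuous_intros f)
  note q = L2_proj_1[OF f, folded q_def] and q' = L2_proj_1[OF cf, folded q'_def]
  have c: "continuous_on UNIV q" "continuous_on UNIV q'"
    using q(1) q'(1) unfolding polys_1 by (auto intro!: continuous_intros)
  have i: "integrable U (\<lambda>x. f x * q x)" "integrable U (\<lambda>x. f x * q' x)" "integrable U (\<lambda>x. q x * q' x)"
    "integrable U (\<lambda>x. q x * q x)" "integrable U (\<lambda>x. q' x * q' x)" "integrable U (\<lambda>x. q' x * q x)"
    by (intro integrable_U continuous_intros c f)+
  note i' = i[THEN integrable_mult_right, of c]
  have 1: "c * (\<integral>x. f x * q' x \<partial>U) = (\<integral>x. q' x * q' x \<partial>U)"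
    using q'(2)[OF q'(1)] i i' by (simp add: left_diff_distrib mult.assoc)
  have 2: "(\<integral>x. f x * q' x \<partial>U) = (\<integral>x. q x * q' x \<partial>U)"
    using q(2)[OF q'(1)] i by (simp add: left_diff_distrib)
  have 3: "c * (\<integral>x. f x * q x \<partial>U) = (\<integral>x. q x * q' x \<partial>U)"
  proof -
    have "c * (\<integral>x. f x * q x \<partial>U) = (\<integral>x. q' x * q x \<partial>U)"
      using q'(2)[OF q(1)] i i' by (simp add: left_diff_distrib mult.assoc)
    also have "\<dots> = (\<integral>x. q x * q' x \<partial>U)"
      by (intro Bochner_Integration.integral_cong refl mult.commute)
    finally show ?thesis .
  qed
  have 4: "(\<integral>x. f x * q x \<partial>U) = (\<integral>x. q x * q x \<partial>U)"
    using q(2)[OF q(1)] i by (simp add: left_diff_distrib)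
  have "(\<integral>x. q' x * q' x \<partial>U) = c * (c * (\<integral>x. q x * q x \<partial>U))"
    unfolding 1[symmetric] 2 3[symmetric] 4 ..
  moreover have "(\<integral>x. (q x)\<^sup>2 \<partial>lebesgue_on T) = vol * (\<integral>x. q x * q x \<partial>U)"
    "(\<integral>x. (q' x)\<^sup>2 \<partial>lebesgue_on T) = vol * (\<integral>x. q' x * q' x \<partial>U)"
    unfolding power2_eq_square by (intro integral_T continuous_intros c)+
  ultimately show ?thesis
    unfolding q_def[symmetric] q'_def[symmetric] by (simp add: power2_eq_square)
qed

text \<open>The degrees are k + 1 and k for k = 0. The face part is the projection onto constants,
  written out as a mean so that it does not involve a choice.\<close>

definition interpolant :: "('a::euclidean_space \<Rightarrow> real) \<Rightarrow> 'a hybrid" where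
  "interpolant \<phi> = (\<lambda>T. L2_proj (lebesgue_on T) 1 \<phi>,
     \<lambda>F x. (\<integral>x. \<phi> x \<partial>face_measure F) / measure (face_measure F) F)"

locale triangulated_domain =
  fixes \<Omega> :: "'a::euclidean_space set" and \<T> :: "'a set set"
  assumes open_domain: "open \<Omega>" and bounded_domain: "bounded \<Omega>" and convex_domain: "convex \<Omega>"
    and mesh: "simplicial_mesh \<Omega> \<T>"
begin

lemma finite_mesh: "finite \<T>"
  using mesh by (simp add: simplicial_mesh_def triangulation_def)

lemma cell:
  assumes "T \<in> \<T>"
  obtains C where "simplex_cell C" "simplex_cell.T C = T" "convex hull C = T"
proof -
  have "int DIM('a) simplex T" using mesh assms by (simp add: simplicial_mesh_def)
  then obtain C where C: "\<not> affine_dependent C" "int (card C) = int DIM('a) + 1" "T = convex hull C"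
    unfolding simplex_def by blast
  have "simplex_cell C" by unfold_locales (use C in auto)
  moreover from simplex_cell.T_def[OF this] have "simplex_cell.T C = T"
    unfolding C(3) .
  ultimately show ?thesis
    using C(3)[symmetric] by (rule that)
qed

lemma compact_cell: "T \<in> \<T> \<Longrightarrow> compact T"
  using cell simplex_cell.compact_T by metis

lemma sets_cell [measurable]: "T \<in> \<T> \<Longrightarrow> T \<in> sets lebesgue"
  using compact_cell lmeasurable_compact by (metis fmeasurableD)

lemma sets_domain [measurable]: "\<Omega> \<in> sets lebesgue"
  using open_domain by (simp add: borel_open)

lemma measure_cell: "T \<in> \<T> \<Longrightarrow> measure lebesgue T > 0"
proof -
  assume "T \<in> \<T>"
  then obtain C where C: "simplex_cell C" "simplex_cell.T C = T" by (rule cell)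
  show ?thesis
    using simplex_cell.vol_pos[OF C(1)] by (simp add: simplex_cell.vol_def[OF C(1)] C(2))
qed

text \<open>The defects are the boundary of the convex set \<Omega> and the overlaps of cells. By
  conformity an overlap is a common face, and for distinct cells it is a proper face of at least one
  of them; it then lies in the frontier of a convex set, which is negligible.\<close>

lemma AE_mesh_cover: "AE x in lebesgue. indicator \<Omega> x = (\<Sum>T\<in>\<T>. indicator T x :: real)"
  and AE_cell_subset: "T \<in> \<T> \<Longrightarrow> AE x in lebesgue. x \<in> T \<longrightarrow> x \<in> \<Omega>"
proof -
  have overlap: "negligible (T \<inter> T')" if T: "T \<in> \<T>" "T' \<in> \<T>" "T \<noteq> T'" for T T'
  proof -
    have face: "(S \<inter> S') face_of S" if "S \<in> \<T>" "S' \<in> \<T>" for S S'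
      using mesh that by (auto simp: simplicial_mesh_def triangulation_def)
    have cv: "convex S" "closed S" if "S \<in> \<T>" for S
      using cell[OF that] convex_convex_hull compact_imp_closed[OF compact_cell[OF that]] by metis+
    have *: "negligible (S \<inter> S')" if S: "S \<in> \<T>" "S' \<in> \<T>" "S \<inter> S' \<noteq> S" for S S'
    proof (rule negligible_subset)
      show "negligible (frontier S)" using cv[OF S(1)] by (intro negligible_convex_frontier)
      have "S \<inter> S' \<subseteq> S - rel_interior S"
        by (rule face_of_subset_rel_boundary[OF face[OF S(1,2)] S(3)])
      then show "S \<inter> S' \<subseteq> frontier S"
        using interior_subset_rel_interior[of S] cv[OF S(1)] by (auto simp: frontier_def closure_closed)
    qed
    show ?thesis
    proof (cases "T \<inter> T' = T")
      case True
      then have "T' \<inter> T \<noteq> T'" using T(3) by auto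
      then have "negligible (T' \<inter> T)" using *[OF T(2,1)] by simp
      then show ?thesis by (simp add: Int_commute)
    next
      case False
      then show ?thesis using *[OF T(1,2)] by simp
    qed
  qed
  define N where "N = frontier \<Omega> \<union> (\<Union>T\<in>\<T>. \<Union>T'\<in>\<T> - {T}. T \<inter> T')"
  have "negligible N"
    unfolding N_def
  proof (intro negligible_Un negligible_Union ballI negligible_convex_frontier convex_domain)
    show "finite ((\<lambda>T. \<Union>T'\<in>\<T> - {T}. T \<inter> T') ` \<T>)" using finite_mesh by simp
    fix X assume "X \<in> (\<lambda>T. \<Union>T'\<in>\<T> - {T}. T \<inter> T') ` \<T>"
    then obtain T where T: "T \<in> \<T>" "X = (\<Union>T'\<in>\<T> - {T}. T \<inter> T')" by blast
    have "negligible (\<Union>((\<lambda>T'. T \<inter> T') ` (\<T> - {T})))"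
    proof (rule negligible_Union)
      show "finite ((\<lambda>T'. T \<inter> T') ` (\<T> - {T}))" using finite_mesh by simp
      fix Y assume "Y \<in> (\<lambda>T'. T \<inter> T') ` (\<T> - {T})"
      then show "negligible Y" using overlap[OF T(1)] by auto
    qed
    then show "negligible X" unfolding T(2) .
  qed
  then have "N \<in> null_sets lebesgue"
    by (simp add: negligible_iff_null_sets)
  then have AE: "AE x in lebesgue. x \<notin> N"
    by (rule AE_not_in)
  have cover: "\<Union>\<T> = closure \<Omega>" using mesh by (simp add: simplicial_mesh_def)
  have int: "interior \<Omega> = \<Omega>" using open_domain by (rule interior_open)
  show "AE x in lebesgue. x \<in> T \<longrightarrow> x \<in> \<Omega>" if T: "T \<in> \<T>" for T
    using AE
  proof eventually_elim
    fix x assume "x \<notin> N"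
    then show "x \<in> T \<longrightarrow> x \<in> \<Omega>"
      using cover T int by (auto simp: N_def frontier_def)
  qed
  show "AE x in lebesgue. indicator \<Omega> x = (\<Sum>T\<in>\<T>. indicator T x :: real)"
    using AE
  proof eventually_elim
    fix x assume x: "x \<notin> N"
    show "indicator \<Omega> x = (\<Sum>T\<in>\<T>. indicator T x :: real)"
    proof (cases "x \<in> \<Omega>")
      case True
      then have "x \<in> \<Union>\<T>" unfolding cover by (rule subsetD[OF closure_subset])
      then obtain T where T: "T \<in> \<T>" "x \<in> T" by blast
      have "indicator T' x = (if T' = T then 1 else 0 :: real)" if "T' \<in> \<T>" for T'
      proof (cases "T' = T")
        case False
        have "x \<notin> T'"
        proof
          assume "x \<in> T'"
          then have "x \<in> (\<Union>T\<in>\<T>. \<Union>T'\<in>\<T> - {T}. T \<inter> T')"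
            using T that False by blast
          then show False using x unfolding N_def by blast
        qed
        then show ?thesis using False by simp
      qed (use T in simp)
      then have "(\<Sum>T\<in>\<T>. indicator T x :: real) = (\<Sum>T'\<in>\<T>. if T' = T then 1 else 0)"
        by (intro sum.cong) auto
      then show ?thesis using True T finite_mesh by simp
    next
      case False
      then have "x \<notin> closure \<Omega>" using x int by (auto simp: N_def frontier_def)
      then have "indicator T x = (0 :: real)" if "T \<in> \<T>" for T
      proof -
        have "x \<notin> \<Union>\<T>" unfolding cover by fact
        then have "x \<notin> T" using that by blast
        then show ?thesis by simp
      qed
      then show ?thesis using False by simp
    qed
  qed
qed

lemma AE_cell:
  assumes T: "T \<in> \<T>" and P: "AE x in lebesgue_on \<Omega>. P x"
  shows "AE x in lebesgue_on T. P x"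
proof -
  have "AE x in lebesgue. x \<in> \<Omega> \<longrightarrow> P x"
    using P by (subst (asm) AE_restrict_space_iff) auto
  with AE_cell_subset[OF T] have "AE x in lebesgue. x \<in> T \<longrightarrow> P x"
    by eventually_elim auto
  then show ?thesis
    using T by (subst AE_restrict_space_iff) auto
qed

text \<open>The closed cells reach the boundary of \<Omega>, where nothing is known about
  \<open>f\<close>. The integrals are therefore computed for \<open>f\<close> cut off outside
  \<Omega>, which agrees with \<open>f\<close> almost everywhere on each cell.\<close>

lemma mesh_split:
  fixes f :: "'a \<Rightarrow> real"
  assumes f: "integrable (lebesgue_on \<Omega>) f"
  shows integrable_cell: "T \<in> \<T> \<Longrightarrow> integrable (lebesgue_on T) f"
    and integral_mesh: "(\<integral>x. f x \<partial>lebesgue_on \<Omega>) = (\<Sum>T\<in>\<T>. \<integral>x. f x \<partial>lebesgue_on T)"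
proof -
  define g where "g x = indicator \<Omega> x * f x" for x
  have g: "integrable lebesgue g"
    using f unfolding g_def by (subst (asm) integrable_restrict_space) auto
  have gT: "integrable (lebesgue_on T) g" if T: "T \<in> \<T>" for T
    using integrable_mult_indicator[OF sets_cell[OF T] g] T by (subst integrable_restrict_space) auto
  have fg: "AE x in lebesgue_on T. f x = g x" if T: "T \<in> \<T>" for T
  proof -
    have "AE x in lebesgue_on \<Omega>. f x = g x"
      by (rule AE_I2) (auto simp: g_def)
    then show ?thesis by (rule AE_cell[OF T])
  qed
  have fT: "integrable (lebesgue_on T) f" "(\<integral>x. f x \<partial>lebesgue_on T) = (\<integral>x. indicator T x * g x \<partial>lebesgue)" if T: "T \<in> \<T>" for T
  proof -
    note * = integral_AE_lebesgue_on[OF sets_cell[OF T] borel_measurable_integrable[OF gT[OF T]] fg[OF T]]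
    show "integrable (lebesgue_on T) f" using *(2) gT[OF T] by simp
    show "(\<integral>x. f x \<partial>lebesgue_on T) = (\<integral>x. indicator T x * g x \<partial>lebesgue)"
      using *(1) T by (simp add: integral_restrict_space)
  qed
  show "integrable (lebesgue_on T) f" if "T \<in> \<T>" for T using fT(1) that .
  have i: "integrable lebesgue (\<lambda>x. indicator T x * g x)" if T: "T \<in> \<T>" for T
    using integrable_mult_indicator[OF sets_cell[OF T] g] by simp
  have "(\<integral>x. f x \<partial>lebesgue_on \<Omega>) = (\<integral>x. g x \<partial>lebesgue)"
    unfolding g_def by (subst integral_restrict_space) auto
  also have "\<dots> = (\<integral>x. (\<Sum>T\<in>\<T>. indicator T x * g x) \<partial>lebesgue)"
  proof (rule integral_cong_AE)
    show "AE x in lebesgue. g x = (\<Sum>T\<in>\<T>. indicator T x * g x)"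
      using AE_mesh_cover
    proof eventually_elim
      fix x assume *: "indicator \<Omega> x = (\<Sum>T\<in>\<T>. indicator T x :: real)"
      have "g x = indicator \<Omega> x * g x" by (simp add: g_def indicator_def)
      then show "g x = (\<Sum>T\<in>\<T>. indicator T x * g x)"
        unfolding * by (simp add: sum_distrib_right)
    qed
    show "g \<in> borel_measurable lebesgue" using g by (rule borel_measurable_integrable)
    show "(\<lambda>x. \<Sum>T\<in>\<T>. indicator T x * g x) \<in> borel_measurable lebesgue"
      by (intro borel_measurable_sum borel_measurable_integrable[OF i])
  qed
  also have "\<dots> = (\<Sum>T\<in>\<T>. \<integral>x. indicator T x * g x \<partial>lebesgue)"
    by (rule Bochner_Integration.integral_sum) (rule i)
  also have "\<dots> = (\<Sum>T\<in>\<T>. \<integral>x. f x \<partial>lebesgue_on T)"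
    by (intro sum.cong refl) (simp add: fT(2))
  finally show "(\<integral>x. f x \<partial>lebesgue_on \<Omega>) = (\<Sum>T\<in>\<T>. \<integral>x. f x \<partial>lebesgue_on T)" .
qed

end

section \<open>The global interpolant and its discrete energy\<close>

context triangulated_domain
begin

lemma mesh_nonneg_size: "T \<in> \<T> \<Longrightarrow> 0 \<le> diameter T \<and> diameter T \<le> mesh_size \<T>"
  unfolding mesh_size_def using finite_mesh compact_cell[of T]
  by (auto intro: diameter_ge_0 compact_imp_bounded)

text \<open>Boundary faces lie outside the open set \<Omega>, where test functions vanish, so the
  face means there are zero.\<close>

lemma interpolant_hho_U:
  assumes \<phi>: "\<phi> \<in> test_functions \<Omega>"
  shows "interpolant \<phi> \<in> hho_U 0 \<Omega> \<T>"
proof -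
  have "L2_proj (lebesgue_on T) 1 \<phi> \<in> polys 1" if T: "T \<in> \<T>" for T
  proof -
    obtain C where C: "simplex_cell C" "simplex_cell.T C = T" "convex hull C = T" using T by (rule cell)
    show ?thesis
      using simplex_cell.L2_proj_1(1)[OF C(1) test_functionD(3)[OF \<phi>]] by (simp add: C(2))
  qed
  moreover have "(\<lambda>x. (\<integral>x. \<phi> x \<partial>face_measure F) / measure (face_measure F) F) \<in> polys 0" for F
    unfolding polys_0 by blast
  moreover have "(\<integral>x. \<phi> x \<partial>face_measure F) = 0" if F: "F \<in> boundary_faces \<Omega> \<T>" for F
  proof -
    have "(\<integral>x. \<phi> x \<partial>face_measure F) = (\<integral>x. 0 \<partial>face_measure F)"
    proof (rule Bochner_Integration.integral_cong[OF refl])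
      fix x assume "x \<in> space (face_measure F)"
      then have "x \<in> F"
        by (simp add: face_measure_def space_restrict_space)
      then have "x \<in> frontier \<Omega>"
        using F by (auto simp: boundary_faces_def)
      then have "x \<notin> \<Omega>"
        using open_domain by (simp add: frontier_def interior_open)
      then show "\<phi> x = 0" by (rule test_functionD(4)[OF \<phi>])
    qed
    then show ?thesis by simp
  qed
  ultimately show ?thesis
    unfolding hho_U_def hho_V_def piecewise_polys_def interpolant_def
    by (intro CollectI conjI ballI SigmaI) simp_all
qed

text \<open>Summation over the elements. Since the local errors are nonnegative, the local diameters
  may be enlarged to \<open>mesh_size\<close>.\<close>

lemma interpolant_estimate:
  assumes dim: "DIM('a) \<in> {2, 3}" and \<sigma>: "\<sigma> \<ge> 0" and \<phi>: "\<phi> \<in> test_functions \<Omega>"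
  obtains W where "W \<ge> 0"
    "hho_form 0 \<sigma> \<T> (interpolant \<phi>) (interpolant \<phi>)
      \<le> (\<integral>x. (norm (grad \<phi> x))\<^sup>2 \<partial>lebesgue_on \<Omega>) - (1 - \<sigma> * (1 / pi\<^sup>2 + C_tr DIM('a))) * W"
    "(\<integral>x. (\<phi> x)\<^sup>2 \<partial>lebesgue_on \<Omega>) - broken_integral \<T> (\<lambda>T x. (fst (interpolant \<phi>) T x)\<^sup>2) \<le> (mesh_size \<T>)\<^sup>2 / pi\<^sup>2 * W"
    "broken_integral \<T> (\<lambda>T x. (fst (interpolant \<phi>) T x)\<^sup>2) \<le> (\<integral>x. (\<phi> x)\<^sup>2 \<partial>lebesgue_on \<Omega>)"
proof -
  define v where "v = interpolant \<phi>"
  define A where "A = 1 - \<sigma> * (1 / pi\<^sup>2 + C_tr DIM('a))"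
  define L where "L T = (\<integral>x. grad (reconstruction 0 v T) x \<bullet> grad (reconstruction 0 v T) x \<partial>lebesgue_on T)
     + (\<sigma> * (\<Sum>F\<in>elem_faces T. inverse (face_length T F) *
              integral\<^sup>L (face_measure F)
                (\<lambda>x. face_proj 0 F (\<lambda>y. snd v F y - reconstruction 0 v T y) x *
                     face_proj 0 F (\<lambda>y. snd v F y - reconstruction 0 v T y) x))
      + \<sigma> * inverse ((diameter T)\<^sup>2) *
          integral\<^sup>L (lebesgue_on T)
            (\<lambda>x. (fst v T x - reconstruction 0 v T x) * (fst v T x - reconstruction 0 v T x)))" for T
  have ex: "\<forall>T\<in>\<T>. \<exists>Ew. Ew \<ge> 0 \<and> L T \<le> (\<integral>x. (norm (grad \<phi> x))\<^sup>2 \<partial>lebesgue_on T) - A * Ew \<and>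
     (\<integral>x. (\<phi> x)\<^sup>2 \<partial>lebesgue_on T) - (\<integral>x. (fst v T x)\<^sup>2 \<partial>lebesgue_on T) \<le> (diameter T)\<^sup>2 / pi\<^sup>2 * Ew \<and>
     (\<integral>x. (fst v T x)\<^sup>2 \<partial>lebesgue_on T) \<le> (\<integral>x. (\<phi> x)\<^sup>2 \<partial>lebesgue_on T)"
  proof
    fix T assume T: "T \<in> \<T>"
    obtain C where C: "simplex_cell C" "simplex_cell.T C = T" "convex hull C = T" using T by (rule cell)
    have f: "fst v T = L2_proj (lebesgue_on T) 1 \<phi>"
      by (simp add: v_def interpolant_def)
    have s: "snd v F = (\<lambda>x. (\<integral>x. \<phi> x \<partial>face_measure F) / measure (face_measure F) F)" for F
      by (simp add: v_def interpolant_def)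
    obtain Ew where "Ew \<ge> 0" "L T \<le> (\<integral>x. (norm (grad \<phi> x))\<^sup>2 \<partial>lebesgue_on T) - A * Ew"
     "(\<integral>x. (\<phi> x)\<^sup>2 \<partial>lebesgue_on T) - (\<integral>x. (fst v T x)\<^sup>2 \<partial>lebesgue_on T) \<le> (diameter T)\<^sup>2 / pi\<^sup>2 * Ew"
     "(\<integral>x. (fst v T x)\<^sup>2 \<partial>lebesgue_on T) \<le> (\<integral>x. (\<phi> x)\<^sup>2 \<partial>lebesgue_on T)"
      by (rule simplex_cell.cell_estimate[OF C(1) dim \<sigma> test_functionD(1,2)[OF \<phi>], unfolded C(2), OF f s,
          folded L_def A_def]) (rule that)
    then show "\<exists>Ew. Ew \<ge> 0 \<and> L T \<le> (\<integral>x. (norm (grad \<phi> x))\<^sup>2 \<partial>lebesgue_on T) - A * Ew \<and>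
     (\<integral>x. (\<phi> x)\<^sup>2 \<partial>lebesgue_on T) - (\<integral>x. (fst v T x)\<^sup>2 \<partial>lebesgue_on T) \<le> (diameter T)\<^sup>2 / pi\<^sup>2 * Ew \<and>
     (\<integral>x. (fst v T x)\<^sup>2 \<partial>lebesgue_on T) \<le> (\<integral>x. (\<phi> x)\<^sup>2 \<partial>lebesgue_on T)"
      by (intro exI[of _ Ew] conjI)
  qed
  from bchoice[OF ex] obtain Ew where Ew: "\<And>T. T \<in> \<T> \<Longrightarrow> Ew T \<ge> 0"
    "\<And>T. T \<in> \<T> \<Longrightarrow> L T \<le> (\<integral>x. (norm (grad \<phi> x))\<^sup>2 \<partial>lebesgue_on T) - A * Ew T"
    "\<And>T. T \<in> \<T> \<Longrightarrow> (\<integral>x. (\<phi> x)\<^sup>2 \<partial>lebesgue_on T) - (\<integral>x. (fst v T x)\<^sup>2 \<partial>lebesgue_on T) \<le> (diameter T)\<^sup>2 / pi\<^sup>2 * Ew T"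
    "\<And>T. T \<in> \<T> \<Longrightarrow> (\<integral>x. (fst v T x)\<^sup>2 \<partial>lebesgue_on T) \<le> (\<integral>x. (\<phi> x)\<^sup>2 \<partial>lebesgue_on T)"
    by blast
  have int: "(\<integral>x. (norm (grad \<phi> x))\<^sup>2 \<partial>lebesgue_on \<Omega>) = (\<Sum>T\<in>\<T>. \<integral>x. (norm (grad \<phi> x))\<^sup>2 \<partial>lebesgue_on T)"
    "(\<integral>x. (\<phi> x)\<^sup>2 \<partial>lebesgue_on \<Omega>) = (\<Sum>T\<in>\<T>. \<integral>x. (\<phi> x)\<^sup>2 \<partial>lebesgue_on T)"
    by (intro integral_mesh continuous_integrable_lebesgue_on bounded_domain sets_domain
        continuous_intros test_functionD(2,3)[OF \<phi>])+
  have m: "broken_integral \<T> (\<lambda>T x. (fst (interpolant \<phi>) T x)\<^sup>2) = (\<Sum>T\<in>\<T>. \<integral>x. (fst v T x)\<^sup>2 \<partial>lebesgue_on T)"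
    unfolding broken_integral_def v_def ..
  show ?thesis
  proof (rule that[of "\<Sum>T\<in>\<T>. Ew T"])
    show "(\<Sum>T\<in>\<T>. Ew T) \<ge> 0" by (intro sum_nonneg Ew)
    have "hho_form 0 \<sigma> \<T> v v = (\<Sum>T\<in>\<T>. L T)"
      unfolding hho_form_def hho_stab_def broken_integral_def L_def sum.distrib ..
    also have "\<dots> \<le> (\<Sum>T\<in>\<T>. (\<integral>x. (norm (grad \<phi> x))\<^sup>2 \<partial>lebesgue_on T) - A * Ew T)"
      by (intro sum_mono Ew)
    finally show "hho_form 0 \<sigma> \<T> (interpolant \<phi>) (interpolant \<phi>)
      \<le> (\<integral>x. (norm (grad \<phi> x))\<^sup>2 \<partial>lebesgue_on \<Omega>) - (1 - \<sigma> * (1 / pi\<^sup>2 + C_tr DIM('a))) * (\<Sum>T\<in>\<T>. Ew T)"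
      unfolding int A_def[symmetric] v_def[symmetric] by (simp add: sum_subtractf sum_distrib_left)
    show "broken_integral \<T> (\<lambda>T x. (fst (interpolant \<phi>) T x)\<^sup>2) \<le> (\<integral>x. (\<phi> x)\<^sup>2 \<partial>lebesgue_on \<Omega>)"
      unfolding m int by (intro sum_mono Ew)
    have "(\<integral>x. (\<phi> x)\<^sup>2 \<partial>lebesgue_on \<Omega>) - broken_integral \<T> (\<lambda>T x. (fst (interpolant \<phi>) T x)\<^sup>2)
      = (\<Sum>T\<in>\<T>. (\<integral>x. (\<phi> x)\<^sup>2 \<partial>lebesgue_on T) - (\<integral>x. (fst v T x)\<^sup>2 \<partial>lebesgue_on T))"
      unfolding m int by (simp add: sum_subtractf)
    also have "\<dots> \<le> (\<Sum>T\<in>\<T>. (mesh_size \<T>)\<^sup>2 / pi\<^sup>2 * Ew T)"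
    proof (rule sum_mono)
      fix T assume T: "T \<in> \<T>"
      have "(diameter T)\<^sup>2 / pi\<^sup>2 * Ew T \<le> (mesh_size \<T>)\<^sup>2 / pi\<^sup>2 * Ew T"
        using mesh_nonneg_size[OF T] Ew(1)[OF T]
        by (intro mult_right_mono divide_right_mono power_mono) auto
      with Ew(3)[OF T] show "(\<integral>x. (\<phi> x)\<^sup>2 \<partial>lebesgue_on T) - (\<integral>x. (fst v T x)\<^sup>2 \<partial>lebesgue_on T) \<le> (mesh_size \<T>)\<^sup>2 / pi\<^sup>2 * Ew T"
        by linarith
    qed
    finally show "(\<integral>x. (\<phi> x)\<^sup>2 \<partial>lebesgue_on \<Omega>) - broken_integral \<T> (\<lambda>T x. (fst (interpolant \<phi>) T x)\<^sup>2)
      \<le> (mesh_size \<T>)\<^sup>2 / pi\<^sup>2 * (\<Sum>T\<in>\<T>. Ew T)"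
      by (simp add: sum_distrib_left)
  qed
qed

lemma cell_projection:
  assumes dim: "DIM('a) \<in> {2, 3}" and \<phi>: "\<phi> \<in> test_functions \<Omega>" and T: "T \<in> \<T>"
  shows "(\<integral>x. (fst (interpolant \<phi>) T x)\<^sup>2 \<partial>lebesgue_on T) \<le> (\<integral>x. (\<phi> x)\<^sup>2 \<partial>lebesgue_on T)"
    and "mesh_proj 0 (fst (interpolant \<phi>)) T = (\<lambda>x. (\<integral>x. \<phi> x \<partial>lebesgue_on T) / measure lebesgue T)"
    and "continuous_on UNIV (fst (interpolant \<phi>) T)"
    and "(\<integral>x. (fst (interpolant (\<lambda>x. c * \<phi> x)) T x)\<^sup>2 \<partial>lebesgue_on T)
      = c\<^sup>2 * (\<integral>x. (fst (interpolant \<phi>) T x)\<^sup>2 \<partial>lebesgue_on T)"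
proof -
  obtain C where C: "simplex_cell C" "simplex_cell.T C = T" "convex hull C = T" using T by (rule cell)
  have f: "fst (interpolant \<phi>) T = L2_proj (lebesgue_on T) 1 \<phi>"
    by (simp add: interpolant_def)
  have s: "snd (interpolant \<phi>) F = (\<lambda>x. (\<integral>x. \<phi> x \<partial>face_measure F) / measure (face_measure F) F)" for F
    by (simp add: interpolant_def)
  note est = simplex_cell.cell_estimate[OF C(1) dim order_refl test_functionD(1,2)[OF \<phi>], unfolded C(2), OF f s]
  show "(\<integral>x. (fst (interpolant \<phi>) T x)\<^sup>2 \<partial>lebesgue_on T) \<le> (\<integral>x. (\<phi> x)\<^sup>2 \<partial>lebesgue_on T)"
    by (rule est)
  have "L2_proj (lebesgue_on T) 0 (fst (interpolant \<phi>) T) = (\<lambda>x. \<integral>x. \<phi> x \<partial>simplex_cell.U C)"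
    by (rule est)
  moreover have "(\<integral>x. \<phi> x \<partial>simplex_cell.U C) = (\<integral>x. \<phi> x \<partial>lebesgue_on T) / measure lebesgue T"
    using simplex_cell.integral_T[OF C(1) test_functionD(3)[OF \<phi>]] simplex_cell.vol_pos[OF C(1)]
    unfolding simplex_cell.vol_def[OF C(1)] C(2) by simp
  ultimately show "mesh_proj 0 (fst (interpolant \<phi>)) T = (\<lambda>x. (\<integral>x. \<phi> x \<partial>lebesgue_on T) / measure lebesgue T)"
    by simp
  have "fst (interpolant \<phi>) T \<in> polys 1"
    by (rule est)
  then show "continuous_on UNIV (fst (interpolant \<phi>) T)"
    unfolding polys_1 by (auto intro!: continuous_intros)
  show "(\<integral>x. (fst (interpolant (\<lambda>x. c * \<phi> x)) T x)\<^sup>2 \<partial>lebesgue_on T)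
      = c\<^sup>2 * (\<integral>x. (fst (interpolant \<phi>) T x)\<^sup>2 \<partial>lebesgue_on T)"
    using simplex_cell.integral_L2_proj_scale[OF C(1) test_functionD(3)[OF \<phi>], of c]
    unfolding interpolant_def fst_conv C(2) .
qed

text \<open>On a cell the potential is a nonnegative constant, so the potential energy there is a
  multiple of a squared L^2 norm, and the projection is a contraction of that norm.\<close>

lemma interpolant_potential:
  assumes dim: "DIM('a) \<in> {2, 3}" and \<phi>: "\<phi> \<in> test_functions \<Omega>"
    and V: "integrable (lebesgue_on \<Omega>) (\<lambda>x. V x * \<phi> x * \<phi> x)" "AE x in lebesgue_on \<Omega>. V x \<ge> 0" "piecewise_constant \<T> V"
  shows "broken_integral \<T> (\<lambda>T x. V x * fst (interpolant \<phi>) T x * fst (interpolant \<phi>) T x)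
    \<le> (\<integral>x. V x * \<phi> x * \<phi> x \<partial>lebesgue_on \<Omega>)"
  unfolding broken_integral_def integral_mesh[OF V(1)]
proof (rule sum_mono)
  fix T assume T: "T \<in> \<T>"
  define q where "q = fst (interpolant \<phi>) T"
  have cq: "continuous_on UNIV q" unfolding q_def by (rule cell_projection(3)[OF dim \<phi> T])
  obtain c where c: "c \<in> piecewise_polys 0 \<T>" "AE x in lebesgue_on T. V x = c T x"
    using V(3) T unfolding piecewise_constant_def by blast
  then obtain k where k: "c T = (\<lambda>x. k)"
    using T unfolding piecewise_polys_def polys_0 by blast
  have Vk: "AE x in lebesgue_on T. V x = k" using c(2) by (simp add: k)
  \<comment> \<open>A negative constant would contradict V >= 0 almost everywhere because cells have
    positive measure.\<close>
  have k0: "k \<ge> 0"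
  proof (rule ccontr)
    assume "\<not> k \<ge> 0"
    have "AE x in lebesgue_on T. V x \<ge> 0" by (rule AE_cell[OF T V(2)])
    with Vk have "AE x in lebesgue_on T. False"
      by eventually_elim (use \<open>\<not> k \<ge> 0\<close> in auto)
    then have "AE x in lebesgue. x \<notin> T"
      using T by (subst (asm) AE_restrict_space_iff) auto
    then have "T \<in> null_sets lebesgue"
      using T by (subst (asm) AE_iff_null_sets[symmetric]) auto
    then have "measure lebesgue T = 0"
      by (simp add: measure_eq_0_null_sets)
    then show False using measure_cell[OF T] by simp
  qed
  have b: "bounded T" using compact_cell[OF T] by (rule compact_imp_bounded)
  have eq: "(\<integral>x. V x * f x * f x \<partial>lebesgue_on T) = k * (\<integral>x. (f x)\<^sup>2 \<partial>lebesgue_on T)" if f: "continuous_on UNIV f" for f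
  proof -
    have i: "integrable (lebesgue_on T) (\<lambda>x. k * (f x)\<^sup>2)"
      using b T f by (intro continuous_integrable_lebesgue_on continuous_intros) auto
    have "(\<integral>x. V x * f x * f x \<partial>lebesgue_on T) = (\<integral>x. k * (f x)\<^sup>2 \<partial>lebesgue_on T)"
    proof (rule integral_AE_lebesgue_on(1)[OF sets_cell[OF T] borel_measurable_integrable[OF i]])
      show "AE x in lebesgue_on T. V x * f x * f x = k * (f x)\<^sup>2"
        using Vk by eventually_elim (simp add: power2_eq_square)
    qed
    then show ?thesis by simp
  qed
  have "(\<integral>x. V x * q x * q x \<partial>lebesgue_on T) \<le> (\<integral>x. V x * \<phi> x * \<phi> x \<partial>lebesgue_on T)"
    unfolding eq[OF cq] eq[OF test_functionD(3)[OF \<phi>]] unfolding q_def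
    by (intro mult_left_mono cell_projection(1)[OF dim \<phi> T] k0)
  then show "(\<integral>x. V x * fst (interpolant \<phi>) T x * fst (interpolant \<phi>) T x \<partial>lebesgue_on T) \<le> (\<integral>x. V x * \<phi> x * \<phi> x \<partial>lebesgue_on T)"
    unfolding q_def .
qed

text \<open>The projection preserves cell means, so the modified density is constant on each cell
  and the contraction applies again. The bound keeps the cell means of \<phi> because they survive
  L^2 limits.\<close>

lemma interpolant_nonlinearity:
  assumes dim: "DIM('a) \<in> {2, 3}" and \<phi>: "\<phi> \<in> test_functions \<Omega>"
  shows "broken_integral \<T> (\<lambda>T x. \<bar>mesh_proj 0 (fst (interpolant \<phi>)) T x\<bar>\<^sup>2 * fst (interpolant \<phi>) T x * fst (interpolant \<phi>) T x)
    \<le> (\<Sum>T\<in>\<T>. ((\<integral>x. \<phi> x \<partial>lebesgue_on T) / measure lebesgue T)\<^sup>2 * (\<integral>x. (\<phi> x)\<^sup>2 \<partial>lebesgue_on T))"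
  unfolding broken_integral_def
proof (rule sum_mono)
  fix T assume T: "T \<in> \<T>"
  define r where "r = (\<integral>x. \<phi> x \<partial>lebesgue_on T) / measure lebesgue T"
  have "(\<integral>x. \<bar>mesh_proj 0 (fst (interpolant \<phi>)) T x\<bar>\<^sup>2 * fst (interpolant \<phi>) T x * fst (interpolant \<phi>) T x \<partial>lebesgue_on T)
    = r\<^sup>2 * (\<integral>x. (fst (interpolant \<phi>) T x)\<^sup>2 \<partial>lebesgue_on T)"
    unfolding cell_projection(2)[OF dim \<phi> T] r_def[symmetric] by (simp add: power2_eq_square mult.assoc)
  also have "\<dots> \<le> r\<^sup>2 * (\<integral>x. (\<phi> x)\<^sup>2 \<partial>lebesgue_on T)"
    by (intro mult_left_mono cell_projection(1)[OF dim \<phi> T]) simp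
  finally show "(\<integral>x. \<bar>mesh_proj 0 (fst (interpolant \<phi>)) T x\<bar>\<^sup>2 * fst (interpolant \<phi>) T x * fst (interpolant \<phi>) T x \<partial>lebesgue_on T)
    \<le> ((\<integral>x. \<phi> x \<partial>lebesgue_on T) / measure lebesgue T)\<^sup>2 * (\<integral>x. (\<phi> x)\<^sup>2 \<partial>lebesgue_on T)"
    unfolding r_def .
qed

text \<open>The scaling \<open>M\<^sup>2\<close> on the left compensates for the fact that the interpolant of a normalised
  function is not normalised.\<close>

lemma test_function_bound:
  fixes \<phi> V :: "'a \<Rightarrow> real"
  assumes dim: "DIM('a) \<in> {2, 3}" and \<sigma>: "\<sigma> \<ge> 0" and \<kappa>: "\<kappa> \<ge> 0" and \<phi>: "\<phi> \<in> test_functions \<Omega>"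
    and V: "\<And>\<phi>. \<phi> \<in> test_functions \<Omega> \<Longrightarrow> integrable (lebesgue_on \<Omega>) (\<lambda>x. V x * \<phi> x * \<phi> x)"
      "AE x in lebesgue_on \<Omega>. V x \<ge> 0" "piecewise_constant \<T> V"
    and min: "\<And>v. v \<in> hho_U 0 \<Omega> \<T> \<Longrightarrow> broken_L2_norm \<T> (fst v) = 1 \<Longrightarrow> E \<le> hho_energy0 0 \<sigma> \<T> V \<kappa> v"
    and E: "E \<ge> 0"
    and condition: "1 - \<sigma> * (1 / pi\<^sup>2 + C_tr DIM('a)) - 4 * (mesh_size \<T>)\<^sup>2 * E / pi\<^sup>2 \<ge> 0"
  defines "M \<equiv> \<integral>x. (\<phi> x)\<^sup>2 \<partial>lebesgue_on \<Omega>" and "D \<equiv> \<integral>x. (norm (grad \<phi> x))\<^sup>2 \<partial>lebesgue_on \<Omega>"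
    and "P \<equiv> \<integral>x. V x * \<phi> x * \<phi> x \<partial>lebesgue_on \<Omega>"
    and "N \<equiv> \<Sum>T\<in>\<T>. ((\<integral>x. \<phi> x \<partial>lebesgue_on T) / measure lebesgue T)\<^sup>2 * (\<integral>x. (\<phi> x)\<^sup>2 \<partial>lebesgue_on T)"
  shows "E * M\<^sup>2 \<le> M / 2 * (D + P) + \<kappa> / 4 * N"
proof -
  define A where "A = 1 - \<sigma> * (1 / pi\<^sup>2 + C_tr DIM('a))"
  define k where "k = (mesh_size \<T>)\<^sup>2 / pi\<^sup>2"
  have k0: "k \<ge> 0" unfolding k_def by simp
  have A: "4 * k * E \<le> A"
    using condition unfolding A_def k_def by simp
  define m where "m = broken_integral \<T> (\<lambda>T x. (fst (interpolant \<phi>) T x)\<^sup>2)"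
  have m0: "m \<ge> 0"
    unfolding m_def broken_integral_def by (intro sum_nonneg Bochner_Integration.integral_nonneg) simp
  have M0: "M \<ge> 0" unfolding M_def by simp
  have P0: "P \<ge> 0"
    unfolding P_def using V(2) by (intro integral_nonneg_AE) (auto elim!: eventually_mono simp: mult.assoc)
  have N0: "N \<ge> 0"
    unfolding N_def by (intro sum_nonneg mult_nonneg_nonneg) auto
  show ?thesis
  proof (cases "m = 0")
    \<comment> \<open>An interpolant of mass zero cannot be normalised. But then all the mass is
      lost, and the bound on the lost mass alone gives \<open>4 * E * M \<le> D\<close>.\<close>
    case True
    obtain W where W: "W \<ge> 0" "hho_form 0 \<sigma> \<T> (interpolant \<phi>) (interpolant \<phi>) \<le> D - A * W" "M - m \<le> k * W"
      by (rule interpolant_estimate[OF dim \<sigma> \<phi>, folded D_def M_def m_def A_def k_def]) (rule that)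
    have "4 * E * M \<le> 4 * E * (k * W)"
      using W(3) True E by (intro mult_left_mono) auto
    also have "\<dots> = (4 * k * E) * W" by simp
    also have "\<dots> \<le> A * W" using A W(1) by (rule mult_right_mono)
    also have "\<dots> \<le> D"
      using W(2) hho_form_nonneg[OF \<sigma>, of 0 \<T> "interpolant \<phi>"] by linarith
    finally have "M / 2 * (4 * E * M) \<le> M / 2 * (D + P)"
      using M0 P0 by (intro mult_left_mono) auto
    moreover have "E * M\<^sup>2 \<le> M / 2 * (4 * E * M)"
      using E M0 by (simp add: power2_eq_square)
    moreover have "\<kappa> / 4 * N \<ge> 0" using \<kappa> N0 by simp
    ultimately show ?thesis by linarith
  next
    case False
    then have m: "m > 0" using m0 by simp
    \<comment> \<open>The test function is rescaled instead of the interpolant because the estimates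
      are stated for interpolants of test functions.\<close>
    define c where "c = 1 / sqrt m"
    have c2: "c\<^sup>2 = 1 / m" unfolding c_def using m by (simp add: power_divide)
    define \<psi> where "\<psi> x = c * \<phi> x" for x
    have \<psi>: "\<psi> \<in> test_functions \<Omega>"
      unfolding \<psi>_def[abs_def] by (rule test_function_scale(1)[OF \<phi>])
    have g\<psi>: "grad \<psi> x = c *\<^sub>R grad \<phi> x" for x
      unfolding \<psi>_def[abs_def] by (rule test_function_scale(2)[OF \<phi>])
    have m': "broken_integral \<T> (\<lambda>T x. (fst (interpolant \<psi>) T x)\<^sup>2) = 1"
    proof -
      have "broken_integral \<T> (\<lambda>T x. (fst (interpolant \<psi>) T x)\<^sup>2) = c\<^sup>2 * m"
        unfolding broken_integral_def m_def \<psi>_def[abs_def] sum_distrib_left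
        by (intro sum.cong refl cell_projection(4)[OF dim \<phi>])
      then show ?thesis using m by (simp add: c2)
    qed
    have D': "(\<integral>x. (norm (grad \<psi> x))\<^sup>2 \<partial>lebesgue_on \<Omega>) = D / m"
      unfolding g\<psi> D_def by (simp add: power_mult_distrib c2)
    have M': "(\<integral>x. (\<psi> x)\<^sup>2 \<partial>lebesgue_on \<Omega>) = M / m"
      unfolding \<psi>_def M_def by (simp add: power_mult_distrib c2)
    have P': "(\<integral>x. V x * \<psi> x * \<psi> x \<partial>lebesgue_on \<Omega>) = P / m"
    proof -
      have "V x * \<psi> x * \<psi> x = c\<^sup>2 * (V x * \<phi> x * \<phi> x)" for x
        by (simp add: \<psi>_def power2_eq_square)
      then show ?thesis unfolding P_def by (simp add: c2)
    qed
    have N': "(\<Sum>T\<in>\<T>. ((\<integral>x. \<psi> x \<partial>lebesgue_on T) / measure lebesgue T)\<^sup>2 * (\<integral>x. (\<psi> x)\<^sup>2 \<partial>lebesgue_on T)) = N / m\<^sup>2"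
    proof -
      have "((\<integral>x. \<psi> x \<partial>lebesgue_on T) / measure lebesgue T)\<^sup>2 * (\<integral>x. (\<psi> x)\<^sup>2 \<partial>lebesgue_on T)
        = (1 / m\<^sup>2) * (((\<integral>x. \<phi> x \<partial>lebesgue_on T) / measure lebesgue T)\<^sup>2 * (\<integral>x. (\<phi> x)\<^sup>2 \<partial>lebesgue_on T))" for T
        unfolding \<psi>_def by (simp add: power_mult_distrib power_divide c2 power2_eq_square[of m])
      then show ?thesis unfolding N_def by (simp add: sum_divide_distrib)
    qed
    obtain W where W: "W \<ge> 0" "hho_form 0 \<sigma> \<T> (interpolant \<psi>) (interpolant \<psi>) \<le> D / m - A * W" "M / m - 1 \<le> k * W" "1 \<le> M / m"
      by (rule interpolant_estimate[OF dim \<sigma> \<psi>, unfolded D' M' m', folded A_def k_def]) (rule that)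
    have "broken_L2_norm \<T> (fst (interpolant \<psi>)) = 1"
      unfolding broken_L2_norm_def m' by simp
    then have "E \<le> hho_energy0 0 \<sigma> \<T> V \<kappa> (interpolant \<psi>)"
      using interpolant_hho_U[OF \<psi>] min by blast
    also have "\<dots> \<le> 1 / 2 * (D / m - A * W) + 1 / 2 * (P / m) + \<kappa> / 4 * (N / m\<^sup>2)"
      unfolding hho_energy0_def
      using interpolant_potential[OF dim \<psi> V(1)[OF \<psi>] V(2,3), unfolded P'] W(2)
        interpolant_nonlinearity[OF dim \<psi>, unfolded N'] \<kappa>
      by (intro add_mono mult_left_mono) auto
    finally have E_le: "E \<le> 1 / 2 * (D / m - A * W) + 1 / 2 * (P / m) + \<kappa> / 4 * (N / m\<^sup>2)" .
    \<comment> \<open>The ratio of the mass of the test function to that of its interpolant.\<close>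
    define x where "x = M / m"
    define X where "X = 1 / 2 * (D / m - A * W) + 1 / 2 * (P / m)"
    have X0: "X \<ge> 0"
      unfolding X_def using W(2) hho_form_nonneg[OF \<sigma>, of 0 \<T> "interpolant \<psi>"] P0 m
      by (intro add_nonneg_nonneg) auto
    have x1: "x \<ge> 1" "x - 1 \<le> k * W" using W(3,4) by (auto simp: x_def)
    \<comment> \<open>From x >= 1 follows x + 1 <= 2 x. Together with the factor 1/2 in front of the
      discrete form this is the origin of the 4 in the condition, by which the gain
      \<open>A * W\<close> pays for the rescaling.\<close>
    have "E * x\<^sup>2 - E = E * (x - 1) * (x + 1)"
      by (simp add: power2_eq_square algebra_simps)
    also have "\<dots> \<le> E * (x - 1) * (2 * x)"
      using x1 E by (intro mult_left_mono) auto
    also have "\<dots> \<le> E * (k * W) * (2 * x)"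
      using x1 E by (intro mult_right_mono mult_left_mono) auto
    also have "\<dots> = (4 * k * E) * (W * x / 2)" by simp
    also have "\<dots> \<le> A * (W * x / 2)"
      using A W(1) x1 by (intro mult_right_mono) auto
    finally have 1: "E * x\<^sup>2 \<le> E + A * (W * x / 2)" by simp
    have 2: "X \<le> x * X" using mult_right_mono[OF x1(1) X0] by simp
    have "E * x\<^sup>2 \<le> x * X + \<kappa> / 4 * (N / m\<^sup>2) + A * (W * x / 2)"
      using 1 2 E_le unfolding X_def[symmetric] by linarith
    also have "\<dots> = x / 2 * (D / m + P / m) + \<kappa> / 4 * (N / m\<^sup>2)"
      unfolding X_def by (simp add: field_simps)
    finally have "m\<^sup>2 * (E * x\<^sup>2) \<le> m\<^sup>2 * (x / 2 * (D / m + P / m) + \<kappa> / 4 * (N / m\<^sup>2))"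
      by (intro mult_left_mono) simp_all
    moreover have "m\<^sup>2 * (E * x\<^sup>2) = E * M\<^sup>2"
      unfolding x_def using m by (simp add: power_divide)
    moreover have "m\<^sup>2 * (x / 2 * (D / m + P / m) + \<kappa> / 4 * (N / m\<^sup>2)) = M / 2 * (D + P) + \<kappa> / 4 * N"
      unfolding x_def using m by (simp add: power2_eq_square field_simps)
    ultimately show ?thesis by simp
  qed
qed

end

section \<open>Passage to the limit\<close>

lemma integral_lebesgue_on_zero_outside:
  fixes f :: "'a::euclidean_space \<Rightarrow> real"
  assumes "f \<in> borel_measurable borel" "S \<in> sets lebesgue" "\<And>x. x \<notin> S \<Longrightarrow> f x = 0"
  shows "(\<integral>x. f x \<partial>lebesgue_on S) = (\<integral>x. f x \<partial>lborel)"
proof -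
  have "(\<integral>x. f x \<partial>lebesgue_on S) = (\<integral>x. indicator S x * f x \<partial>lebesgue)"
    using integral_restrict_space[of S lebesgue f] assms(2) by simp
  also have "(\<lambda>x. indicator S x * f x) = f"
    using assms(3) by (auto simp: indicator_def fun_eq_iff)
  also have "(\<integral>x. f x \<partial>lebesgue) = (\<integral>x. f x \<partial>lborel)"
    using assms(1) by (intro integral_completion) auto
  finally show ?thesis .
qed

text \<open>Integrating \<open>\<psi>(x + b) - \<psi>(x)\<close> over the whole space gives 0 by translation invariance.\<close>

lemma integral_directional_derivative_zero:
  fixes \<psi> :: "'a::euclidean_space \<Rightarrow> real"
  assumes d: "\<And>x. (\<psi> has_derivative (\<lambda>h. G x \<bullet> h)) (at x)" and G: "continuous_on UNIV G"
    and R: "\<And>x. norm x > R \<Longrightarrow> \<psi> x = 0" "\<And>x. norm x > R \<Longrightarrow> G x = 0"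
  shows "(\<integral>x. G x \<bullet> b \<partial>lborel) = 0"
proof -
  define R' where "R' = \<bar>R\<bar> + norm b"
  \<comment> \<open>The cut-off to a compact set makes the integrand integrable on the product, so
    that Fubini applies; the radius \<open>R'\<close> leaves room for all shifts by
    \<open>s *\<^sub>R b\<close> with s in [0, 1].\<close>
  define K where "K = {0..1::real} \<times> cball (0::'a) R'"
  define f where "f s x = indicator K (s, x) * (G (x + s *\<^sub>R b) \<bullet> b)" for s and x :: 'a
  have c\<psi>: "continuous_on UNIV \<psi>"
    by (intro continuous_at_imp_continuous_on ballI has_derivative_continuous[OF d])
  have int_c: "integrable lborel h" if h: "continuous_on UNIV h" "\<And>x. norm x > R' \<Longrightarrow> h x = 0" for h :: "'a \<Rightarrow> real"
  proof -
    have "integrable lborel (\<lambda>x. indicator (cball 0 R') x *\<^sub>R h x)"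
      by (intro borel_integrable_compact) (auto intro: continuous_on_subset[OF h(1)])
    also have "(\<lambda>x. indicator (cball 0 R') x *\<^sub>R h x) = h"
      using h(2) by (auto simp: fun_eq_iff indicator_def dist_norm not_le)
    finally show ?thesis .
  qed
  have shift: "\<psi> (x + s *\<^sub>R b) = 0 \<and> G (x + s *\<^sub>R b) = 0" if "norm x > R'" "s \<in> {0..1}" for x s
  proof -
    have "norm x \<le> norm (x + s *\<^sub>R b) + norm (s *\<^sub>R b)"
      using norm_triangle_ineq4[of "x + s *\<^sub>R b" "s *\<^sub>R b"] by simp
    moreover have "norm (s *\<^sub>R b) \<le> norm b"
      using that(2) by (simp add: mult_left_le_one_le)
    ultimately have "norm (x + s *\<^sub>R b) > R"
      using that(1) unfolding R'_def by linarith
    then show ?thesis using R by blast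
  qed
  have "integrable (lborel \<Otimes>\<^sub>M lborel) (\<lambda>z. indicator K z *\<^sub>R (G (snd z + fst z *\<^sub>R b) \<bullet> b))"
    unfolding lborel_prod
  proof (rule borel_integrable_compact)
    show "compact K" unfolding K_def by (intro compact_Times compact_Icc compact_cball)
    show "continuous_on K (\<lambda>z. G (snd z + fst z *\<^sub>R b) \<bullet> b)"
      by (intro continuous_intros continuous_on_compose2[OF G]) auto
  qed
  then have i: "integrable (lborel \<Otimes>\<^sub>M lborel) (case_prod f)"
    by (simp add: f_def case_prod_unfold)
  have fx: "(\<integral>s. f s x \<partial>lborel) = \<psi> (x + b) - \<psi> x" for x
  proof (cases "norm x > R'")
    case True
    then have "f s x = 0" for s by (simp add: f_def K_def indicator_def dist_norm)
    moreover have "\<psi> (x + b) = 0" "\<psi> x = 0" using shift[OF True, of 1] shift[OF True, of 0] by auto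
    ultimately show ?thesis by simp
  next
    case False
    have cg: "continuous_on {0..1} (\<lambda>s. G (x + s *\<^sub>R b) \<bullet> b)"
      by (intro continuous_intros continuous_on_compose2[OF G]) auto
    have "(\<integral>s. f s x \<partial>lborel) = (LINT s:{0..1}|lborel. G (x + s *\<^sub>R b) \<bullet> b)"
      unfolding set_lebesgue_integral_def using False
      by (intro Bochner_Integration.integral_cong refl) (auto simp: f_def K_def indicator_def dist_norm)
    also have "\<dots> = integral {0..1} (\<lambda>s. G (x + s *\<^sub>R b) \<bullet> b)"
      by (intro set_borel_integral_eq_integral borel_integrable_atLeastAtMost' cg)
    also have "\<dots> = \<psi> (x + 1 *\<^sub>R b) - \<psi> (x + 0 *\<^sub>R b)"
    proof (intro integral_unique fundamental_theorem_of_calculus)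
      fix s :: real
      have "((\<lambda>s. \<psi> (x + s *\<^sub>R b)) has_derivative (\<lambda>h. G (x + s *\<^sub>R b) \<bullet> (h *\<^sub>R b))) (at s within {0..1})"
        by (rule has_derivative_eq_rhs[OF has_derivative_compose[OF _ d]]) (auto intro!: derivative_eq_intros)
      then show "((\<lambda>s. \<psi> (x + s *\<^sub>R b)) has_vector_derivative G (x + s *\<^sub>R b) \<bullet> b) (at s within {0..1})"
        by (simp add: has_vector_derivative_def)
    qed simp
    finally show ?thesis by simp
  qed
  have fs: "(\<integral>x. f s x \<partial>lborel) = indicator {0..1} s * (\<integral>x. G x \<bullet> b \<partial>lborel)" for s
  proof (cases "s \<in> {0..1}")
    case True
    have "f s x = G (s *\<^sub>R b + x) \<bullet> b" for x
      using True shift[of x s] by (auto simp: f_def K_def indicator_def dist_norm add.commute)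
    then have "(\<integral>x. f s x \<partial>lborel) = (\<integral>x. G (s *\<^sub>R b + x) \<bullet> b \<partial>lborel)" by simp
    also have "\<dots> = (\<integral>x. G x \<bullet> b \<partial>distr lborel borel ((+) (s *\<^sub>R b)))"
    proof (rule integral_distr[symmetric])
      have "continuous_on UNIV (\<lambda>x. G x \<bullet> b)" by (intro continuous_intros G)
      then show "(\<lambda>x. G x \<bullet> b) \<in> borel_measurable borel" by (rule borel_measurable_continuous_onI)
    qed simp
    finally show ?thesis using True by (simp add: lborel_distr_plus)
  next
    case False
    then have "f s x = 0" for x by (auto simp: f_def K_def indicator_def)
    then show ?thesis using False by simp
  qed
  have "(\<integral>x. \<psi> (x + b) - \<psi> x \<partial>lborel) = 0"
  proof -
    have i1: "integrable lborel \<psi>"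
    proof (rule int_c[OF c\<psi>])
      show "\<psi> x = 0" if "norm x > R'" for x using shift[OF that, of 0] by simp
    qed
    have "(\<integral>x. \<psi> (x + b) \<partial>lborel) = (\<integral>x. \<psi> x \<partial>distr lborel borel ((+) b))"
      using borel_measurable_continuous_onI[OF c\<psi>] by (subst integral_distr) (auto simp: add.commute)
    moreover have "integrable lborel (\<lambda>x. \<psi> (x + b))"
    proof (rule int_c)
      show "continuous_on UNIV (\<lambda>x. \<psi> (x + b))" by (intro continuous_on_compose2[OF c\<psi>] continuous_intros) auto
      show "\<psi> (x + b) = 0" if "norm x > R'" for x using shift[OF that, of 1] by simp
    qed
    ultimately show ?thesis using i1 by (simp add: lborel_distr_plus)
  qed
  \<comment> \<open>In the other order each inner integral is that of the derivative over a
    translate, and thus the same for all s in [0, 1].\<close>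
  then have "0 = (\<integral>x. (\<integral>s. f s x \<partial>lborel) \<partial>lborel)"
    unfolding fx by simp
  also have "\<dots> = (\<integral>s. (\<integral>x. f s x \<partial>lborel) \<partial>lborel)"
    by (rule lborel_pair.Fubini_integral[OF i])
  also have "\<dots> = (\<integral>x. G x \<bullet> b \<partial>lborel)"
    unfolding fs by simp
  finally show ?thesis by simp
qed

text \<open>The product of the two functions has compact support, so the integral of its derivative
  vanishes; both integrands are zero outside \<Omega>.\<close>

lemma test_function_integration_by_parts:
  fixes \<phi> \<psi> :: "'a::euclidean_space \<Rightarrow> real"
  assumes \<phi>: "\<phi> \<in> test_functions \<Omega>" and \<psi>: "\<psi> \<in> test_functions \<Omega>" and "open \<Omega>"
  shows "(\<integral>x. \<phi> x * partial_deriv b \<psi> x \<partial>lebesgue_on \<Omega>) = - (\<integral>x. (grad \<phi> x \<bullet> b) * \<psi> x \<partial>lebesgue_on \<Omega>)"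
proof -
  have \<Omega>: "\<Omega> \<in> sets lebesgue" using assms(3) by (simp add: borel_open)
  define G where "G x = \<phi> x *\<^sub>R grad \<psi> x + \<psi> x *\<^sub>R grad \<phi> x" for x
  note c = test_functionD(2,3)[OF \<phi>] test_functionD(2,3)[OF \<psi>]
  obtain R where R: "\<And>x. x \<in> closure {x. \<phi> x \<noteq> 0} \<Longrightarrow> norm x \<le> R"
  proof -
    have "bounded (closure {x. \<phi> x \<noteq> 0})"
      using \<phi> by (simp add: test_functions_def compact_imp_bounded)
    then obtain R where "\<forall>x\<in>closure {x. \<phi> x \<noteq> 0}. norm x \<le> R"
      unfolding bounded_iff by (elim exE)
    then show thesis by (intro that[of R]) simp
  qed
  have zero: "\<phi> x = 0 \<and> grad \<phi> x = 0" if "norm x > R" for x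
  proof -
    have *: "x \<notin> closure {x. \<phi> x \<noteq> 0}" using R[of x] that by auto
    then have "x \<notin> {x. \<phi> x \<noteq> 0}" by (meson closure_subset subsetD)
    then show ?thesis using test_functionD(7)[OF \<phi> *] by simp
  qed
  have "(\<integral>x. G x \<bullet> b \<partial>lborel) = 0"
  proof (rule integral_directional_derivative_zero)
    show "((\<lambda>x. \<phi> x * \<psi> x) has_derivative (\<lambda>h. G x \<bullet> h)) (at x)" for x
      by (rule has_derivative_eq_rhs[OF has_derivative_mult[OF test_functionD(1)[OF \<phi>] test_functionD(1)[OF \<psi>]]])
         (auto simp: G_def inner_add_left)
    show "continuous_on UNIV G" unfolding G_def[abs_def] by (intro continuous_intros c)
  qed (use zero in \<open>auto simp: G_def\<close>)
  moreover have m: "(\<lambda>x. \<phi> x * (grad \<psi> x \<bullet> b)) \<in> borel_measurable borel" "(\<lambda>x. (grad \<phi> x \<bullet> b) * \<psi> x) \<in> borel_measurable borel"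
    by (intro borel_measurable_continuous_onI continuous_intros c)+
  moreover have "integrable lborel (\<lambda>x. \<phi> x * (grad \<psi> x \<bullet> b))" "integrable lborel (\<lambda>x. (grad \<phi> x \<bullet> b) * \<psi> x)"
  proof -
    have int: "integrable lborel h" if h: "continuous_on UNIV h" "\<And>x. norm x > R \<Longrightarrow> h x = 0" for h :: "'a \<Rightarrow> real"
    proof -
      have "integrable lborel (\<lambda>x. indicator (cball 0 R) x *\<^sub>R h x)"
        by (intro borel_integrable_compact) (auto intro: continuous_on_subset[OF h(1)])
      also have "(\<lambda>x. indicator (cball 0 R) x *\<^sub>R h x) = h"
        using h(2) by (auto simp: fun_eq_iff indicator_def dist_norm not_le)
      finally show ?thesis .
    qed
    show "integrable lborel (\<lambda>x. \<phi> x * (grad \<psi> x \<bullet> b))" "integrable lborel (\<lambda>x. (grad \<phi> x \<bullet> b) * \<psi> x)"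
      using zero by (intro int continuous_intros c; simp)+
  qed
  moreover have "(\<integral>x. G x \<bullet> b \<partial>lborel) = (\<integral>x. \<phi> x * (grad \<psi> x \<bullet> b) + (grad \<phi> x \<bullet> b) * \<psi> x \<partial>lborel)"
    by (intro Bochner_Integration.integral_cong refl) (simp add: G_def inner_add_left)
  ultimately have "(\<integral>x. \<phi> x * (grad \<psi> x \<bullet> b) \<partial>lborel) = - (\<integral>x. (grad \<phi> x \<bullet> b) * \<psi> x \<partial>lborel)"
    by simp
  moreover have "(\<integral>x. \<phi> x * (grad \<psi> x \<bullet> b) \<partial>lebesgue_on \<Omega>) = (\<integral>x. \<phi> x * (grad \<psi> x \<bullet> b) \<partial>lborel)"
    "(\<integral>x. (grad \<phi> x \<bullet> b) * \<psi> x \<partial>lebesgue_on \<Omega>) = (\<integral>x. (grad \<phi> x \<bullet> b) * \<psi> x \<partial>lborel)"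
    using test_functionD(4)[OF \<phi>] test_functionD(4)[OF \<psi>]
    by (intro integral_lebesgue_on_zero_outside m \<Omega>; simp)+
  ultimately show ?thesis
    by (simp add: test_functionD(6)[OF \<psi>])
qed

section \<open>Square integrable functions and convergence of weighted norms\<close>

lemma L2_fun_mult:
  fixes f :: "'a::euclidean_space \<Rightarrow> 'b::euclidean_space"
  assumes "L2_fun \<Omega> f" "L2_fun \<Omega> g"
  shows "integrable (lebesgue_on \<Omega>) (\<lambda>x. f x \<bullet> g x)"
proof -
  have [measurable]: "f \<in> borel_measurable (lebesgue_on \<Omega>)" "g \<in> borel_measurable (lebesgue_on \<Omega>)"
    and i: "integrable (lebesgue_on \<Omega>) (\<lambda>x. (norm (f x))\<^sup>2)" "integrable (lebesgue_on \<Omega>) (\<lambda>x. (norm (g x))\<^sup>2)"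
    using assms by (auto simp: L2_fun_def)
  have le: "norm (f x) * norm (g x) \<le> (norm (f x))\<^sup>2 + (norm (g x))\<^sup>2" for x
    using sum_squares_bound[of "norm (f x)" "norm (g x)"] mult_nonneg_nonneg[OF norm_ge_zero[of "f x"] norm_ge_zero[of "g x"]]
    by linarith
  show "integrable (lebesgue_on \<Omega>) (\<lambda>x. f x \<bullet> g x)"
  proof (rule Bochner_Integration.integrable_bound[OF Bochner_Integration.integrable_add[OF i]])
    show "AE x in lebesgue_on \<Omega>. norm (f x \<bullet> g x) \<le> norm ((norm (f x))\<^sup>2 + (norm (g x))\<^sup>2)"
    proof (rule AE_I2)
      fix x
      have "\<bar>f x \<bullet> g x\<bar> \<le> norm (f x) * norm (g x)" by (rule Cauchy_Schwarz_ineq2)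
      then show "norm (f x \<bullet> g x) \<le> norm ((norm (f x))\<^sup>2 + (norm (g x))\<^sup>2)"
        using le[of x] by simp
    qed
  qed simp
qed

lemma L2_fun_add:
  fixes f :: "'a::euclidean_space \<Rightarrow> 'b::euclidean_space"
  assumes "L2_fun \<Omega> f" "L2_fun \<Omega> g"
  shows "L2_fun \<Omega> (\<lambda>x. f x + g x)"
proof -
  have [measurable]: "f \<in> borel_measurable (lebesgue_on \<Omega>)" "g \<in> borel_measurable (lebesgue_on \<Omega>)"
    and i: "integrable (lebesgue_on \<Omega>) (\<lambda>x. (norm (f x))\<^sup>2)" "integrable (lebesgue_on \<Omega>) (\<lambda>x. (norm (g x))\<^sup>2)"
    using assms by (auto simp: L2_fun_def)
  have eq: "(norm (f x + g x))\<^sup>2 = (norm (f x))\<^sup>2 + (norm (g x))\<^sup>2 + 2 * (f x \<bullet> g x)" for x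
    by (simp add: power2_norm_eq_inner inner_add_left inner_add_right inner_commute)
  have "integrable (lebesgue_on \<Omega>) (\<lambda>x. (norm (f x + g x))\<^sup>2)"
    unfolding eq using i L2_fun_mult[OF assms] by simp
  then show ?thesis by (simp add: L2_fun_def)
qed

lemma L2_fun_uminus: "L2_fun \<Omega> f \<Longrightarrow> L2_fun \<Omega> (\<lambda>x. - f x)"
  for f :: "'a::euclidean_space \<Rightarrow> 'b::euclidean_space"
  by (simp add: L2_fun_def)

lemma L2_fun_diff: "L2_fun \<Omega> f \<Longrightarrow> L2_fun \<Omega> g \<Longrightarrow> L2_fun \<Omega> (\<lambda>x. f x - g x)"
  for f :: "'a::euclidean_space \<Rightarrow> 'b::euclidean_space"
  using L2_fun_add[OF _ L2_fun_uminus] by fastforce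

lemma integrable_bounded_mult:
  fixes w h :: "'a \<Rightarrow> real"
  assumes w: "w \<in> borel_measurable M" "AE x in M. \<bar>w x\<bar> \<le> C" and h: "integrable M h"
  shows "integrable M (\<lambda>x. w x * h x)"
proof (rule Bochner_Integration.integrable_bound[OF integrable_mult_right[OF integrable_norm[OF h], of C]])
  show "(\<lambda>x. w x * h x) \<in> borel_measurable (M)"
    using w(1) borel_measurable_integrable[OF h] by simp
  show "AE x in M. norm (w x * h x) \<le> norm (C * norm (h x))"
    using w(2)
  proof eventually_elim
    fix x assume "\<bar>w x\<bar> \<le> C"
    then have "\<bar>w x\<bar> * \<bar>h x\<bar> \<le> \<bar>C\<bar> * \<bar>h x\<bar>" by (intro mult_right_mono) auto
    then show "norm (w x * h x) \<le> norm (C * norm (h x))" by (simp add: abs_mult)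
  qed
qed

text \<open>Young's inequality with a parameter \<open>\<delta> n\<close> bounds the difference of
  the squared norms; the parameter tends to 0 slowly enough that \<open>a n / \<delta> n\<close>
  does as well.\<close>

lemma L2_limit:
  fixes f :: "'a::euclidean_space \<Rightarrow> 'b::euclidean_space" and e :: "nat \<Rightarrow> 'a \<Rightarrow> 'b"
  assumes f: "L2_fun \<Omega> f" and e: "\<And>n. L2_fun \<Omega> (e n)"
    and w: "w \<in> borel_measurable (lebesgue_on \<Omega>)" "AE x in lebesgue_on \<Omega>. \<bar>w x\<bar> \<le> C"
    and lim: "(\<lambda>n. \<integral>x. (norm (e n x))\<^sup>2 \<partial>lebesgue_on \<Omega>) \<longlonglongrightarrow> 0"
  shows "(\<lambda>n. \<integral>x. w x * (norm (f x + e n x))\<^sup>2 \<partial>lebesgue_on \<Omega>) \<longlonglongrightarrow> (\<integral>x. w x * (norm (f x))\<^sup>2 \<partial>lebesgue_on \<Omega>)"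
proof -
  define F where "F = (\<integral>x. (norm (f x))\<^sup>2 \<partial>lebesgue_on \<Omega>)"
  define a where "a n = (\<integral>x. (norm (e n x))\<^sup>2 \<partial>lebesgue_on \<Omega>)" for n
  \<comment> \<open>The square root keeps \<open>a n / \<delta> n\<close> below
    \<open>sqrt (a n)\<close>; the second summand ensures positivity when \<open>a n\<close> is
    0.\<close>
  define \<delta> where "\<delta> n = sqrt (a n) + 1 / real (Suc n)" for n
  have a0: "a n \<ge> 0" for n unfolding a_def by simp
  have F0: "F \<ge> 0" unfolding F_def by simp
  have \<delta>0: "\<delta> n > 0" for n unfolding \<delta>_def using a0[of n] by (simp add: add_nonneg_pos)
  note w(1)[measurable]
  have wi: "integrable (lebesgue_on \<Omega>) (\<lambda>x. w x * h x)" if "integrable (lebesgue_on \<Omega>) h" for h :: "'a \<Rightarrow> real"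
    by (rule integrable_bounded_mult[OF w that])
  have if': "integrable (lebesgue_on \<Omega>) (\<lambda>x. (norm (f x))\<^sup>2)" "integrable (lebesgue_on \<Omega>) (\<lambda>x. (norm (e n x))\<^sup>2)"
    "integrable (lebesgue_on \<Omega>) (\<lambda>x. (norm (f x + e n x))\<^sup>2)" for n
    using f e L2_fun_add[OF f e] by (auto simp: L2_fun_def)
  have bound: "\<bar>(\<integral>x. w x * (norm (f x + e n x))\<^sup>2 \<partial>lebesgue_on \<Omega>) - (\<integral>x. w x * (norm (f x))\<^sup>2 \<partial>lebesgue_on \<Omega>)\<bar>
      \<le> C * (\<delta> n * F + sqrt (a n) + a n)" for n
  proof -
    \<comment> \<open>\<open>C\<close> can be negative only over a null domain, where the integrals
      of both squared norms vanish.\<close>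
    have C0: "C * h \<ge> 0 \<or> F = 0 \<and> a n = 0" if "h \<ge> 0" for h :: real
    proof (cases "C \<ge> 0")
      case False
      with w(2) have "AE x in lebesgue_on \<Omega>. False" by (auto elim: eventually_mono)
      then have "AE x in lebesgue_on \<Omega>. (norm (f x))\<^sup>2 = 0" "AE x in lebesgue_on \<Omega>. (norm (e n x))\<^sup>2 = 0"
        by (auto elim: eventually_mono)
      then show ?thesis
        unfolding F_def a_def by (auto intro!: integral_eq_zero_AE)
    qed (use that in simp)
    have "(\<integral>x. w x * (norm (f x + e n x))\<^sup>2 \<partial>lebesgue_on \<Omega>) - (\<integral>x. w x * (norm (f x))\<^sup>2 \<partial>lebesgue_on \<Omega>)
      = (\<integral>x. w x * ((norm (f x + e n x))\<^sup>2 - (norm (f x))\<^sup>2) \<partial>lebesgue_on \<Omega>)"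
      using wi[OF if'(3)] wi[OF if'(1)] by (simp add: right_diff_distrib)
    then have "\<bar>(\<integral>x. w x * (norm (f x + e n x))\<^sup>2 \<partial>lebesgue_on \<Omega>) - (\<integral>x. w x * (norm (f x))\<^sup>2 \<partial>lebesgue_on \<Omega>)\<bar>
      \<le> (\<integral>x. \<bar>w x * ((norm (f x + e n x))\<^sup>2 - (norm (f x))\<^sup>2)\<bar> \<partial>lebesgue_on \<Omega>)"
      using integral_abs_bound by metis
    also have "\<dots> \<le> (\<integral>x. C * (\<delta> n * (norm (f x))\<^sup>2 + (1 / \<delta> n) * (norm (e n x))\<^sup>2 + (norm (e n x))\<^sup>2) \<partial>lebesgue_on \<Omega>)"
    proof (rule integral_mono_AE)
      show "integrable (lebesgue_on \<Omega>) (\<lambda>x. \<bar>w x * ((norm (f x + e n x))\<^sup>2 - (norm (f x))\<^sup>2)\<bar>)"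
        by (intro integrable_abs wi Bochner_Integration.integrable_diff if')
      show "integrable (lebesgue_on \<Omega>) (\<lambda>x. C * (\<delta> n * (norm (f x))\<^sup>2 + (1 / \<delta> n) * (norm (e n x))\<^sup>2 + (norm (e n x))\<^sup>2))"
        by (intro integrable_mult_right Bochner_Integration.integrable_add if')
      show "AE x in lebesgue_on \<Omega>. \<bar>w x * ((norm (f x + e n x))\<^sup>2 - (norm (f x))\<^sup>2)\<bar>
        \<le> C * (\<delta> n * (norm (f x))\<^sup>2 + (1 / \<delta> n) * (norm (e n x))\<^sup>2 + (norm (e n x))\<^sup>2)"
        using w(2)
      proof eventually_elim
        fix x assume wC: "\<bar>w x\<bar> \<le> C"
        define p where "p = norm (f x)"
        define q where "q = norm (e n x)"
        have "(norm (f x + e n x))\<^sup>2 - p\<^sup>2 = 2 * (f x \<bullet> e n x) + q\<^sup>2"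
          unfolding p_def q_def by (simp add: power2_norm_eq_inner inner_add_left inner_add_right inner_commute)
        then have "\<bar>(norm (f x + e n x))\<^sup>2 - p\<^sup>2\<bar> \<le> 2 * \<bar>f x \<bullet> e n x\<bar> + q\<^sup>2"
          using zero_le_power2[of q] by linarith
        also have "\<dots> \<le> 2 * (p * q) + q\<^sup>2"
          using Cauchy_Schwarz_ineq2[of "f x" "e n x"] by (simp add: p_def q_def)
        also have "2 * (p * q) \<le> \<delta> n * p\<^sup>2 + (1 / \<delta> n) * q\<^sup>2"
        proof -
          have "0 \<le> (1 / \<delta> n) * (\<delta> n * p - q)\<^sup>2" using \<delta>0[of n] by simp
          also have "\<dots> = \<delta> n * p\<^sup>2 + (1 / \<delta> n) * q\<^sup>2 - 2 * (p * q)"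
            using \<delta>0[of n] by (simp add: power2_eq_square field_simps)
          finally show ?thesis by simp
        qed
        finally have "\<bar>(norm (f x + e n x))\<^sup>2 - p\<^sup>2\<bar> \<le> \<delta> n * p\<^sup>2 + (1 / \<delta> n) * q\<^sup>2 + q\<^sup>2" by simp
        then have "\<bar>w x\<bar> * \<bar>(norm (f x + e n x))\<^sup>2 - p\<^sup>2\<bar> \<le> C * (\<delta> n * p\<^sup>2 + (1 / \<delta> n) * q\<^sup>2 + q\<^sup>2)"
          using wC by (intro mult_mono) auto
        then show "\<bar>w x * ((norm (f x + e n x))\<^sup>2 - (norm (f x))\<^sup>2)\<bar>
          \<le> C * (\<delta> n * (norm (f x))\<^sup>2 + (1 / \<delta> n) * (norm (e n x))\<^sup>2 + (norm (e n x))\<^sup>2)"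
          by (simp add: abs_mult p_def q_def)
      qed
    qed
    also have "\<dots> = C * (\<delta> n * F + (1 / \<delta> n) * a n + a n)"
      using if' by (simp add: F_def a_def)
    also have "\<dots> \<le> C * (\<delta> n * F + sqrt (a n) + a n)"
    proof -
      have "(1 / \<delta> n) * a n \<le> sqrt (a n)"
      proof -
        have "a n = sqrt (a n) * sqrt (a n)" using a0 by simp
        also have "\<dots> \<le> \<delta> n * sqrt (a n)"
          using a0 by (intro mult_right_mono) (auto simp: \<delta>_def)
        finally show ?thesis using \<delta>0[of n] by (simp add: field_simps)
      qed
      then show ?thesis
        using C0[of "sqrt (a n) - (1 / \<delta> n) * a n"] by (auto simp: algebra_simps)
    qed
    finally show ?thesis .
  qed
  have "(\<lambda>n. C * (\<delta> n * F + sqrt (a n) + a n)) \<longlonglongrightarrow> C * ((sqrt 0 + 0) * F + sqrt 0 + 0)"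
    unfolding \<delta>_def using lim[folded a_def]
    by (intro tendsto_intros lim_1_over_n[THEN LIMSEQ_Suc]) 
  then have "(\<lambda>n. C * (\<delta> n * F + sqrt (a n) + a n)) \<longlonglongrightarrow> 0" by simp
  then have "(\<lambda>n. (\<integral>x. w x * (norm (f x + e n x))\<^sup>2 \<partial>lebesgue_on \<Omega>) - (\<integral>x. w x * (norm (f x))\<^sup>2 \<partial>lebesgue_on \<Omega>)) \<longlonglongrightarrow> 0"
    by (rule Lim_null_comparison[rotated]) (use bound in simp)
  then show ?thesis by (simp add: LIM_zero_iff)
qed

lemma L2_fun_continuous:
  fixes f :: "'a::euclidean_space \<Rightarrow> 'b::euclidean_space"
  assumes "bounded S" "S \<in> sets lebesgue" "continuous_on UNIV f"
  shows "L2_fun S f"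
  unfolding L2_fun_def
proof
  show "f \<in> borel_measurable (lebesgue_on S)"
    using assms by (intro continuous_imp_measurable_on_sets_lebesgue) (auto intro: continuous_on_subset)
  show "integrable (lebesgue_on S) (\<lambda>x. (norm (f x))\<^sup>2)"
    using assms by (intro continuous_integrable_lebesgue_on continuous_intros)
qed

lemma L2_fun_inner:
  fixes f :: "'a::euclidean_space \<Rightarrow> 'b::euclidean_space"
  assumes "L2_fun \<Omega> f"
  shows "L2_fun \<Omega> (\<lambda>x. f x \<bullet> b)"
proof -
  have [measurable]: "f \<in> borel_measurable (lebesgue_on \<Omega>)" and i: "integrable (lebesgue_on \<Omega>) (\<lambda>x. (norm (f x))\<^sup>2)"
    using assms by (auto simp: L2_fun_def)
  have le: "(f x \<bullet> b)\<^sup>2 \<le> (norm b)\<^sup>2 * (norm (f x))\<^sup>2" for x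
  proof -
    have "\<bar>f x \<bullet> b\<bar>\<^sup>2 \<le> (norm (f x) * norm b)\<^sup>2"
      by (intro power_mono Cauchy_Schwarz_ineq2) simp
    then show ?thesis by (simp add: power_mult_distrib mult.commute)
  qed
  have "integrable (lebesgue_on \<Omega>) (\<lambda>x. (f x \<bullet> b)\<^sup>2)"
    by (rule Bochner_Integration.integrable_bound[OF integrable_mult_right[OF i, of "(norm b)\<^sup>2"]]) (auto simp: le)
  then show ?thesis by (simp add: L2_fun_def)
qed

section \<open>Weak gradients and approximation by test functions\<close>

lemma is_weak_gradient_diff:
  fixes u v :: "'a::euclidean_space \<Rightarrow> real"
  assumes \<Omega>: "bounded \<Omega>" "\<Omega> \<in> sets lebesgue"
    and u: "L2_fun \<Omega> u" "is_weak_gradient \<Omega> u g" and v: "L2_fun \<Omega> v" "is_weak_gradient \<Omega> v g'"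
  shows "is_weak_gradient \<Omega> (\<lambda>x. u x - v x) (\<lambda>x. g x - g' x)"
  unfolding is_weak_gradient_def
proof (intro conjI ballI)
  have g: "L2_fun \<Omega> g" "L2_fun \<Omega> g'" using u v by (auto simp: is_weak_gradient_def)
  show "L2_fun \<Omega> (\<lambda>x. g x - g' x)" using g by (rule L2_fun_diff)
  fix \<phi> :: "'a \<Rightarrow> real" and b :: 'a assume \<phi>: "\<phi> \<in> test_functions \<Omega>" and b: "b \<in> Basis"
  have L: "L2_fun \<Omega> \<phi>" "L2_fun \<Omega> (partial_deriv b \<phi>)"
    using L2_fun_continuous[OF \<Omega> test_functionD(3)] \<phi> test_functionD(5)[OF \<phi> b] by blast+
  note i = L2_fun_mult[OF u(1) L(2)] L2_fun_mult[OF v(1) L(2)]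
    L2_fun_mult[OF L2_fun_inner[OF g(1)] L(1), of b] L2_fun_mult[OF L2_fun_inner[OF g(2)] L(1), of b]
  have "(\<integral>x. (u x - v x) * partial_deriv b \<phi> x \<partial>lebesgue_on \<Omega>)
    = (\<integral>x. u x * partial_deriv b \<phi> x \<partial>lebesgue_on \<Omega>) - (\<integral>x. v x * partial_deriv b \<phi> x \<partial>lebesgue_on \<Omega>)"
    using i(1,2) by (simp add: left_diff_distrib)
  also have "\<dots> = - ((\<integral>x. (g x \<bullet> b) * \<phi> x \<partial>lebesgue_on \<Omega>) - (\<integral>x. (g' x \<bullet> b) * \<phi> x \<partial>lebesgue_on \<Omega>))"
    using u(2) v(2) \<phi> b by (simp add: is_weak_gradient_def)
  also have "\<dots> = - (\<integral>x. ((g x - g' x) \<bullet> b) * \<phi> x \<partial>lebesgue_on \<Omega>)"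
    using i(3,4) by (simp add: left_diff_distrib inner_diff_left)
  finally show "(\<integral>x. (u x - v x) * partial_deriv b \<phi> x \<partial>lebesgue_on \<Omega>) = - (\<integral>x. ((g x - g' x) \<bullet> b) * \<phi> x \<partial>lebesgue_on \<Omega>)" .
qed

lemma is_weak_gradient_grad:
  assumes "\<phi> \<in> test_functions \<Omega>" "open \<Omega>" "bounded \<Omega>"
  shows "is_weak_gradient \<Omega> \<phi> (grad \<phi>)"
  using assms test_function_integration_by_parts[OF assms(1) _ assms(2)]
  by (auto simp: is_weak_gradient_def borel_open intro!: L2_fun_continuous test_functionD(2)[OF assms(1)])

text \<open>Weak gradients are chosen by \<open>SOME\<close>, so instead of their uniqueness we use that every weak
  gradient of a test function has at least the norm of the classical one.\<close>

lemma grad_le_weak_gradient: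
  fixes \<phi> :: "'a::euclidean_space \<Rightarrow> real"
  assumes \<phi>: "\<phi> \<in> test_functions \<Omega>" and \<Omega>: "open \<Omega>" "bounded \<Omega>" and g: "is_weak_gradient \<Omega> \<phi> g"
  shows "(\<integral>x. (norm (grad \<phi> x))\<^sup>2 \<partial>lebesgue_on \<Omega>) \<le> (\<integral>x. (norm (g x))\<^sup>2 \<partial>lebesgue_on \<Omega>)"
proof -
  define G where "G = grad \<phi>"
  have L: "L2_fun \<Omega> g" "L2_fun \<Omega> G"
    using g is_weak_gradient_grad[OF \<phi> \<Omega>] unfolding is_weak_gradient_def G_def by blast+
  have ii: "integrable (lebesgue_on \<Omega>) (\<lambda>x. (norm (g x))\<^sup>2)" "integrable (lebesgue_on \<Omega>) (\<lambda>x. (norm (G x))\<^sup>2)"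
    using L by (auto simp: L2_fun_def)
  have b: "(\<integral>x. (G x \<bullet> b) * (G x \<bullet> b) \<partial>lebesgue_on \<Omega>) = (\<integral>x. (g x \<bullet> b) * (G x \<bullet> b) \<partial>lebesgue_on \<Omega>)"
    if b: "b \<in> Basis" for b
  proof -
    note \<psi> = test_functionD(5)[OF \<phi> b]
    have "(\<integral>x. \<phi> x * partial_deriv b (partial_deriv b \<phi>) x \<partial>lebesgue_on \<Omega>) = - (\<integral>x. (g x \<bullet> b) * partial_deriv b \<phi> x \<partial>lebesgue_on \<Omega>)"
      using g \<psi> b by (simp add: is_weak_gradient_def)
    moreover have "(\<integral>x. \<phi> x * partial_deriv b (partial_deriv b \<phi>) x \<partial>lebesgue_on \<Omega>) = - (\<integral>x. (G x \<bullet> b) * partial_deriv b \<phi> x \<partial>lebesgue_on \<Omega>)"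
      unfolding G_def by (rule test_function_integration_by_parts[OF \<phi> \<psi> \<Omega>(1)])
    ultimately show ?thesis by (simp add: G_def test_functionD(6)[OF \<phi>])
  qed
  have i: "integrable (lebesgue_on \<Omega>) (\<lambda>x. (f x \<bullet> b) * (G x \<bullet> b))" if "L2_fun \<Omega> f" for f and b :: 'a
    using L2_fun_mult[OF L2_fun_inner[OF that] L2_fun_inner[OF L(2)], of b b] by simp
  have eq: "(norm (G x))\<^sup>2 = (\<Sum>b\<in>Basis. (G x \<bullet> b) * (G x \<bullet> b))" "g x \<bullet> G x = (\<Sum>b\<in>Basis. (g x \<bullet> b) * (G x \<bullet> b))" for x
    unfolding power2_norm_eq_inner by (rule euclidean_inner)+
  have "(\<integral>x. (norm (G x))\<^sup>2 \<partial>lebesgue_on \<Omega>) = (\<integral>x. (\<Sum>b\<in>Basis. (G x \<bullet> b) * (G x \<bullet> b)) \<partial>lebesgue_on \<Omega>)"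
    unfolding eq(1) ..
  also have "\<dots> = (\<Sum>b\<in>Basis. \<integral>x. (g x \<bullet> b) * (G x \<bullet> b) \<partial>lebesgue_on \<Omega>)"
    by (subst Bochner_Integration.integral_sum) (use i[OF L(2)] b in \<open>auto intro!: sum.cong\<close>)
  also have "\<dots> = (\<integral>x. g x \<bullet> G x \<partial>lebesgue_on \<Omega>)"
    unfolding eq(2) using i[OF L(1)] by (rule Bochner_Integration.integral_sum[symmetric])
  also have "\<dots> \<le> (\<integral>x. (norm (g x))\<^sup>2 / 2 + (norm (G x))\<^sup>2 / 2 \<partial>lebesgue_on \<Omega>)"
  proof (rule integral_mono)
    show "integrable (lebesgue_on \<Omega>) (\<lambda>x. g x \<bullet> G x)" by (rule L2_fun_mult[OF L])
    show "integrable (lebesgue_on \<Omega>) (\<lambda>x. (norm (g x))\<^sup>2 / 2 + (norm (G x))\<^sup>2 / 2)" using ii by simp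
    show "g x \<bullet> G x \<le> (norm (g x))\<^sup>2 / 2 + (norm (G x))\<^sup>2 / 2" for x
      using inner_ge_zero[of "g x - G x"] by (simp add: power2_norm_eq_inner inner_diff_left inner_diff_right inner_commute)
  qed
  also have "\<dots> = (\<integral>x. (norm (g x))\<^sup>2 \<partial>lebesgue_on \<Omega>) / 2 + (\<integral>x. (norm (G x))\<^sup>2 \<partial>lebesgue_on \<Omega>) / 2"
    using ii by simp
  finally show ?thesis by (simp add: G_def)
qed

text \<open>If \<open>e n\<close> is a weak gradient of u - \<phi> n, then g - e n is one of \<phi>
  n; its norm dominates that of the classical gradient, and it converges. Such an upper bound
  \<delta> for the Dirichlet energies is all that the limit of the energy inequality asks
  for.\<close>

lemma H10_approximation:
  fixes u :: "'a::euclidean_space \<Rightarrow> real"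
  assumes u: "u \<in> H10 \<Omega>" and \<Omega>: "open \<Omega>" "bounded \<Omega>"
  obtains \<phi> \<delta> where "L2_fun \<Omega> u" "L2_fun \<Omega> (weak_grad \<Omega> u)"
    "\<And>n. \<phi> n \<in> test_functions \<Omega>" "\<And>n. L2_fun \<Omega> (\<lambda>x. \<phi> n x - u x)"
    "(\<lambda>n. \<integral>x. (\<phi> n x - u x)\<^sup>2 \<partial>lebesgue_on \<Omega>) \<longlonglongrightarrow> 0"
    "\<And>n :: nat. (\<integral>x. (norm (grad (\<phi> n) x))\<^sup>2 \<partial>lebesgue_on \<Omega>) \<le> \<delta> n"
    "\<delta> \<longlonglongrightarrow> (\<integral>x. (norm (weak_grad \<Omega> u x))\<^sup>2 \<partial>lebesgue_on \<Omega>)"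
proof -
  have s\<Omega>: "\<Omega> \<in> sets lebesgue" using \<Omega>(1) by (simp add: borel_open)
  obtain \<phi> where \<phi>: "\<And>n :: nat. \<phi> n \<in> test_functions \<Omega>" and lim: "(\<lambda>n. H1_norm \<Omega> (\<lambda>x. u x - \<phi> n x)) \<longlonglongrightarrow> 0"
    using u unfolding H10_def by blast
  define g where "g = weak_grad \<Omega> u"
  define e where "e n = weak_grad \<Omega> (\<lambda>x. u x - \<phi> n x)" for n
  have Lu: "L2_fun \<Omega> u" and ex: "\<exists>g. is_weak_gradient \<Omega> u g"
    using u unfolding H10_def H1_def by blast+
  from ex have g: "is_weak_gradient \<Omega> u g"
    unfolding g_def weak_grad_def by (rule someI_ex)
  have L\<phi>: "L2_fun \<Omega> (\<phi> n)" for n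
    by (rule L2_fun_continuous[OF \<Omega>(2) s\<Omega> test_functionD(3)[OF \<phi>]])
  note d = is_weak_gradient_diff[OF \<Omega>(2) s\<Omega>]
  \<comment> \<open>Some weak gradient of the difference has to exist before the choice in
    \<open>weak_grad\<close> can be used.\<close>
  have e: "is_weak_gradient \<Omega> (\<lambda>x. u x - \<phi> n x) (e n)" for n
  proof -
    have "\<exists>g'. is_weak_gradient \<Omega> (\<lambda>x. u x - \<phi> n x) g'"
      by (rule exI, rule d[OF Lu g L\<phi> is_weak_gradient_grad[OF \<phi> \<Omega>]])
    then show ?thesis
      unfolding e_def weak_grad_def by (rule someI_ex)
  qed
  have ge: "is_weak_gradient \<Omega> (\<phi> n) (\<lambda>x. g x - e n x)" for n
    using d[OF Lu g L2_fun_diff[OF Lu L\<phi>] e] by simp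
  have Lg: "L2_fun \<Omega> g" "L2_fun \<Omega> (\<lambda>x. - e n x)" for n
    using g e[of n] by (auto simp: is_weak_gradient_def intro!: L2_fun_uminus)
  define a where "a n = (\<integral>x. (norm (u x - \<phi> n x))\<^sup>2 \<partial>lebesgue_on \<Omega>)" for n
  define c where "c n = (\<integral>x. (norm (e n x))\<^sup>2 \<partial>lebesgue_on \<Omega>)" for n
  have ac: "a n \<ge> 0" "c n \<ge> 0" for n unfolding a_def c_def by simp_all
  have "(H1_norm \<Omega> (\<lambda>x. u x - \<phi> n x))\<^sup>2 = a n + c n" for n
    using ac[of n] unfolding H1_norm_def L2_norm_def a_def c_def e_def by simp
  with tendsto_power[OF lim, of 2] have ac0: "(\<lambda>n. a n + c n) \<longlonglongrightarrow> 0" by simp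
  have a0: "a \<longlonglongrightarrow> 0" and c0: "c \<longlonglongrightarrow> 0"
    by (rule tendsto_sandwich[OF _ _ tendsto_const ac0]; use ac in simp)+
  show thesis
  proof (rule that[of \<phi> "\<lambda>n. \<integral>x. (norm (g x - e n x))\<^sup>2 \<partial>lebesgue_on \<Omega>"])
    show "L2_fun \<Omega> u" "L2_fun \<Omega> (weak_grad \<Omega> u)" "\<And>n. \<phi> n \<in> test_functions \<Omega>"
      using Lu Lg(1) \<phi> by (auto simp: g_def)
    show "L2_fun \<Omega> (\<lambda>x. \<phi> n x - u x)" for n by (rule L2_fun_diff[OF L\<phi> Lu])
    have "a = (\<lambda>n. \<integral>x. (\<phi> n x - u x)\<^sup>2 \<partial>lebesgue_on \<Omega>)"
      by (simp add: a_def fun_eq_iff power2_commute)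
    then show "(\<lambda>n. \<integral>x. (\<phi> n x - u x)\<^sup>2 \<partial>lebesgue_on \<Omega>) \<longlonglongrightarrow> 0" using a0 by simp
    show "(\<integral>x. (norm (grad (\<phi> n) x))\<^sup>2 \<partial>lebesgue_on \<Omega>) \<le> (\<integral>x. (norm (g x - e n x))\<^sup>2 \<partial>lebesgue_on \<Omega>)" for n
      by (rule grad_le_weak_gradient[OF \<phi> \<Omega> ge])
    have "(\<lambda>n. \<integral>x. 1 * (norm (g x + - e n x))\<^sup>2 \<partial>lebesgue_on \<Omega>) \<longlonglongrightarrow> (\<integral>x. 1 * (norm (g x))\<^sup>2 \<partial>lebesgue_on \<Omega>)"
      by (rule L2_limit[OF Lg, where C = 1]) (use c0 in \<open>simp_all add: c_def[abs_def]\<close>)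
    then show "(\<lambda>n. \<integral>x. (norm (g x - e n x))\<^sup>2 \<partial>lebesgue_on \<Omega>) \<longlonglongrightarrow> (\<integral>x. (norm (weak_grad \<Omega> u x))\<^sup>2 \<partial>lebesgue_on \<Omega>)"
      by (simp add: g_def)
  qed
qed

text \<open>Cauchy-Schwarz against the constant 1, from the nonnegative integral of (m f - a)^2.
  Scaling by the measure m instead of dividing by it postpones the case m = 0.\<close>

lemma square_integral_le:
  fixes f :: "'a::euclidean_space \<Rightarrow> real"
  assumes S: "S \<in> lmeasurable" and f: "integrable (lebesgue_on S) f" "integrable (lebesgue_on S) (\<lambda>x. (f x)\<^sup>2)"
  shows "(\<integral>x. f x \<partial>lebesgue_on S)\<^sup>2 \<le> measure lebesgue S * (\<integral>x. (f x)\<^sup>2 \<partial>lebesgue_on S)"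
proof -
  interpret finite_measure "lebesgue_on S" by (rule finite_measure_lebesgue_on[OF S])
  define m where "m = measure lebesgue S"
  define a where "a = (\<integral>x. f x \<partial>lebesgue_on S)"
  define b where "b = (\<integral>x. (f x)\<^sup>2 \<partial>lebesgue_on S)"
  have m: "measure (lebesgue_on S) S = m"
    using S by (simp add: m_def measure_restrict_space space_restrict_space fmeasurableD)
  have "0 \<le> (\<integral>x. (m * f x - a)\<^sup>2 \<partial>lebesgue_on S)" by simp
  also have "\<dots> = (\<integral>x. m\<^sup>2 * (f x)\<^sup>2 - 2 * m * a * f x + a\<^sup>2 \<partial>lebesgue_on S)"
    by (simp add: power2_diff power_mult_distrib algebra_simps)
  also have "\<dots> = m\<^sup>2 * b - 2 * m * a * a + a\<^sup>2 * m"
    using f by (simp add: a_def b_def m)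
  finally have "0 \<le> m * (m * b - a\<^sup>2)" by (simp add: power2_eq_square algebra_simps)
  moreover have "m \<ge> 0" unfolding m_def by simp
  moreover have "a = 0" if "m = 0"
  proof -
    have "emeasure lebesgue S = 0"
      using that S by (simp add: m_def emeasure_eq_measure2)
    then have "AE x in lebesgue_on S. f x = 0"
      using S by (intro AE_I[where N = S]) (auto simp: emeasure_restrict_space space_restrict_space fmeasurableD)
    then show ?thesis unfolding a_def by (rule integral_eq_zero_AE)
  qed
  ultimately have "a\<^sup>2 \<le> m * b"
    by (cases "m = 0") (auto simp: zero_le_mult_iff)
  then show ?thesis unfolding a_def b_def m_def .
qed

section \<open>The energy bound for the ground state\<close>

context triangulated_domain
begin

lemma integral_cell_indicator:
  fixes f :: "'a \<Rightarrow> real"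
  assumes T: "T \<in> \<T>" and f: "integrable (lebesgue_on \<Omega>) f"
  shows "(\<integral>x. f x \<partial>lebesgue_on T) = (\<integral>x. indicator T x * f x \<partial>lebesgue_on \<Omega>)"
proof -
  note sT = sets_cell[OF T]
  have i: "integrable lebesgue (\<lambda>x. indicator T x * f x)"
    using integrable_cell[OF f T] sT by (simp add: integrable_restrict_space)
  have "(\<integral>x. f x \<partial>lebesgue_on T) = (\<integral>x. indicator T x * f x \<partial>lebesgue)"
    using sT by (simp add: integral_restrict_space)
  also have "\<dots> = (\<integral>x. indicator \<Omega> x * (indicator T x * f x) \<partial>lebesgue)"
  proof (rule integral_cong_AE)
    show "(\<lambda>x. indicator T x * f x) \<in> borel_measurable lebesgue"
      using i by (rule borel_measurable_integrable)
    then show "(\<lambda>x. indicator \<Omega> x * (indicator T x * f x)) \<in> borel_measurable lebesgue"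
      by (rule borel_measurable_times[OF borel_measurable_indicator[OF sets_domain]])
    show "AE x in lebesgue. indicator T x * f x = indicator \<Omega> x * (indicator T x * f x)"
      using AE_cell_subset[OF T] by eventually_elim (auto simp: indicator_def)
  qed
  also have "\<dots> = (\<integral>x. indicator T x * f x \<partial>lebesgue_on \<Omega>)"
    using sets_domain by (simp add: integral_restrict_space)
  finally show ?thesis .
qed

text \<open>Mass, potential energy and cell averages are continuous under L^2 convergence, and the
  Dirichlet energy is replaced by its convergent upper bound \<delta>. The normalisation of u sends
  the mass to 1, so the scaling factors disappear in the limit.\<close>

lemma H10_bound:
  fixes u V :: "'a \<Rightarrow> real"
  assumes dim: "DIM('a) \<in> {2, 3}" and \<sigma>: "\<sigma> \<ge> 0" and \<kappa>: "\<kappa> \<ge> 0"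
    and u: "u \<in> H10 \<Omega>" "L2_norm \<Omega> u = 1"
    and V: "Linfty_fun \<Omega> V" "AE x in lebesgue_on \<Omega>. V x \<ge> 0" "piecewise_constant \<T> V"
    and min: "\<And>v. v \<in> hho_U 0 \<Omega> \<T> \<Longrightarrow> broken_L2_norm \<T> (fst v) = 1 \<Longrightarrow> E \<le> hho_energy0 0 \<sigma> \<T> V \<kappa> v"
    and E: "E \<ge> 0"
    and condition: "1 - \<sigma> * (1 / pi\<^sup>2 + C_tr DIM('a)) - 4 * (mesh_size \<T>)\<^sup>2 * E / pi\<^sup>2 \<ge> 0"
  shows "E \<le> 1 / 2 * ((\<integral>x. (norm (weak_grad \<Omega> u x))\<^sup>2 \<partial>lebesgue_on \<Omega>) + (\<integral>x. V x * (u x)\<^sup>2 \<partial>lebesgue_on \<Omega>))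
    + \<kappa> / 4 * (\<Sum>T\<in>\<T>. ((\<integral>x. u x \<partial>lebesgue_on T) / measure lebesgue T)\<^sup>2 * (\<integral>x. (u x)\<^sup>2 \<partial>lebesgue_on T))"
proof -
  obtain \<phi> \<delta> where Lu: "L2_fun \<Omega> u" and \<phi>: "\<And>n. \<phi> n \<in> test_functions \<Omega>"
    and e: "\<And>n. L2_fun \<Omega> (\<lambda>x. \<phi> n x - u x)"
    and lim: "(\<lambda>n. \<integral>x. (\<phi> n x - u x)\<^sup>2 \<partial>lebesgue_on \<Omega>) \<longlonglongrightarrow> 0"
    and D: "\<And>n :: nat. (\<integral>x. (norm (grad (\<phi> n) x))\<^sup>2 \<partial>lebesgue_on \<Omega>) \<le> \<delta> n"
    and \<delta>: "\<delta> \<longlonglongrightarrow> (\<integral>x. (norm (weak_grad \<Omega> u x))\<^sup>2 \<partial>lebesgue_on \<Omega>)"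
    by (rule H10_approximation[OF u(1) open_domain bounded_domain]) (rule that)
  obtain C where VC: "V \<in> borel_measurable (lebesgue_on \<Omega>)" "AE x in lebesgue_on \<Omega>. \<bar>V x\<bar> \<le> C"
    using V(1) unfolding Linfty_fun_def by blast
  have L\<phi>: "L2_fun \<Omega> \<psi>" if "\<psi> \<in> test_functions \<Omega>" for \<psi>
    by (rule L2_fun_continuous[OF bounded_domain sets_domain test_functionD(3)[OF that]])
  have L1: "L2_fun \<Omega> (\<lambda>x. 1 :: real)"
    by (rule L2_fun_continuous[OF bounded_domain sets_domain continuous_on_const])
  have sq: "integrable (lebesgue_on \<Omega>) (\<lambda>x. (f x)\<^sup>2)" if "L2_fun \<Omega> f" for f :: "'a \<Rightarrow> real"
    using that by (simp add: L2_fun_def)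
  have int: "integrable (lebesgue_on \<Omega>) f" if "L2_fun \<Omega> f" for f :: "'a \<Rightarrow> real"
    using L2_fun_mult[OF that L1] by simp
  have conv: "(\<lambda>n. \<integral>x. w x * (\<phi> n x + c)\<^sup>2 \<partial>lebesgue_on \<Omega>) \<longlonglongrightarrow> (\<integral>x. w x * (u x + c)\<^sup>2 \<partial>lebesgue_on \<Omega>)"
    if w: "w \<in> borel_measurable (lebesgue_on \<Omega>)" "AE x in lebesgue_on \<Omega>. \<bar>w x\<bar> \<le> K" for w K and c :: real
  proof -
    have Lc: "L2_fun \<Omega> (\<lambda>x. u x + c)"
      by (rule L2_fun_add[OF Lu L2_fun_continuous[OF bounded_domain sets_domain continuous_on_const]])
    have eq: "u x + c + (\<phi> n x - u x) = \<phi> n x + c" for n x by simp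
    show ?thesis
      using L2_limit[OF Lc e w] lim unfolding eq by simp
  qed
  \<comment> \<open>Linear functionals are recovered from quadratic ones by polarisation: w f is
    half of w (f + 1)^2 - w f^2 - w. This is why \<open>conv\<close> carries a shift by a
    constant.\<close>
  have conv1: "(\<lambda>n. \<integral>x. w x * \<phi> n x \<partial>lebesgue_on \<Omega>) \<longlonglongrightarrow> (\<integral>x. w x * u x \<partial>lebesgue_on \<Omega>)"
    if w: "w \<in> borel_measurable (lebesgue_on \<Omega>)" "AE x in lebesgue_on \<Omega>. \<bar>w x\<bar> \<le> K" for w K
  proof -
    have polar: "(\<integral>x. w x * f x \<partial>lebesgue_on \<Omega>) = ((\<integral>x. w x * (f x + 1)\<^sup>2 \<partial>lebesgue_on \<Omega>)
      - (\<integral>x. w x * (f x + 0)\<^sup>2 \<partial>lebesgue_on \<Omega>) - (\<integral>x. w x * 1 \<partial>lebesgue_on \<Omega>)) / 2" if f: "L2_fun \<Omega> f" for f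
    proof -
      note i = integrable_bounded_mult[OF w sq[OF f]] integrable_bounded_mult[OF w int[OF f]]
        integrable_bounded_mult[OF w int[OF L1]]
      have "(\<integral>x. w x * (f x + 1)\<^sup>2 \<partial>lebesgue_on \<Omega>) = (\<integral>x. w x * (f x)\<^sup>2 + (2 * (w x * f x) + w x * 1) \<partial>lebesgue_on \<Omega>)"
        by (simp add: power2_eq_square algebra_simps)
      also have "\<dots> = (\<integral>x. w x * (f x)\<^sup>2 \<partial>lebesgue_on \<Omega>) + (2 * (\<integral>x. w x * f x \<partial>lebesgue_on \<Omega>) + (\<integral>x. w x * 1 \<partial>lebesgue_on \<Omega>))"
        using i by simp
      finally show ?thesis by simp
    qed
    show ?thesis
      unfolding polar[OF Lu] polar[OF L\<phi>[OF \<phi>]]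
      by (intro tendsto_intros conv[OF w]) simp
  qed
  have w1: "(\<lambda>x. 1) \<in> borel_measurable (lebesgue_on \<Omega>)" "AE x in lebesgue_on \<Omega>. \<bar>1 :: real\<bar> \<le> 1"
    by simp_all
  have wT: "indicator T \<in> borel_measurable (lebesgue_on \<Omega>)" "AE x in lebesgue_on \<Omega>. \<bar>indicator T x :: real\<bar> \<le> 1"
    if "T \<in> \<T>" for T
    using measurable_restrict_space1[OF borel_measurable_indicator[OF sets_cell[OF that]]] by (auto simp: indicator_def)
  define M where "M n = (\<integral>x. (\<phi> n x)\<^sup>2 \<partial>lebesgue_on \<Omega>)" for n
  define P where "P n = (\<integral>x. V x * \<phi> n x * \<phi> n x \<partial>lebesgue_on \<Omega>)" for n
  define N where "N f = (\<Sum>T\<in>\<T>. ((\<integral>x. f x \<partial>lebesgue_on T) / measure lebesgue T)\<^sup>2 * (\<integral>x. (f x)\<^sup>2 \<partial>lebesgue_on T))"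
    for f :: "'a \<Rightarrow> real"
  define g where "g = (\<integral>x. (norm (weak_grad \<Omega> u x))\<^sup>2 \<partial>lebesgue_on \<Omega>)"
  have M: "M \<longlonglongrightarrow> 1"
    using conv[OF w1, of 0] u(2) by (simp add: M_def[abs_def] L2_norm_def)
  have P: "P \<longlonglongrightarrow> (\<integral>x. V x * (u x)\<^sup>2 \<partial>lebesgue_on \<Omega>)"
    using conv[OF VC, of 0] by (simp add: P_def[abs_def] power2_eq_square mult.assoc)
  have N: "(\<lambda>n. N (\<phi> n)) \<longlonglongrightarrow> N u"
    unfolding N_def
  proof (intro tendsto_sum tendsto_mult tendsto_power tendsto_divide tendsto_const)
    fix T assume T: "T \<in> \<T>"
    note c = integral_cell_indicator[OF T]
    show "(\<lambda>n. \<integral>x. \<phi> n x \<partial>lebesgue_on T) \<longlonglongrightarrow> (\<integral>x. u x \<partial>lebesgue_on T)"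
      using conv1[OF wT[OF T]] unfolding c[OF int[OF Lu]] c[OF int[OF L\<phi>[OF \<phi>]]] .
    show "(\<lambda>n. \<integral>x. (\<phi> n x)\<^sup>2 \<partial>lebesgue_on T) \<longlonglongrightarrow> (\<integral>x. (u x)\<^sup>2 \<partial>lebesgue_on T)"
      using conv[OF wT[OF T], of 0] unfolding c[OF sq[OF Lu]] c[OF sq[OF L\<phi>[OF \<phi>]]] by simp
    show "measure lebesgue T \<noteq> 0" using measure_cell[OF T] by simp
  qed
  have le: "E * (M n)\<^sup>2 \<le> M n / 2 * (\<delta> n + P n) + \<kappa> / 4 * N (\<phi> n)" for n
  proof -
    have i: "integrable (lebesgue_on \<Omega>) (\<lambda>x. V x * \<psi> x * \<psi> x)" if "\<psi> \<in> test_functions \<Omega>" for \<psi>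
      using integrable_bounded_mult[OF VC sq[OF L\<phi>[OF that]]] by (simp add: power2_eq_square mult.assoc)
    have "E * (M n)\<^sup>2 \<le> M n / 2 * ((\<integral>x. (norm (grad (\<phi> n) x))\<^sup>2 \<partial>lebesgue_on \<Omega>) + P n) + \<kappa> / 4 * N (\<phi> n)"
      unfolding M_def P_def N_def by (rule test_function_bound[OF dim \<sigma> \<kappa> \<phi> i V(2,3) min E condition])
    also have "\<dots> \<le> M n / 2 * (\<delta> n + P n) + \<kappa> / 4 * N (\<phi> n)"
    proof -
      have "M n \<ge> 0" unfolding M_def by simp
      then show ?thesis using D[of n] by (intro add_right_mono mult_left_mono) auto
    qed
    finally show ?thesis .
  qed
  have "(\<lambda>n. E * (M n)\<^sup>2) \<longlonglongrightarrow> E * 1\<^sup>2"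
    by (intro tendsto_intros M)
  moreover have "(\<lambda>n. M n / 2 * (\<delta> n + P n) + \<kappa> / 4 * N (\<phi> n))
    \<longlonglongrightarrow> 1 / 2 * (g + (\<integral>x. V x * (u x)\<^sup>2 \<partial>lebesgue_on \<Omega>)) + \<kappa> / 4 * N u"
    by (intro tendsto_intros M P N \<delta>[folded g_def]) simp
  ultimately have "E * 1\<^sup>2 \<le> 1 / 2 * (g + (\<integral>x. V x * (u x)\<^sup>2 \<partial>lebesgue_on \<Omega>)) + \<kappa> / 4 * N u"
    by (rule LIMSEQ_le) (use le in blast)
  then show ?thesis by (simp add: g_def N_def)
qed

text \<open>Jensen's inequality is applied twice on each cell, to the mean of u and to the mean of
  u^2.\<close>

lemma projected_nonlinearity_le:
  fixes u :: "'a \<Rightarrow> real"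
  assumes u: "L2_fun \<Omega> u" and i4: "integrable (lebesgue_on \<Omega>) (\<lambda>x. \<bar>u x\<bar> ^ 4)"
  shows "(\<Sum>T\<in>\<T>. ((\<integral>x. u x \<partial>lebesgue_on T) / measure lebesgue T)\<^sup>2 * (\<integral>x. (u x)\<^sup>2 \<partial>lebesgue_on T))
    \<le> (\<integral>x. \<bar>u x\<bar> ^ 4 \<partial>lebesgue_on \<Omega>)"
  unfolding integral_mesh[OF i4]
proof (rule sum_mono)
  fix T assume T: "T \<in> \<T>"
  define m where "m = measure lebesgue T"
  define a where "a = (\<integral>x. u x \<partial>lebesgue_on T)"
  define b where "b = (\<integral>x. (u x)\<^sup>2 \<partial>lebesgue_on T)"
  define c where "c = (\<integral>x. \<bar>u x\<bar> ^ 4 \<partial>lebesgue_on T)"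
  have m: "m > 0" unfolding m_def by (rule measure_cell[OF T])
  have lm: "T \<in> lmeasurable" using compact_cell[OF T] by (rule lmeasurable_compact)
  have L1: "L2_fun \<Omega> (\<lambda>x. 1 :: real)"
    by (rule L2_fun_continuous[OF bounded_domain sets_domain continuous_on_const])
  have i1: "integrable (lebesgue_on T) u"
    using L2_fun_mult[OF u L1] by (intro integrable_cell[OF _ T]) simp
  have i2: "integrable (lebesgue_on T) (\<lambda>x. (u x)\<^sup>2)"
    using u by (intro integrable_cell[OF _ T]) (simp add: L2_fun_def)
  have eq: "((u x)\<^sup>2)\<^sup>2 = \<bar>u x\<bar> ^ 4" for x by simp
  have i3: "integrable (lebesgue_on T) (\<lambda>x. ((u x)\<^sup>2)\<^sup>2)"
    unfolding eq by (rule integrable_cell[OF i4 T])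
  have ab: "a\<^sup>2 \<le> m * b"
    unfolding a_def b_def m_def by (rule square_integral_le[OF lm i1 i2])
  have bc: "b\<^sup>2 \<le> m * c"
    using square_integral_le[OF lm i2 i3] unfolding b_def c_def m_def eq .
  have "b \<ge> 0" unfolding b_def by simp
  have "(a / m)\<^sup>2 * b = a\<^sup>2 * b / m\<^sup>2" by (simp add: power_divide)
  also have "\<dots> \<le> m * b * b / m\<^sup>2"
    using ab \<open>b \<ge> 0\<close> by (intro divide_right_mono mult_right_mono) auto
  also have "\<dots> = b\<^sup>2 / m" using m by (simp add: power2_eq_square)
  also have "\<dots> \<le> c" using bc m by (simp add: field_simps)
  finally show "((\<integral>x. u x \<partial>lebesgue_on T) / measure lebesgue T)\<^sup>2 * (\<integral>x. (u x)\<^sup>2 \<partial>lebesgue_on T) \<le> (\<integral>x. \<bar>u x\<bar> ^ 4 \<partial>lebesgue_on T)"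
    unfolding a_def b_def c_def m_def .
qed

end

theorem theorem3p1:
  fixes \<Omega> :: "'a::euclidean_space set" and \<T> :: "'a set set"
    and V :: "'a \<Rightarrow> real" and \<kappa> \<sigma> \<rho> h E\<^sub>h :: real and E :: ennreal
    and u :: "'a \<Rightarrow> real" and u\<^sub>h :: "'a hybrid"
  assumes dimension: "DIM('a) \<in> {2, 3}"
    and domain: "open \<Omega>" "\<Omega> \<noteq> {}" "bounded \<Omega>" "convex \<Omega>"
    and mesh: "simplicial_mesh \<Omega> \<T>" "shape_regular \<rho> \<T>"
    and mesh_size: "h = mesh_size \<T>"
    and potential: "Linfty_fun \<Omega> V" "AE x in lebesgue_on \<Omega>. V x \<ge> 0"
    and potential_pw_constant: "piecewise_constant \<T> V"
    and parameters: "\<kappa> > 0" "\<sigma> > 0"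
    and ground_state: "ground_state \<Omega> V \<kappa> u" "E = GP_energy \<Omega> V \<kappa> u"
    and hho_ground_state:
      "hho_ground_state 0 \<sigma> \<Omega> \<T> V \<kappa> u\<^sub>h" "E\<^sub>h = hho_energy0 0 \<sigma> \<T> V \<kappa> u\<^sub>h"
    and condition: "1 - \<sigma> * (1 / pi\<^sup>2 + C_tr DIM('a)) - 4 * h\<^sup>2 * E\<^sub>h / pi\<^sup>2 \<ge> 0"
  shows "ennreal E\<^sub>h \<le> E"
proof -
  interpret triangulated_domain \<Omega> \<T>
    using domain mesh(1) by (simp add: triangulated_domain_def)
  have u: "u \<in> H10 \<Omega>" "L2_norm \<Omega> u = 1"
    using ground_state(1) by (auto simp: ground_state_def is_arg_min_def)
  have min: "E\<^sub>h \<le> hho_energy0 0 \<sigma> \<T> V \<kappa> v" if "v \<in> hho_U 0 \<Omega> \<T>" "broken_L2_norm \<T> (fst v) = 1" for v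
    using hho_ground_state that
    by (auto simp: hho_ground_state_def is_arg_min_def not_less simp del: split_paired_All split_paired_Ex)
  obtain C where VC: "V \<in> borel_measurable (lebesgue_on \<Omega>)" "AE x in lebesgue_on \<Omega>. \<bar>V x\<bar> \<le> C"
    using potential(1) unfolding Linfty_fun_def by blast
  define g where "g = (\<integral>x. (norm (weak_grad \<Omega> u x))\<^sup>2 \<partial>lebesgue_on \<Omega>)"
  define P where "P = (\<integral>x. V x * (u x)\<^sup>2 \<partial>lebesgue_on \<Omega>)"
  have L: "L2_fun \<Omega> u" "L2_fun \<Omega> (weak_grad \<Omega> u)"
    by (rule H10_approximation[OF u(1) domain(1,3)], assumption)+
  have iu: "integrable (lebesgue_on \<Omega>) (\<lambda>x. (u x)\<^sup>2)" and ig: "integrable (lebesgue_on \<Omega>) (\<lambda>x. (norm (weak_grad \<Omega> u x))\<^sup>2)"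
    using L by (simp_all add: L2_fun_def)
  have g: "(\<integral>\<^sup>+x. ennreal ((norm (weak_grad \<Omega> u x))\<^sup>2) \<partial>lebesgue_on \<Omega>) = ennreal g"
    unfolding g_def by (rule nn_integral_eq_integral[OF ig]) simp
  have AEP: "AE x in lebesgue_on \<Omega>. 0 \<le> V x * (u x)\<^sup>2"
    using potential(2) by eventually_elim simp
  have P: "(\<integral>\<^sup>+x. ennreal (V x * u x * u x) \<partial>lebesgue_on \<Omega>) = ennreal P"
    using nn_integral_eq_integral[OF integrable_bounded_mult[OF VC iu] AEP]
    by (simp add: P_def power2_eq_square mult.assoc)
  have nn: "g \<ge> 0" "P \<ge> 0"
    unfolding g_def P_def using AEP by (auto intro: integral_nonneg_AE)
  show ?thesis
  \<comment> \<open>The other cases are trivial in [0, \<infinity>]: an infinite quartic term makes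
    E infinite, and \<open>ennreal\<close> sends a negative \<open>E\<^sub>h\<close> to 0. Thus
    finiteness of the L^4 norm of the ground state never has to be proved.\<close>
  proof (cases "E\<^sub>h \<ge> 0 \<and> (\<integral>\<^sup>+x. ennreal (\<bar>u x\<bar> ^ 4) \<partial>lebesgue_on \<Omega>) \<noteq> \<infinity>")
    case True
    define Q where "Q = (\<integral>x. \<bar>u x\<bar> ^ 4 \<partial>lebesgue_on \<Omega>)"
    have m: "(\<lambda>x. \<bar>u x\<bar> ^ 4) \<in> borel_measurable (lebesgue_on \<Omega>)"
      using L(1) unfolding L2_fun_def by (intro borel_measurable_power borel_measurable_abs) simp
    have i4: "integrable (lebesgue_on \<Omega>) (\<lambda>x. \<bar>u x\<bar> ^ 4)"
      using True m by (intro integrableI_nonneg) (auto simp: less_top)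
    have Q: "(\<integral>\<^sup>+x. ennreal (\<bar>u x\<bar> ^ 4) \<partial>lebesgue_on \<Omega>) = ennreal Q"
      unfolding Q_def by (rule nn_integral_eq_integral[OF i4]) simp
    have Q0: "Q \<ge> 0" unfolding Q_def by simp
    have "E\<^sub>h \<le> 1 / 2 * (g + P) + \<kappa> / 4 * (\<Sum>T\<in>\<T>. ((\<integral>x. u x \<partial>lebesgue_on T) / measure lebesgue T)\<^sup>2 * (\<integral>x. (u x)\<^sup>2 \<partial>lebesgue_on T))"
      unfolding g_def P_def
    proof (rule H10_bound[OF dimension _ _ u potential potential_pw_constant min])
      show "1 - \<sigma> * (1 / pi\<^sup>2 + C_tr DIM('a)) - 4 * (mesh_size \<T>)\<^sup>2 * E\<^sub>h / pi\<^sup>2 \<ge> 0"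
        using condition unfolding mesh_size .
    qed (use parameters True in auto)
    also have "\<dots> \<le> 1 / 2 * (g + P) + \<kappa> / 4 * Q"
      unfolding Q_def using parameters(1)
      by (intro add_left_mono mult_left_mono projected_nonlinearity_le[OF L(1) i4]) simp
    finally have "ennreal E\<^sub>h \<le> ennreal (1 / 2 * g + 1 / 2 * P + \<kappa> / 4 * Q)"
      by (intro ennreal_leI) argo
    also have "\<dots> = E"
      unfolding ground_state(2) GP_energy_def g P Q
      using nn Q0 parameters(1) by (simp only: ennreal_plus ennreal_mult' ennreal_mult divide_nonneg_nonneg mult_nonneg_nonneg zero_le_one zero_le_numeral less_imp_le add_nonneg_nonneg)
    finally show ?thesis .
  next
    case False
    then show ?thesis
    proof (cases "E\<^sub>h \<ge> 0")
      case True
      with False have "(\<integral>\<^sup>+x. ennreal (\<bar>u x\<bar> ^ 4) \<partial>lebesgue_on \<Omega>) = \<infinity>" by simp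
      then have "E = \<infinity>"
        unfolding ground_state(2) GP_energy_def using parameters(1) by (simp add: ennreal_mult_top)
      then show ?thesis by simp
    qed (simp add: ennreal_neg)
  qed
qed

end
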